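(* Let $k\in\mathbb{N}$, $t>0$, and let $u_0,a_1,\dots,a_k$ be freely independent operators in a $W^*$-probability space $(\mathscr{A},\varphi)$ with $u_0$ unitary and $a_1,\dots,a_k$ $\mathscr{R}$-diagonal. Let $$u_0b_k(t)=u_0\prod_{j=1}^k\Big(1+\sqrt{\tfrac tk}\,a_j\Big),\qquad Z=\sum_{j=1}^k u_0^{1/k}\otimes E_{j,j+1},\qquad A=\sum_{j=1}^k a_j\otimes E_{j,j+1}.$$ Then the Brown measure of $u_0b_k(t)$ (with respect to $\varphi$) is the push-forward, under the map $z\mapsto z^k$, of the Brown measure of $Z+\sqrt{t/k}\,A$ in $(\mathscr{A}\otimes \mathrm{M}_k(\mathbb{C}),\varphi\otimes\mathrm{tr})$.
   Context: A $W^*$-probability space $(\mathscr{A},\varphi)$ is a von Neumann algebra with a faithful normal tracial state. $E_{i,j}$ are the matrix units of $\mathrm{M}_k(\mathbb{C})$, indices are mod $k$ (so $k+1\equiv1$), and $\mathrm{tr}=\frac1k\mathrm{Tr}$. $u_0^{1/k}$ is a fixed unitary, in the von Neumann algebra generated by $u_0$, whose $k$th power is $u_0$. Products are ordered left to right by increasing $j$. Free independence means $*$-freeness. $a$ is $\mathscr{R}$-diagonal if its free cumulants satisfy $\kappa_n[a^{\varepsilon_1},\dots,a^{\varepsilon_n}]=0$ ($\varepsilon_i\in\{1,*\}$) unless $n$ is even and the $\varepsilon_i$ alternate. The Brown measure of $x$ with respect to a tracial state $\tau$ is the probability measure $\mu_x=\frac1{2\pi}\nabla^2_z\int_0^\infty\log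 s\,\nu_{x-z}(ds)$ on $\mathbb{C}$ (distributional Laplacian), $\nu_{x-z}$ being the spectral distribution of $|x-z|$ with respect to $\tau$. *)

theory Defs
  imports "HOL-Analysis.Analysis" "HOL-Probability.Probability"
begin

section \<open>Complex Hilbert spaces\<close>

text \<open>The inner product is linear in the second argument.  Positive definiteness is inherited
  from the underlying real inner product.\<close>

class complex_inner_space = real_inner +
  fixes scaleC :: "complex \<Rightarrow> 'a \<Rightarrow> 'a"  (infixr \<open>*\<^sub>C\<close> 75)
    and cinner :: "'a \<Rightarrow> 'a \<Rightarrow> complex"
  assumes scaleC_add_right: "c *\<^sub>C (x + y) = c *\<^sub>C x + c *\<^sub>C y"
    and scaleC_add_left: "(c + d) *\<^sub>C x = c *\<^sub>C x + d *\<^sub>C x"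
    and scaleC_scaleC: "c *\<^sub>C d *\<^sub>C x = (c * d) *\<^sub>C x"
    and scaleR_scaleC: "r *\<^sub>R x = complex_of_real r *\<^sub>C x"
    and cinner_commute: "cinner x y = cnj (cinner y x)"
    and cinner_add_right: "cinner x (y + z) = cinner x y + cinner x z"
    and cinner_scaleC_right: "cinner x (c *\<^sub>C y) = c * cinner x y"
    and inner_eq_Re_cinner: "inner x y = Re (cinner x y)"

class complex_hilbert_space = complex_inner_space + complete_space

lemma Im_cinner_self: "Im (cinner x x) = 0"
  using cinner_commute[of x x] by (simp add: complex_eq_iff)

lemma norm_scaleC: "norm (c *\<^sub>C x) = cmod c * norm x"
  for x :: "'h::complex_inner_space"
proof -
  have "cinner (c *\<^sub>C x) (c *\<^sub>C x) = c * cnj (c * cinner x x)"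
    by (metis cinner_commute cinner_scaleC_right)
  also have "\<dots> = complex_of_real ((cmod c)\<^sup>2) * cnj (cinner x x)"
    by (simp only: complex_norm_square complex_cnj_mult mult.assoc)
  finally have "inner (c *\<^sub>C x) (c *\<^sub>C x) = (cmod c)\<^sup>2 * inner x x"
    by (simp add: inner_eq_Re_cinner)
  then show ?thesis
    by (simp add: norm_eq_sqrt_inner real_sqrt_mult)
qed

text \<open>The Hilbert space \<open>H \<otimes> \<complex>\<^sup>k = H\<^sup>k\<close>, with \<open>k = CARD('k)\<close>.\<close>

instantiation vec :: (complex_inner_space, finite) complex_inner_space
begin

definition scaleC_vec :: "complex \<Rightarrow> 'a ^ 'b \<Rightarrow> 'a ^ 'b" where
  "scaleC_vec c x = (\<chi> i. c *\<^sub>C (x $ i))"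

definition cinner_vec :: "'a ^ 'b \<Rightarrow> 'a ^ 'b \<Rightarrow> complex" where
  "cinner_vec x y = (\<Sum>i\<in>UNIV. cinner (x $ i) (y $ i))"

instance
proof
  fix x y z :: "'a ^ 'b" and c d :: complex and r :: real
  show "c *\<^sub>C (x + y) = c *\<^sub>C x + c *\<^sub>C y"
    by (simp add: scaleC_vec_def vec_eq_iff scaleC_add_right)
  show "(c + d) *\<^sub>C x = c *\<^sub>C x + d *\<^sub>C x"
    by (simp add: scaleC_vec_def vec_eq_iff scaleC_add_left)
  show "c *\<^sub>C d *\<^sub>C x = (c * d) *\<^sub>C x"
    by (simp add: scaleC_vec_def vec_eq_iff scaleC_scaleC)
  show "r *\<^sub>R x = complex_of_real r *\<^sub>C x"
    by (simp add: scaleC_vec_def vec_eq_iff scaleR_scaleC)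
  show "cinner x y = cnj (cinner y x)"
    unfolding cinner_vec_def cnj_sum by (rule sum.cong[OF refl], rule cinner_commute)
  show "cinner x (y + z) = cinner x y + cinner x z"
    by (simp add: cinner_vec_def cinner_add_right sum.distrib)
  show "cinner x (c *\<^sub>C y) = c * cinner x y"
    by (simp add: cinner_vec_def scaleC_vec_def cinner_scaleC_right sum_distrib_left)
  show "inner x y = Re (cinner x y)"
    by (simp add: cinner_vec_def inner_vec_def inner_eq_Re_cinner)
qed

end

instance vec :: (complex_hilbert_space, finite) complex_hilbert_space ..


section \<open>Bounded operators and von Neumann algebras\<close>

text \<open>The elements of \<open>'h \<Rightarrow>\<^sub>L 'h\<close> are only real-linear; \<open>bounded_ops\<close> is \<open>B(H)\<close>.\<close>

type_synonym 'h op = "'h \<Rightarrow>\<^sub>L 'h"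

definition bounded_ops :: "'h::complex_hilbert_space op set" where
  "bounded_ops = {T. \<forall>c x. blinfun_apply T (c *\<^sub>C x) = c *\<^sub>C blinfun_apply T x}"

lift_definition scalar_op :: "complex \<Rightarrow> 'h::complex_hilbert_space op" is "\<lambda>c x. c *\<^sub>C x"
proof -
  fix c :: complex
  show "bounded_linear (\<lambda>x::'h. c *\<^sub>C x)"
    by (rule bounded_linear_intro[where K = "cmod c"])
       (simp_all add: scaleC_add_right scaleR_scaleC scaleC_scaleC norm_scaleC mult.commute)
qed

definition adj_op :: "'h::complex_hilbert_space op \<Rightarrow> 'h op" where
  "adj_op T = (THE S. \<forall>x y. cinner (blinfun_apply S x) y = cinner x (blinfun_apply T y))"

definition positive_op :: "'h::complex_hilbert_space op \<Rightarrow> bool" where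
  "positive_op T \<longleftrightarrow> T \<in> bounded_ops \<and> (\<forall>x. cinner x (blinfun_apply T x) \<in> \<real>\<^sub>\<ge>\<^sub>0)"

definition unitary_op :: "'h::complex_hilbert_space op \<Rightarrow> bool" where
  "unitary_op T \<longleftrightarrow> T \<in> bounded_ops \<and>
     adj_op T o\<^sub>L T = id_blinfun \<and> T o\<^sub>L adj_op T = id_blinfun"

definition op_prod :: "'h::complex_hilbert_space op list \<Rightarrow> 'h op" where
  "op_prod Ts = foldr (o\<^sub>L) Ts id_blinfun"

definition op_power :: "'h::complex_hilbert_space op \<Rightarrow> nat \<Rightarrow> 'h op" where
  "op_power T n = op_prod (replicate n T)"

definition commutant :: "'h::complex_hilbert_space op set \<Rightarrow> 'h op set" where
  "commutant S = {T \<in> bounded_ops. \<forall>X\<in>S. T o\<^sub>L X = X o\<^sub>L T}"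

definition von_neumann_algebra :: "'h::complex_hilbert_space op set \<Rightarrow> bool" where
  "von_neumann_algebra A \<longleftrightarrow>
     A \<subseteq> bounded_ops \<and> (\<forall>T\<in>A. adj_op T \<in> A) \<and> commutant (commutant A) = A"

definition generated_vn_algebra :: "'h::complex_hilbert_space op set \<Rightarrow> 'h op set" where
  "generated_vn_algebra S = commutant (commutant (S \<union> adj_op ` S))"

text \<open>Normality is continuity in the \<open>\<sigma>\<close>-weak (ultraweak) topology, which is generated by the
  seminorms \<open>T \<mapsto> \<bar>\<Sum>\<^sub>n \<langle>\<xi>\<^sub>n, T \<eta>\<^sub>n\<rangle>\<bar>\<close> with \<open>\<xi>\<close> and \<open>\<eta>\<close> square-summable.  A linear functional is
  continuous iff it is dominated by a finite sum of such seminorms (a constant factor can be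
  absorbed into \<open>\<xi>\<close>).\<close>

definition normal_functional ::
    "'h::complex_hilbert_space op set \<Rightarrow> ('h op \<Rightarrow> complex) \<Rightarrow> bool" where
  "normal_functional A \<phi> \<longleftrightarrow>
     (\<exists>(m::nat) (\<xi> :: nat \<Rightarrow> nat \<Rightarrow> 'h) (\<eta> :: nat \<Rightarrow> nat \<Rightarrow> 'h).
        (\<forall>i<m. summable (\<lambda>n. (norm (\<xi> i n))\<^sup>2) \<and> summable (\<lambda>n. (norm (\<eta> i n))\<^sup>2)) \<and>
        (\<forall>T\<in>A. cmod (\<phi> T) \<le> (\<Sum>i<m. cmod (\<Sum>n. cinner (\<xi> i n) (blinfun_apply T (\<eta> i n))))))"

text \<open>The values of \<open>\<phi>\<close> outside \<open>A\<close> are irrelevant.\<close>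

locale wstar_probability_space =
  fixes A :: "'h::complex_hilbert_space op set" and \<phi> :: "'h op \<Rightarrow> complex"
  assumes von_neumann: "von_neumann_algebra A"
    and add: "S \<in> A \<Longrightarrow> T \<in> A \<Longrightarrow> \<phi> (S + T) = \<phi> S + \<phi> T"
    and scale: "T \<in> A \<Longrightarrow> \<phi> (scalar_op c o\<^sub>L T) = c * \<phi> T"
    and positive: "T \<in> A \<Longrightarrow> \<phi> (adj_op T o\<^sub>L T) \<in> \<real>\<^sub>\<ge>\<^sub>0"
    and unit: "\<phi> id_blinfun = 1"
    and faithful: "T \<in> A \<Longrightarrow> \<phi> (adj_op T o\<^sub>L T) = 0 \<Longrightarrow> T = 0"
    and tracial: "S \<in> A \<Longrightarrow> T \<in> A \<Longrightarrow> \<phi> (S o\<^sub>L T) = \<phi> (T o\<^sub>L S)"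
    and normal: "normal_functional A \<phi>"


section \<open>Free independence and R-diagonal elements\<close>

inductive_set star_algebra_generated ::
    "'h::complex_hilbert_space op set \<Rightarrow> 'h op set" for S where
  "T \<in> S \<Longrightarrow> T \<in> star_algebra_generated S"
| "scalar_op c \<in> star_algebra_generated S"
| "T \<in> star_algebra_generated S \<Longrightarrow> adj_op T \<in> star_algebra_generated S"
| "T \<in> star_algebra_generated S \<Longrightarrow> R \<in> star_algebra_generated S \<Longrightarrow>
     T + R \<in> star_algebra_generated S"
| "T \<in> star_algebra_generated S \<Longrightarrow> R \<in> star_algebra_generated S \<Longrightarrow>
     T o\<^sub>L R \<in> star_algebra_generated S"

text \<open>A word is a list of pairs \<open>(i, y)\<close> with \<open>y\<close> a centred element of the unital \<open>*\<close>-algebra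
  generated by \<open>x i\<close>.\<close>

definition star_free ::
    "('h::complex_hilbert_space op \<Rightarrow> complex) \<Rightarrow> 'i set \<Rightarrow> ('i \<Rightarrow> 'h op) \<Rightarrow> bool" where
  "star_free \<phi> I x \<longleftrightarrow>
     (\<forall>w. w \<noteq> [] \<longrightarrow> distinct_adj (map fst w) \<longrightarrow>
        (\<forall>(i, y)\<in>set w. i \<in> I \<and> y \<in> star_algebra_generated {x i} \<and> \<phi> y = 0) \<longrightarrow>
        \<phi> (op_prod (map snd w)) = 0)"

definition noncrossing_partitions :: "nat \<Rightarrow> nat set set set" where
  "noncrossing_partitions n = {\<pi>. partition_on {..<n} \<pi> \<and>
     \<not> (\<exists>V\<in>\<pi>. \<exists>W\<in>\<pi>. V \<noteq> W \<and>
          (\<exists>a b c d. a < b \<and> b < c \<and> c < d \<and> a \<in> V \<and> c \<in> V \<and> b \<in> W \<and> d \<in> W))}"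

text \<open>The moment-cumulant formula \<open>\<phi>(x\<^sub>1 \<cdots> x\<^sub>n) = \<Sum>\<pi>\<in>NC(n). \<Prod>V\<in>\<pi>. \<kappa>[x\<^sub>V]\<close>, solved for the
  term of the one-block partition.\<close>

function free_cumulant ::
    "('h::complex_hilbert_space op \<Rightarrow> complex) \<Rightarrow> 'h op list \<Rightarrow> complex" where
  "free_cumulant \<phi> xs = \<phi> (op_prod xs) -
     (\<Sum>\<pi>\<in>noncrossing_partitions (length xs) - {{{..<length xs}}}.
        \<Prod>V\<in>\<pi>. free_cumulant \<phi> (nths xs V))"
  by auto
termination
proof (relation "Wellfounded.measure (\<lambda>(\<phi>, xs). length xs)", goal_cases)
  case 1
  then show ?case by simp
next
  case (2 \<phi> xs \<pi> V)
  then have part: "partition_on {..<length xs} \<pi>" and ne: "\<pi> \<noteq> {{..<length xs}}"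
    by (auto simp: noncrossing_partitions_def)
  have "V \<noteq> {..<length xs}"
  proof
    assume V: "V = {..<length xs}"
    have "W = V" if "W \<in> \<pi>" for W
    proof (rule ccontr)
      assume "W \<noteq> V"
      with part that 2 have "W \<inter> V = {}"
        by (auto simp: partition_on_def dest: disjointD)
      moreover have "W \<subseteq> {..<length xs}" "W \<noteq> {}"
        using part that by (auto simp: partition_on_def)
      ultimately show False using V by auto
    qed
    with 2 V ne show False by auto
  qed
  moreover have "V \<subseteq> {..<length xs}"
    using part 2 by (auto simp: partition_on_def)
  ultimately have "V \<subset> {..<length xs}" by auto
  then have "card V < length xs"
    using psubset_card_mono[of "{..<length xs}" V] by simp
  moreover have "{i. i < length xs \<and> i \<in> V} = V"
    using \<open>V \<subseteq> {..<length xs}\<close> by auto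
  ultimately show ?case by (simp add: length_nths)
qed

declare free_cumulant.simps [simp del]

text \<open>In a word \<open>\<epsilon>\<close> the letter \<open>True\<close> stands for the adjoint.\<close>

definition R_diagonal ::
    "('h::complex_hilbert_space op \<Rightarrow> complex) \<Rightarrow> 'h op \<Rightarrow> bool" where
  "R_diagonal \<phi> a \<longleftrightarrow>
     (\<forall>\<epsilon>. \<not> (even (length \<epsilon>) \<and> distinct_adj \<epsilon>) \<longrightarrow>
        free_cumulant \<phi> (map (\<lambda>s. if s then adj_op a else a) \<epsilon>) = 0)"


section \<open>Brown measure\<close>

definition abs_op :: "'h::complex_hilbert_space op \<Rightarrow> 'h op" where
  "abs_op x = (THE h. positive_op h \<and> h o\<^sub>L h = adj_op x o\<^sub>L x)"

text \<open>The compactly supported probability measure on the line with the moments of the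
  self-adjoint element \<open>h\<close>.\<close>

definition spectral_distribution ::
    "('h::complex_hilbert_space op \<Rightarrow> complex) \<Rightarrow> 'h op \<Rightarrow> real measure" where
  "spectral_distribution \<phi> h = (THE \<nu>. prob_space \<nu> \<and> sets \<nu> = sets borel \<and>
     (\<exists>R. AE s in \<nu>. \<bar>s\<bar> \<le> R) \<and>
     (\<forall>n. \<phi> (op_power h n) = complex_of_real (LINT s|\<nu>. s ^ n)))"

text \<open>For Lebesgue-almost every \<open>z\<close> the integral below is finite.  On the exceptional null set,
  where the potential is \<open>-\<infinity>\<close>, the library's conventions for \<open>ln 0\<close> and for non-integrable
  functions produce some real value, which does not affect the distributional Laplacian.\<close>

definition log_potential ::
    "('h::complex_hilbert_space op \<Rightarrow> complex) \<Rightarrow> 'h op \<Rightarrow> complex \<Rightarrow> real" where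
  "log_potential \<phi> x z =
     (LINT s:{0..}|spectral_distribution \<phi> (abs_op (x - scalar_op z)). ln s)"

definition dir_deriv :: "complex \<Rightarrow> (complex \<Rightarrow> real) \<Rightarrow> complex \<Rightarrow> real" where
  "dir_deriv v f z = frechet_derivative f (at z) v"

definition laplacian :: "(complex \<Rightarrow> real) \<Rightarrow> complex \<Rightarrow> real" where
  "laplacian f z = dir_deriv 1 (dir_deriv 1 f) z + dir_deriv \<i> (dir_deriv \<i> f) z"

text \<open>Smooth functions of compact support.\<close>

definition test_function :: "(complex \<Rightarrow> real) \<Rightarrow> bool" where
  "test_function f \<longleftrightarrow>
     (\<forall>vs. foldr dir_deriv vs f differentiable_on UNIV) \<and> compact (closure {z. f z \<noteq> 0})"

text \<open>Only the operator \<open>x\<close> and the trace enter: the surrounding von Neumann algebra contains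
  \<open>\<bar>x - z\<bar>\<close> and its powers as soon as it contains \<open>x\<close>.\<close>

definition brown_measure ::
    "('h::complex_hilbert_space op \<Rightarrow> complex) \<Rightarrow> 'h op \<Rightarrow> complex measure" where
  "brown_measure \<phi> x = (THE \<mu>. prob_space \<mu> \<and> sets \<mu> = sets borel \<and>
     (\<forall>f. test_function f \<longrightarrow>
        (LINT z|\<mu>. f z) = 1 / (2 * pi) * (LINT z|lebesgue. log_potential \<phi> x z * laplacian f z)))"


section \<open>Matrices over an operator algebra\<close>

text \<open>\<open>T \<otimes> E\<^bsub>p,q\<^esub>\<close> as an operator on \<open>H\<^sup>k\<close>, with \<open>E\<^bsub>p,q\<^esub>\<close> mapping \<open>e\<^sub>q\<close> to \<open>e\<^sub>p\<close>.\<close>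

lift_definition tensor_unit ::
    "'h::complex_hilbert_space op \<Rightarrow> 'k::finite \<Rightarrow> 'k \<Rightarrow> ('h ^ 'k) op"
  is "\<lambda>T p q x. axis p (T (x $ q))"
proof -
  fix T :: "'h \<Rightarrow> 'h" and p q :: 'k
  assume T: "bounded_linear T"
  have "norm (axis p y :: 'h ^ 'k) = norm y" for y
    by (simp add: norm_eq_sqrt_inner inner_axis_axis)
  then have "bounded_linear (axis p :: 'h \<Rightarrow> 'h ^ 'k)"
    by (intro bounded_linear_intro[where K = 1]) (auto simp: vec_eq_iff axis_def)
  from bounded_linear_compose[OF this bounded_linear_compose[OF T bounded_linear_vec_nth]]
  show "bounded_linear (\<lambda>x. axis p (T (x $ q)) :: 'h ^ 'k)" .
qed

lift_definition matrix_entry ::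
    "('h::complex_hilbert_space ^ 'k::finite) op \<Rightarrow> 'k \<Rightarrow> 'k \<Rightarrow> 'h op"
  is "\<lambda>X p q y. X (axis q y) $ p"
proof -
  fix X :: "'h ^ 'k \<Rightarrow> 'h ^ 'k" and p q :: 'k
  assume X: "bounded_linear X"
  have "norm (axis q y :: 'h ^ 'k) = norm y" for y
    by (simp add: norm_eq_sqrt_inner inner_axis_axis)
  then have "bounded_linear (axis q :: 'h \<Rightarrow> 'h ^ 'k)"
    by (intro bounded_linear_intro[where K = 1]) (auto simp: vec_eq_iff axis_def)
  from bounded_linear_compose[OF bounded_linear_vec_nth bounded_linear_compose[OF X this]]
  show "bounded_linear (\<lambda>y. X (axis q y) $ p)" .
qed

text \<open>The functional \<open>\<phi> \<otimes> tr\<close>.\<close>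

definition matrix_trace ::
    "('h::complex_hilbert_space op \<Rightarrow> complex) \<Rightarrow> ('h ^ 'k::finite) op \<Rightarrow> complex" where
  "matrix_trace \<phi> X = (\<Sum>p\<in>UNIV. \<phi> (matrix_entry X p p)) / of_nat CARD('k)"

end

theory Submission
 imports Defs "HOL-Real_Asymp.Real_Asymp"
begin

text \<open>The Brown measure of \<open>x\<close> is determined by the potential \<open>\<phi>(ln \<bar>x - z\<bar>)\<close>, the limit of
 \<open>\<phi>(ln ((x - z)\<^sup>* (x - z) + e)) / 2\<close> as \<open>e\<close> tends to \<open>0\<close>.  Put \<open>v = u\<^sub>0\<^bsup>1/k\<^esup>\<close>, \<open>s = \<surd>(t/k)\<close> and
 \<open>y\<^sub>j = v + s a\<^sub>j\<close>.  Multiplying \<open>Z + s A - z\<close> by unipotent matrices reduces it to a diagonal matrix with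
 entries \<open>y\<^sub>1 \<cdots> y\<^sub>k - z\<^sup>k\<close> and scalars, so the potential of \<open>Z + s A\<close> at \<open>z\<close> is \<open>1/k\<close> times that of
 \<open>y\<^sub>1 \<cdots> y\<^sub>k\<close> at \<open>z\<^sup>k\<close>; the Laplacian turns this into the push-forward.  Finally
 \<open>y\<^sub>1 \<cdots> y\<^sub>k = u\<^sub>0 (1 + s a'\<^sub>1) \<cdots> (1 + s a'\<^sub>k)\<close> with \<open>a'\<^sub>j = v\<^sup>j\<^sup>-\<^sup>k\<^sup>-\<^sup>1 a\<^sub>j v\<^sup>k\<^sup>-\<^sup>j\<close>, and R-diagonality makes
 \<open>(u\<^sub>0, a'\<^sub>1, \<dots>, a'\<^sub>k)\<close> equal in \<open>*\<close>-distribution to \<open>(u\<^sub>0, a\<^sub>1, \<dots>, a\<^sub>k)\<close>.\<close>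

section \<open>Orthogonal projections and adjoints\<close>

text \<open>The absolute value, the spectral distribution and the Brown measure are definite
  descriptions, so existence and uniqueness of each come before any computation. For the Brown
  measure this means that the Laplacian of the potential is a probability measure: the regularized
  potentials are subharmonic, their Laplacians have a vague limit point, and the growth of the
  potentials at infinity prevents a loss of mass. Multiplicativity of the determinant is replaced by
  a differential inequality for factors \<open>1 + N\<close> with \<open>N * N = 0\<close> and trace
  0. For fixed \<open>e\<close> it costs a constant factor in \<open>e\<close>, which is harmless
  because only the limit at 0 matters. On the free side there are two obstacles. The unitary
  \<open>v\<close> lies in the von Neumann algebra of \<open>u0\<close>, in general not in its
  star-algebra, so freeness has to be extended by density. And the conjugated elements are compared
  with the original ones by expanding words, where products of centred alternating words in one
  R-diagonal element appear; that these have trace 0 when adjoining letters agree is the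
  combinatorial core, a statement on noncrossing partitions.\<close>

lemma projection_exists:
 fixes S :: "'a::{real_inner,complete_space} set"
 assumes "closed S" "subspace S"
 shows "\<exists>y\<in>S. \<forall>z\<in>S. inner (x - y) z = 0"
proof -
 define D where "D = (INF z\<in>S. (norm (x - z))\<^sup>2)"
 have ne: "S ~= {}" using subspace_0[OF assms(2)] by auto
 have bdd: "bdd_below ((%z. (norm (x - z))\<^sup>2) ` S)" by (rule bdd_belowI[of _ 0]) auto
 have low: "D <= (norm (x - z))\<^sup>2" if "z \<in> S" for z unfolding D_def by (rule cINF_lower[OF bdd that])
 have "\<exists>y. y \<in> S & (norm (x - y))\<^sup>2 < D + 1 / (real n + 1)" for n
  using cINF_less_iff[OF ne bdd, of "D + 1 / (real n + 1)"] unfolding D_def[symmetric] by auto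
 then obtain y where y: "!!n. y n \<in> S" "!!n. (norm (x - y n))\<^sup>2 < D + 1 / (real n + 1)" by metis
 have par: "(norm (y m - y n))\<^sup>2 <= 2 / (real m + 1) + 2 / (real n + 1)" for m n
 proof -
  have "(1/2) *\<^sub>R (y m + y n) \<in> S" using y(1) assms(2) by (simp add: subspace_add subspace_scale)
  from low[OF this] have l: "4 * D <= 4 * (norm (x - (1/2) *\<^sub>R (y m + y n)))\<^sup>2" by simp
  have "(norm (y m - y n))\<^sup>2 = 2 * (norm (x - y m))\<^sup>2 + 2 * (norm (x - y n))\<^sup>2
    - 4 * (norm (x - (1/2) *\<^sub>R (y m + y n)))\<^sup>2"
   by (simp add: power2_norm_eq_inner inner_diff inner_add algebra_simps inner_commute)
  thus ?thesis using l y(2)[of m] y(2)[of n] by linarith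
 qed
 have "Cauchy y"
 proof (rule metric_CauchyI)
  fix e :: real assume e: "e > 0"
  obtain N :: nat where N: "4 / e\<^sup>2 < real N" using reals_Archimedean2 by blast
  show "\<exists>M. \<forall>m\<ge>M. \<forall>n\<ge>M. dist (y m) (y n) < e"
  proof (intro exI[of _ N] allI impI)
   fix m n assume mn: "N <= m" "N <= n"
   have "0 < 4 / e\<^sup>2" using e by simp
   hence N0: "real N > 0" using N by linarith
   have "2 / (real m + 1) <= 2 / (real N + 1)" "2 / (real n + 1) <= 2 / (real N + 1)" using mn by (auto intro!: divide_left_mono)
   with par[of m n] have "(norm (y m - y n))\<^sup>2 <= 2 * (2 / (real N + 1))" by linarith
   hence "(norm (y m - y n))\<^sup>2 <= 4 / (real N + 1)" by simp
   also have "... < 4 / real N" using N0 by (simp add: divide_strict_left_mono)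
   also have "... < e\<^sup>2" using N N0 e by (simp add: field_simps)
   finally show "dist (y m) (y n) < e" using e by (simp add: dist_norm power2_less_imp_less)
  qed
 qed
 then obtain l where l: "y \<longlonglongrightarrow> l" using Cauchy_convergent convergent_def by blast
 have lS: "l \<in> S" using closed_sequentially[OF assms(1) _ l] y(1) by blast
 have "(%n. (norm (x - y n))\<^sup>2) \<longlonglongrightarrow> (norm (x - l))\<^sup>2" by (intro tendsto_intros l)
 moreover have "(%n. D + 1 / (real n + 1)) \<longlonglongrightarrow> D + 0"
  using LIMSEQ_inverse_real_of_nat by (intro tendsto_intros) (simp add: inverse_eq_divide add.commute)
 ultimately have lD: "(norm (x - l))\<^sup>2 <= D" using y(2) by (intro LIMSEQ_le) (auto intro: less_imp_le)
 have "inner (x - l) z = 0" if z: "z \<in> S" for z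
 proof (cases "z = 0")
  case False
  define t where "t = inner (x - l) z / inner z z"
  have "l + t *\<^sub>R z \<in> S" using lS z assms(2) by (simp add: subspace_add subspace_scale)
  from order_trans[OF lD low[OF this]]
  have "(norm (x - l))\<^sup>2 <= (norm ((x - l) - t *\<^sub>R z))\<^sup>2" by (simp only: diff_diff_eq)
  also have "... = (norm (x - l))\<^sup>2 - 2 * t * inner (x - l) z + t\<^sup>2 * inner z z"
   unfolding power2_norm_eq_inner by (simp add: inner_diff inner_commute algebra_simps power2_eq_square)
  finally have "2 * t * inner (x - l) z <= t\<^sup>2 * inner z z" by simp
  hence "2 * (inner (x - l) z)\<^sup>2 / inner z z <= (inner (x - l) z)\<^sup>2 / inner z z"
   using False by (simp add: t_def power2_eq_square divide_simps split: if_splits)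
  hence "(inner (x - l) z)\<^sup>2 <= 0" using False by (simp add: divide_simps)
  thus ?thesis by simp
 qed simp
 with lS show ?thesis by blast
qed

lemma Riesz_representation:
 fixes f :: "'a::{real_inner,complete_space} => real"
 assumes f: "bounded_linear f"
 shows "\<exists>y. \<forall>x. f x = inner y x"
proof (cases "\<forall>x. f x = 0")
 case True thus ?thesis by (intro exI[of _ 0]) auto
next
 case False
 interpret bounded_linear f by (rule f)
 obtain x0 where x0: "f x0 ~= 0" using False by auto
 let ?S = "{x. f x = 0}"
 have "closed ?S" by (intro closed_Collect_eq continuous_intros continuous_on)
 moreover have "subspace ?S" by (auto simp: subspace_def zero add scaleR)
 ultimately obtain y where y: "f y = 0" "\<forall>z\<in>?S. inner (x0 - y) z = 0" using projection_exists[of ?S x0] by auto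
 define w where "w = x0 - y"
 have fw: "f w ~= 0" using x0 y by (simp add: w_def diff)
 hence w0: "w ~= 0" by (auto simp: zero)
 have "f x = inner ((f w / inner w w) *\<^sub>R w) x" for x
 proof -
  have "x - (f x / f w) *\<^sub>R w \<in> ?S" using fw by (simp add: diff scaleR)
  with y(2) have "inner w (x - (f x / f w) *\<^sub>R w) = 0" unfolding w_def by blast
  hence "inner w x = f x / f w * inner w w" by (simp add: inner_diff_right)
  thus ?thesis using fw w0 by simp
 qed
 thus ?thesis by blast
qed

lemma real_adjoint_exists:
 fixes T :: "'a::{real_inner,complete_space} => 'b::real_inner"
 assumes T: "bounded_linear T"
 shows "\<exists>S. bounded_linear S & (\<forall>x y. inner (S x) y = inner x (T y))"
proof -
 have "\<exists>s. \<forall>y. inner x (T y) = inner s y" for x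
  by (rule Riesz_representation, rule bounded_linear_compose[OF bounded_linear_inner_right T])
 then obtain S where S: "!!x y. inner (S x) y = inner x (T y)" by metis
 obtain K where K: "!!y. norm (T y) <= norm y * K" and K0: "K >= 0" using bounded_linear.nonneg_bounded[OF T] by blast
 have "bounded_linear S"
 proof (rule bounded_linear_intro[where K = K])
  show "S (x + y) = S x + S y" for x y by (rule vector_eq_rdot[THEN iffD1]) (simp add: S inner_add linear_simps(1)[OF T])
  show "S (r *\<^sub>R x) = r *\<^sub>R S x" for r x by (rule vector_eq_rdot[THEN iffD1]) (simp add: S linear_simps(5)[OF T])
  show "norm (S x) <= norm x * K" for x
  proof (cases "S x = 0")
   case True
   have "0 <= norm x * K" using K0 by simp
   thus ?thesis using True by simp
  next
   case False
   have "norm (S x) * norm (S x) = inner x (T (S x))" using S[of x "S x"] by (simp add: power2_norm_eq_inner flip: power2_eq_square)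
   also have "... <= norm x * norm (T (S x))" by (rule norm_cauchy_schwarz)
   also have "... <= norm x * (norm (S x) * K)" by (intro mult_left_mono K) auto
   finally have "norm (S x) * norm (S x) <= (norm x * K) * norm (S x)" by (simp add: algebra_simps)
   thus ?thesis using False by simp
  qed
 qed
 with S show ?thesis by blast
qed

text \<open>A complex inner product is determined by its real part, so adjoints can be constructed
  for the real structure and then transferred.\<close>

lemma cinner_eq: "cinner x y = Complex (inner x y) (- inner x (\<i> *\<^sub>C y))"
 by (simp add: complex_eq_iff inner_eq_Re_cinner cinner_scaleC_right)

lemma scaleC_0_right [simp]: "c *\<^sub>C (0::'a::complex_inner_space) = 0" using scaleC_add_right[of c 0 "0::'a"] by simp

lemma scaleC_1 [simp]: "1 *\<^sub>C (x::'a::complex_inner_space) = x" using scaleR_scaleC[of 1 x] by simp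

lemma cinner_add_left: "cinner (x + y) z = cinner x z + cinner y z" by (metis cinner_add_right cinner_commute complex_cnj_add)

lemma cinner_scaleC_left: "cinner (c *\<^sub>C x) y = cnj c * cinner x y"
 by (metis cinner_commute cinner_scaleC_right complex_cnj_mult)

lemma cinner_ext:
 assumes "!!y. cinner x y = cinner x' y" shows "x = x'"
 using assms by (intro vector_eq_rdot[THEN iffD1]) (simp add: inner_eq_Re_cinner)

lemma cinner_0 [simp]: "cinner 0 x = 0" "cinner x 0 = 0" by (simp_all add: cinner_eq complex_eq_iff)

lemma cmod_cinner_le: "cmod (cinner x y) <= norm x * norm y"
proof (cases "cinner x y = 0")
 case False
 define c where "c = cnj (sgn (cinner x y))"
 have "cmod (cinner x y) = Re (c * cinner x y)"
  using False by (simp add: c_def sgn_eq complex_mult_cnj cmod_def power2_eq_square real_div_sqrt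
   flip: add_divide_distrib)
 also have "... = inner x (c *\<^sub>C y)" by (simp add: inner_eq_Re_cinner cinner_scaleC_right)
 also have "... <= norm x * norm (c *\<^sub>C y)" by (rule norm_cauchy_schwarz)
 also have "... = norm x * norm y" using False by (simp add: norm_scaleC c_def norm_sgn)
 finally show ?thesis .
qed simp

lemma cinner_same: "cinner x x = complex_of_real ((norm x)\<^sup>2)"
 by (simp add: complex_eq_iff Im_cinner_self power2_norm_eq_inner inner_eq_Re_cinner)

lemma adj_op_unique:
 assumes "!!x y. cinner (blinfun_apply S x) y = cinner x (blinfun_apply T y)"
 shows "adj_op T = S" unfolding adj_op_def
proof (rule the_equality)
 show "S' = S" if "\<forall>x y. cinner (blinfun_apply S' x) y = cinner x (blinfun_apply T y)" for S'
  by (rule blinfun_eqI, rule cinner_ext) (simp add: that assms)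
qed (simp add: assms)

lemma adj_op_exists:
 assumes T: "T \<in> bounded_ops"
 shows "adj_op T \<in> bounded_ops"
  "cinner (blinfun_apply (adj_op T) x) y = cinner x (blinfun_apply T y)"
proof -
 obtain S where S: "bounded_linear S" "!!x y. inner (S x) y = inner x (blinfun_apply T y)"
  using real_adjoint_exists[OF blinfun.bounded_linear_right[of T]] by blast
 have Tc: "blinfun_apply T (c *\<^sub>C z) = c *\<^sub>C blinfun_apply T z" for c z using T by (simp add: bounded_ops_def)
 have S': "cinner (S x) y = cinner x (blinfun_apply T y)" for x y by (simp add: cinner_eq S Tc)
 have ad: "adj_op T = Blinfun S" by (rule adj_op_unique) (simp add: bounded_linear_Blinfun_apply[OF S(1)] S')
 show "cinner (blinfun_apply (adj_op T) x) y = cinner x (blinfun_apply T y)" by (simp add: ad bounded_linear_Blinfun_apply[OF S(1)] S')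
 have "S (c *\<^sub>C x) = c *\<^sub>C S x" for c x by (rule cinner_ext) (simp add: S' cinner_scaleC_left)
 thus "adj_op T \<in> bounded_ops" by (simp add: bounded_ops_def ad bounded_linear_Blinfun_apply[OF S(1)])
qed

section \<open>The algebra of bounded operators\<close>

text \<open>A type for B(H) makes the ring and Banach space classes available, so that power series
  and algebraic rewriting apply. Complex scalars act through the central elements
  \<open>cs c\<close> defined below.\<close>

typedef (overloaded) 'h bop = "bounded_ops :: 'h::complex_hilbert_space op set"
 morphisms op_of bop_of by (rule exI[of _ 0]) (simp add: bounded_ops_def)

setup_lifting type_definition_bop

instantiation bop :: (complex_hilbert_space) "{zero, plus, uminus, minus, scaleR}"
begin
lift_definition zero_bop :: "'a bop" is 0 by (simp add: bounded_ops_def)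
lift_definition plus_bop :: "'a bop => 'a bop => 'a bop" is "(+)" by (simp add: bounded_ops_def blinfun.add_left scaleC_add_right)
lift_definition uminus_bop :: "'a bop => 'a bop" is "uminus"
proof -
 fix b :: "'a op" assume b: "b \<in> bounded_ops"
 have "c *\<^sub>C (- x) = - (c *\<^sub>C x)" for c and x :: 'a
  using scaleC_add_right[of c x "-x"] by (simp add: add_eq_0_iff2 minus_unique)
 thus "- b \<in> bounded_ops" using b by (simp add: bounded_ops_def blinfun.minus_left)
qed
lift_definition minus_bop :: "'a bop => 'a bop => 'a bop" is "(-)"
proof -
 fix b d :: "'a op" assume b: "b \<in> bounded_ops" "d \<in> bounded_ops"
 have "c *\<^sub>C (x - y) = c *\<^sub>C x - c *\<^sub>C y" for c and x y :: 'a
  by (metis add_diff_cancel diff_add_cancel scaleC_add_right)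
 thus "b - d \<in> bounded_ops" using b by (simp add: bounded_ops_def blinfun.diff_left)
qed
lift_definition scaleR_bop :: "real => 'a bop => 'a bop" is "(*\<^sub>R)"
 by (simp add: bounded_ops_def blinfun.scaleR_left scaleR_scaleC scaleC_scaleC mult.commute)
instance ..
end

instantiation bop :: (complex_hilbert_space) real_normed_vector
begin
lift_definition norm_bop :: "'a bop => real" is norm .
definition dist_bop :: "'a bop => 'a bop => real" where "dist_bop x y = norm (x - y)"
definition sgn_bop :: "'a bop => 'a bop" where "sgn_bop x = x /\<^sub>R norm x"
definition uniformity_bop :: "('a bop \<times> 'a bop) filter"
 where "uniformity_bop = (INF e\<in>{0<..}. principal {(x, y). dist x y < e})"
definition open_bop :: "'a bop set => bool"
 where "open_bop U = (\<forall>x\<in>U. \<forall>\<^sub>F (x', y) in uniformity. x' = x --> y \<in> U)"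
instance
proof
 fix x y z :: "'a bop" and a b :: real and U :: "'a bop set"
 show "dist x y = norm (x - y)" "sgn x = x /\<^sub>R norm x"
  "uniformity = (INF e\<in>{0<..}. principal {(x :: 'a bop, y). dist x y < e})"
  "open U = (\<forall>x\<in>U. \<forall>\<^sub>F (x', y) in uniformity. x' = x --> y \<in> U)"
  by (rule dist_bop_def sgn_bop_def uniformity_bop_def open_bop_def)+
 show "x + y + z = x + (y + z)" by transfer (rule add.assoc)
 show "x + y = y + x" by transfer (rule add.commute)
 show "0 + x = x" by transfer (rule add_0_left)
 show "- x + x = 0" by transfer (rule left_minus)
 show "x - y = x + - y" by transfer (rule diff_conv_add_uminus)
 show "a *\<^sub>R (x + y) = a *\<^sub>R x + a *\<^sub>R y" by transfer (rule scaleR_add_right)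
 show "(a + b) *\<^sub>R x = a *\<^sub>R x + b *\<^sub>R x" by transfer (rule scaleR_add_left)
 show "a *\<^sub>R b *\<^sub>R x = (a * b) *\<^sub>R x" by transfer (rule scaleR_scaleR)
 show "1 *\<^sub>R x = x" by transfer (rule scaleR_one)
 show "(norm x = 0) = (x = 0)" by transfer (rule norm_eq_zero)
 show "norm (x + y) <= norm x + norm y" by transfer (rule norm_triangle_ineq)
 show "norm (a *\<^sub>R x) = \<bar>a\<bar> * norm x" by transfer (rule norm_scaleR)
qed
end

text \<open>The Hilbert space may be zero, so \<open>norm 1 = 1\<close> cannot be required; the
  bound \<open>norm_one_bop\<close> takes its place.\<close>

instantiation bop :: (complex_hilbert_space) "{real_normed_algebra, monoid_mult}"
begin
lift_definition one_bop :: "'a bop" is id_blinfun by (simp add: bounded_ops_def)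
lift_definition times_bop :: "'a bop => 'a bop => 'a bop" is "(o\<^sub>L)" by (simp add: bounded_ops_def)
instance
proof
 fix x y z :: "'a bop" and r :: real
 show "x * y * z = x * (y * z)" by transfer (auto intro!: blinfun_eqI)
 show "(x + y) * z = x * z + y * z" "x * (y + z) = x * y + x * z"
  by (transfer; auto intro!: blinfun_eqI simp: blinfun.add_left blinfun.add_right)+
 show "1 * x = x" "x * 1 = x" by (transfer; auto intro!: blinfun_eqI)+
 show "norm (x * y) <= norm x * norm y" by transfer (rule norm_blinfun_compose)
 show "r *\<^sub>R x * y = r *\<^sub>R (x * y)" "x * r *\<^sub>R y = r *\<^sub>R (x * y)"
  by (transfer; auto intro!: blinfun_eqI simp: blinfun.scaleR_left blinfun.scaleR_right)+
qed
end

lift_definition ap :: "'h::complex_hilbert_space bop => 'h => 'h" is blinfun_apply .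
lift_definition cs :: "complex => 'h::complex_hilbert_space bop" is scalar_op
 by (simp add: bounded_ops_def scalar_op.rep_eq scaleC_scaleC mult.commute)
lift_definition adj :: "'h::complex_hilbert_space bop => 'h bop" is adj_op by (rule adj_op_exists)

instance complex_hilbert_space \<subseteq> banach ..

instance bop :: (complex_hilbert_space) banach
proof
 fix X :: "nat => 'a bop" assume C: "Cauchy X"
 have nd: "norm (op_of (X m) - op_of (X n)) = dist (X m) (X n)" for m n unfolding dist_bop_def by transfer simp
 have "Cauchy (%n. op_of (X n))" using C unfolding Cauchy_def by (simp add: dist_norm nd)
 hence "convergent (%n. op_of (X n))" by (rule Cauchy_convergent)
 then obtain L where L: "(%n. op_of (X n)) \<longlonglongrightarrow> L" unfolding convergent_def by (elim exE)
 have Lb: "L \<in> bounded_ops" unfolding bounded_ops_def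
 proof (intro CollectI allI)
  fix c and x :: 'a
  have lc: "bounded_linear ((*\<^sub>C) c :: 'a => 'a)" by (rule bounded_linear_intro[where K = "cmod c"])
     (simp_all add: scaleC_add_right scaleR_scaleC scaleC_scaleC norm_scaleC mult.commute)
  have "(%n. blinfun_apply (op_of (X n)) (c *\<^sub>C x)) \<longlonglongrightarrow> blinfun_apply L (c *\<^sub>C x)"
   by (intro tendsto_intros L)
  moreover have "(%n. c *\<^sub>C blinfun_apply (op_of (X n)) x) \<longlonglongrightarrow> c *\<^sub>C blinfun_apply L x"
   by (intro bounded_linear.tendsto[OF lc] tendsto_intros L)
  moreover have "blinfun_apply (op_of (X n)) (c *\<^sub>C x) = c *\<^sub>C blinfun_apply (op_of (X n)) x" for n
   using op_of[of "X n"] by (simp add: bounded_ops_def)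
  ultimately show "blinfun_apply L (c *\<^sub>C x) = c *\<^sub>C blinfun_apply L x" using LIMSEQ_unique by simp
 qed
 have "norm (X n - bop_of L) = norm (op_of (X n) - L)" for n using Lb by (simp add: norm_bop.rep_eq minus_bop.rep_eq bop_of_inverse)
 hence "X \<longlonglongrightarrow> bop_of L" using L unfolding LIMSEQ_def by (simp add: dist_norm)
 thus "convergent X" by (auto simp: convergent_def)
qed

lemma bop_eqI: "(!!u. ap x u = ap y u) ==> x = y" by transfer (rule blinfun_eqI)

lemma ap_simps [simp]:
 "ap (x + y) u = ap x u + ap y u" "ap (x - y) u = ap x u - ap y u" "ap (- x) u = - ap x u"
 "ap 0 u = 0" "ap 1 u = u" "ap (x * y) u = ap x (ap y u)" "ap (cs c) u = c *\<^sub>C u"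
 "ap (r *\<^sub>R x) u = r *\<^sub>R ap x u" by (transfer; simp add: blinfun.bilinear_simps scalar_op.rep_eq)+

lemma ap_right [simp]:
 "ap x (u + v) = ap x u + ap x v" "ap x (u - v) = ap x u - ap x v" "ap x 0 = 0"
 "ap x (r *\<^sub>R u) = r *\<^sub>R ap x u" "ap x (c *\<^sub>C u) = c *\<^sub>C ap x u"
 by (transfer; simp add: blinfun.bilinear_simps bounded_ops_def)+

lemma norm_ap: "norm (ap x u) <= norm x * norm u" by transfer (rule norm_blinfun)

lemma norm_bop_bound: "0 <= b ==> (!!u. norm (ap x u) <= b * norm u) ==> norm x <= b" by transfer (rule norm_blinfun_bound)

lemma cinner_adj: "cinner (ap (adj x) u) v = cinner u (ap x v)" by transfer (rule adj_op_exists)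

lemma cinner_adj': "cinner (ap x u) v = cinner u (ap (adj x) v)" by (metis cinner_adj cinner_commute)

lemma adj_unique: "(!!u v. cinner (ap y u) v = cinner u (ap x v)) ==> adj x = y" by transfer (rule adj_op_unique)

lemma adj_simps [simp]:
 "adj (adj x) = x" "adj (x + y) = adj x + adj y" "adj (x - y) = adj x - adj y" "adj (- x) = - adj x"
 "adj 0 = 0" "adj 1 = 1" "adj (x * y) = adj y * adj x" "adj (cs c) = cs (cnj c)"
 "adj (r *\<^sub>R x) = r *\<^sub>R adj x"
proof -
 have d: "cinner u (v - w) = cinner u v - cinner u w" for u v w :: 'a using cinner_add_right[of u "v - w" w] by simp
 have m: "cinner u (- v) = - cinner u v" for u v :: 'a using d[of u 0 v] by simp
 have d': "cinner (v - w) u = cinner v u - cinner w u" for u v w :: 'a using cinner_add_left[of "v - w" w u] by simp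
 have m': "cinner (- v) u = - cinner v u" for u v :: 'a using d'[of 0 v u] by simp
 show "adj (adj x) = x" by (rule adj_unique) (simp add: cinner_adj')
 show "adj (x + y) = adj x + adj y" by (rule adj_unique) (simp add: cinner_adj cinner_add_left cinner_add_right)
 show "adj (x - y) = adj x - adj y" by (rule adj_unique) (simp add: cinner_adj d d')
 show "adj (- x) = - adj x" by (rule adj_unique) (simp add: cinner_adj m m')
 show "adj 0 = 0" "adj 1 = 1" by (rule adj_unique; simp)+
 show "adj (x * y) = adj y * adj x" by (rule adj_unique) (simp add: cinner_adj)
 show "adj (cs c) = cs (cnj c)" by (rule adj_unique) (simp add: cinner_scaleC_left cinner_scaleC_right)
 show "adj (r *\<^sub>R x) = r *\<^sub>R adj x"
  by (rule adj_unique) (simp add: cinner_adj scaleR_scaleC cinner_scaleC_left cinner_scaleC_right)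
qed

lemma norm_adj [simp]: "norm (adj x) = norm x"
proof -
 have le: "norm (adj x) <= norm x" for x :: "'a bop"
 proof (rule norm_bop_bound)
  fix u
  show "norm (ap (adj x) u) <= norm x * norm u"
  proof (cases "ap (adj x) u = 0")
   case False
   have "norm (ap (adj x) u) * norm (ap (adj x) u) = Re (cinner (ap (adj x) u) (ap (adj x) u))"
    by (simp add: cinner_same flip: power2_eq_square)
   also have "... = Re (cinner u (ap x (ap (adj x) u)))" by (simp add: cinner_adj)
   also have "... <= cmod (cinner u (ap x (ap (adj x) u)))" by (rule complex_Re_le_cmod)
   also have "... <= norm u * norm (ap x (ap (adj x) u))" by (rule cmod_cinner_le)
   also have "... <= norm u * (norm x * norm (ap (adj x) u))" by (intro mult_left_mono norm_ap) auto
   finally show ?thesis using False by (simp add: algebra_simps)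
  qed simp
 qed simp
 show ?thesis using le[of x] le[of "adj x"] by simp
qed

lemma bounded_linear_adj: "bounded_linear adj" by (rule bounded_linear_intro[where K = 1]) simp_all

lemma scaleC_0_left [simp]: "0 *\<^sub>C u = (0::'a::complex_inner_space)" using scaleR_scaleC[of 0 u, symmetric] by simp

lemma scaleC_minus_left: "(- c) *\<^sub>C u = - (c *\<^sub>C (u::'a::complex_inner_space))"
 using scaleC_add_left[of c "- c" u] by (simp add: eq_neg_iff_add_eq_0 add.commute)

lemma scaleC_diff_left: "(c - d) *\<^sub>C u = c *\<^sub>C u - d *\<^sub>C (u::'a::complex_inner_space)"
 using scaleC_add_left[of c "- d" u] by (simp add: scaleC_minus_left)

lemma cs_simps [simp]:
 "cs (c + d) = cs c + cs d" "cs (c - d) = cs c - cs d" "cs (- c) = - cs c" "cs 0 = 0" "cs 1 = 1"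
 "cs (c * d) = cs c * cs d" by (rule bop_eqI; simp add: scaleC_add_left scaleC_diff_left scaleC_minus_left scaleC_scaleC mult.commute)+

lemma cs_commute: "x * cs c = cs c * x" by (rule bop_eqI) simp

lemma cs_left_commute: "x * (cs c * y) = cs c * (x * y)" by (rule bop_eqI) simp

lemma cs_of_real: "cs (complex_of_real r) * x = r *\<^sub>R x" by (rule bop_eqI) (simp add: scaleR_scaleC)

lemma cs_of_real': "cs (complex_of_real r) = r *\<^sub>R 1" by (rule bop_eqI) (simp add: scaleR_scaleC)

lemma norm_cs: "norm (cs c :: 'h::complex_hilbert_space bop) <= cmod c" by (rule norm_bop_bound) (simp_all add: norm_scaleC)

lemma norm_one_bop: "norm (1 :: 'h::complex_hilbert_space bop) <= 1" by (rule norm_bop_bound) simp_all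

lemma norm_power_bop: "norm (x ^ n :: 'h::complex_hilbert_space bop) <= norm x ^ n"
proof (induction n)
 case (Suc n)
 have "norm (x * x ^ n) <= norm x * norm (x ^ n)" by (rule norm_mult_ineq)
 also have "... <= norm x * norm x ^ n" by (intro mult_left_mono Suc) auto
 finally show ?case by simp
qed (simp add: norm_one_bop)

section \<open>Moment problems on a bounded interval\<close>

text \<open>The characteristic function of a law on a bounded interval is the limit of its moment
  series, by dominated convergence with majorant \<open>exp (abs t * abs R)\<close>.\<close>

lemma moments_determine_measure:
 fixes \<mu> \<nu> :: "real measure"
 assumes \<mu>: "prob_space \<mu>" "sets \<mu> = sets borel" "AE s in \<mu>. \<bar>s\<bar> <= R"
  and \<nu>: "prob_space \<nu>" "sets \<nu> = sets borel" "AE s in \<nu>. \<bar>s\<bar> <= R"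
  and eq: "!!n. (LINT s|\<mu>. s ^ n) = (LINT s|\<nu>. s ^ n)"
 shows "\<mu> = \<nu>"
proof (rule Levy_uniqueness)
 have rd: "real_distribution M" if "prob_space M" "sets M = sets borel" for M :: "real measure"
 proof -
  interpret prob_space M by (rule that)
  show ?thesis by unfold_locales (use that sets_eq_imp_space_eq[OF that(2)] in auto)
 qed
 show "real_distribution \<mu>" "real_distribution \<nu>" using rd \<mu> \<nu> by blast+
 have lim: "(%N. \<Sum>n<N. (\<i> * t) ^ n /\<^sub>R fact n * complex_of_real (LINT s|M. s ^ n)) \<longlonglongrightarrow> char M t"
  if M: "prob_space M" "sets M = sets borel" "AE s in M. \<bar>s\<bar> <= R" for M t
 proof -
  interpret real_distribution M by (rule rd[OF M(1,2)])
  have int: "integrable M (%s. s ^ n)" for n by (rule integrable_const_bound[of _ "\<bar>R\<bar> ^ n"])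
     (use M(3) in "auto elim!: eventually_mono simp: power_abs intro!: power_mono")
  have eqn: "(\<Sum>n<N. (\<i> * t) ^ n /\<^sub>R fact n * complex_of_real (LINT s|M. s ^ n))
    = (LINT s|M. (\<Sum>n<N. (\<i> * complex_of_real (t * s)) ^ n /\<^sub>R fact n))" for N
  proof -
   have "(LINT s|M. (\<Sum>n<N. (\<i> * complex_of_real (t * s)) ^ n /\<^sub>R fact n))
     = (LINT s|M. (\<Sum>n<N. (\<i> * t) ^ n /\<^sub>R fact n * complex_of_real (s ^ n)))"
    by (intro Bochner_Integration.integral_cong refl sum.cong) (simp add: power_mult_distrib mult_ac)
   also have "... = (\<Sum>n<N. (\<i> * t) ^ n /\<^sub>R fact n * (LINT s|M. complex_of_real (s ^ n)))"
    by (subst Bochner_Integration.integral_sum) (auto intro!: integrable_of_real int simp del: of_real_power)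
   finally show ?thesis by (simp del: of_real_power)
  qed
  have "(%N. LINT s|M. (\<Sum>n<N. (\<i> * complex_of_real (t * s)) ^ n /\<^sub>R fact n)) \<longlonglongrightarrow> (CLINT s|M. iexp (t * s))"
  proof (rule integral_dominated_convergence[where w = "%_. exp (\<bar>t\<bar> * \<bar>R\<bar>)"])
   show "AE s in M. (%N. \<Sum>n<N. (\<i> * complex_of_real (t * s)) ^ n /\<^sub>R fact n) \<longlonglongrightarrow> iexp (t * s)"
    using exp_converges[of "\<i> * complex_of_real (t * s)" for s] by (auto simp: sums_def)
   show "AE s in M. norm (\<Sum>n<N. (\<i> * complex_of_real (t * s)) ^ n /\<^sub>R fact n) <= exp (\<bar>t\<bar> * \<bar>R\<bar>)" for N
    using M(3)
   proof eventually_elim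
    case (elim s)
    have "norm (\<Sum>n<N. (\<i> * complex_of_real (t * s)) ^ n /\<^sub>R fact n) <= (\<Sum>n<N. (\<bar>t\<bar> * \<bar>R\<bar>) ^ n /\<^sub>R fact n)"
     using elim by (intro sum_norm_le) (auto simp: norm_mult norm_power abs_mult intro!: mult_left_mono power_mono)
    also have "... <= exp (\<bar>t\<bar> * \<bar>R\<bar>)" unfolding sums_unique[OF exp_converges[of "\<bar>t\<bar> * \<bar>R\<bar>"]]
     by (rule sum_le_suminf[OF sums_summable[OF exp_converges]]) auto
    finally show ?case .
   qed
  qed (auto intro!: borel_measurable_sum)
  thus ?thesis unfolding char_def eqn .
 qed
 show "char \<mu> = char \<nu>"
 proof
  fix t
  show "char \<mu> t = char \<nu> t" using LIMSEQ_unique[OF lim[OF \<mu>, of t]] lim[OF \<nu>, of t] eq by simp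
 qed
qed

text \<open>Image measures on the unit interval are tight, so Helly's theorem applies. The measures
  stay on their own spaces because the lemma serves both the Bernstein weights and the coded
  measures of the plane.\<close>

lemma unit_interval_subsequence:
 fixes E :: "nat => 'a => real"
 assumes p: "!!n. prob_space (\<mu> n)" and E: "!!n. E n \<in> borel_measurable (\<mu> n)"
  and E01: "!!n x. x \<in> space (\<mu> n) ==> 0 <= E n x & E n x <= 1"
 shows "\<exists>s \<nu>. strict_mono s & real_distribution \<nu> & (\<forall>f B. continuous_on UNIV f --> (\<forall>x. \<bar>f x\<bar> <= B) -->
  (%n. LINT x|\<mu> (s n). f (E (s n) x)) \<longlonglongrightarrow> (LINT x|\<nu>. f x :: real))"
proof -
 define M where "M n = distr (\<mu> n) borel (E n)" for n
 have rd: "real_distribution (M n)" for n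
 proof -
  interpret prob_space "M n" unfolding M_def by (rule prob_space.prob_space_distr[OF p E])
  show ?thesis by unfold_locales (auto simp: M_def)
 qed
 have tight: "tight M" unfolding tight_def
 proof (intro conjI allI impI rd)
  fix e :: real assume e: "e > 0"
  have "measure (M n) {-1<..1} = 1" for n
  proof -
   interpret prob_space "\<mu> n" by (rule p)
   have "-1 < E n x" if "x \<in> space (\<mu> n)" for x using E01[OF that] by linarith
   hence "E n -` {-1<..1} \<inter> space (\<mu> n) = space (\<mu> n)" using E01[of _ n] by auto
   thus ?thesis unfolding M_def by (subst measure_distr[OF E]) (auto simp: prob_space)
  qed
  with e show "\<exists>a b. a < b & (\<forall>n. 1 - e < measure (M n) {a<..b})" by (intro exI[of _ "-1"] exI[of _ 1]) auto
 qed
 obtain s \<nu> where s: "strict_mono s" and \<nu>: "real_distribution \<nu>" and wc: "weak_conv_m (M \<circ> s) \<nu>"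
  using tight_imp_convergent_subsubsequence[OF tight, of id] by (auto simp: strict_mono_id)
 have rds: "real_distribution ((M \<circ> s) n)" for n using rd by simp
 have "(%n. LINT x|\<mu> (s n). f (E (s n) x)) \<longlonglongrightarrow> (LINT x|\<nu>. f x)"
  if f: "continuous_on UNIV f" and B: "!!x. \<bar>f x\<bar> <= B" for f :: "real => real" and B
 proof -
  have "(%n. LINT x|(M \<circ> s) n. f x) \<longlonglongrightarrow> (LINT x|\<nu>. f x)"
   by (rule weak_conv_imp_integral_bdd_continuous_conv[OF rds \<nu> wc]) (use f B in "auto simp: continuous_on_eq_continuous_at")
  moreover have "(LINT x|(M \<circ> s) n. f x) = (LINT x|\<mu> (s n). f (E (s n) x))" for n
   unfolding M_def comp_def by (rule integral_distr[OF E]) (rule borel_measurable_continuous_onI[OF f])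
  ultimately show ?thesis by simp
 qed
 thus ?thesis using s \<nu> by blast
qed

text \<open>The values \<open>r i j\<close> stand for the moments of \<open>s\<^sup>i (1 - s)\<^sup>j\<close>; the solution is a limit of the
 measures with the Bernstein weights \<open>binomial N j * r j (N - j)\<close> at \<open>j / N\<close>.\<close>

lemma Hausdorff_moment_problem:
 fixes r :: "nat => nat => real"
 assumes pos: "!!i j. r i j >= 0" and rec: "!!i j. r i j = r (Suc i) j + r i (Suc j)" and one: "r 0 0 = 1"
 shows "\<exists>\<nu>. prob_space \<nu> & sets \<nu> = sets borel & (AE s in \<nu>. 0 <= s & s <= (1::real)) &
  (\<forall>n. (LINT s|\<nu>. s ^ n) = r n 0)"
proof -
 \<comment> \<open>Applying \<open>rec\<close> N times splits \<open>r a b\<close> binomially; for a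
   = b = 0 this says that the weights have sum 1.\<close>
 have expand: "(\<Sum>j\<le>N. real (N choose j) * r (a + j) (b + (N - j))) = r a b" for N a b
 proof (induction N arbitrary: a b)
  case (Suc N)
  have "(\<Sum>j\<le>Suc N. real (Suc N choose j) * r (a + j) (b + (Suc N - j)))
    = r a (b + Suc N) + (\<Sum>j\<le>N. real ((N choose j) + (N choose Suc j)) * r (a + Suc j) (b + (N - j)))"
   by (subst sum.atMost_Suc_shift) simp
  also have "... = (\<Sum>j\<le>N. real (N choose j) * r (Suc a + j) (b + (N - j)))
    + (r a (b + Suc N) + (\<Sum>j\<le>N. real (N choose Suc j) * r (a + Suc j) (b + (N - j))))"
   by (simp add: algebra_simps sum.distrib)
  also have "r a (b + Suc N) + (\<Sum>j\<le>N. real (N choose Suc j) * r (a + Suc j) (b + (N - j)))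
    = (\<Sum>j\<le>Suc N. real (N choose j) * r (a + j) (b + (Suc N - j)))" by (subst sum.atMost_Suc_shift) simp
  also have "... = (\<Sum>j\<le>N. real (N choose j) * r (a + j) (Suc b + (N - j)))" by (simp add: Suc_diff_le)
  finally show ?case unfolding Suc.IH using rec[of a b] by simp
 qed simp
 define w where "w N j = real (N choose j) * r j (N - j)" for N j
 have w0: "w N j >= 0" for N j using pos by (simp add: w_def)
 have w1: "(\<Sum>j\<le>N. w N j) = 1" for N using expand[of N 0 0] one by (simp add: w_def)
 define M where "M N = density (count_space {..N}) (%j. ennreal (w N j))" for N
 have int: "(LINT j|M N. f (real j / real N)) = (\<Sum>j\<le>N. w N j * f (real j / real N))" for f :: "real => real" and N
  unfolding M_def by (subst integral_density) (auto simp: w0 lebesgue_integral_count_space_finite)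
 have prob: "prob_space (M N)" for N
 proof
  have "emeasure (M N) (space (M N)) = (\<Sum>j\<le>N. ennreal (w N j))"
   by (simp add: M_def emeasure_density nn_integral_count_space_finite)
  thus "emeasure (M N) (space (M N)) = 1" using w1[of N] w0 by (simp add: sum_ennreal)
 qed
 obtain s \<nu> where s: "strict_mono s" and \<nu>: "real_distribution \<nu>" and conv: "!!f B. continuous_on UNIV f ==> (!!x. \<bar>f x\<bar> <= B) ==>
   (%n. \<Sum>j\<le>s n. w (s n) j * f (real j / real (s n))) \<longlonglongrightarrow> (LINT x|\<nu>. f x)"
  using unit_interval_subsequence[of M "%N j. real j / real N", OF prob] unfolding int by (force simp: M_def divide_simps)
 interpret \<nu>: real_distribution \<nu> by (rule \<nu>)
 define cl :: "real => real" where "cl x = max 0 (min 1 x)" for x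
 have cl_m [measurable]: "cl \<in> borel_measurable borel" unfolding cl_def by measurable
 have cl_id: "cl (real j / real N) = real j / real N" if "j <= N" for j N
  using that by (auto simp: cl_def divide_simps min_def max_def)
 \<comment> \<open>A bounded continuous function whose zero set is the unit interval: its integral
   passes to the limit and forces the support of the limit measure.\<close>
 define d :: "real => real" where "d x = min 1 \<bar>x - cl x\<bar>" for x
 have d_m [measurable]: "d \<in> borel_measurable borel" unfolding d_def by measurable
 have "(%n. \<Sum>j\<le>s n. w (s n) j * d (real j / real (s n))) \<longlonglongrightarrow> (LINT x|\<nu>. d x)"
  by (rule conv[of _ 1]) (auto simp: d_def cl_def intro!: continuous_intros)
 moreover have "(\<Sum>j\<le>s n. w (s n) j * d (real j / real (s n))) = 0" for n by (auto simp: d_def cl_id intro!: sum.neutral)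
 ultimately have d0: "(LINT x|\<nu>. d x) = 0" by (simp only: LIMSEQ_const_iff)
 have "integrable \<nu> d" by (rule \<nu>.integrable_const_bound[of _ 1]) (auto simp: d_def)
 hence "AE x in \<nu>. d x = 0" using integral_nonneg_eq_0_iff_AE[of \<nu> d] d0 by (auto simp: d_def)
 hence AE: "AE x in \<nu>. 0 <= x & x <= 1" by eventually_elim (auto simp: d_def cl_def min_def max_def split: if_splits)
 \<comment> \<open>The n-th Bernstein moment for the array shifted by \<open>m\<close>. The shift
   drives the induction on \<open>n\<close>: one factor j / N is absorbed into the binomial
   coefficient and reappears as a shift of the first index.\<close>
 define A where "A N m n = (\<Sum>j\<le>N. real (N choose j) * (real j / real N) ^ n * r (m + j) (N - j))" for N m n
 have A: "(%N. A N m n) \<longlonglongrightarrow> r (m + n) 0" for m n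
 proof (induction n arbitrary: m)
  case 0
  have "A N m 0 = r m 0" for N using expand[of N m 0] by (simp add: A_def)
  thus ?case by simp
 next
  case (Suc n)
  have diff: "\<bar>A (Suc N) m (Suc n) - A N (Suc m) n\<bar> <= real n * r (Suc m) 0 / real (Suc N)" if N: "N > 0" for N
  proof -
   have *: "real (Suc N choose Suc j) * (real (Suc j) / real (Suc N)) ^ Suc n = real (N choose j) * (real (Suc j) / real (Suc N)) ^ n" for j
   proof -
    have "real (Suc N choose Suc j) * real (Suc j) = real (Suc N) * real (N choose j)"
     using Suc_times_binomial[of j N] by (metis mult.commute of_nat_mult)
    hence "real (Suc N choose Suc j) * (real (Suc j) / real (Suc N)) = real (N choose j)"
     by (simp add: field_simps del: of_nat_Suc binomial_Suc_Suc)
    thus ?thesis by (simp only: power_Suc mult.assoc[symmetric])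
   qed
   have "A (Suc N) m (Suc n) = (\<Sum>j\<le>N. real (N choose j) * (real (Suc j) / real (Suc N)) ^ n * r (Suc m + j) (N - j))"
    unfolding A_def by (subst sum.atMost_Suc_shift) (simp only: *, simp)
   hence eq: "A (Suc N) m (Suc n) - A N (Suc m) n
     = (\<Sum>j\<le>N. real (N choose j) * r (Suc m + j) (N - j) * ((real (Suc j) / real (Suc N)) ^ n - (real j / real N) ^ n))"
    unfolding A_def by (simp add: sum_subtractf[symmetric] algebra_simps)
   have "\<bar>A (Suc N) m (Suc n) - A N (Suc m) n\<bar> <= (\<Sum>j\<le>N. real (N choose j) * r (Suc m + j) (N - j) * (real n / real (Suc N)))"
    unfolding eq
   proof (rule order_trans[OF sum_abs], rule sum_mono)
    fix j assume j: "j \<in> {..N}"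
    have "norm ((real (Suc j) / real (Suc N)) ^ n - (real j / real N) ^ n) <= real n * norm (real (Suc j) / real (Suc N) - real j / real N)"
     by (rule norm_power_diff) (use j in "auto simp: divide_simps")
    also have "norm (real (Suc j) / real (Suc N) - real j / real N) <= 1 / real (Suc N)"
    proof -
     have "real (Suc j) / real (Suc N) - real j / real N = (real N - real j) / real N / real (Suc N)"
      using N by (simp add: field_simps)
     moreover have "0 <= (real N - real j) / real N / real (Suc N)" using j by (intro divide_nonneg_nonneg) auto
     moreover have "(real N - real j) / real N / real (Suc N) <= 1 / real (Suc N)"
      using N by (intro divide_right_mono) (auto simp: divide_simps)
     ultimately show ?thesis by (simp only: real_norm_def abs_of_nonneg)
    qed
    finally have "\<bar>(real (Suc j) / real (Suc N)) ^ n - (real j / real N) ^ n\<bar> <= real n / real (Suc N)"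
     by (simp add: mult_left_mono)
    note bd = this
    have p: "0 <= real (N choose j) * r (Suc m + j) (N - j)" using pos by simp
    show "\<bar>real (N choose j) * r (Suc m + j) (N - j) * ((real (Suc j) / real (Suc N)) ^ n - (real j / real N) ^ n)\<bar>
      <= real (N choose j) * r (Suc m + j) (N - j) * (real n / real (Suc N))"
     unfolding abs_mult[of "real (N choose j) * r (Suc m + j) (N - j)"] abs_of_nonneg[OF p] by (rule mult_left_mono[OF bd p])
   qed
   also have "... = real n / real (Suc N) * (\<Sum>j\<le>N. real (N choose j) * r (Suc m + j) (0 + (N - j)))"
    unfolding sum_distrib_left by (intro sum.cong refl) (simp only: add_0_left mult.commute)
   also have "... = real n * r (Suc m) 0 / real (Suc N)" unfolding expand by simp
   finally show ?thesis .
  qed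
  have "(%N. real n * r (Suc m) 0 * inverse (real (Suc N))) \<longlonglongrightarrow> real n * r (Suc m) 0 * 0"
   by (intro tendsto_intros LIMSEQ_inverse_real_of_nat)
  hence l0: "(%N. real n * r (Suc m) 0 / real (Suc N)) \<longlonglongrightarrow> 0" by (simp add: divide_inverse)
  have "(%N. A (Suc N) m (Suc n) - A N (Suc m) n) \<longlonglongrightarrow> 0" by (rule Lim_null_comparison[OF _ l0])
     (use diff in "auto intro!: eventually_sequentiallyI[of 1]")
  from tendsto_add[OF this Suc.IH[of "Suc m"]]
  have "(%N. A (Suc N) m (Suc n)) \<longlonglongrightarrow> r (m + Suc n) 0" by simp
  thus ?case by (rule LIMSEQ_imp_Suc)
 qed
 have mom: "(LINT x|\<nu>. x ^ n) = r n 0" for n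
 proof -
  have "(%k. \<Sum>j\<le>s k. w (s k) j * cl (real j / real (s k)) ^ n) \<longlonglongrightarrow> (LINT x|\<nu>. cl x ^ n)"
   by (rule conv[of _ 1]) (auto intro!: power_le_one continuous_intros simp: cl_def power_abs)
  moreover have "(\<Sum>j\<le>s k. w (s k) j * cl (real j / real (s k)) ^ n) = A (s k) 0 n" for k
   by (auto simp: A_def w_def cl_id intro!: sum.cong)
  moreover have "(%k. A (s k) 0 n) \<longlonglongrightarrow> r n 0" using LIMSEQ_subseq_LIMSEQ[OF A[of 0 n] s] by (simp add: comp_def)
  ultimately have "(LINT x|\<nu>. cl x ^ n) = r n 0" by (simp only: LIMSEQ_unique)
  moreover have "AE x in \<nu>. cl x ^ n = x ^ n" using AE by eventually_elim (simp add: cl_def)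
  hence "(LINT x|\<nu>. cl x ^ n) = (LINT x|\<nu>. x ^ n)" by (intro integral_cong_AE) auto
  ultimately show ?thesis by simp
 qed
 show ?thesis using \<nu>.prob_space_axioms AE mom by (intro exI[of _ \<nu>]) auto
qed

section \<open>Square roots\<close>

text \<open>The Taylor coefficients of the square root of 1 - x.\<close>

definition sqc :: "nat => real" where "sqc n = (-1) ^ n * ((1/2) gchoose n)"

text \<open>The central binomial coefficient of 2 n over n, divided by \<open>4 ^ n\<close>. These
  are the partial sums of \<open>sqc\<close>, and their positivity controls every estimate
  below.\<close>

primrec sqp :: "nat => real" where
 "sqp 0 = 1"
| "sqp (Suc n) = sqp n * (2 * real n + 1) / (2 * real n + 2)"

lemma sqp_pos: "sqp n > 0" by (induction n) (auto simp: add_pos_pos intro!: divide_pos_pos mult_pos_pos)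

lemma sqc_Suc: "sqc (Suc n) = - sqp n / (2 * real n + 2)"
proof (induction n)
 case (Suc n)
 have rec: "sqc (Suc k) = (real k - 1/2) / (real k + 1) * sqc k" for k
 proof -
  have "(1/2) * ((1/2::real) gchoose k) = real k * ((1/2) gchoose k) + real (Suc k) * ((1/2) gchoose Suc k)" by (rule gbinomial_mult_1)
  hence "((1/2::real) gchoose Suc k) = (1/2 - real k) / (real k + 1) * ((1/2) gchoose k)" by (simp add: field_simps)
  hence "sqc (Suc k) = (-1) ^ Suc k * ((1/2 - real k) / (real k + 1) * ((1/2) gchoose k))" by (simp only: sqc_def)
  thus ?thesis by (simp add: sqc_def field_simps)
 qed
 show ?case unfolding rec[of "Suc n"] Suc by (simp add: field_simps)
qed (simp add: sqc_def)

lemma sqc_0 [simp]: "sqc 0 = 1" by (simp add: sqc_def)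

lemma sqc_Suc_le: "sqc (Suc n) <= 0" unfolding sqc_Suc using sqp_pos[of n] by (simp add: divide_nonpos_pos)

lemma sum_sqc: "(\<Sum>i\<le>n. sqc i) = sqp n"
proof (induction n)
 case (Suc n)
 thus ?case by (simp add: sqc_Suc field_simps)
qed simp

text \<open>All coefficients after the first are nonpositive, so the sum of the absolute values is 2
  minus the partial sum \<open>sqp\<close>.\<close>

lemma summable_abs_sqc: "summable (%n. \<bar>sqc n\<bar>)"
proof (rule summableI_nonneg_bounded[where x = 2])
 fix n
 have "(\<Sum>i<n. \<bar>sqc i\<bar>) <= (\<Sum>i\<le>n. \<bar>sqc i\<bar>)" by (rule sum_mono2) auto
 also have "... = 2 - (\<Sum>i\<le>n. sqc i)"
 proof (induction n)
  case (Suc n)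
  thus ?case using sqc_Suc_le[of n] by simp
 qed simp
 also have "... <= 2" using sqp_pos[of n] by (simp add: sum_sqc)
 finally show "(\<Sum>i<n. \<bar>sqc i\<bar>) <= 2" .
qed auto

text \<open>The power series of \<open>sqrt (1 - x)\<close>, which still converges absolutely for \<open>norm x = 1\<close>.\<close>

definition sq :: "'a::{real_normed_algebra,monoid_mult,banach} => 'a" where
 "sq x = (\<Sum>n. sqc n *\<^sub>R x ^ n)"

lemma sq_abs_summable:
 assumes "!!n. norm (x ^ n) <= 1"
 shows "summable (%n. norm (sqc n *\<^sub>R x ^ n))" by (rule summable_comparison_test'[OF summable_abs_sqc, of 0])
   (use assms in "auto intro!: mult_left_le")

lemma sq_sums:
 assumes "!!n. norm (x ^ n) <= 1"
 shows "(%n. sqc n *\<^sub>R x ^ n) sums sq x"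
 unfolding sq_def by (rule summable_sums, rule summable_norm_cancel, rule sq_abs_summable[OF assms])

text \<open>In the Cauchy product the coefficients collapse by Vandermonde's identity, since 1/2 +
  1/2 = 1.\<close>

lemma sq_mult_self:
 assumes "!!n. norm (x ^ n) <= 1"
 shows "sq x * sq x = 1 - x"
proof -
 define d :: "nat => real" where "d n = (if n = 0 then 1 else if n = 1 then -1 else 0)" for n
 have d: "(\<Sum>i\<le>n. sqc i * sqc (n - i)) = d n" for n
 proof -
  have "(\<Sum>i\<le>n. sqc i * sqc (n - i)) = (\<Sum>i\<le>n. (-1) ^ n * (((1/2) gchoose i) * ((1/2) gchoose (n - i))))"
   by (rule sum.cong) (auto simp: sqc_def mult_ac simp flip: power_add)
  also have "... = (-1) ^ n * ((1::real) gchoose n)" using gbinomial_Vandermonde[of "1/2::real" "1/2" n]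
   by (simp add: sum_distrib_left[symmetric] atLeast0AtMost)
  also have "(1::real) gchoose n = real (1 choose n)" using binomial_gbinomial[of 1 n, where ?'a = real] by simp
  also have "(-1) ^ n * real (1 choose n) = d n" by (cases n) (auto simp: d_def)
  finally show ?thesis .
 qed
 have "(%n. \<Sum>i\<le>n. (sqc i *\<^sub>R x ^ i) * (sqc (n - i) *\<^sub>R x ^ (n - i))) sums (sq x * sq x)"
  unfolding sq_def by (rule Cauchy_product_sums; rule sq_abs_summable[OF assms])
 also have "(%n. \<Sum>i\<le>n. (sqc i *\<^sub>R x ^ i) * (sqc (n - i) *\<^sub>R x ^ (n - i))) = (%n. d n *\<^sub>R x ^ n)"
 proof
  fix n
  have "(\<Sum>i\<le>n. (sqc i *\<^sub>R x ^ i) * (sqc (n - i) *\<^sub>R x ^ (n - i))) = (\<Sum>i\<le>n. (sqc i * sqc (n - i)) *\<^sub>R x ^ n)"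
   by (rule sum.cong) (auto simp: mult.commute simp flip: power_add)
  thus "(\<Sum>i\<le>n. (sqc i *\<^sub>R x ^ i) * (sqc (n - i) *\<^sub>R x ^ (n - i))) = d n *\<^sub>R x ^ n"
   by (simp add: d flip: scaleR_sum_left)
 qed
 finally have "(%n. d n *\<^sub>R x ^ n) sums (sq x * sq x)" .
 moreover have "(%n. d n *\<^sub>R x ^ n) sums (\<Sum>n\<in>{0,1}. d n *\<^sub>R x ^ n)" by (rule sums_finite) (auto simp: d_def)
 ultimately have "sq x * sq x = (\<Sum>n\<in>{0,1}. d n *\<^sub>R x ^ n)" by (rule sums_unique2)
 also have "... = 1 - x" by (simp add: d_def)
 finally show ?thesis .
qed

text \<open>Replacing each \<open>p i\<close> by the maximum \<open>p 0\<close> can only decrease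
  the sum, because the coefficients from the second on are nonpositive; what remains is
  \<open>sqp\<close> times \<open>p 0\<close>. Used for the positivity of the root in
  \<open>pos_absb\<close>.\<close>

lemma sum_sqc_ge:
 assumes "!!n. p n <= p 0" "p 0 >= (0::real)"
 shows "(\<Sum>i<n. sqc i * p i) >= 0"
proof (cases n)
 case (Suc m)
 have "0 <= sqp m * p 0" using sqp_pos[of m] assms(2) by simp
 also have "... = (\<Sum>i\<le>m. sqc i * p 0)" unfolding sum_sqc[symmetric] sum_distrib_right ..
 also have "... <= (\<Sum>i\<le>m. sqc i * p i)"
 proof (rule sum_mono)
  fix i show "sqc i * p 0 <= sqc i * p i" by (cases i) (auto intro: mult_left_mono_neg sqc_Suc_le assms(1))
 qed
 finally show ?thesis using Suc by (simp add: lessThan_Suc_atMost)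
qed simp

lemma norm_power_le_one: "norm (x::'h::complex_hilbert_space bop) <= 1 ==> norm (x ^ n) <= 1"
 using norm_power_bop[of x n] power_le_one[of "norm x" n] by (simp add: order_trans)

text \<open>The series of \<open>1 - sq x\<close> has nonnegative coefficients of sum at most 1.
  This allows a second root to be taken in \<open>absb_moments\<close>.\<close>

lemma norm_one_minus_sq:
 fixes x :: "'h::complex_hilbert_space bop"
 assumes x: "norm x <= 1" shows "norm (1 - sq x) <= 1"
proof (rule LIMSEQ_le_const2)
 show "(%n. norm (1 - (\<Sum>i\<le>n. sqc i *\<^sub>R x ^ i))) \<longlonglongrightarrow> norm (1 - sq x)"
  using sq_sums[OF norm_power_le_one[OF x]] unfolding sums_def_le by (intro tendsto_intros)
 have "norm (1 - (\<Sum>i\<le>n. sqc i *\<^sub>R x ^ i)) <= 1" for n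
 proof -
  have "norm (\<Sum>i<n. sqc (Suc i) *\<^sub>R x ^ Suc i) <= (\<Sum>i<n. - sqc (Suc i))"
  proof (intro sum_norm_le)
   fix i
   have "norm (sqc (Suc i) *\<^sub>R x ^ Suc i) <= - sqc (Suc i) * 1"
    unfolding norm_scaleR using sqc_Suc_le[of i] norm_power_le_one[OF x, of "Suc i"] by (intro mult_mono) auto
   thus "norm (sqc (Suc i) *\<^sub>R x ^ Suc i) <= - sqc (Suc i)" by simp
  qed
  also have "... <= 1" using sum_sqc[of n] sqp_pos[of n] by (simp add: sum.atMost_shift sum_negf)
  finally show ?thesis by (simp add: sum.atMost_shift)
 qed
 thus "\<exists>N. \<forall>n\<ge>N. norm (1 - (\<Sum>i\<le>n. sqc i *\<^sub>R x ^ i)) <= 1" by blast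
qed

lemma sq_commute:
 fixes x y :: "'h::complex_hilbert_space bop"
 assumes "norm x <= 1" "y * x = x * y"
 shows "y * sq x = sq x * y"
proof -
 note s = sq_sums[OF norm_power_le_one[OF assms(1)]]
 have "(%n. y * (sqc n *\<^sub>R x ^ n)) sums (y * sq x)" by (rule bounded_linear.sums[OF bounded_linear_mult_right s])
 moreover have "(%n. (sqc n *\<^sub>R x ^ n) * y) sums (sq x * y)" by (rule bounded_linear.sums[OF bounded_linear_mult_left s])
 moreover have "(%n. y * (sqc n *\<^sub>R x ^ n)) = (%n. (sqc n *\<^sub>R x ^ n) * y)"
  using power_commuting_commutes[OF assms(2)[symmetric]] by simp
 ultimately show ?thesis by (simp only: sums_unique2)
qed

lemma adj_power: "adj (x ^ n) = adj x ^ n" by (induction n) (simp_all add: power_commutes)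

lemma adj_sq:
 assumes "norm x <= 1" shows "adj (sq x) = sq (adj x)"
proof -
 note s = sq_sums[OF norm_power_le_one]
 have "(%n. adj (sqc n *\<^sub>R x ^ n)) sums adj (sq x)" by (rule bounded_linear.sums[OF bounded_linear_adj s[OF assms]])
 thus ?thesis using s[of "adj x"] assms by (simp add: adj_power sums_unique2)
qed

text \<open>The square of the norm of \<open>T u\<close> is that of \<open>u\<close> minus that of
  \<open>y u\<close>, which bounds \<open>T\<close>. Squaring \<open>T\<close> then bounds
  \<open>1 - adj y * y\<close>, so no functional calculus for positive operators enters.\<close>

lemma contraction_root:
 assumes "norm y <= 1"
 defines "T \<equiv> sq (adj y * y)"
 shows "T * T = 1 - adj y * y" "adj T = T" "norm T <= 1" "norm (1 - adj y * y) <= 1"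
proof -
 have n1: "norm (adj y * y) <= 1" using norm_mult_ineq[of "adj y" y] assms(1) by (simp add: mult_le_one order_trans)
 show TT: "T * T = 1 - adj y * y" unfolding T_def by (rule sq_mult_self, rule norm_power_le_one[OF n1])
 show aT: "adj T = T" unfolding T_def by (simp add: adj_sq[OF n1])
 show nT: "norm T <= 1"
 proof (rule norm_bop_bound)
  fix u
  have "complex_of_real ((norm (ap T u))\<^sup>2) = cinner u (ap (T * T) u)"
   using cinner_adj[of T u "ap T u"] by (simp add: aT cinner_same)
  also have "... = cinner u u - cinner (ap y u) (ap y u)" using cinner_add_right[of u "u - ap (adj y) (ap y u)" "ap (adj y) (ap y u)"]
   by (simp add: TT cinner_adj')
  finally have "(norm (ap T u))\<^sup>2 = (norm u)\<^sup>2 - (norm (ap y u))\<^sup>2"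
   unfolding cinner_same of_real_diff[symmetric] of_real_eq_iff .
  thus "norm (ap T u) <= 1 * norm u" by (simp add: power2_le_imp_le)
 qed simp
 have "norm (T * T) <= 1" using norm_mult_ineq[of T T] nT by (simp add: mult_le_one order_trans)
 thus "norm (1 - adj y * y) <= 1" by (simp add: TT)
qed

lemma norm_diff_square_le:
 assumes "(norm y)\<^sup>2 <= R" shows "norm (R *\<^sub>R 1 - adj y * y) <= R"
proof (cases "R = 0")
 case True
 thus ?thesis using assms by simp
next
 case False
 hence R: "R > 0" using assms zero_le_power2[of "norm y"] by linarith
 define z where "z = (1 / sqrt R) *\<^sub>R y"
 have "norm y <= sqrt R" using assms by (simp add: real_le_rsqrt)
 hence "norm z <= 1" using R by (simp add: z_def)
 hence "norm (1 - adj z * z) <= 1" by (rule contraction_root(4))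
 moreover have "R *\<^sub>R (1 - adj z * z) = R *\<^sub>R 1 - adj y * y" using R by (simp add: z_def scaleR_right_diff_distrib)
 ultimately have "norm (R *\<^sub>R 1 - adj y * y) = R * norm (1 - adj z * z)" "norm (1 - adj z * z) <= 1"
  using R norm_scaleR[of R "1 - adj z * z"] by auto
 thus ?thesis using R by (simp add: mult_left_le)
qed

section \<open>Absolute values\<close>

definition pos_bop :: "'h::complex_hilbert_space bop => bool" where
 "pos_bop k \<longleftrightarrow> (\<forall>x. cinner x (ap k x) \<in> \<real>\<^sub>\<ge>\<^sub>0)"

text \<open>The root of P = \<open>adj y * y\<close>, with P scaled to norm at most 1 and written as
  1 - (1 - P) to fit the series \<open>sq\<close>. For \<open>y = 0\<close> the division by zero is
  neutralized by the factor \<open>norm y\<close>.\<close>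

definition absb :: "'h::complex_hilbert_space bop => 'h bop" where
 "absb y = norm y *\<^sub>R sq (1 - (adj y * y) /\<^sub>R (norm y)\<^sup>2)"

lemma absb_arg:
 "norm (1 - (adj y * y) /\<^sub>R (norm y)\<^sup>2) <= 1" "adj (1 - (adj y * y) /\<^sub>R (norm y)\<^sup>2) = 1 - (adj y * y) /\<^sub>R (norm y)\<^sup>2"
proof -
 define z where "z = y /\<^sub>R norm y"
 have "adj z * z = (adj y * y) /\<^sub>R (norm y)\<^sup>2" by (simp add: z_def power2_eq_square)
 moreover have "norm z <= 1" by (cases "y = 0") (simp_all add: z_def)
 ultimately show "norm (1 - (adj y * y) /\<^sub>R (norm y)\<^sup>2) <= 1" using contraction_root(4)[of z] by simp
qed simp

lemma absb_square: "absb y * absb y = adj y * y"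
proof -
 have "absb y * absb y = (norm y * norm y) *\<^sub>R (1 - (1 - (adj y * y) /\<^sub>R (norm y)\<^sup>2))"
  unfolding absb_def using sq_mult_self[OF norm_power_le_one[OF absb_arg(1)[of y]]] by simp
 also have "... = adj y * y"
 proof (cases "y = 0")
  case False
  hence "norm y * norm y * inverse ((norm y)\<^sup>2) = 1" by (simp add: power2_eq_square field_simps)
  thus ?thesis by (simp only: diff_diff_eq2 add_diff_cancel_left' scaleR_scaleR scaleR_one)
 qed simp
 finally show ?thesis .
qed

lemma adj_absb: "adj (absb y) = absb y" unfolding absb_def using adj_sq[OF absb_arg(1)[of y]] absb_arg(2)[of y] by simp

lemma absb_commute:
 assumes "k * (adj y * y) = (adj y * y) * k" shows "k * absb y = absb y * k"
proof -
 have "k * (1 - (adj y * y) /\<^sub>R (norm y)\<^sup>2) = (1 - (adj y * y) /\<^sub>R (norm y)\<^sup>2) * k"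
  using assms by (simp add: right_diff_distrib left_diff_distrib)
 from sq_commute[OF absb_arg(1) this] show ?thesis by (simp add: absb_def)
qed

lemma pos_absb: "pos_bop (absb y)" unfolding pos_bop_def
proof
 fix u
 define X where "X = 1 - (adj y * y) /\<^sub>R (norm y)\<^sup>2"
 have X: "norm X <= 1" unfolding X_def by (rule absb_arg)
 have "(%n. inner u (ap (sqc n *\<^sub>R X ^ n) u)) sums inner u (ap (sq X) u)"
 proof (rule bounded_linear.sums[OF _ sq_sums[OF norm_power_le_one[OF X]]])
  show "bounded_linear (%x. inner u (ap x u))"
  proof (rule bounded_linear_intro[where K = "norm u * norm u"])
   fix x :: "'a bop"
   have "\<bar>inner u (ap x u)\<bar> <= norm u * norm (ap x u)" by (rule Cauchy_Schwarz_ineq2)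
   also have "... <= norm u * (norm x * norm u)" by (intro mult_left_mono norm_ap) auto
   finally show "norm (inner u (ap x u)) <= norm x * (norm u * norm u)" by (simp add: mult_ac)
  qed (simp_all add: inner_add_right)
 qed
 hence lim: "(%n. \<Sum>i<n. sqc i * inner u (ap (X ^ i) u)) \<longlonglongrightarrow> inner u (ap (sq X) u)" by (simp add: sums_def)
 have "(\<Sum>i<n. sqc i * inner u (ap (X ^ i) u)) >= 0" for n
 proof (rule sum_sqc_ge)
  fix n
  have "inner u (ap (X ^ n) u) <= norm u * norm (ap (X ^ n) u)" by (rule norm_cauchy_schwarz)
  also have "... <= norm u * (1 * norm u)" by (intro mult_left_mono order_trans[OF norm_ap] mult_right_mono norm_power_le_one X) auto
  finally show "inner u (ap (X ^ n) u) <= inner u (ap (X ^ 0) u)" by (simp add: power2_norm_eq_inner flip: power2_eq_square)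
 qed simp
 hence "0 <= inner u (ap (sq X) u)" by (intro LIMSEQ_le_const[OF lim]) auto
 hence re: "0 <= Re (cinner u (ap (absb y) u))" by (simp add: absb_def X_def inner_eq_Re_cinner[symmetric])
 have "cinner u (ap (absb y) u) = cnj (cinner u (ap (absb y) u))" by (metis adj_absb cinner_adj cinner_commute)
 hence "Im (cinner u (ap (absb y) u)) = 0" by (simp add: complex_eq_iff)
 with re show "cinner u (ap (absb y) u) \<in> \<real>\<^sub>\<ge>\<^sub>0" by (simp add: complex_nonneg_Reals_iff)
qed

lemma pos_bop_adj:
 assumes "pos_bop k" shows "adj k = k"
proof (rule adj_unique)
 fix u v
 have im: "Im (cinner w (ap k w)) = 0" for w using assms by (auto simp: pos_bop_def complex_nonneg_Reals_iff)
 have "Im (cinner u (ap k v)) + Im (cinner v (ap k u)) = 0"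
  using im[of "u + v"] im[of u] im[of v] by (simp add: cinner_add_left cinner_add_right)
 moreover have "Re (cinner u (ap k v)) = Re (cinner v (ap k u))" using im[of "u + \<i> *\<^sub>C v"] im[of u] im[of v]
  by (simp add: cinner_add_left cinner_add_right cinner_scaleC_left cinner_scaleC_right)
 ultimately have "cinner u (ap k v) = cnj (cinner v (ap k u))" by (simp add: complex_eq_iff)
 thus "cinner (ap k u) v = cinner u (ap k v)" by (metis cinner_commute)
qed

text \<open>Otherwise the form would be negative at \<open>z - t w\<close>, where
  \<open>w = ap k z\<close>: the linear term in \<open>t\<close> is \<open>- 2 * inner w w\<close>,
  and \<open>t = 1 / (norm k + 1)\<close> keeps the quadratic term below it.\<close>

lemma pos_bop_null:
 assumes k: "pos_bop k" and z: "cinner z (ap k z) = 0" shows "ap k z = 0"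
proof (rule ccontr)
 define w where "w = ap k z"
 define C where "C = norm k"
 assume "ap k z ~= 0"
 hence w0: "inner w w > 0" by (simp add: w_def)
 have C: "C >= 0" by (simp add: C_def)
 have sa: "inner a (ap k b) = inner (ap k a) b" for a b by (metis pos_bop_adj[OF k] cinner_adj' inner_eq_Re_cinner)
 define t where "t = 1 / (C + 1)"
 have t: "t > 0" "t * C <= 1" using C by (auto simp: t_def)
 have z0: "inner z (ap k z) = 0" using z by (simp add: inner_eq_Re_cinner)
 have "inner w (ap k w) <= norm w * norm (ap k w)" by (rule norm_cauchy_schwarz)
 also have "... <= norm w * (C * norm w)" unfolding C_def by (intro mult_left_mono norm_ap) auto
 also have "... = C * inner w w" by (simp add: power2_norm_eq_inner[symmetric] power2_eq_square)
 finally have wk: "inner w (ap k w) <= C * inner w w" .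
 have "0 <= inner (z - t *\<^sub>R w) (ap k (z - t *\<^sub>R w))"
  using k unfolding pos_bop_def complex_nonneg_Reals_iff inner_eq_Re_cinner by blast
 also have "... = t * (t * inner w (ap k w) - 2 * inner w w)"
  using sa[of z w] z0 by (simp add: inner_diff_left inner_diff_right w_def[symmetric] algebra_simps)
 finally have "2 * inner w w <= t * inner w (ap k w)" using t by (simp add: zero_le_mult_iff)
 also have "... <= t * (C * inner w w)" using wk t by (simp add: mult_left_mono)
 also have "... <= 1 * inner w w" using t w0 by (simp only: mult.assoc[symmetric] mult_right_mono less_imp_le)
 finally show False using w0 by simp
qed

text \<open>The roots commute because \<open>absb y\<close> is a power series in
  \<open>adj y * y = k * k\<close>. Hence their sum annihilates the range of their difference, and
  there both positive forms vanish separately.\<close>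

lemma pos_root_unique:
 assumes k: "pos_bop k" "k * k = adj y * y" shows "k = absb y"
proof -
 define h d where "h = absb y" and "d = absb y - k"
 have com: "k * h = h * k" unfolding h_def by (rule absb_commute) (simp add: k(2)[symmetric] mult.assoc)
 have dhk: "(h + k) * d = 0" using com absb_square[of y] k(2) by (simp add: d_def h_def[symmetric] algebra_simps)
 have "ap d u = 0" for u
 proof -
  define z where "z = ap d u"
  have "cinner z (ap (h + k) z) = 0" using arg_cong[OF dhk, of "%x. ap x u"] by (simp add: z_def)
  hence s: "cinner z (ap h z) + cinner z (ap k z) = 0" by (simp add: cinner_add_right)
  have p: "cinner z (ap h z) \<in> \<real>\<^sub>\<ge>\<^sub>0" "cinner z (ap k z) \<in> \<real>\<^sub>\<ge>\<^sub>0"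
   using k(1) pos_absb[of y] by (auto simp: pos_bop_def h_def)
  have "cinner z (ap h z) = 0" "cinner z (ap k z) = 0" using s p by (auto simp: complex_nonneg_Reals_iff complex_eq_iff)
  hence "ap h z = 0" "ap k z = 0" using pos_bop_null[OF k(1)] pos_bop_null[OF pos_absb[of y]] by (auto simp: h_def)
  hence dz: "ap d z = 0" by (simp add: d_def h_def)
  have "adj d = d" using pos_bop_adj[OF k(1)] adj_absb[of y] by (simp add: d_def)
  hence "cinner z z = 0" using dz by (metis cinner_0(2) cinner_adj' z_def)
  thus ?thesis by (simp add: z_def cinner_same)
 qed
 hence "d = 0" by (intro bop_eqI) simp
 thus ?thesis by (simp add: d_def)
qed

lemma op_of_mult: "op_of (x * y) = op_of x o\<^sub>L op_of y" by (rule times_bop.rep_eq)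

lemma op_of_adj: "op_of (adj x) = adj_op (op_of x)" by (rule adj.rep_eq)

lemma abs_op_eq: "abs_op (op_of y) = op_of (absb y)" unfolding abs_op_def
proof (rule the_equality)
 have pos: "positive_op (op_of k) \<longleftrightarrow> pos_bop k" for k :: "'a bop"
  using op_of[of k] by (simp add: positive_op_def pos_bop_def ap.rep_eq)
 show "positive_op (op_of (absb y)) & op_of (absb y) o\<^sub>L op_of (absb y) = adj_op (op_of y) o\<^sub>L op_of y"
  unfolding pos using pos_absb absb_square[of y] by (simp flip: op_of_mult op_of_adj)
 fix h assume h: "positive_op h & h o\<^sub>L h = adj_op (op_of y) o\<^sub>L op_of y"
 then obtain k where k: "h = op_of k" by (metis bop_of_inverse positive_op_def)
 have "pos_bop k" "k * k = adj y * y" using h by (auto simp: k pos op_of_inject simp flip: op_of_mult op_of_adj)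
 thus "h = op_of (absb y)" using pos_root_unique k by blast
qed

section \<open>Tracial states and the law of \<open>y\<^sup>* y\<close>\<close>

text \<open>A setting that passes to matrices, see \<open>tracial_matrix\<close>. Closedness of
  \<open>AA\<close> and boundedness of the trace keep power series inside the algebra and let the
  trace be applied term by term.\<close>

locale tracial =
 fixes AA :: "'h::complex_hilbert_space bop set" and \<tau> :: "'h bop => complex"
 assumes cs_in: "cs c \<in> AA"
  and add_in: "x \<in> AA ==> y \<in> AA ==> x + y \<in> AA"
  and mult_in: "x \<in> AA ==> y \<in> AA ==> x * y \<in> AA"
  and adj_in: "x \<in> AA ==> adj x \<in> AA"
  and closed_AA: "closed AA"
  and tau_add: "x \<in> AA ==> y \<in> AA ==> \<tau> (x + y) = \<tau> x + \<tau> y"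
  and tau_cs: "x \<in> AA ==> \<tau> (cs c * x) = c * \<tau> x"
  and tau_pos: "x \<in> AA ==> \<tau> (adj x * x) \<in> \<real>\<^sub>\<ge>\<^sub>0"
  and tau_one: "\<tau> 1 = 1"
  and tau_comm: "x \<in> AA ==> y \<in> AA ==> \<tau> (x * y) = \<tau> (y * x)"
  and tau_bound: "\<exists>K. \<forall>x\<in>AA. cmod (\<tau> x) <= K * norm x"
begin

lemma one_in: "1 \<in> AA" using cs_in[of 1] by simp

lemma zero_in: "0 \<in> AA" using cs_in[of 0] by simp

lemma scaleR_in: "x \<in> AA ==> r *\<^sub>R x \<in> AA" using mult_in[OF cs_in[of "complex_of_real r"]] by (simp add: cs_of_real)

lemma uminus_in: "x \<in> AA ==> - x \<in> AA" using scaleR_in[of x "-1"] by simp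

lemma diff_in: "x \<in> AA ==> y \<in> AA ==> x - y \<in> AA" using add_in[OF _ uminus_in, of x y] by simp

lemma power_in: "x \<in> AA ==> x ^ n \<in> AA" by (induction n) (auto intro: one_in mult_in)

lemma sum_in: "(!!i. i \<in> I ==> f i \<in> AA) ==> sum f I \<in> AA"
 by (induction I rule: infinite_finite_induct) (auto intro: zero_in add_in)

lemmas AA_intros [simp, intro] =
 cs_in add_in mult_in adj_in one_in zero_in scaleR_in uminus_in diff_in power_in sum_in

lemma tau_scaleR: "x \<in> AA ==> \<tau> (r *\<^sub>R x) = complex_of_real r * \<tau> x"
 using tau_cs[of x "complex_of_real r"] by (simp add: cs_of_real)

lemma tau_0: "\<tau> 0 = 0" using tau_scaleR[of 1 0] by simp

lemma tau_minus: "x \<in> AA ==> \<tau> (- x) = - \<tau> x" using tau_scaleR[of x "-1"] by simp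

lemma tau_diff: "x \<in> AA ==> y \<in> AA ==> \<tau> (x - y) = \<tau> x - \<tau> y" using tau_add[of x "- y"] tau_minus[of y] by simp

lemma tau_sum: "(!!i. i \<in> I ==> f i \<in> AA) ==> \<tau> (sum f I) = (\<Sum>i\<in>I. \<tau> (f i))"
 by (induction I rule: infinite_finite_induct) (auto simp: tau_0 tau_add)

text \<open>Polarization: the traces of \<open>adj y * y\<close> for y = x + 1 and for y = i x + 1
  are real.\<close>

lemma tau_adj: assumes x: "x \<in> AA" shows "\<tau> (adj x) = cnj (\<tau> x)"
proof -
 have r: "Im (\<tau> (adj y * y)) = 0" if "y \<in> AA" for y using tau_pos[OF that] by (auto simp: complex_nonneg_Reals_iff)
 have "adj (x + 1) * (x + 1) = adj x * x + adj x + x + 1" by (simp add: algebra_simps)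
 hence "Im (\<tau> (adj x)) + Im (\<tau> x) = 0" using r[of "x + 1"] r[of x] x by (simp add: tau_add tau_one)
 moreover have "adj (cs \<i> * x + 1) * (cs \<i> * x + 1) = adj x * x + cs (- \<i>) * adj x + cs \<i> * x + 1"
 proof -
  have "adj (cs \<i> * x + 1) * (cs \<i> * x + 1) = adj x * (cs (- \<i>) * cs \<i>) * x + adj x * cs (- \<i>) + cs \<i> * x + 1"
   by (simp add: algebra_simps)
  also have "cs (- \<i>) * cs \<i> = (1 :: 'h bop)" by (simp flip: cs_simps)
  finally show ?thesis by (simp only: cs_commute[of "adj x"] mult_1_right)
 qed
 hence "Re (\<tau> (adj x)) = Re (\<tau> x)"
  using r[of "cs \<i> * x + 1"] r[of x] x by (simp add: tau_add tau_one tau_cs del: cs_simps(3))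
 ultimately show ?thesis by (simp add: complex_eq_iff)
qed

lemma tau_tendsto:
 assumes "(f \<longlongrightarrow> l) F" "!!s. f s \<in> AA" "l \<in> AA"
 shows "((%s. \<tau> (f s)) \<longlongrightarrow> \<tau> l) F"
proof -
 obtain K where K: "!!x. x \<in> AA ==> cmod (\<tau> x) <= K * norm x" using tau_bound by blast
 have "((%s. \<tau> (f s) - \<tau> l) \<longlongrightarrow> 0) F"
 proof (rule Lim_null_comparison)
  show "\<forall>\<^sub>F s in F. norm (\<tau> (f s) - \<tau> l) <= K * norm (f s - l)"
   using K[OF diff_in[OF assms(2,3)]] assms by (simp add: tau_diff)
  have "((%s. K * norm (f s - l)) \<longlongrightarrow> K * norm (l - l)) F" by (intro tendsto_intros assms)
  thus "((%s. K * norm (f s - l)) \<longlongrightarrow> 0) F" by simp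
 qed
 thus ?thesis using Lim_null by blast
qed

lemma sums_in:
 assumes "!!n. f n \<in> AA" "f sums s" shows "s \<in> AA" "(%n. \<tau> (f n)) sums \<tau> s"
proof -
 have l: "(%n. \<Sum>i<n. f i) \<longlonglongrightarrow> s" using assms by (simp add: sums_def)
 show s: "s \<in> AA" by (rule closed_sequentially[OF closed_AA _ l]) (use assms in auto)
 have "(%n. \<tau> (\<Sum>i<n. f i)) \<longlonglongrightarrow> \<tau> s" by (rule tau_tendsto[OF l]) (use assms s in auto)
 thus "(%n. \<tau> (f n)) sums \<tau> s" using assms by (simp add: sums_def tau_sum)
qed

lemma tau_has_vector_derivative:
 assumes f: "(f has_vector_derivative f') (at x within S)" and "!!s. f s \<in> AA" "f' \<in> AA"
 shows "((%s. \<tau> (f s)) has_vector_derivative \<tau> f') (at x within S)"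
proof -
 obtain K where K: "!!x. x \<in> AA ==> cmod (\<tau> x) <= K * norm x" using tau_bound by blast
 have "((%y. norm ((f y - f x) - (y - x) *\<^sub>R f') / norm (y - x)) \<longlongrightarrow> 0) (at x within S)"
  using f by (simp add: has_vector_derivative_def has_derivative_iff_norm)
 from tendsto_mult[OF tendsto_const[of K] this]
 have lim: "((%y. K * (norm ((f y - f x) - (y - x) *\<^sub>R f') / norm (y - x))) \<longlongrightarrow> 0) (at x within S)" by simp
 have "norm ((\<tau> (f y) - \<tau> (f x)) - (y - x) *\<^sub>R \<tau> f') / norm (y - x)
   <= K * (norm ((f y - f x) - (y - x) *\<^sub>R f') / norm (y - x))" for y
 proof -
  have "\<tau> (f y) - \<tau> (f x) - (y - x) *\<^sub>R \<tau> f' = \<tau> ((f y - f x) - (y - x) *\<^sub>R f')"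
   using assms by (simp add: tau_diff tau_scaleR scaleR_conv_of_real)
  thus ?thesis using divide_right_mono[OF K[of "(f y - f x) - (y - x) *\<^sub>R f'"], of "norm (y - x)"] assms by simp
 qed
 hence "((%y. norm ((\<tau> (f y) - \<tau> (f x)) - (y - x) *\<^sub>R \<tau> f') / norm (y - x)) \<longlongrightarrow> 0) (at x within S)"
  by (intro Lim_null_comparison[OF _ lim]) auto
 thus ?thesis by (simp add: has_vector_derivative_def has_derivative_iff_norm bounded_linear_scaleR_left)
qed

lemma tau_contraction:
 assumes y: "y \<in> AA" "norm y <= 1"
 shows "sq (adj y * y) \<in> AA"
proof -
 have "norm (adj y * y) <= 1" using norm_mult_ineq[of "adj y" y] y by (simp add: mult_le_one order_trans)
 from sums_in(1)[OF _ sq_sums[OF norm_power_le_one[OF this]]] show ?thesis using y by auto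
qed

text \<open>The law of \<open>adj y * y\<close> rather than of the absolute value: its moments are
  traces of words in \<open>y\<close> and \<open>adj y\<close>, which can be compared without taking
  roots.\<close>

definition law :: "'h bop => real measure" where
 "law y = (SOME \<nu>. prob_space \<nu> & sets \<nu> = sets borel & (AE s in \<nu>. 0 <= s & s <= (norm y)\<^sup>2) &
   (\<forall>n. \<tau> ((adj y * y) ^ n) = complex_of_real (LINT s|\<nu>. s ^ n)))"

lemma law_ex:
 assumes y: "y \<in> AA"
 shows "\<exists>\<nu>. prob_space \<nu> & sets \<nu> = sets borel & (AE s in \<nu>. 0 <= s & s <= (norm y)\<^sup>2) &
   (\<forall>n. \<tau> ((adj y * y) ^ n) = complex_of_real (LINT s|\<nu>. s ^ n))"
proof -
 define c where "c = (norm y)\<^sup>2"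
 have c0: "c >= 0" by (simp add: c_def)
 define z where "z = y /\<^sub>R norm y"
 have z: "z \<in> AA" "norm z <= 1" using y by (cases "y = 0"; simp add: z_def)+
 define Q where "Q = adj z * z"
 define T where "T = sq Q"
 have T: "T * T = 1 - Q" "adj T = T" "T \<in> AA" using contraction_root[OF z(2)] tau_contraction[OF z] by (auto simp: T_def Q_def)
 have Q: "Q \<in> AA" "adj Q = Q" using z by (auto simp: Q_def)
 have QT: "Q * T = T * Q" unfolding T_def Q_def
  by (rule sq_commute) (use norm_mult_ineq[of "adj z" z] z in "auto simp: mult_le_one intro: order_trans")
 have pw: "(1 - Q) ^ j = T ^ j * T ^ j" for j
  using power_mult[of T 2 j] power_add[of T j j] by (simp add: T(1)[symmetric] power2_eq_square mult_2)
 have QTc: "Q ^ a * T ^ j = T ^ j * Q ^ a" for a j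
  by (rule power_commuting_commutes, rule power_commuting_commutes[symmetric], simp add: QT)
 \<comment> \<open>With \<open>W = Q ^ a * T ^ j\<close> the element has the trace of
   \<open>adj W * W\<close> for even \<open>i\<close>, and of \<open>adj (z * W) * (z * W)\<close>
   for odd \<open>i\<close>, because \<open>Q\<close> is itself \<open>adj z * z\<close>.\<close>
 have pos: "\<tau> (Q ^ i * (1 - Q) ^ j) \<in> \<real>\<^sub>\<ge>\<^sub>0" for i j
 proof -
  define a where "a = i div 2"
  have a: "i = a + a \<or> i = Suc (a + a)" unfolding a_def by presburger
  define W where "W = Q ^ a * T ^ j"
  have W: "W \<in> AA" using Q T by (auto simp: W_def)
  have aW: "adj W = W" using Q T QTc by (simp add: W_def adj_power)
  have "W * W = Q ^ a * (T ^ j * Q ^ a) * T ^ j" by (simp add: W_def mult.assoc)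
  also have "... = Q ^ a * (Q ^ a * T ^ j) * T ^ j" by (simp only: QTc)
  finally have WW: "W * W = Q ^ (a + a) * (1 - Q) ^ j" by (simp add: pw power_add mult.assoc)
  have "W * Q = Q ^ a * (T ^ j * Q ^ 1)" by (simp add: W_def mult.assoc)
  also have "... = Q ^ a * Q * T ^ j" by (simp add: QTc[of 1 j, simplified] mult.assoc)
  also have "... = Q * W" by (simp only: power_commutes W_def mult.assoc)
  finally have WQW: "W * Q * W = Q ^ Suc (a + a) * (1 - Q) ^ j" by (simp add: WW mult.assoc)
  have "\<tau> (W * W) \<in> \<real>\<^sub>\<ge>\<^sub>0" using tau_pos[OF W] by (simp add: aW)
  moreover have "\<tau> (W * Q * W) \<in> \<real>\<^sub>\<ge>\<^sub>0" using tau_pos[of "z * W"] z W by (simp add: aW Q_def mult.assoc)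
  ultimately show ?thesis using a by (auto simp: WW WQW)
 qed
 define r where "r i j = Re (\<tau> (Q ^ i * (1 - Q) ^ j))" for i j
 have "\<exists>\<nu>. prob_space \<nu> & sets \<nu> = sets borel & (AE s in \<nu>. 0 <= s & s <= (1::real)) &
  (\<forall>n. (LINT s|\<nu>. s ^ n) = r n 0)"
 proof (rule Hausdorff_moment_problem)
  show "r i j >= 0" for i j using pos[of i j] by (simp add: r_def complex_nonneg_Reals_iff)
  show "r i j = r (Suc i) j + r i (Suc j)" for i j
  proof -
   have "Q ^ i * (1 - Q) ^ j = Q ^ Suc i * (1 - Q) ^ j + Q ^ i * (1 - Q) ^ Suc j"
    unfolding power_Suc2[of Q i] power_Suc[of "1 - Q" j] by (simp add: algebra_simps)
   thus ?thesis using Q by (simp add: r_def tau_add del: power_Suc)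
  qed
  show "r 0 0 = 1" by (simp add: r_def tau_one)
 qed
 then obtain \<nu> where \<nu>: "prob_space \<nu>" "sets \<nu> = sets borel" "AE s in \<nu>. 0 <= s & s <= (1::real)"
  "!!n. (LINT s|\<nu>. s ^ n) = r n 0" by blast
 have m [measurable]: "(%s. c * s) \<in> measurable \<nu> borel" using \<nu>(2) measurable_cong_sets[OF \<nu>(2) refl] by simp
 have "\<tau> ((adj y * y) ^ n) = complex_of_real (LINT s|distr \<nu> borel (%s. c * s). s ^ n)" for n
 proof -
  have yQ: "adj y * y = c *\<^sub>R Q" by (cases "y = 0") (auto simp: c_def Q_def z_def power2_eq_square field_simps)
  have cQ: "(c *\<^sub>R Q) ^ n = c ^ n *\<^sub>R Q ^ n" by (induction n) simp_all
  have "\<tau> ((adj y * y) ^ n) = c ^ n * \<tau> (Q ^ n)" using Q by (simp add: yQ cQ tau_scaleR)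
  also have "\<tau> (Q ^ n) = complex_of_real (r n 0)" using pos[of n 0] by (simp add: r_def complex_eq_iff complex_nonneg_Reals_iff)
  also have "r n 0 = (LINT s|\<nu>. s ^ n)" by (simp add: \<nu>)
  also have "c ^ n * complex_of_real (LINT s|\<nu>. s ^ n) = complex_of_real (LINT s|\<nu>. (c * s) ^ n)"
   by (simp add: power_mult_distrib)
  also have "(LINT s|\<nu>. (c * s) ^ n) = (LINT s|distr \<nu> borel (%s. c * s). s ^ n)" by (rule integral_distr[symmetric]) auto
  finally show ?thesis .
 qed
 moreover have "AE s in distr \<nu> borel (%s. c * s). 0 <= s & s <= c"
  using \<nu>(3) m c0 by (subst AE_distr_iff) (auto simp: mult_left_le)
 ultimately show ?thesis
  using prob_space.prob_space_distr[OF \<nu>(1) m] unfolding c_def[symmetric] by (intro exI[of _ "distr \<nu> borel (%s. c * s)"]) simp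
qed

lemma law:
 assumes "y \<in> AA"
 shows "prob_space (law y)" "sets (law y) = sets borel" "AE s in law y. 0 <= s & s <= (norm y)\<^sup>2"
  "\<tau> ((adj y * y) ^ n) = complex_of_real (LINT s|law y. s ^ n)" using someI_ex[OF law_ex[OF assms]] unfolding law_def by blast+

lemma law_unique:
 assumes y: "y \<in> AA" and \<nu>: "prob_space \<nu>" "sets \<nu> = sets borel" "AE s in \<nu>. \<bar>s\<bar> <= R"
  and eq: "!!n. \<tau> ((adj y * y) ^ n) = complex_of_real (LINT s|\<nu>. s ^ n)"
 shows "law y = \<nu>"
proof (rule moments_determine_measure)
 show "AE s in law y. \<bar>s\<bar> <= max R ((norm y)\<^sup>2)" using law(3)[OF y] by eventually_elim auto
 show "AE s in \<nu>. \<bar>s\<bar> <= max R ((norm y)\<^sup>2)" using \<nu>(3) by eventually_elim auto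
 show "(LINT s|law y. s ^ n) = (LINT s|\<nu>. s ^ n)" for n using law(4)[OF y, of n] eq[of n] by (metis of_real_eq_iff)
qed (use law y \<nu> in auto)

text \<open>By the trace property \<open>y * adj y\<close> and \<open>adj y * y\<close> have the
  same moments.\<close>

lemma law_adj: assumes y: "y \<in> AA" shows "law (adj y) = law y"
proof (rule law_unique)
 show "AE s in law y. \<bar>s\<bar> <= (norm y)\<^sup>2" using law(3)[OF y] by eventually_elim auto
 show "\<tau> ((adj (adj y) * adj y) ^ n) = complex_of_real (LINT s|law y. s ^ n)" for n
 proof -
  have c: "(y * adj y) ^ n * y = y * (adj y * y) ^ n" for n by (induction n) (simp_all add: mult.assoc)
  have "\<tau> ((y * adj y) ^ n) = \<tau> ((adj y * y) ^ n)"
  proof (cases n)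
   case (Suc m)
   have "\<tau> ((y * adj y) ^ n) = \<tau> ((y * adj y) ^ m * y * adj y)"
    unfolding Suc by (simp add: power_Suc2 mult.assoc del: power_Suc)
   also have "... = \<tau> (adj y * ((y * adj y) ^ m * y))" using y by (intro tau_comm) auto
   also have "adj y * ((y * adj y) ^ m * y) = (adj y * y) ^ n" by (simp add: c Suc mult.assoc)
   finally show ?thesis .
  qed simp
  thus ?thesis using law(4)[OF y] by simp
 qed
qed (use law y in auto)

lemma law_integrable:
 assumes y: "y \<in> AA" and f: "f \<in> borel_measurable borel" and b: "!!s. 0 <= s ==> s <= (norm y)\<^sup>2 ==> \<bar>f s\<bar> <= B"
 shows "integrable (law y) (f :: real => real)"
proof -
 interpret prob_space "law y" by (rule law[OF y])
 have "AE s in law y. norm (f s) <= B" using law(3)[OF y] by eventually_elim (use b in auto)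
 moreover have "f \<in> borel_measurable (law y)" using f measurable_cong_sets[OF law(2)[OF y] refl] by blast
 ultimately show ?thesis by (intro integrable_const_bound)
qed

lemma law_poly:
 assumes y: "y \<in> AA"
 shows "\<tau> ((adj y * y) ^ m * (a *\<^sub>R (adj y * y) + b *\<^sub>R 1) ^ n) = complex_of_real (LINT s|law y. s ^ m * (a * s + b) ^ n)"
proof (induction n arbitrary: m)
 case 0 thus ?case using law(4)[OF y] by simp
next
 case (Suc n)
 have int: "integrable (law y) (%s. s ^ m * (a * s + b) ^ n)" for m
 proof (rule law_integrable[OF y])
  show "\<bar>s ^ m * (a * s + b) ^ n\<bar> <= ((norm y)\<^sup>2) ^ m * (\<bar>a\<bar> * (norm y)\<^sup>2 + \<bar>b\<bar>) ^ n" if s: "0 <= s" "s <= (norm y)\<^sup>2" for s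
   unfolding abs_mult power_abs by (intro mult_mono power_mono order_trans[OF abs_triangle_ineq])
    (use s in "auto simp: abs_mult intro!: mult_left_mono")
 qed auto
 define P where "P = adj y * y"
 have P: "P \<in> AA" using y by (simp add: P_def)
 have "P ^ m * (a *\<^sub>R P + b *\<^sub>R 1) ^ Suc n
   = a *\<^sub>R (P ^ Suc m * (a *\<^sub>R P + b *\<^sub>R 1) ^ n) + b *\<^sub>R (P ^ m * (a *\<^sub>R P + b *\<^sub>R 1) ^ n)"
  unfolding power_Suc2[of P m] power_Suc[of _ n] by (simp add: algebra_simps)
 hence "\<tau> (P ^ m * (a *\<^sub>R P + b *\<^sub>R 1) ^ Suc n) =
   a * \<tau> (P ^ Suc m * (a *\<^sub>R P + b *\<^sub>R 1) ^ n) + b * \<tau> (P ^ m * (a *\<^sub>R P + b *\<^sub>R 1) ^ n)"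
  using P by (simp add: tau_add tau_scaleR del: power_Suc)
 also have "... = complex_of_real (a * (LINT s|law y. s ^ Suc m * (a * s + b) ^ n) + b * (LINT s|law y. s ^ m * (a * s + b) ^ n))"
  using Suc.IH[of m] Suc.IH[of "Suc m"] by (simp add: P_def del: power_Suc)
 also have "a * (LINT s|law y. s ^ Suc m * (a * s + b) ^ n) + b * (LINT s|law y. s ^ m * (a * s + b) ^ n)
   = (LINT s|law y. a * (s ^ Suc m * (a * s + b) ^ n) + b * (s ^ m * (a * s + b) ^ n))"
  by (subst Bochner_Integration.integral_add) (use int in "auto simp del: power_Suc")
 also have "... = (LINT s|law y. s ^ m * (a * s + b) ^ Suc n)" by (rule Bochner_Integration.integral_cong) (auto simp: algebra_simps)
 finally show ?case by (simp add: P_def)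
qed

text \<open>If \<open>R - y\<^sup>* y\<close> has norm at most \<open>c\<close>, then \<open>\<bar>R - s\<bar> \<le> c\<close> almost surely, by comparing the growth
 of the even moments of \<open>R - s\<close>.\<close>

lemma law_support:
 assumes y: "y \<in> AA" and c: "norm (R *\<^sub>R 1 - adj y * y) <= c" "c > 0"
 shows "AE s in law y. \<bar>R - s\<bar> <= c"
proof -
 interpret prob_space "law y" by (rule law[OF y])
 note [measurable_cong] = law(2)[OF y]
 define w where "w = R *\<^sub>R 1 - adj y * y"
 have w: "w \<in> AA" "adj w = w" using y by (auto simp: w_def)
 \<comment> \<open>Since \<open>w\<close> is self-adjoint, its law is the image of
   \<open>law y\<close> under the square of R - s; and any law is carried by the interval from 0 to
   the squared norm.\<close>
 have l: "law w = distr (law y) borel (%s. (R - s)\<^sup>2)"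
 proof (rule law_unique[OF w(1)])
  show "prob_space (distr (law y) borel (%s. (R - s)\<^sup>2))" by (rule prob_space_distr) measurable
  show "AE s in distr (law y) borel (%s. (R - s)\<^sup>2). \<bar>s\<bar> <= (\<bar>R\<bar> + (norm y)\<^sup>2)\<^sup>2"
  proof (subst AE_distr_iff)
   show "AE s in law y. \<bar>(R - s)\<^sup>2\<bar> <= (\<bar>R\<bar> + (norm y)\<^sup>2)\<^sup>2"
    using law(3)[OF y] by eventually_elim (auto intro!: abs_le_square_iff[THEN iffD1])
  qed auto
  show "\<tau> ((adj w * w) ^ n) = complex_of_real (LINT s|distr (law y) borel (%s. (R - s)\<^sup>2). s ^ n)" for n
   using law_poly[OF y, of 0 "-1" R "2 * n"]
   by (subst integral_distr) (auto simp: w(2) w_def[symmetric] power_mult power2_eq_square[of w])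
 qed simp
 have "AE s in distr (law y) borel (%s. (R - s)\<^sup>2). s <= (norm w)\<^sup>2"
  using law(3)[OF w(1)] unfolding l by eventually_elim simp
 hence "AE s in law y. (R - s)\<^sup>2 <= (norm w)\<^sup>2" by (subst (asm) AE_distr_iff) auto
 thus ?thesis
 proof eventually_elim
  case (elim s)
  hence "\<bar>R - s\<bar> <= \<bar>norm w\<bar>" by (simp only: abs_le_square_iff)
  thus ?case using c by (simp add: w_def)
 qed
qed
end

section \<open>Neumann series and difference quotients\<close>

lemma geometric_bop:
 fixes X :: "'h::complex_hilbert_space bop"
 assumes "norm X <= q" "q < 1"
 shows "summable (%n. X ^ n)" "(1 - X) * (\<Sum>n. X ^ n) = 1" "(\<Sum>n. X ^ n) * (1 - X) = 1"
  "norm (\<Sum>n. X ^ n) <= 1 / (1 - q)"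
proof -
 have q: "0 <= q" using assms norm_ge_zero order_trans by blast
 have le: "norm (X ^ n) <= q ^ n" for n by (rule order_trans[OF norm_power_bop]) (use assms in "auto intro: power_mono")
 have sg: "summable (%n. q ^ n)" using q assms by (simp add: summable_geometric)
 have sn: "summable (%n. norm (X ^ n))" by (rule summable_comparison_test'[OF sg, of 0]) (simp add: le)
 thus s: "summable (%n. X ^ n)" by (rule summable_norm_cancel)
 have h: "(\<Sum>n. X ^ Suc n) = (\<Sum>n. X ^ n) - 1" using suminf_split_head[OF s] by simp
 have "X * (\<Sum>n. X ^ n) = (\<Sum>n. X ^ Suc n)" using bounded_linear.suminf[OF bounded_linear_mult_right s, of X] by simp
 thus "(1 - X) * (\<Sum>n. X ^ n) = 1" using h by (simp add: left_diff_distrib)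
 have "(\<Sum>n. X ^ n) * X = (\<Sum>n. X ^ Suc n)"
  using bounded_linear.suminf[OF bounded_linear_mult_left s, of X] by (simp add: power_commutes)
 thus "(\<Sum>n. X ^ n) * (1 - X) = 1" using h by (simp add: right_diff_distrib)
 have "norm (\<Sum>n. X ^ n) <= (\<Sum>n. norm (X ^ n))" by (rule summable_norm[OF sn])
 also have "... <= (\<Sum>n. q ^ n)" by (rule suminf_le[OF le sn sg])
 also have "... = 1 / (1 - q)" using q assms by (simp add: suminf_geometric)
 finally show "norm (\<Sum>n. X ^ n) <= 1 / (1 - q)" .
qed

text \<open>Difference quotients suit the resolvent, whose increments are given exactly by
  \<open>res_diff\<close>.\<close>

lemma has_vector_derivative_quotient:
 fixes f :: "real => 'a::real_normed_vector"
 shows "(f has_vector_derivative f') (at x) \<longleftrightarrow> ((%y. (1 / (y - x)) *\<^sub>R (f y - f x)) \<longlongrightarrow> f') (at x)"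
proof -
 have "(f has_vector_derivative f') (at x) \<longleftrightarrow>
   ((%y. norm ((f y - f x) - (y - x) *\<^sub>R f') / norm (y - x)) \<longlongrightarrow> 0) (at x)"
  by (simp add: has_vector_derivative_def has_derivative_iff_norm bounded_linear_scaleR_left)
 also have "... \<longleftrightarrow> ((%y. norm ((1 / (y - x)) *\<^sub>R (f y - f x) - f')) \<longlongrightarrow> 0) (at x)"
 proof (rule filterlim_cong[OF refl refl])
  show "\<forall>\<^sub>F y in at x. norm ((f y - f x) - (y - x) *\<^sub>R f') / norm (y - x) = norm ((1 / (y - x)) *\<^sub>R (f y - f x) - f')"
  proof (rule eventually_at_topological[THEN iffD2], intro exI[of _ UNIV] conjI ballI impI)
   fix y assume "y ~= x"
   hence "(1 / (y - x)) *\<^sub>R (f y - f x) - f' = (1 / (y - x)) *\<^sub>R ((f y - f x) - (y - x) *\<^sub>R f')"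
    by (simp add: scaleR_right_diff_distrib)
   thus "norm ((f y - f x) - (y - x) *\<^sub>R f') / norm (y - x) = norm ((1 / (y - x)) *\<^sub>R (f y - f x) - f')"
    by (simp only: norm_scaleR) simp
  qed auto
 qed
 also have "... \<longleftrightarrow> ((%y. (1 / (y - x)) *\<^sub>R (f y - f x)) \<longlongrightarrow> f') (at x)"
  by (simp add: tendsto_norm_zero_iff Lim_null[symmetric])
 finally show ?thesis .
qed

section \<open>Regularized logarithms\<close>

definition shifted :: "'h::complex_hilbert_space bop => real => 'h bop" where
 "shifted y e = adj y * y + e *\<^sub>R 1"

text \<open>The inverse of \<open>shifted y e\<close>: a Neumann series for its quotient by the
  scalar norm squared plus \<open>e\<close>, at which the series converges geometrically.\<close>

definition res :: "'h::complex_hilbert_space bop => real => 'h bop" where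
 "res y e = (1 / ((norm y)\<^sup>2 + e)) *\<^sub>R (\<Sum>n. (1 - (1 / ((norm y)\<^sup>2 + e)) *\<^sub>R shifted y e) ^ n)"

lemma norm_series_arg:
 assumes e: "e > 0" and R: "(norm y)\<^sup>2 + e <= R"
 shows "norm (1 - (1 / R) *\<^sub>R shifted y e) <= 1 - e / R" "1 - e / R < 1" "0 <= 1 - e / R" "R > 0"
proof -
 show R0: "R > 0" using e R zero_le_power2[of "norm y"] by linarith
 show "1 - e / R < 1" using e R0 by simp
 have "e <= R" using R zero_le_power2[of "norm y"] by linarith
 thus "0 <= 1 - e / R" using R0 by simp
 have "1 - (1 / R) *\<^sub>R shifted y e = (1 / R) *\<^sub>R ((R - e) *\<^sub>R 1 - adj y * y)"
  using R0 by (simp add: shifted_def algebra_simps)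
 moreover have "norm ((R - e) *\<^sub>R 1 - adj y * y) <= R - e" by (rule norm_diff_square_le) (use R in simp)
 ultimately have "norm (1 - (1 / R) *\<^sub>R shifted y e) <= (1 / R) * (R - e)" using R0 by (simp add: divide_right_mono)
 also have "... = 1 - e / R" using R0 by (simp add: field_simps)
 finally show "norm (1 - (1 / R) *\<^sub>R shifted y e) <= 1 - e / R" .
qed

lemma res_inverse:
 assumes e: "e > 0"
 shows "shifted y e * res y e = 1" "res y e * shifted y e = 1" "norm (res y e) <= 1 / e"
proof -
 define R where "R = (norm y)\<^sup>2 + e"
 have R: "(norm y)\<^sup>2 + e <= R" by (simp add: R_def)
 note n = norm_series_arg[OF e R]
 note g = geometric_bop[OF n(1,2)]
 have s: "shifted y e = R *\<^sub>R (1 - (1 - (1 / R) *\<^sub>R shifted y e))" using n(4) by simp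
 show "shifted y e * res y e = 1" "res y e * shifted y e = 1" unfolding res_def R_def[symmetric] by (subst s; use g(2,3) n(4) in simp)+
 have "norm (res y e) <= (1 / R) * (1 / (1 - (1 - e / R)))" unfolding res_def R_def[symmetric] norm_scaleR using n(4)
  by (intro mult_mono g(4)) auto
 also have "... = 1 / e" using n(4) e by simp
 finally show "norm (res y e) <= 1 / e" .
qed

lemma res_unique:
 assumes e: "e > 0" and "J * shifted y e = 1" shows "J = res y e"
 by (metis assms(2) mult.assoc mult_1_left mult_1_right res_inverse(1)[OF e])

lemma res_eq:
 assumes e: "e > 0" and R: "(norm y)\<^sup>2 + e <= R"
 shows "res y e = (1 / R) *\<^sub>R (\<Sum>n. (1 - (1 / R) *\<^sub>R shifted y e) ^ n)"
proof (rule res_unique[OF e, symmetric])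
 note n = norm_series_arg[OF e R]
 note g = geometric_bop[OF n(1,2)]
 have s: "shifted y e = R *\<^sub>R (1 - (1 - (1 / R) *\<^sub>R shifted y e))" using n(4) by simp
 show "(1 / R) *\<^sub>R (\<Sum>n. (1 - (1 / R) *\<^sub>R shifted y e) ^ n) * shifted y e = 1" by (subst (2) s) (use g(3) n(4) in simp)
qed

lemma adj_shifted [simp]: "adj (shifted y e) = shifted y e" by (simp add: shifted_def)

lemma adj_res:
 assumes e: "e > 0" shows "adj (res y e) = res y e"
proof (rule res_unique[OF e])
 have "adj (shifted y e * res y e) = 1" by (simp only: res_inverse(1)[OF e] adj_simps)
 thus "adj (res y e) * shifted y e = 1" by simp
qed

lemma res_diff:
 assumes e: "e > 0"
 shows "res y e - res w e = - (res y e * (shifted y e - shifted w e) * res w e)"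
proof -
 have "res y e * (shifted y e - shifted w e) * res w e
   = (res y e * shifted y e) * res w e - res y e * (shifted w e * res w e)" by (simp add: algebra_simps)
 thus ?thesis by (simp add: res_inverse[OF e])
qed

lemma tendsto_res:
 assumes e: "e > 0" and Y: "(Y \<longlongrightarrow> y) F" shows "((%s. res (Y s) e) \<longlongrightarrow> res y e) F"
proof -
 have "((%s. shifted (Y s) e) \<longlongrightarrow> shifted y e) F"
  unfolding shifted_def by (intro tendsto_intros bounded_linear.tendsto[OF bounded_linear_adj] Y)
 hence "((%s. norm (shifted (Y s) e - shifted y e) * (1 / e\<^sup>2)) \<longlongrightarrow> 0 * (1 / e\<^sup>2)) F"
  by (intro tendsto_mult tendsto_const) (simp add: tendsto_norm_zero_iff Lim_null[symmetric])
 hence l: "((%s. norm (shifted (Y s) e - shifted y e) * (1 / e\<^sup>2)) \<longlongrightarrow> 0) F" by simp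
 have "norm (res (Y s) e - res y e) <= norm (shifted (Y s) e - shifted y e) * (1 / e\<^sup>2)" for s
 proof -
  have "norm (res (Y s) e - res y e) <= norm (res (Y s) e) * norm (shifted (Y s) e - shifted y e) * norm (res y e)"
   unfolding res_diff[OF e] norm_minus_cancel by (rule order_trans[OF norm_mult_ineq], rule mult_right_mono[OF norm_mult_ineq]) simp
  also have "... <= (1 / e) * norm (shifted (Y s) e - shifted y e) * (1 / e)" using e by (intro mult_mono res_inverse(3)) auto
  finally show ?thesis by (simp add: power2_eq_square mult_ac)
 qed
 hence "((%s. res (Y s) e - res y e) \<longlongrightarrow> 0) F" by (intro Lim_null_comparison[OF _ l]) simp
 thus ?thesis by (simp add: Lim_null[symmetric])
qed

lemma has_vector_derivative_shifted:
 assumes "(Y has_vector_derivative Y') (at s within S)" "(E has_vector_derivative E') (at s within S)"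
 shows "((%s. shifted (Y s) (E s)) has_vector_derivative adj Y' * Y s + adj (Y s) * Y' + E' *\<^sub>R 1) (at s within S)"
proof -
 have "((%s. adj (Y s)) has_vector_derivative adj Y') (at s within S)"
  by (rule bounded_linear.has_vector_derivative[OF bounded_linear_adj assms(1)])
 moreover have "((%s. E s *\<^sub>R (1 :: 'a bop)) has_vector_derivative E' *\<^sub>R 1) (at s within S)"
  by (rule bounded_linear.has_vector_derivative[OF bounded_linear_scaleR_left assms(2)])
 ultimately show ?thesis unfolding shifted_def
  by (intro has_vector_derivative_eq_rhs[OF has_vector_derivative_add[OF has_vector_derivative_mult[OF _ assms(1)]]])
    (assumption+, simp add: add_ac)
qed

lemma has_vector_derivative_res:
 assumes e: "e > 0" and Y: "(Y has_vector_derivative Y') (at s)"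
 defines "P' \<equiv> adj Y' * Y s + adj (Y s) * Y'"
 shows "((%s. res (Y s) e) has_vector_derivative - (res (Y s) e * P' * res (Y s) e)) (at s)"
proof -
 have sh: "((%s. shifted (Y s) e) has_vector_derivative P') (at s)"
  using has_vector_derivative_shifted[OF Y has_vector_derivative_const] by (simp add: P'_def)
 have "(Y \<longlongrightarrow> Y s) (at s)" using has_vector_derivative_continuous[OF Y] by (simp add: continuous_at)
 hence J: "((%t. res (Y t) e) \<longlongrightarrow> res (Y s) e) (at s)" by (rule tendsto_res[OF e])
 have "((%t. - (res (Y t) e * ((1 / (t - s)) *\<^sub>R (shifted (Y t) e - shifted (Y s) e)) * res (Y s) e))
   \<longlongrightarrow> - (res (Y s) e * P' * res (Y s) e)) (at s)"
  by (intro tendsto_intros J sh[unfolded has_vector_derivative_quotient])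
 thus ?thesis unfolding has_vector_derivative_quotient by (simp add: res_diff[OF e])
qed

context tracial
begin

lemma shifted_in [simp, intro]: "y \<in> AA ==> shifted y e \<in> AA" by (simp add: shifted_def)

lemma res_in [simp, intro]: assumes "y \<in> AA" "e > 0" shows "res y e \<in> AA"
proof -
 note n = norm_series_arg[OF assms(2), of y, OF order_refl]
 have "(\<Sum>n. (1 - (1 / ((norm y)\<^sup>2 + e)) *\<^sub>R shifted y e) ^ n) \<in> AA"
  by (rule sums_in(1)[OF _ summable_sums[OF geometric_bop(1)[OF n(1,2)]]]) (use assms in auto)
 thus ?thesis by (simp add: res_def)
qed

text \<open>The trace of the logarithm of \<open>adj y * y + e\<close>, hence twice the regularized
  logarithm of the absolute value.\<close>

definition lr :: "'h bop => real => real" where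
 "lr y e = (LINT s|law y. ln (s + e))"

lemma lr_integrable:
 assumes y: "y \<in> AA" and e: "e > 0"
 shows "integrable (law y) (%s. ln (s + e))"
proof (rule law_integrable[OF y])
 show "\<bar>ln (s + e)\<bar> <= \<bar>ln e\<bar> + \<bar>ln ((norm y)\<^sup>2 + e)\<bar>" if "0 <= s" "s <= (norm y)\<^sup>2" for s
 proof -
  have "ln e <= ln (s + e)" "ln (s + e) <= ln ((norm y)\<^sup>2 + e)" using that e by (auto intro!: ln_mono)
  thus ?thesis by linarith
 qed
qed auto

text \<open>The series of - ln (1 - v) at v = 1 - (s + e) / R, integrated. It expresses
  \<open>lr\<close> by traces of powers, from which derivatives, scalings and diagonal matrices are
  read off. \<open>R\<close> is only bounded below, so that one \<open>R\<close> can serve a whole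
  family of operators.\<close>

lemma lr_series:
 assumes y: "y \<in> AA" and e: "e > 0" and R: "(norm y)\<^sup>2 + e <= R"
 shows "(%n. Re (\<tau> ((1 - (1 / R) *\<^sub>R shifted y e) ^ Suc n)) / real (Suc n)) sums (ln R - lr y e)"
proof -
 interpret prob_space "law y" by (rule law[OF y])
 have m [measurable]: "sets (law y) = sets borel" by (rule law[OF y])
 define q where "q = 1 - e / R"
 note n = norm_series_arg[OF e R, folded q_def]
 define f where "f k s = (1 - (s + e) / R) ^ Suc k / real (Suc k)" for k s
 have u: "0 <= 1 - (s + e) / R" "1 - (s + e) / R <= q" if "0 <= s" "s <= (norm y)\<^sup>2" for s
  using that R n(4) by (auto simp: q_def divide_simps)
 have fb: "0 <= f k s" "f k s <= q ^ Suc k" if "0 <= s" "s <= (norm y)\<^sup>2" for k s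
 proof -
  show "0 <= f k s" using u[OF that] by (simp add: f_def del: power_Suc)
  have "f k s <= (1 - (s + e) / R) ^ Suc k / 1"
   unfolding f_def by (rule divide_left_mono) (use u[OF that] in "auto simp del: power_Suc")
  also have "... <= q ^ Suc k" using u[OF that] by (simp only: div_by_1 power_mono)
  finally show "f k s <= q ^ Suc k" .
 qed
 have fm [measurable]: "f k \<in> borel_measurable borel" for k unfolding f_def by measurable
 have fi: "integrable (law y) (f k)" for k by (rule law_integrable[OF y fm, of _ "q ^ Suc k"]) (use fb in "auto simp del: power_Suc")
 have sg: "summable (%k. q ^ Suc k)" using n by (subst summable_Suc_iff) (simp add: summable_geometric)
 have "(%k. LINT s|law y. f k s) sums (LINT s|law y. (\<Sum>k. f k s))"
 proof (rule sums_integral)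
  show "AE s in law y. summable (%k. norm (f k s))"
   using law(3)[OF y] by eventually_elim (auto intro!: summable_comparison_test'[OF sg, of 0] simp: fb simp del: power_Suc)
  show "summable (%k. LINT s|law y. norm (f k s))"
  proof (rule summable_comparison_test'[OF sg, of 0])
   fix k
   have "(LINT s|law y. norm (f k s)) <= (LINT s|law y. q ^ Suc k)"
   proof (rule integral_mono_AE)
    show "AE s in law y. norm (f k s) <= q ^ Suc k" using law(3)[OF y] by eventually_elim (auto simp: fb simp del: power_Suc)
   qed (use fi in auto)
   thus "norm (LINT s|law y. norm (f k s)) <= q ^ Suc k" by (simp add: prob_space del: power_Suc)
  qed
 qed (rule fi)
 also have "(LINT s|law y. (\<Sum>k. f k s)) = (LINT s|law y. ln R - ln (s + e))"
 proof (rule integral_cong_AE)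
  show "AE s in law y. (\<Sum>k. f k s) = ln R - ln (s + e)" using law(3)[OF y]
  proof eventually_elim
   case (elim s)
   define v where "v = 1 - (s + e) / R"
   have v: "0 <= v" "v < 1" using u[of s] elim n by (auto simp: v_def)
   have "ln (1 - v) = (\<Sum>k. (-1) ^ k * (1 / real (k + 1)) * ((1 - v) - 1) ^ Suc k)" using v by (intro ln_series) auto
   also have "... = (\<Sum>k. - f k s)"
   proof (intro suminf_cong)
    fix k
    have "(-1 :: real) ^ k * (- v) ^ Suc k = - (v ^ Suc k)"
     by (subst power_minus) (simp flip: power_mult_distrib add: power_add[symmetric])
    thus "(-1) ^ k * (1 / real (k + 1)) * ((1 - v) - 1) ^ Suc k = - f k s" by (simp add: f_def v_def[symmetric] del: power_Suc)
   qed
   also have "... = - (\<Sum>k. f k s)"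
    by (rule suminf_minus, rule summable_comparison_test'[OF sg, of 0]) (use elim in "auto simp: fb simp del: power_Suc")
   also have "1 - v = (s + e) / R" by (simp add: v_def)
   also have "ln ((s + e) / R) = ln (s + e) - ln R" using elim e n by (intro ln_divide_pos) auto
   finally show ?case by simp
  qed
 qed (unfold measurable_cong_sets[OF m refl], measurable)
 also have "... = ln R - lr y e"
  unfolding lr_def by (subst Bochner_Integration.integral_diff) (use lr_integrable[OF y e] in "auto simp: prob_space")
 also have "(%k. LINT s|law y. f k s) = (%k. Re (\<tau> ((1 - (1 / R) *\<^sub>R shifted y e) ^ Suc k)) / real (Suc k))"
 proof
  fix k
  have "(1 - (1 / R) *\<^sub>R shifted y e) = (-1 / R) *\<^sub>R (adj y * y) + q *\<^sub>R 1"
   by (simp add: shifted_def q_def algebra_simps)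
  hence "\<tau> ((1 - (1 / R) *\<^sub>R shifted y e) ^ Suc k) = complex_of_real (LINT s|law y. (-1 / R * s + q) ^ Suc k)"
   using law_poly[OF y, of 0 "-1 / R" q "Suc k"] by (simp del: power_Suc)
  moreover have "(LINT s|law y. f k s) = (LINT s|law y. (-1 / R * s + q) ^ Suc k) / real (Suc k)"
   unfolding f_def by (simp add: q_def add_divide_distrib algebra_simps del: power_Suc)
  ultimately show "(LINT s|law y. f k s) = Re (\<tau> ((1 - (1 / R) *\<^sub>R shifted y e) ^ Suc k)) / real (Suc k)"
   by (simp del: power_Suc)
 qed
 finally show ?thesis .
qed

text \<open>The derivative of a power is a sum with \<open>X'\<close> in every position; under the
  trace, against a power of \<open>X s\<close>, all these terms agree. Only such traces are used, so
  \<open>D\<close> itself stays anonymous.\<close>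

lemma power_has_vector_derivative:
 assumes X: "(X has_vector_derivative X') (at s within S)" "X' \<in> AA" "X s \<in> AA"
 shows "\<exists>D\<in>AA. ((%s. X s ^ n) has_vector_derivative D) (at s within S) &
   (\<forall>m. \<tau> (X s ^ m * D) = of_nat n * \<tau> (X s ^ (m + n - 1) * X'))"
proof (induction n)
 case 0
 thus ?case by (intro bexI[of _ 0]) (auto simp: tau_0)
next
 case (Suc n)
 then obtain D where D: "D \<in> AA" "((%s. X s ^ n) has_vector_derivative D) (at s within S)"
   "!!m. \<tau> (X s ^ m * D) = of_nat n * \<tau> (X s ^ (m + n - 1) * X')" by blast
 show ?case
 proof (intro bexI[of _ "X s * D + X' * X s ^ n"] conjI allI)
  show "((%s. X s ^ Suc n) has_vector_derivative X s * D + X' * X s ^ n) (at s within S)"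
   using has_vector_derivative_mult[OF X(1) D(2)] by simp
  fix m
  have "\<tau> (X s ^ m * (X s * D + X' * X s ^ n)) = \<tau> (X s ^ Suc m * D) + \<tau> ((X s ^ m * X') * X s ^ n)"
   using X D by (subst tau_add[symmetric]) (auto simp: distrib_left mult.assoc power_Suc2 simp del: power_Suc)
  also have "\<tau> (X s ^ Suc m * D) = of_nat n * \<tau> (X s ^ (m + n) * X')" by (subst D(3)) simp
  also have "\<tau> ((X s ^ m * X') * X s ^ n) = \<tau> (X s ^ (m + n) * X')"
   using X by (subst tau_comm) (auto simp: mult.assoc[symmetric] power_add[symmetric] add.commute)
  finally show "\<tau> (X s ^ m * (X s * D + X' * X s ^ n)) = of_nat (Suc n) * \<tau> (X s ^ (m + Suc n - 1) * X')"
   by (simp add: algebra_simps)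
 qed (use X D in auto)
qed

text \<open>Although S and S' need not commute, the trace of ln S has as derivative the trace of S'
  divided by S, because the trace ignores cyclic order. The proof differentiates
  \<open>lr_series\<close> term by term.\<close>

lemma lr_deriv:
 assumes Y: "!!s. Y s \<in> AA" "!!s. Y' s \<in> AA" "!!s. (Y has_vector_derivative Y' s) (at s)" "continuous_on UNIV Y'"
  and E: "!!s. E s > 0" "!!s. (E has_real_derivative E' s) (at s)" "continuous_on UNIV E'"
 shows "((%s. lr (Y s) (E s)) has_real_derivative
  Re (\<tau> (res (Y s0) (E s0) * (adj (Y' s0) * Y s0 + adj (Y s0) * Y' s0 + E' s0 *\<^sub>R 1)))) (at s0)"
proof -
 define S where "S = cball s0 (1::real)"
 have cY: "continuous_on UNIV Y" and cE: "continuous_on UNIV E"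
  using Y(3) E(2) by (auto intro!: continuous_at_imp_continuous_on has_vector_derivative_continuous DERIV_isCont)
 have cA: "continuous_on T (%s. adj (f s))" if "continuous_on T f" for T and f :: "real => 'h bop"
  by (rule bounded_linear.continuous_on[OF bounded_linear_adj that])
 define P' where "P' s = adj (Y' s) * Y s + adj (Y s) * Y' s + E' s *\<^sub>R 1" for s
 have cP: "continuous_on UNIV P'" unfolding P'_def by (intro continuous_intros cA cY Y E)
 have bd: "\<exists>B. \<forall>s\<in>S. norm (f s) <= B" if "continuous_on UNIV f" for f :: "real => 'b::real_normed_vector"
 proof -
  have "compact (f ` S)" unfolding S_def by (rule compact_continuous_image[OF continuous_on_subset[OF that]]) auto
  thus ?thesis using compact_imp_bounded[of "f ` S"] by (auto simp: bounded_iff)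
 qed
 obtain B where B: "!!s. s \<in> S ==> norm (Y s) <= B" using bd[OF cY] by blast
 obtain e1 where e1: "!!s. s \<in> S ==> norm (E s) <= e1" using bd[OF cE] by blast
 obtain B' where B': "!!s. s \<in> S ==> norm (P' s) <= B'" using bd[OF cP] by blast
 have s0: "s0 \<in> S" by (simp add: S_def)
 have "compact S" "S ~= {}" by (auto simp: S_def)
 from continuous_attains_inf[OF this continuous_on_subset[OF cE]]
 obtain sm where sm: "sm \<in> S" "!!s. s \<in> S ==> E sm <= E s" by auto
 \<comment> \<open>On a compact neighbourhood of \<open>s0\<close> one \<open>R\<close> and one
   \<open>q < 1\<close> work for all parameters, which provides the geometric majorant for the
   differentiated series.\<close>
 define R where "R = B\<^sup>2 + e1"
 have R: "(norm (Y s))\<^sup>2 + E s <= R" if "s \<in> S" for s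
  using B[OF that] e1[OF that] unfolding R_def by (intro add_mono power_mono) auto
 define q where "q = 1 - E sm / R"
 define X where "X s = 1 - (1 / R) *\<^sub>R shifted (Y s) (E s)" for s
 have R0: "R > 0" and q: "q < 1" "0 <= q" using norm_series_arg[OF E(1) R[OF sm(1)]] by (auto simp: q_def)
 have nX: "norm (X s) <= q" if "s \<in> S" for s
 proof -
  have "norm (X s) <= 1 - E s / R" unfolding X_def by (rule norm_series_arg(1)[OF E(1) R[OF that]])
  also have "... <= q" using sm(2)[OF that] R0 by (simp add: q_def divide_right_mono)
  finally show ?thesis .
 qed
 define X' where "X' s = - ((1 / R) *\<^sub>R P' s)" for s
 have XA: "X s \<in> AA" "X' s \<in> AA" "P' s \<in> AA" for s using Y by (auto simp: X_def X'_def P'_def)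
 have dX: "(X has_vector_derivative X' s) (at s within S)" for s
 proof -
  have "(Y has_vector_derivative Y' s) (at s within S)" "(E has_vector_derivative E' s) (at s within S)"
   using Y(3)[of s] E(2)[of s] by (auto simp: has_real_derivative_iff_has_vector_derivative intro: has_vector_derivative_at_within)
  from has_vector_derivative_shifted[OF this]
  have "((%s. shifted (Y s) (E s)) has_vector_derivative P' s) (at s within S)" unfolding P'_def .
  from bounded_linear.has_vector_derivative[OF bounded_linear_scaleR_right this, of "1 / R"]
  have "((%s. (1 / R) *\<^sub>R shifted (Y s) (E s)) has_vector_derivative (1 / R) *\<^sub>R P' s) (at s within S)" .
  from has_vector_derivative_diff[OF has_vector_derivative_const this, of 1]
  show ?thesis unfolding X_def X'_def by simp
 qed
 define g where "g n s = Re (\<tau> (X s ^ Suc n)) / real (Suc n)" for n s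
 define g' where "g' n s = Re (\<tau> (X s ^ n * X' s))" for n s
 have dg: "(g n has_field_derivative g' n s) (at s within S)" for n s
 proof -
  obtain D where D: "D \<in> AA" "((%s. X s ^ Suc n) has_vector_derivative D) (at s within S)"
   "!!m. \<tau> (X s ^ m * D) = of_nat (Suc n) * \<tau> (X s ^ (m + Suc n - 1) * X' s)"
   using power_has_vector_derivative[OF dX XA(2,1), of "Suc n" s] by blast
  have "((%s. \<tau> (X s ^ Suc n)) has_vector_derivative \<tau> D) (at s within S)"
   by (rule tau_has_vector_derivative[OF D(2)]) (use XA D in auto)
  from bounded_linear.has_vector_derivative[OF bounded_linear_Re this]
  have "((%s. Re (\<tau> (X s ^ Suc n))) has_field_derivative Re (\<tau> D)) (at s within S)"
   by (simp add: has_real_derivative_iff_has_vector_derivative)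
  from DERIV_cdivide[OF this, of "real (Suc n)"]
  show ?thesis unfolding g_def[abs_def] g'_def using D(3)[of 0] by (simp del: power_Suc of_nat_Suc)
 qed
 obtain K where K: "!!x. x \<in> AA ==> cmod (\<tau> x) <= K * norm x" using tau_bound by blast
 have K0: "K >= 0"
 proof (rule ccontr)
  assume "\<not> K >= 0"
  hence "K * norm (1 :: 'h bop) <= 0" by (simp add: mult_nonpos_nonneg)
  with K[OF one_in] show False by (simp add: tau_one)
 qed
 have uc: "uniformly_convergent_on S (%n s. \<Sum>i<n. g' i s)"
 proof (rule Weierstrass_m_test')
  fix n s assume s: "s \<in> S"
  have "norm (g' n s) <= cmod (\<tau> (X s ^ n * X' s))" unfolding g'_def by (simp add: abs_Re_le_cmod)
  also have "... <= K * norm (X s ^ n * X' s)" using XA by (intro K) auto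
  also have "... <= K * (q ^ n * (B' / R))"
  proof (intro mult_left_mono K0 order_trans[OF norm_mult_ineq] mult_mono)
   show "norm (X s ^ n) <= q ^ n" by (rule order_trans[OF norm_power_bop]) (use nX[OF s] in "auto intro: power_mono")
   show "norm (X' s) <= B' / R" using B'[OF s] R0 by (simp add: X'_def divide_right_mono)
  qed (use q in auto)
  finally show "norm (g' n s) <= K * (q ^ n * (B' / R))" .
 next
  show "summable (%n. K * (q ^ n * (B' / R)))" using q by (intro summable_mult summable_mult2) (simp add: summable_geometric)
 qed
 have gs: "(%n. g n s) sums (ln R - lr (Y s) (E s))" if "s \<in> S" for s
  unfolding g_def X_def by (rule lr_series[OF Y(1) E(1) R[OF that]])
 have "((%s. \<Sum>n. g n s) has_field_derivative (\<Sum>n. g' n s0)) (at s0)"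
  by (rule has_field_derivative_series'(2)[of S g g', OF _ dg uc s0 sums_summable[OF gs[OF s0]]]) (auto simp: S_def)
 from DERIV_diff[OF DERIV_const[of "ln R"] this]
 have d: "((%s. ln R - (\<Sum>n. g n s)) has_field_derivative - (\<Sum>n. g' n s0)) (at s0)" by simp
 have d2: "((%s. lr (Y s) (E s)) has_field_derivative - (\<Sum>n. g' n s0)) (at s0)"
 proof (rule has_field_derivative_transform_within_open[OF d, of "ball s0 1"])
  fix s assume "s \<in> ball s0 1"
  hence "s \<in> S" by (simp add: S_def)
  from sums_unique[OF gs[OF this]] show "ln R - (\<Sum>n. g n s) = lr (Y s) (E s)" by simp
 qed auto
 have sG: "(%n. X s0 ^ n * X' s0) sums ((\<Sum>n. X s0 ^ n) * X' s0)"
  by (rule bounded_linear.sums[OF bounded_linear_mult_left summable_sums[OF geometric_bop(1)[OF nX[OF s0] q(1)]]])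
 have "(%n. \<tau> (X s0 ^ n * X' s0)) sums \<tau> ((\<Sum>n. X s0 ^ n) * X' s0)" by (rule sums_in(2)[OF _ sG]) (use XA in auto)
 from bounded_linear.sums[OF bounded_linear_Re this]
 have "(\<Sum>n. g' n s0) = Re (\<tau> ((\<Sum>n. X s0 ^ n) * X' s0))" by (simp add: g'_def sums_iff)
 also have "(\<Sum>n. X s0 ^ n) * X' s0 = - (res (Y s0) (E s0) * P' s0)" unfolding res_eq[OF E(1) R[OF s0]] X'_def X_def by simp
 finally show ?thesis using d2 XA Y E by (simp add: tau_minus P'_def[symmetric])
qed

end

section \<open>Multiplication by unipotent factors\<close>

context tracial
begin

lemma square_root_in:
 assumes y: "y \<in> AA" and R: "(norm y)\<^sup>2 <= R"
 shows "\<exists>T\<in>AA. adj T * T = R *\<^sub>R 1 - adj y * y"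
proof (cases "R = 0")
 case True
 thus ?thesis using R by (intro bexI[of _ 0]) auto
next
 case False
 hence R0: "R > 0" using R zero_le_power2[of "norm y"] by linarith
 define z where "z = (1 / sqrt R) *\<^sub>R y"
 have "norm y <= sqrt R" using R by (simp add: real_le_rsqrt)
 hence z: "norm z <= 1" "z \<in> AA" using R0 y by (auto simp: z_def)
 define T where "T = sqrt R *\<^sub>R sq (adj z * z)"
 have "adj T * T = R *\<^sub>R (1 - adj z * z)" using contraction_root[OF z(1)] R0 by (simp add: T_def)
 also have "... = R *\<^sub>R 1 - adj y * y" using R0 by (simp add: z_def scaleR_right_diff_distrib)
 finally show ?thesis using tau_contraction[OF z(2,1)] by (intro bexI[of _ T]) (auto simp: T_def)
qed

lemma Re_tau_pos: "x \<in> AA ==> 0 <= Re (\<tau> (adj x * x))" using tau_pos by (auto simp: complex_nonneg_Reals_iff)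

text \<open>Expands \<open>res * shifted * res\<close>. Positivity of the trace is available for
  elements \<open>adj c * c\<close>, and this displays the resolvent in that form without a root of
  it.\<close>

lemma res_sum_of_squares:
 assumes e: "e > 0"
 shows "res y e = adj (y * res y e) * (y * res y e) + adj (sqrt e *\<^sub>R res y e) * (sqrt e *\<^sub>R res y e)"
proof -
 have "adj (y * res y e) * (y * res y e) + adj (sqrt e *\<^sub>R res y e) * (sqrt e *\<^sub>R res y e)
   = res y e * shifted y e * res y e" using e by (simp add: adj_res[OF e] shifted_def algebra_simps)
 thus ?thesis by (simp add: res_inverse[OF e])
qed

text \<open>Positivity of (1 - N) (1 - adj N) gives N + adj N <= 1 + N adj N, and N adj N is at most
  the squared norm of \<open>N\<close>; both inequalities are compressed by
  \<open>c\<close>.\<close>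

lemma tau_square_bound:
 assumes c: "c \<in> AA" and N: "N \<in> AA"
 shows "Re (\<tau> (adj c * c * (N + adj N))) <= (1 + (norm N)\<^sup>2) * Re (\<tau> (adj c * c))"
proof -
 obtain T where T: "T \<in> AA" "adj T * T = (norm N)\<^sup>2 *\<^sub>R 1 - N * adj N"
  using square_root_in[of "adj N" "(norm N)\<^sup>2"] N by auto
 have "0 <= Re (\<tau> (adj (adj (c - c * N)) * adj (c - c * N)))" using c N by (intro Re_tau_pos) auto
 also have "adj (adj (c - c * N)) * adj (c - c * N) = c * adj c - c * (N + adj N) * adj c + c * (N * adj N) * adj c"
  by (simp add: algebra_simps)
 finally have "Re (\<tau> (c * (N + adj N) * adj c)) <= Re (\<tau> (c * adj c)) + Re (\<tau> (c * (N * adj N) * adj c))"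
  using c N by (simp add: tau_add tau_diff)
 also have "Re (\<tau> (c * (N * adj N) * adj c)) <= (norm N)\<^sup>2 * Re (\<tau> (c * adj c))"
 proof -
  have "0 <= Re (\<tau> (adj (T * adj c) * (T * adj c)))" using c T by (intro Re_tau_pos) auto
  also have "adj (T * adj c) * (T * adj c) = c * (adj T * T) * adj c" by (simp add: mult.assoc)
  also have "... = (norm N)\<^sup>2 *\<^sub>R (c * adj c) - c * (N * adj N) * adj c" by (simp add: T algebra_simps)
  finally show ?thesis using c N by (simp add: tau_diff tau_scaleR)
 qed
 finally have "Re (\<tau> (c * (N + adj N) * adj c)) <= (1 + (norm N)\<^sup>2) * Re (\<tau> (c * adj c))" by (simp add: algebra_simps)
 moreover have "\<tau> (c * (N + adj N) * adj c) = \<tau> (adj c * c * (N + adj N))"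
  using c N by (subst tau_comm) (auto simp: mult.assoc)
 moreover have "\<tau> (c * adj c) = \<tau> (adj c * c)" using c by (intro tau_comm) auto
 ultimately show ?thesis by simp
qed

lemma tau_res_bound:
 assumes y: "y \<in> AA" and N: "N \<in> AA" and e: "e > 0"
 shows "Re (\<tau> (res y e * (N + adj N))) <= (1 + (norm N)\<^sup>2) * Re (\<tau> (res y e))"
proof -
 define c d where "c = y * res y e" and "d = sqrt e *\<^sub>R res y e"
 have cd: "c \<in> AA" "d \<in> AA" using y e by (auto simp: c_def d_def)
 have J: "res y e = adj c * c + adj d * d" unfolding c_def d_def by (rule res_sum_of_squares[OF e])
 show ?thesis using tau_square_bound[OF cd(1) N] tau_square_bound[OF cd(2) N] cd N
  unfolding J by (simp add: distrib_right tau_add algebra_simps)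
qed

text \<open>Along \<open>Y\<^sub>s = y (1 + s N)\<close> the logarithm with the slowly growing parameter \<open>e\<^sub>s\<close> increases, because
 \<open>Y\<^sub>s' = Y\<^sub>s N\<close> and \<open>\<tau> N = 0\<close> leave only terms that carry the factor \<open>e\<^sub>s\<close>.\<close>

lemma lr_nilpotent_le:
 assumes y: "y \<in> AA" and N: "N \<in> AA" "N * N = 0" "\<tau> N = 0" and e: "e > 0"
 shows "lr y e <= lr (y * (1 + N)) (e * exp (1 + (norm N)\<^sup>2))"
proof -
 \<comment> \<open>The constant of \<open>tau_res_bound\<close>. Since \<open>E\<close> satisfies E'
   = c E, the growth of the parameter compensates the error terms exactly to that bound.\<close>
 define c where "c = 1 + (norm N)\<^sup>2"
 define Y where "Y s = y * (1 + s *\<^sub>R N)" for s :: real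
 define E where "E s = e * exp (c * s)" for s :: real
 have YA: "Y s \<in> AA" for s using y N by (auto simp: Y_def)
 have E0: "E s > 0" for s using e by (simp add: E_def)
 \<comment> \<open>Since \<open>N * N = 0\<close>, the constant derivative \<open>y * N\<close> is
   also \<open>Y s * N\<close>, a multiplicative perturbation of \<open>Y s\<close>.\<close>
 have YN: "Y s * N = y * N" for s using N(2) by (simp add: Y_def algebra_simps)
 have dY: "(Y has_vector_derivative y * N) (at s)" for s unfolding Y_def by (auto intro!: derivative_eq_intros simp: algebra_simps)
 have dE: "(E has_real_derivative c * E s) (at s)" for s unfolding E_def by (auto intro!: derivative_eq_intros)
 define L where "L s = Re (\<tau> (res (Y s) (E s) * (adj (y * N) * Y s + adj (Y s) * (y * N) + (c * E s) *\<^sub>R 1)))" for s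
 have dL: "((%s. lr (Y s) (E s)) has_real_derivative L s) (at s)" for s unfolding L_def
  by (rule lr_deriv[where Y' = "%_. y * N" and E' = "%s. c * E s"],
    rule YA, use y N in simp, rule dY, rule continuous_on_const, rule E0, rule dE)
    (auto simp: E_def intro!: continuous_intros)
 have "L s >= 0" for s
 proof -
  define J where "J = res (Y s) (E s)"
  have J: "J \<in> AA" using YA E0 by (simp add: J_def)
  have YY: "adj (Y s) * Y s = shifted (Y s) (E s) - E s *\<^sub>R 1" by (simp add: shifted_def)
  \<comment> \<open>\<open>adj (Y s) * Y s\<close> is the shifted operator minus \<open>E s\<close>,
    so the resolvent cancels it up to a term with the factor \<open>E s\<close>; the remaining
    \<open>N\<close> and, below, \<open>adj N\<close> have trace 0.\<close>
  have 1: "J * (adj (Y s) * (y * N)) = N - E s *\<^sub>R (J * N)"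
  proof -
   have "J * (adj (Y s) * (y * N)) = J * (adj (Y s) * Y s) * N" by (simp only: YN[of s, symmetric] mult.assoc)
   also have "... = (J * shifted (Y s) (E s)) * N - E s *\<^sub>R (J * N)" by (simp add: YY algebra_simps)
   finally show ?thesis by (simp add: J_def res_inverse[OF E0])
  qed
  have 2: "(adj (y * N) * Y s) * J = adj N - E s *\<^sub>R (adj N * J)"
  proof -
   have "(adj (y * N) * Y s) * J = adj N * (adj (Y s) * Y s) * J" unfolding YN[of s, symmetric] by (simp add: mult.assoc)
   also have "... = adj N * (shifted (Y s) (E s) * J) - E s *\<^sub>R (adj N * J)" by (simp add: YY algebra_simps)
   finally show ?thesis by (simp add: J_def res_inverse[OF E0])
  qed
  have a: "\<tau> (J * (adj (y * N) * Y s)) = \<tau> (adj N) - E s * \<tau> (J * adj N)"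
   using J N YA y tau_comm[of J "adj (y * N) * Y s"] tau_comm[of "adj N" J] 2 by (simp add: tau_diff tau_scaleR)
  have "\<tau> (J * (adj (y * N) * Y s + adj (Y s) * (y * N) + (c * E s) *\<^sub>R 1))
    = \<tau> (J * (adj (y * N) * Y s)) + \<tau> (N - E s *\<^sub>R (J * N)) + c * E s * \<tau> J"
   using J N YA y by (simp add: distrib_left 1 tau_add tau_scaleR del: adj_simps)
  hence "L s = Re (\<tau> (adj N) - E s * \<tau> (J * adj N) + \<tau> (N - E s *\<^sub>R (J * N)) + c * E s * \<tau> J)"
   unfolding L_def J_def[symmetric] a by (rule arg_cong)
  also have "... = E s * (c * Re (\<tau> J) - Re (\<tau> (J * (N + adj N))))"
   using J N by (simp add: distrib_left tau_add tau_diff tau_scaleR tau_adj algebra_simps)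
  finally have "L s = E s * (c * Re (\<tau> J) - Re (\<tau> (J * (N + adj N))))" .
  moreover have "Re (\<tau> (J * (N + adj N))) <= c * Re (\<tau> J)" unfolding J_def c_def by (rule tau_res_bound[OF YA N(1) E0])
  ultimately show ?thesis using E0[of s] by simp
 qed
 hence "lr (Y 0) (E 0) <= lr (Y 1) (E 1)" using dL by (intro DERIV_nonneg_imp_nondecreasing[of 0 1 "%s. lr (Y s) (E s)"]) auto
 thus ?thesis by (simp add: Y_def E_def c_def)
qed

lemma lr_adj: "y \<in> AA ==> lr (adj y) e = lr y e" by (simp add: lr_def law_adj)

lemma lr_mono:
 assumes y: "y \<in> AA" and e: "0 < e" "e <= e'"
 shows "lr y e <= lr y e'" unfolding lr_def
proof (rule integral_mono_AE)
 show "AE s in law y. ln (s + e) <= ln (s + e')" using law(3)[OF y] by eventually_elim (use e in auto)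
qed (use lr_integrable[OF y] e in auto)

section \<open>The Laplacian of the regularized potential\<close>

text \<open>A quarter of the Laplacian of the regularized logarithm, by \<open>d2_sum\<close>.
  Divided by pi it is the density of the regularized Brown measure.\<close>

definition gam :: "'h bop => real => complex => real" where
 "gam x e z = e * Re (\<tau> (res (x - cs z) e * res (adj (x - cs z)) e))"

text \<open>Both resolvents are sums of elements \<open>adj c * c\<close>, and the trace of
  \<open>adj c * c * (adj d * d)\<close> is that of a square of \<open>c * adj d\<close>. This is
  the subharmonicity of the regularized potential.\<close>

lemma gam_nonneg:
 assumes x: "x \<in> AA" and e: "e > 0" shows "gam x e z >= 0"
proof -
 define y where "y = x - cs z"
 have y: "y \<in> AA" using x by (simp add: y_def)
 have p: "0 <= Re (\<tau> (adj c * c * (adj d * d)))" if "c \<in> AA" "d \<in> AA" for c d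
 proof -
  have "\<tau> (adj c * c * (adj d * d)) = \<tau> ((adj c * c * adj d) * d)" by (simp add: mult.assoc)
  also have "... = \<tau> (adj (c * adj d) * (c * adj d))" using that by (subst tau_comm) (auto simp: mult.assoc)
  finally show ?thesis using Re_tau_pos[of "c * adj d"] that by simp
 qed
 define c1 c2 where "c1 = y * res y e" and "c2 = sqrt e *\<^sub>R res y e"
 define b1 b2 where "b1 = adj y * res (adj y) e" and "b2 = sqrt e *\<^sub>R res (adj y) e"
 have A: "c1 \<in> AA" "c2 \<in> AA" "b1 \<in> AA" "b2 \<in> AA" using y e by (auto simp: c1_def c2_def b1_def b2_def)
 have J: "res y e = adj c1 * c1 + adj c2 * c2" "res (adj y) e = adj b1 * b1 + adj b2 * b2"
  unfolding c1_def c2_def b1_def b2_def by (rule res_sum_of_squares[OF e])+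
 have "0 <= Re (\<tau> (res y e * res (adj y) e))" unfolding J using A p by (simp add: distrib_left distrib_right tau_add)
 thus ?thesis using e by (simp add: gam_def y_def)
qed

text \<open>\<open>d1\<close> and \<open>d2\<close> are the first and second derivatives in
  direction \<open>v\<close> of the regularized logarithm at \<open>z\<close>, see
  \<open>lr_d1\<close> and \<open>d1_d2\<close>.\<close>

definition d1 :: "'h bop => real => complex => complex => real" where
 "d1 x e v z = Re (\<tau> (res (x - cs z) e * (- (cs (cnj v) * (x - cs z) + adj (x - cs z) * cs v))))"

definition d2 :: "'h bop => real => complex => complex => real" where
 "d2 x e v z = Re (2 * (cmod v)\<^sup>2 * \<tau> (res (x - cs z) e)
   - \<tau> (res (x - cs z) e * (cs (cnj v) * (x - cs z) + adj (x - cs z) * cs v) *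
    (res (x - cs z) e * (cs (cnj v) * (x - cs z) + adj (x - cs z) * cs v))))"

lemma dY: "((%s. x - cs (z + of_real s * v)) has_vector_derivative - cs v) (at s)"
proof -
 have "(%s. x - cs (z + complex_of_real s * v)) = (%s. (x - cs z) + s *\<^sub>R (- cs v))" by (auto simp: cs_of_real' algebra_simps)
 thus ?thesis by (auto intro!: derivative_eq_intros)
qed

lemma lr_d1:
 assumes x: "x \<in> AA" and e: "e > 0"
 shows "((%s. lr (x - cs (z + of_real s * v)) e) has_real_derivative d1 x e v (z + of_real s0 * v)) (at s0)"
proof -
 have "((%s. lr (x - cs (z + of_real s * v)) e) has_real_derivative
  Re (\<tau> (res (x - cs (z + of_real s0 * v)) e * (adj (- cs v) * (x - cs (z + of_real s0 * v))
   + adj (x - cs (z + of_real s0 * v)) * (- cs v) + 0 *\<^sub>R 1)))) (at s0)"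
  by (rule lr_deriv[where Y' = "%_. - cs v" and E' = "%_. 0"])
    (use x e dY in "auto simp del: cs_simps")
 thus ?thesis by (simp add: d1_def algebra_simps del: cs_simps)
qed

lemma d1_d2:
 assumes x: "x \<in> AA" and e: "e > 0"
 shows "((%s. d1 x e v (z + of_real s * v)) has_real_derivative d2 x e v (z + of_real s0 * v)) (at s0)"
proof -
 define Y where "Y s = x - cs (z + of_real s * v)" for s :: real
 define Q where "Q s = cs (cnj v) * Y s + adj (Y s) * cs v" for s :: real
 define J where "J s = res (Y s) e" for s
 have Yd: "(Y has_vector_derivative - cs v) (at s)" for s unfolding Y_def by (rule dY)
 have Ad: "((%s. adj (Y s)) has_vector_derivative adj (- cs v)) (at s)" for s
  by (rule bounded_linear.has_vector_derivative[OF bounded_linear_adj Yd])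
 have vv: "cs (cnj v) * cs v = (cmod v)\<^sup>2 *\<^sub>R (1 :: 'h bop)"
 proof -
  have "cnj v * v = complex_of_real ((cmod v)\<^sup>2)" by (simp only: complex_norm_square mult.commute)
  thus ?thesis by (simp only: cs_simps(6)[symmetric] cs_of_real')
 qed
 have A: "Y s \<in> AA" "J s \<in> AA" "Q s \<in> AA" for s using x e by (auto simp: Y_def J_def Q_def)
 have "(Q has_vector_derivative cs (cnj v) * (- cs v) + (adj (- cs v) * cs v)) (at s0)" unfolding Q_def
  by (auto intro!: derivative_eq_intros Yd Ad)
 moreover have "cs (cnj v) * (- cs v) + (adj (- cs v) * cs v) = (- 2 * (cmod v)\<^sup>2) *\<^sub>R (1 :: 'h bop)"
 proof -
  have "(2 * (cmod v)\<^sup>2) *\<^sub>R (1 :: 'h bop) = (cmod v)\<^sup>2 *\<^sub>R 1 + (cmod v)\<^sup>2 *\<^sub>R 1"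
   unfolding mult_2 by (rule scaleR_add_left)
  thus ?thesis by (simp add: vv)
 qed
 ultimately have Qd: "(Q has_vector_derivative (- 2 * (cmod v)\<^sup>2) *\<^sub>R 1) (at s0)" by (simp only:)
 have Jd: "(J has_vector_derivative J s0 * Q s0 * J s0) (at s0)" using has_vector_derivative_res[OF e Yd, of s0]
  by (simp add: J_def[symmetric] Q_def algebra_simps)
 have d: "((%s. J s * (- Q s)) has_vector_derivative J s0 * (2 * (cmod v)\<^sup>2) *\<^sub>R 1 - J s0 * Q s0 * (J s0 * Q s0)) (at s0)"
  by (rule has_vector_derivative_eq_rhs[OF has_vector_derivative_mult[OF Jd has_vector_derivative_minus[OF Qd]]])
    (simp add: mult.assoc)
 have "((%s. \<tau> (J s * (- Q s))) has_vector_derivative \<tau> (J s0 * (2 * (cmod v)\<^sup>2) *\<^sub>R 1 - J s0 * Q s0 * (J s0 * Q s0))) (at s0)"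
  by (rule tau_has_vector_derivative[OF d]) (use A in auto)
 from bounded_linear.has_vector_derivative[OF bounded_linear_Re this]
 have "((%s. Re (\<tau> (J s * (- Q s)))) has_real_derivative Re (\<tau> (J s0 * (2 * (cmod v)\<^sup>2) *\<^sub>R 1 - J s0 * Q s0 * (J s0 * Q s0)))) (at s0)"
  by (simp add: has_real_derivative_iff_has_vector_derivative)
 moreover have "\<tau> (J s0 * (2 * (cmod v)\<^sup>2) *\<^sub>R 1 - J s0 * Q s0 * (J s0 * Q s0))
   = 2 * (cmod v)\<^sup>2 * \<tau> (J s0) - \<tau> (J s0 * Q s0 * (J s0 * Q s0))" using A by (simp add: tau_diff tau_scaleR)
 ultimately show ?thesis by (simp only: d1_def d2_def Y_def[symmetric] J_def[symmetric] Q_def[symmetric])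
qed

text \<open>Adding the directions 1 and i leaves only the products mixing y and adj y. These reduce
  through J' y = y J, where J' is the resolvent of adj y, to the product of the two
  resolvents.\<close>

lemma d2_sum:
 assumes x: "x \<in> AA" and e: "e > 0"
 shows "d2 x e 1 z + d2 x e \<i> z = 4 * gam x e z"
proof -
 define y where "y = x - cs z"
 define J where "J = res y e"
 have A: "y \<in> AA" "J \<in> AA" using x e by (auto simp: y_def J_def)
 define a where "a = adj y"
 have aA: "a \<in> AA" using A by (simp add: a_def)
 have ii: "cs \<i> * cs \<i> = - (1 :: 'h bop)" by (simp flip: cs_simps)
 have "J * (cs (cnj \<i>) * y + a * cs \<i>) = cs \<i> * (J * (a - y))"
  by (simp add: algebra_simps cs_commute[of a] cs_left_commute[of J])
 hence "J * (cs (cnj \<i>) * y + a * cs \<i>) * (J * (cs (cnj \<i>) * y + a * cs \<i>))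
   = cs \<i> * (J * (a - y)) * (cs \<i> * (J * (a - y)))" by simp
 also have "... = (cs \<i> * cs \<i>) * (J * (a - y) * (J * (a - y)))"
  using cs_left_commute[of "J * (a - y)" \<i> "J * (a - y)"] by (simp only: mult.assoc)
 finally have i2: "J * (cs (cnj \<i>) * y + a * cs \<i>) * (J * (cs (cnj \<i>) * y + a * cs \<i>))
   = - (J * (a - y) * (J * (a - y)))" by (simp add: ii)
 have "d2 x e 1 z + d2 x e \<i> z = Re (4 * \<tau> J - \<tau> (J * (y + a) * (J * (y + a))) + \<tau> (J * (a - y) * (J * (a - y))))"
  unfolding d2_def y_def[symmetric] J_def[symmetric] a_def[symmetric] i2 using A aA by (simp add: tau_minus)
 also have "\<tau> (J * (y + a) * (J * (y + a))) = \<tau> (J * (a - y) * (J * (a - y))) + 2 * \<tau> (J * y * (J * a)) + 2 * \<tau> (J * a * (J * y))"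
  using A aA by (simp add: distrib_left distrib_right right_diff_distrib left_diff_distrib tau_add tau_diff)
 also have "\<tau> (J * a * (J * y)) = \<tau> (J * y * (J * a))" using A aA by (intro tau_comm) auto
 also have "J * y * (J * a) = J - e *\<^sub>R (J * res a e)"
 proof -
  define J' where "J' = res a e"
  have "y * shifted y e = shifted a e * y" by (simp add: shifted_def a_def algebra_simps)
  hence "J' * (y * shifted y e) * J = (J' * shifted a e) * y * J" by (simp add: mult.assoc)
  moreover have "J' * (y * shifted y e) * J = J' * y * (shifted y e * J)" by (simp add: mult.assoc)
  ultimately have "J' * y = y * J" by (simp add: J_def J'_def res_inverse[OF e])
  hence "y * J * a = J' * (y * a)" by (simp add: mult.assoc[symmetric])
  also have "y * a = shifted a e - e *\<^sub>R 1" by (simp add: shifted_def a_def)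
  also have "J' * (shifted a e - e *\<^sub>R 1) = 1 - e *\<^sub>R J'" by (simp add: right_diff_distrib J'_def res_inverse[OF e])
  finally have "J * (y * J * a) = J * (1 - e *\<^sub>R J')" by simp
  thus ?thesis by (simp add: J'_def right_diff_distrib mult.assoc)
 qed
 finally show ?thesis using A aA e by (simp add: tau_diff tau_scaleR gam_def y_def[symmetric] J_def a_def)
qed

lemma isCont_tau:
 assumes "isCont f z" "!!w. f w \<in> AA" shows "isCont (%w. \<tau> (f w)) z"
 using tau_tendsto[of f "f z" "at z"] assms by (simp add: isCont_def)

lemma isCont_adj: "isCont f z ==> isCont (%w. adj (f w)) z"
 using bounded_linear.tendsto[OF bounded_linear_adj] by (simp add: isCont_def)

lemma isCont_cs: "isCont (%z. cs z :: 'h bop) z" by (rule bounded_linear.isCont[OF bounded_linear_intro[where K = 1]])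
   (auto simp: norm_cs cs_of_real[symmetric] scaleR_conv_of_real)

lemma isCont_res: "e > 0 ==> isCont f z ==> isCont (%w. res (f w) e) z" using tendsto_res by (simp add: isCont_def)

lemma isCont_gam_d:
 assumes x: "x \<in> AA" and e: "e > 0"
 shows "isCont (gam x e) z" "isCont (d1 x e v) z" "isCont (d2 x e v) z" unfolding gam_def d1_def d2_def
 by (intro isCont_Re isCont_diff isCont_mult isCont_add isCont_minus continuous_const isCont_tau isCont_res
   isCont_adj isCont_cs e; use x e in "simp del: adj_simps cs_simps")+

text \<open>The law of \<open>\<bar>y\<bar>\<close> is that of \<open>r\<^sup>* r\<close> for a square root \<open>r\<close> of \<open>\<bar>y\<bar>\<close>.\<close>

lemma absb_moments:
 assumes y: "y \<in> AA"
 shows "\<tau> (absb y ^ n) = complex_of_real (LINT s|law y. sqrt s ^ n)"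
proof -
 define x where "x = 1 - (adj y * y) /\<^sub>R (norm y)\<^sup>2"
 have x: "norm x <= 1" "adj x = x" "x \<in> AA" unfolding x_def by (rule absb_arg | simp add: y)+
 \<comment> \<open>\<open>absb y\<close> is \<open>norm y * sq x\<close>. Writing
   \<open>sq x\<close> as 1 - (1 - \<open>sq x\<close>), with inner part of norm at most 1, lets the
   same series extract a second root.\<close>
 define r where "r = sqrt (norm y) *\<^sub>R sq (1 - sq x)"
 note n1 = norm_one_minus_sq[OF x(1)]
 have sA: "sq z \<in> AA" if "z \<in> AA" "norm z <= 1" for z
  using sums_in(1)[OF _ sq_sums[OF norm_power_le_one[OF that(2)]]] that by auto
 have r: "r \<in> AA" unfolding r_def by (intro scaleR_in sA diff_in one_in x n1)
 have rr: "adj r * r = absb y"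
  using sq_mult_self[OF norm_power_le_one[OF n1]] adj_sq[OF n1] adj_sq[OF x(1)] x(2) by (simp add: r_def absb_def x_def)
 interpret prob_space "law r" by (rule law[OF r])
 note [measurable_cong] = law(2)[OF r]
 have l: "law y = distr (law r) borel (%s. s\<^sup>2)"
 proof (rule law_unique[OF y])
  show "prob_space (distr (law r) borel (%s. s\<^sup>2))" by (rule prob_space_distr) measurable
  show "AE s in distr (law r) borel (%s. s\<^sup>2). \<bar>s\<bar> <= ((norm r)\<^sup>2)\<^sup>2"
  proof (subst AE_distr_iff)
   show "AE s in law r. \<bar>s\<^sup>2\<bar> <= ((norm r)\<^sup>2)\<^sup>2" using law(3)[OF r] by eventually_elim (use power_mono[of _ "(norm r)\<^sup>2" 2] in simp)
  qed auto
  show "\<tau> ((adj y * y) ^ n) = complex_of_real (LINT s|distr (law r) borel (%s. s\<^sup>2). s ^ n)" for n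
   using law(4)[OF r, of "2 * n"] by (subst integral_distr) (auto simp: rr power_mult power2_eq_square[of "absb y"] absb_square)
 qed simp
 have "(LINT s|law y. sqrt s ^ n) = (LINT s|law r. sqrt (s\<^sup>2) ^ n)" unfolding l by (rule integral_distr) measurable
 also have "... = (LINT s|law r. s ^ n)" by (rule integral_cong_AE) (use law(3)[OF r] in "auto elim!: eventually_mono")
 finally show ?thesis using law(4)[OF r, of n] by (simp add: rr)
qed

end

section \<open>Green's formula in the plane\<close>

lemma cont_supp_bounded:
 fixes f :: "complex => real"
 assumes f: "continuous_on UNIV f" and supp: "!!z. r <= cmod z ==> f z = 0"
 shows "\<exists>M. \<forall>z. \<bar>f z\<bar> <= M"
proof -
 have "compact (f ` cball 0 r)" by (rule compact_continuous_image[OF continuous_on_subset[OF f]]) auto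
 then obtain M where "!!z. cmod z <= r ==> \<bar>f z\<bar> <= M" using compact_imp_bounded by (force simp: bounded_iff)
 hence "\<bar>f z\<bar> <= max M 0" for z using supp[of z] by (cases "cmod z <= r") (auto simp: le_max_iff_disj)
 thus ?thesis by blast
qed

definition locally_finite :: "complex measure => bool" where
 "locally_finite \<rho> \<longleftrightarrow> sets \<rho> = sets borel & (\<forall>r. emeasure \<rho> (cball 0 r) < \<infinity>)"

lemma locally_finite_lborel: "locally_finite lborel"
 unfolding locally_finite_def by (intro conjI allI emeasure_lborel_cball_finite) simp

lemma finite_locally_finite: "finite_measure \<rho> ==> sets \<rho> = sets borel ==> locally_finite \<rho>"
 by (simp add: locally_finite_def finite_measure.emeasure_finite less_top[symmetric])

lemma locally_finite_density:
 assumes g: "continuous_on UNIV g" "!!z. 0 <= g z"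
 shows "locally_finite (density lborel (%z. ennreal (g z)))"
proof -
 have [measurable]: "g \<in> borel_measurable borel" by (rule borel_measurable_continuous_onI[OF g(1)])
 have "emeasure (density lborel (%z. ennreal (g z))) (cball 0 r) < \<infinity>" for r
 proof -
  have i: "integrable lborel (%z. indicator (cball 0 r) z *\<^sub>R g z)"
   by (rule borel_integrable_compact) (auto intro: continuous_on_subset[OF g(1)])
  have "emeasure (density lborel (%z. ennreal (g z))) (cball 0 r) = (\<integral>\<^sup>+z. ennreal (indicator (cball 0 r) z *\<^sub>R g z) \<partial>lborel)"
   by (subst emeasure_density) (auto intro!: nn_integral_cong simp: indicator_def)
  also have "... < \<infinity>" by (subst nn_integral_eq_integral[OF i]) (auto simp: g)
  finally show ?thesis .
 qed
 thus ?thesis by (simp add: locally_finite_def)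
qed

lemma integrable_ball:
 assumes "locally_finite \<rho>" shows "integrable \<rho> (%z. M * indicator (cball 0 r) z :: real)"
 using assms unfolding locally_finite_def by (intro integrable_mult_right integrable_real_indicator) auto

lemma cont_supp_integrable_gen:
 fixes f :: "complex => real"
 assumes \<rho>: "locally_finite \<rho>" and f: "continuous_on UNIV f" and supp: "!!z. r <= cmod z ==> f z = 0"
 shows "integrable \<rho> f"
proof -
 have s: "sets \<rho> = sets borel" using \<rho> by (simp add: locally_finite_def)
 obtain M where M: "!!z. \<bar>f z\<bar> <= M" using cont_supp_bounded[OF f supp] by blast
 show ?thesis
 proof (rule Bochner_Integration.integrable_bound[OF integrable_ball[OF \<rho>]])
  show "AE z in \<rho>. norm (f z) <= norm (M * indicator (cball 0 r) z)"
   using M supp by (intro AE_I2) (auto simp: indicator_def intro: order_trans[OF M])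
  show "f \<in> borel_measurable \<rho>" unfolding measurable_cong_sets[OF s refl] by (rule borel_measurable_continuous_onI[OF f])
 qed
qed

lemmas cont_supp_integrable = cont_supp_integrable_gen[OF locally_finite_lborel]

text \<open>Differentiability along all lines of direction \<open>v\<close>. It is weaker than
  differentiability in the plane and is the form in which integration by parts is carried
  out.\<close>

definition dd :: "complex => (complex => real) => (complex => real) => bool" where
 "dd v f f' \<longleftrightarrow> (\<forall>z s. ((%s. f (z + of_real s * v)) has_real_derivative f' (z + of_real s * v)) (at s))"

lemma dd_I0:
 assumes "!!z. ((%s. f (z + of_real s * v)) has_real_derivative f' z) (at 0)"
 shows "dd v f f'" unfolding dd_def
proof (intro allI)
 fix z s
 have "((%t. f ((z + of_real s * v) + of_real t * v)) has_real_derivative f' (z + of_real s * v)) (at 0)" by (rule assms)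
 also have "(%t. f ((z + of_real s * v) + of_real t * v)) = (%t. f (z + of_real (t + s) * v))" by (simp add: algebra_simps)
 finally show "((%s. f (z + of_real s * v)) has_real_derivative f' (z + of_real s * v)) (at s)"
  using DERIV_shift[of "%s. f (z + of_real s * v)" "f' (z + of_real s * v)" 0 s] by simp
qed

lemma dd_0: "dd v f f' ==> ((%s. f (z + of_real s * v)) has_real_derivative f' z) (at 0)"
 unfolding dd_def by (drule spec[of _ z], drule spec[of _ 0]) simp

text \<open>Difference quotients are bounded by the mean value theorem and vanish off a fixed disc.
  The measure is general because the lemma serves Lebesgue measure and the image measure under the
  power map.\<close>

lemma integral_shift_deriv:
 fixes g g' :: "complex => real"
 assumes \<rho>: "locally_finite \<rho>" and d: "dd v g g'" and c: "continuous_on UNIV g" "continuous_on UNIV g'"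
  and supp: "!!z. r <= cmod z ==> g z = 0" "!!z. r <= cmod z ==> g' z = 0"
 shows "((%s. LINT z|\<rho>. g (z + of_real s * v)) has_real_derivative (LINT z|\<rho>. g' z)) (at 0)"
 unfolding DERIV_def tendsto_at_iff_sequentially comp_def
proof (intro allI impI)
 fix X :: "nat => real" assume X0: "\<forall>i. X i \<in> UNIV - {0}" and X: "X \<longlonglongrightarrow> 0"
 have s [measurable_cong]: "sets \<rho> = sets borel" using \<rho> by (simp add: locally_finite_def)
 have [measurable]: "g \<in> borel_measurable borel" "g' \<in> borel_measurable borel" using c by (auto intro: borel_measurable_continuous_onI)
 obtain M where M: "!!z. \<bar>g' z\<bar> <= M" using cont_supp_bounded[OF c(2) supp(2)] by blast
 obtain C where C: "!!i. \<bar>X i\<bar> <= C" using convergent_imp_Bseq[OF convergentI[OF X]] by (auto simp: Bseq_def)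
 have Xv: "cmod (of_real (X i) * v) <= C * cmod v" for i using C[of i] by (simp add: norm_mult mult_right_mono)
 have far: "r <= cmod (z + of_real t * v)" if "r + C * cmod v < cmod z" "\<bar>t\<bar> <= C" for z t
  using that norm_diff_ineq[of z "of_real t * v"] mult_right_mono[OF that(2) norm_ge_zero[of v]] by (simp add: norm_mult)
 have i: "integrable \<rho> (%z. g (z + of_real t * v))" if "\<bar>t\<bar> <= C" for t
  by (rule cont_supp_integrable_gen[OF \<rho>, of _ "r + C * cmod v + 1"])
   (use far[OF _ that] supp(1) in "auto intro!: continuous_on_compose2[OF c(1)] continuous_intros")
 have "(%i. LINT z|\<rho>. (g (z + of_real (X i) * v) - g z) / X i) \<longlonglongrightarrow> (LINT z|\<rho>. g' z)"
 proof (rule integral_dominated_convergence[OF _ _ integrable_ball[OF \<rho>, of M "r + C * cmod v"]])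
  show "AE z in \<rho>. (%i. (g (z + of_real (X i) * v) - g z) / X i) \<longlonglongrightarrow> g' z"
  proof (rule AE_I2)
   fix z
   have "((%t. (g (z + of_real t * v) - g z) / t) \<longlongrightarrow> g' z) (at 0)" using dd_0[OF d, of z] by (simp add: DERIV_def)
   thus "(%i. (g (z + of_real (X i) * v) - g z) / X i) \<longlonglongrightarrow> g' z"
    using X0 X by (simp add: tendsto_at_iff_sequentially comp_def)
  qed
  show "AE z in \<rho>. norm ((g (z + of_real (X i) * v) - g z) / X i) <= M * indicator (cball 0 (r + C * cmod v)) z" for i
  proof (rule AE_I2)
   fix z
   have "\<bar>g (z + of_real (X i) * v) - g z\<bar> <= M * \<bar>X i\<bar>"
    using field_differentiable_bound[of UNIV "%s. g (z + of_real s * v)" "%s. g' (z + of_real s * v)" M "X i" 0] d M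
    unfolding dd_def by simp
   hence "\<bar>(g (z + of_real (X i) * v) - g z) / X i\<bar> <= M" using X0 by (simp add: divide_simps)
   moreover have "g (z + of_real (X i) * v) - g z = 0" if "\<not> cmod z <= r + C * cmod v"
    using far[OF _ C[of i], of z] far[of z 0] that supp(1) C[of i] by simp
   ultimately show "norm ((g (z + of_real (X i) * v) - g z) / X i) <= M * indicator (cball 0 (r + C * cmod v)) z"
    by (cases "cmod z <= r + C * cmod v") auto
  qed
 qed measurable
 moreover have "(LINT z|\<rho>. (g (z + of_real (X i) * v) - g z) / X i) =
   ((LINT z|\<rho>. g (z + of_real (0 + X i) * v)) - (LINT z|\<rho>. g (z + of_real 0 * v))) / X i" for i
  using Bochner_Integration.integral_diff[OF i[OF C[of i]] i[of 0]] C[of i] abs_ge_zero[of "X i"] by (simp del: abs_ge_zero)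
 ultimately show "(%i. ((LINT z|\<rho>. g (z + of_real (0 + X i) * v)) - (LINT z|\<rho>. g (z + of_real 0 * v))) / X i) \<longlonglongrightarrow> (LINT z|\<rho>. g' z)"
  by (simp only:)
qed

text \<open>By translation invariance the integral is constant in the shift, so its derivative at 0
  vanishes.\<close>

lemma integral_deriv_zero:
 fixes g g' :: "complex => real"
 assumes d: "dd v g g'" and c: "continuous_on UNIV g" "continuous_on UNIV g'"
  and supp: "!!z. r <= cmod z ==> g z = 0" "!!z. r <= cmod z ==> g' z = 0"
 shows "(LINT z|lborel. g' z) = 0"
proof -
 have [measurable]: "g \<in> borel_measurable borel" using c by (auto intro: borel_measurable_continuous_onI)
 have "(LINT z|lborel. g (z + w)) = (LINT z|lborel. g z)" for w
 proof -
  have "(LINT z|lborel. g z) = (LINT z|distr lborel borel ((+) w). g z)" by (simp add: lborel_distr_plus)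
  also have "... = (LINT z|lborel. g (w + z))" by (rule integral_distr) auto
  finally show ?thesis by (simp add: add.commute)
 qed
 thus ?thesis using DERIV_unique[OF integral_shift_deriv[OF locally_finite_lborel d c supp]] by simp
qed

text \<open>\<open>L\<close> is the Laplacian of \<open>f\<close>. The partial derivatives are
  quantified away because later only the pair of a function and its Laplacian is handled.\<close>

definition C2 :: "(complex => real) => (complex => real) => bool" where
 "C2 f L \<longleftrightarrow> continuous_on UNIV f & (\<exists>f1 f11 f2 f22. dd 1 f f1 & dd 1 f1 f11 & dd \<i> f f2 & dd \<i> f2 f22 &
   continuous_on UNIV f1 & continuous_on UNIV f11 & continuous_on UNIV f2 & continuous_on UNIV f22 &
   (\<forall>z. L z = f11 z + f22 z))"

lemma C2_cont: assumes "C2 f L" shows "continuous_on UNIV f" "continuous_on UNIV L"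
proof -
 from assms obtain f1 f11 f2 f22 where "continuous_on UNIV f" "continuous_on UNIV f11" "continuous_on UNIV f22"
  "\<forall>z. L z = f11 z + f22 z" unfolding C2_def by blast
 moreover from this have "L = (%z. f11 z + f22 z)" by auto
 ultimately show "continuous_on UNIV f" "continuous_on UNIV L" by (auto intro: continuous_on_add)
qed

lemma dd_supp:
 assumes d: "dd v f f'" and s: "!!z. r <= cmod z ==> f z = 0" and z: "r < cmod z"
 shows "f' z = 0"
proof -
 have "\<forall>\<^sub>F t in nhds 0. r < cmod (z + of_real t * v)"
  by (rule order_tendstoD(1)[OF _ z]) (auto intro!: tendsto_eq_intros filterlim_ident)
 hence "\<forall>\<^sub>F t in nhds 0. f (z + of_real t * v) = 0" by eventually_elim (use s in auto)
 hence "((%t. f (z + of_real t * v)) has_real_derivative 0) (at 0)" by (subst DERIV_cong_ev[OF refl _ refl, where g = "%_. 0"]) auto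
 with dd_0[OF d, of z] show ?thesis by (rule DERIV_unique)
qed

lemma C2_supp:
 assumes "C2 f L" and s: "!!z. r <= cmod z ==> f z = 0" and z: "r + 1 <= cmod z"
 shows "L z = 0"
proof -
 obtain f1 f11 f2 f22 where d: "dd 1 f f1" "dd 1 f1 f11" "dd \<i> f f2" "dd \<i> f2 f22" and L: "\<forall>z. L z = f11 z + f22 z"
  using assms(1) unfolding C2_def by blast
 have "f1 w = 0" "f2 w = 0" if "r + 1/2 <= cmod w" for w using dd_supp[OF d(1) s] dd_supp[OF d(3) s] that by auto
 hence "f11 z = 0" "f22 z = 0" using dd_supp[OF d(2), of "r + 1/2"] dd_supp[OF d(4), of "r + 1/2"] z by auto
 thus ?thesis by (simp add: L)
qed

lemma green_one:
 assumes G: "dd v G G1" "dd v G1 G11" "continuous_on UNIV G" "continuous_on UNIV G1" "continuous_on UNIV G11"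
  and f: "dd v f f1" "dd v f1 f11" "continuous_on UNIV f" "continuous_on UNIV f1" "continuous_on UNIV f11"
  and s: "!!z. r <= cmod z ==> f z = 0"
 shows "(LINT z|lborel. G z * f11 z) = (LINT z|lborel. G11 z * f z)"
proof -
 have s1: "f1 w = 0" if "r + 1/2 <= cmod w" for w using dd_supp[OF f(1) s] that by auto
 have s2: "f11 w = 0" if "r + 1 <= cmod w" for w using dd_supp[OF f(2) s1] that by auto
 have "(LINT z|lborel. (G z * f11 z - G11 z * f z)) = 0"
 proof (rule integral_deriv_zero[where g = "%z. G z * f1 z - G1 z * f z" and r = "r + 1"])
  show "dd v (%z. G z * f1 z - G1 z * f z) (%z. G z * f11 z - G11 z * f z)"
   by (rule dd_I0) (use dd_0[OF G(1)] dd_0[OF G(2)] dd_0[OF f(1)] dd_0[OF f(2)] in "auto intro!: derivative_eq_intros")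
 qed (use G f s s1 s2 in "auto intro!: continuous_intros")
 moreover have "integrable lborel (%z. G z * f11 z)"
  by (rule cont_supp_integrable[of _ "r + 1"]) (use G f s2 in "auto intro!: continuous_intros")
 moreover have "integrable lborel (%z. G11 z * f z)"
  by (rule cont_supp_integrable[of _ r]) (use G f s in "auto intro!: continuous_intros")
 ultimately show ?thesis by simp
qed

lemma green:
 assumes G: "C2 G LG" and f: "C2 f Lf" and s: "!!z. r <= cmod z ==> f z = 0"
 shows "(LINT z|lborel. G z * Lf z) = (LINT z|lborel. LG z * f z)"
proof -
 obtain f1 f11 f2 f22 where f': "dd 1 f f1" "dd 1 f1 f11" "dd \<i> f f2" "dd \<i> f2 f22"
   "continuous_on UNIV f1" "continuous_on UNIV f11" "continuous_on UNIV f2" "continuous_on UNIV f22"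
   "\<forall>z. Lf z = f11 z + f22 z" using f unfolding C2_def by blast
 obtain G1 G11 G2 G22 where G': "dd 1 G G1" "dd 1 G1 G11" "dd \<i> G G2" "dd \<i> G2 G22"
   "continuous_on UNIV G1" "continuous_on UNIV G11" "continuous_on UNIV G2" "continuous_on UNIV G22"
   "\<forall>z. LG z = G11 z + G22 z" using G unfolding C2_def by blast
 note c = C2_cont(1)[OF f] C2_cont(1)[OF G]
 have s1: "f1 w = 0" "f2 w = 0" if "r + 1/2 <= cmod w" for w using dd_supp[OF f'(1) s] dd_supp[OF f'(3) s] that by auto
 have s2: "f11 w = 0" "f22 w = 0" if "r + 1 <= cmod w" for w using dd_supp[OF f'(2) s1(1)] dd_supp[OF f'(4) s1(2)] that by auto
 have i1: "integrable lborel (%z. G z * f11 z)" "integrable lborel (%z. G z * f22 z)"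
  by (rule cont_supp_integrable[of _ "r + 1"]; use c G' f' s2 in "auto intro!: continuous_intros")+
 have i2: "integrable lborel (%z. G11 z * f z)" "integrable lborel (%z. G22 z * f z)"
  by (rule cont_supp_integrable[of _ r]; use c G' f' s in "auto intro!: continuous_intros")+
 have "(LINT z|lborel. G z * Lf z) = (LINT z|lborel. G z * f11 z) + (LINT z|lborel. G z * f22 z)"
  using i1 f'(9) by (simp add: distrib_left)
 also have "... = (LINT z|lborel. G11 z * f z) + (LINT z|lborel. G22 z * f z)"
  using green_one[of 1 G G1 G11 f f1 f11 r] green_one[of \<i> G G2 G22 f f2 f22 r] G' f' c s by auto
 also have "... = (LINT z|lborel. LG z * f z)" using i2 G'(9) by (simp add: distrib_right)
 finally show ?thesis .
qed

section \<open>Radial functions and the total mass\<close>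

lemma max_power_deriv:
 assumes n: "n >= 1"
 shows "((%t::real. max 0 t ^ Suc n) has_real_derivative real (Suc n) * max 0 t ^ n) (at t)"
proof (cases t "0::real" rule: linorder_cases)
 case less
 have "((%t::real. 0) has_real_derivative 0) (at t)" by simp
 hence "((%t::real. max 0 t ^ Suc n) has_real_derivative 0) (at t)"
  by (rule has_field_derivative_transform_within_open[of _ _ _ "{..<0}"]) (use less in auto)
 thus ?thesis using less n by (simp add: power_0_left max_absorb1 del: power_Suc)
next
 case greater
 have "((%t::real. t ^ Suc n) has_real_derivative real (Suc n) * t ^ n) (at t)"
  using DERIV_pow[of "Suc n" t] by (simp del: power_Suc of_nat_Suc)
 hence "((%t::real. max 0 t ^ Suc n) has_real_derivative real (Suc n) * t ^ n) (at t)"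
  by (rule has_field_derivative_transform_within_open[of _ _ _ "{0<..}"]) (use greater in auto)
 thus ?thesis using greater by simp
next
 case equal
 have "((%h::real. \<bar>h\<bar> ^ n) \<longlongrightarrow> \<bar>0\<bar> ^ n) (at 0)" by (intro tendsto_intros)
 hence l: "((%h::real. \<bar>h\<bar> ^ n) \<longlongrightarrow> 0) (at 0)" using n by (simp add: power_0_left)
 have "((%h::real. max 0 h ^ Suc n / h) \<longlongrightarrow> 0) (at 0)"
 proof (rule Lim_null_comparison[OF _ l])
  show "\<forall>\<^sub>F h::real in at 0. norm (max 0 h ^ Suc n / h) <= \<bar>h\<bar> ^ n"
   by (rule always_eventually) (auto simp: max_def)
 qed
 thus ?thesis using equal n by (simp add: DERIV_def power_0_left)
qed

text \<open>The cube is the lowest power of the positive part with continuous second derivatives.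
  Its Laplacian, \<open>rad_lap\<close>, is negative only where the squared distance to
  \<open>z0\<close> is below \<open>a / 3\<close>.\<close>

definition rad :: "real => complex => complex => real" where
 "rad a z0 z = max 0 (a - (cmod (z - z0))\<^sup>2) ^ 3"

definition rad_lap :: "real => complex => complex => real" where
 "rad_lap a z0 z = 12 * max 0 (a - (cmod (z - z0))\<^sup>2) * (3 * (cmod (z - z0))\<^sup>2 - a)"

lemma C2_radial:
 assumes q: "!!s. s >= 0 ==> (q has_real_derivative q1 s) (at s)" "!!s. s >= 0 ==> (q1 has_real_derivative q2 s) (at s)"
  and q2: "continuous_on {0..} q2"
 shows "C2 (%z. q ((cmod (z - z0))\<^sup>2)) (%z. 4 * (cmod (z - z0))\<^sup>2 * q2 ((cmod (z - z0))\<^sup>2) + 4 * q1 ((cmod (z - z0))\<^sup>2))"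
proof -
 define S where "S z = (cmod (z - z0))\<^sup>2" for z
 define X where "X v z = 2 * Re (cnj v * (z - z0))" for v z
 have S0: "S z >= 0" for z by (simp add: S_def)
 have dS: "((%s. S (z + of_real s * v)) has_real_derivative X v z) (at 0)" for z v
 proof -
  have "S (z + of_real s * v) = S z + s * X v z + s\<^sup>2 * (cmod v)\<^sup>2" for s
   unfolding S_def X_def cmod_power2 by (simp add: power2_eq_square algebra_simps)
  thus ?thesis by (auto intro!: derivative_eq_intros)
 qed
 have dX: "((%s. X v (z + of_real s * v)) has_real_derivative 2 * (cmod v)\<^sup>2) (at 0)" for z v
 proof -
  have "X v (z + of_real s * v) = X v z + s * (2 * (cmod v)\<^sup>2)" for s
   unfolding X_def cmod_power2 by (simp add: power2_eq_square algebra_simps)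
  thus ?thesis by (auto intro!: derivative_eq_intros)
 qed
 have ch: "((%s. p (S (z + of_real s * v))) has_real_derivative p' (S z) * X v z) (at 0)"
  if "!!s. s >= 0 ==> (p has_real_derivative p' s) (at s)" for p p' z v
  using DERIV_chain2[of p "p' (S z)" "%s. S (z + of_real s * v)" 0 "X v z"] that[OF S0] dS by simp
 have d: "dd v (%z. q (S z)) (%z. q1 (S z) * X v z)" "dd v (%z. q1 (S z) * X v z) (%z. q2 (S z) * (X v z)\<^sup>2 + 2 * (cmod v)\<^sup>2 * q1 (S z))" for v
  by (rule dd_I0, rule ch[OF q(1)], assumption)
   (rule dd_I0, rule DERIV_cong[OF DERIV_mult[OF ch[OF q(2)] dX]], assumption, simp add: power2_eq_square algebra_simps)
 have c: "continuous_on UNIV S" "continuous_on UNIV (X v)" for v unfolding S_def X_def by (auto intro!: continuous_intros)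
 have cc: "continuous_on UNIV (%z. p (S z))" if "continuous_on {0..} p" for p :: "real => real"
  by (rule continuous_on_compose2[OF that c(1)]) (auto simp: S0)
 have ci: "continuous_on {0..} q" "continuous_on {0..} q1" using q by (auto intro!: continuous_at_imp_continuous_on DERIV_isCont)
 have XX: "(X 1 z)\<^sup>2 + (X \<i> z)\<^sup>2 = 4 * S z" for z unfolding X_def S_def cmod_power2 by (simp add: power2_eq_square algebra_simps)
 have lap: "4 * S z * q2 (S z) + 4 * q1 (S z) = (q2 (S z) * (X 1 z)\<^sup>2 + 2 * (cmod 1)\<^sup>2 * q1 (S z)) + (q2 (S z) * (X \<i> z)\<^sup>2 + 2 * (cmod \<i>)\<^sup>2 * q1 (S z))" for z
  unfolding XX[symmetric] by (simp add: algebra_simps)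
 show ?thesis unfolding C2_def S_def[symmetric]
 proof (rule conjI[OF cc[OF ci(1)]], intro exI conjI allI)
  show "dd 1 (%z. q (S z)) (%z. q1 (S z) * X 1 z)" "dd \<i> (%z. q (S z)) (%z. q1 (S z) * X \<i> z)" by (rule d)+
  show "dd 1 (%z. q1 (S z) * X 1 z) (%z. q2 (S z) * (X 1 z)\<^sup>2 + 2 * (cmod 1)\<^sup>2 * q1 (S z))"
   "dd \<i> (%z. q1 (S z) * X \<i> z) (%z. q2 (S z) * (X \<i> z)\<^sup>2 + 2 * (cmod \<i>)\<^sup>2 * q1 (S z))" by (rule d)+
 qed (rule lap | intro continuous_on_add continuous_on_mult continuous_on_power continuous_on_const cc ci q2 c)+
qed

lemma C2_rad: "C2 (rad a z0) (rad_lap a z0)"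
proof -
 have q: "((%s. max 0 (a - s) ^ 3) has_real_derivative - 3 * max 0 (a - s) ^ 2) (at s)"
  "((%s. - 3 * max 0 (a - s) ^ 2) has_real_derivative 6 * max 0 (a - s)) (at s)" for s
 proof -
  have m: "((%t::real. max 0 t ^ 3) has_real_derivative 3 * max 0 t ^ 2) (at t)" "((%t::real. max 0 t ^ 2) has_real_derivative 2 * max 0 t) (at t)" for t
   using max_power_deriv[of 2 t] max_power_deriv[of 1 t] by (simp_all add: numeral_3_eq_3 numeral_2_eq_2)
  note ch = DERIV_chain2[OF _ DERIV_diff[OF DERIV_const DERIV_ident]]
  show "((%s. max 0 (a - s) ^ 3) has_real_derivative - 3 * max 0 (a - s) ^ 2) (at s)"
   "((%s. - 3 * max 0 (a - s) ^ 2) has_real_derivative 6 * max 0 (a - s)) (at s)"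
   using ch[OF m(1), of a s] DERIV_cmult[OF ch[OF m(2), of a s], of "-3"] by simp_all
 qed
 have c: "continuous_on {0..} (%s. 6 * max 0 (a - s))" by (intro continuous_intros)
 have "rad_lap a z0 = (%z. 4 * (cmod (z - z0))\<^sup>2 * (6 * max 0 (a - (cmod (z - z0))\<^sup>2)) + 4 * (- 3 * max 0 (a - (cmod (z - z0))\<^sup>2) ^ 2))"
  by (auto simp: fun_eq_iff rad_lap_def max_def power2_eq_square algebra_simps)
 thus ?thesis using C2_radial[OF q c, of z0] by (simp only: rad_def[abs_def])
qed

lemma rad_supp: "r\<^sup>2 >= a ==> r >= 0 ==> cmod z0 + r <= cmod z ==> rad a z0 z = 0"
proof -
 assume a: "r\<^sup>2 >= a" "r >= 0" "cmod z0 + r <= cmod z"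
 have "r <= cmod (z - z0)" using a(3) norm_triangle_ineq2[of z z0] by linarith
 hence "r\<^sup>2 <= (cmod (z - z0))\<^sup>2" using a by (intro power_mono) auto
 hence "a - (cmod (z - z0))\<^sup>2 <= 0" using a by linarith
 thus ?thesis by (simp add: rad_def max_absorb1)
qed

text \<open>A smooth substitute for the logarithm of the modulus. The Laplacian has integral 2 pi,
  which makes it the reference at infinity in \<open>mass_one\<close>.\<close>

lemma C2_ln: "C2 (%z. ln (1 + (cmod z)\<^sup>2) / 2) (%z. 2 / (1 + (cmod z)\<^sup>2)\<^sup>2)"
proof -
 have q: "((%s. ln (1 + s) / 2) has_real_derivative inverse (1 + s) / 2) (at s)"
  "((%s. inverse (1 + s) / 2) has_real_derivative - (inverse (1 + s))\<^sup>2 / 2) (at s)" if "s >= 0" for s :: real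
 proof -
  show "((%s. ln (1 + s) / 2) has_real_derivative inverse (1 + s) / 2) (at s)"
   by (rule DERIV_cdivide) (use that in "auto intro!: derivative_eq_intros simp: divide_inverse")
  show "((%s. inverse (1 + s) / 2) has_real_derivative - (inverse (1 + s))\<^sup>2 / 2) (at s)"
   by (rule DERIV_cdivide) (use that in "auto intro!: derivative_eq_intros simp: power2_eq_square")
 qed
 have c: "continuous_on {0..} (%s. - (inverse (1 + s))\<^sup>2 / 2 :: real)" by (auto intro!: continuous_intros)
 have "2 / (1 + s)\<^sup>2 = 4 * s * (- (inverse (1 + s))\<^sup>2 / 2) + 4 * (inverse (1 + s) / 2)" if "s >= 0" for s :: real
 proof -
  define u where "u = inverse (1 + s)"
  have su: "s * u = 1 - u" using that by (simp add: u_def field_simps)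
  have "4 * s * (- u\<^sup>2 / 2) + 4 * (u / 2) = 2 * u - 2 * (s * u) * u" by (simp add: power2_eq_square)
  also have "... = 2 * u\<^sup>2" unfolding su by (simp add: power2_eq_square algebra_simps)
  also have "2 * u\<^sup>2 = 2 / (1 + s)\<^sup>2" unfolding u_def divide_inverse power_inverse by (rule refl)
  finally show ?thesis unfolding u_def ..
 qed
 thus ?thesis using C2_radial[OF q c, of 0] by simp
qed
lemma measure_disc: assumes "r >= 0" shows "emeasure lborel (cball (0::complex) r) = ennreal (pi * r\<^sup>2)"
 using emeasure_cball[of r "0::complex"] assms by (simp add: unit_ball_vol_2)

lemma rad_supp0: "1 + \<bar>a\<bar> <= cmod z ==> rad a 0 z = 0"
proof (rule rad_supp[of a "1 + \<bar>a\<bar>"])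
 have "\<bar>a\<bar> * 1 <= (1 + \<bar>a\<bar>) * (1 + \<bar>a\<bar>)" by (intro mult_mono) auto
 thus "a <= (1 + \<bar>a\<bar>)\<^sup>2" by (simp add: power2_eq_square)
qed auto

text \<open>The squared modulus maps planar Lebesgue measure to pi times Lebesgue measure on the
  half-line, since a disc of squared radius t has area pi t.\<close>

lemma nn_integral_radial:
 assumes [measurable]: "h \<in> borel_measurable borel"
 shows "(\<integral>\<^sup>+z. h ((cmod z)\<^sup>2) \<partial>lborel) = (\<integral>\<^sup>+s. ennreal pi * indicator {0..} s * h s \<partial>lborel)"
proof -
 have "distr lborel borel (%z::complex. (cmod z)\<^sup>2) = density lborel (%s. ennreal pi * indicator {0..} s)" (is "?M = ?N")
 proof (rule measure_eqI_generator_eq)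
  show "Int_stable (range atMost :: real set set)" by (auto simp: Int_stable_def)
  show "range atMost \<subseteq> Pow (UNIV :: real set)" "range (%n. {..real n}) \<subseteq> range atMost" by auto
  show "(\<Union>n. {..real n}) = UNIV" using real_arch_simple by auto
  show "sets ?M = sigma_sets UNIV (range atMost)" "sets ?N = sigma_sets UNIV (range atMost)" by (simp_all add: borel_eq_atMost)
  have M: "emeasure ?M {..t} = ennreal (pi * max 0 t)" for t
  proof -
   have "emeasure ?M {..t} = emeasure lborel {z::complex. (cmod z)\<^sup>2 <= t}" by (subst emeasure_distr) (auto simp: vimage_def)
   moreover have "{z::complex. (cmod z)\<^sup>2 <= t} = (if t < 0 then {} else cball 0 (sqrt t))"
    using real_le_rsqrt[of "cmod _" t] sqrt_ge_absD[of "cmod _" t] by (auto dest: order_trans[OF zero_le_power2])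
   ultimately show ?thesis using measure_disc[of "sqrt t"] by (simp add: max_def)
  qed
  thus "emeasure ?M {..real n} ~= \<infinity>" for n by simp
  fix X :: "real set" assume "X \<in> range atMost"
  then obtain t where X: "X = {..t}" by auto
  have "emeasure ?N X = (\<integral>\<^sup>+s. ennreal pi * indicator {0..t} s \<partial>lborel)"
   unfolding X by (subst emeasure_density) (auto intro!: nn_integral_cong simp: indicator_def)
  also have "... = ennreal (pi * max 0 t)" by (subst nn_integral_cmult_indicator) (auto simp: max_def ennreal_mult)
  finally show "emeasure ?M X = emeasure ?N X" unfolding X M ..
 qed
 hence "(\<integral>\<^sup>+s. h s \<partial>?M) = (\<integral>\<^sup>+s. h s \<partial>?N)" by simp
 thus ?thesis by (simp add: nn_integral_distr nn_integral_density)
qed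

text \<open>The cut-offs \<open>f n\<close> increase to 1, and their Laplacians \<open>l n\<close>
  are of order 1 / a n on a disc of area pi * a n. The part \<open>H\<close> of the potential that
  tends to 0 at infinity therefore contributes nothing in the limit, while the reference potential
  contributes 2 pi by Green's formula.\<close>

lemma mass_one:
 fixes m :: "complex measure" and G :: "complex => real"
 assumes m: "locally_finite m"
  and weak: "!!f Lf r. C2 f Lf ==> (!!z. r <= cmod z ==> f z = 0) ==> (LINT z|m. f z) = 1 / (2 * pi) * (LINT z|lborel. G z * Lf z)"
  and Gm [measurable]: "G \<in> borel_measurable borel"
  and Gi: "!!r. set_integrable lborel (cball 0 r) G"
  and asym: "((%z. G z - ln (1 + (cmod z)\<^sup>2) / 2) \<longlongrightarrow> 0) at_infinity"
 shows "emeasure m UNIV = 1"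
proof -
 have sm [measurable_cong]: "sets m = sets borel" using m by (simp add: locally_finite_def)
 define G0 where "G0 z = ln (1 + (cmod z)\<^sup>2) / 2" for z :: complex
 have G0c: "continuous_on UNIV G0" using C2_cont(1)[OF C2_ln] by (simp add: G0_def[abs_def])
 hence G0m [measurable]: "G0 \<in> borel_measurable borel" by (rule borel_measurable_continuous_onI)
 define H where "H z = G z - G0 z" for z
 have Hm [measurable]: "H \<in> borel_measurable borel" unfolding H_def by measurable
 define a where "a n = real (Suc n)" for n
 have a0: "a n > 0" for n by (simp add: a_def)
 define f where "f n z = rad (a n) 0 z / a n ^ 3" for n z
 define l where "l n z = rad_lap (a n) 0 z / a n ^ 3" for n z
 have lm [measurable]: "l n \<in> borel_measurable borel" for n unfolding l_def rad_lap_def by measurable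
 have lb: "\<bar>l n z\<bar> <= 24 / a n * indicator (cball 0 (sqrt (a n))) z" for n z
 proof (cases "(cmod z)\<^sup>2 <= a n")
  case True
  hence zi: "cmod z <= sqrt (a n)" using a0[of n] by (simp add: real_le_rsqrt)
  define q where "q = (cmod z)\<^sup>2"
  have q: "0 <= q" "q <= a n" using True by (auto simp: q_def)
  have "\<bar>rad_lap (a n) 0 z\<bar> = 12 * (a n - q) * \<bar>3 * q - a n\<bar>" using q by (simp add: rad_lap_def abs_mult q_def)
  also have "... <= 12 * a n * (2 * a n)" using q a0[of n] by (intro mult_mono) (auto simp: abs_le_iff)
  finally have "\<bar>l n z\<bar> <= 12 * a n * (2 * a n) / a n ^ 3" using a0[of n] by (simp add: l_def divide_right_mono)
  also have "... = 24 / a n" using a0[of n] by (simp add: field_simps power3_eq_cube)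
  finally show ?thesis using zi by simp
 next
  case False
  thus ?thesis using a0[of n] by (simp add: l_def rad_lap_def indicator_def)
 qed
 have li: "integrable lborel (%z. g z * l n z)" if gi: "!!r. set_integrable lborel (cball 0 r) g" and [measurable]: "g \<in> borel_measurable borel" for g :: "complex => real" and n
 proof (rule Bochner_Integration.integrable_bound)
  have "integrable lborel (%z. indicator (cball 0 (sqrt (a n))) z *\<^sub>R g z)" using gi by (simp add: set_integrable_def)
  from integrable_mult_right[OF integrable_abs[OF this], of "24 / a n"]
  show "integrable lborel (%z. 24 / a n * \<bar>indicator (cball 0 (sqrt (a n))) z *\<^sub>R g z\<bar>)" by simp
  show "AE z in lborel. norm (g z * l n z) <= norm (24 / a n * \<bar>indicator (cball 0 (sqrt (a n))) z *\<^sub>R g z\<bar>)"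
  proof (rule AE_I2)
   fix z
   have "\<bar>g z\<bar> * \<bar>l n z\<bar> <= \<bar>g z\<bar> * (24 / a n * indicator (cball 0 (sqrt (a n))) z)" by (intro mult_left_mono lb) auto
   thus "norm (g z * l n z) <= norm (24 / a n * \<bar>indicator (cball 0 (sqrt (a n))) z *\<^sub>R g z\<bar>)"
    using a0[of n] by (simp add: abs_mult mult_ac)
  qed
 qed simp
 have G0i: "set_integrable lborel (cball 0 r) G0" for r
  unfolding set_integrable_def by (rule borel_integrable_compact[OF compact_cball continuous_on_subset[OF G0c]]) auto
 have Hi: "set_integrable lborel (cball 0 r) H" for r unfolding H_def by (intro set_integral_diff(1) Gi G0i)
 have fs: "(LINT z|m. f n z) = 1 / (2 * pi) * (LINT z|lborel. G z * l n z)" for n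
  unfolding f_def l_def using weak[OF C2_rad rad_supp0] by simp
 have fl: "f n z = max 0 (1 - (cmod z)\<^sup>2 / a n) ^ 3" for n z
 proof -
  have "max 0 (a n - (cmod z)\<^sup>2) = a n * max 0 (1 - (cmod z)\<^sup>2 / a n)"
   using a0[of n] by (simp add: max_mult_distrib_left right_diff_distrib)
  thus ?thesis using a0[of n] by (simp add: f_def rad_def power_mult_distrib)
 qed
 have f0: "0 <= f n z" "f n z <= 1" for n z using a0[of n] by (auto simp: fl intro!: power_le_one)
 have fmono: "f n z <= f n' z" if "n <= n'" for n n' z unfolding fl using that a0[of n] a0[of n']
  by (intro power_mono max.mono diff_left_mono divide_left_mono) (auto simp: a_def)
 have flim: "(%n. f n z) \<longlonglongrightarrow> 1" for z
 proof -
  have "(%n. max 0 (1 - (cmod z)\<^sup>2 * inverse (real (Suc n))) ^ 3) \<longlonglongrightarrow> max 0 (1 - (cmod z)\<^sup>2 * 0) ^ 3"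
   by (intro tendsto_intros LIMSEQ_inverse_real_of_nat)
  thus ?thesis by (simp add: fl a_def divide_inverse)
 qed
 define k :: "complex => real" where "k z = 2 / (1 + (cmod z)\<^sup>2)\<^sup>2" for z
 have k0: "k z >= 0" for z by (simp add: k_def)
 have km [measurable]: "k \<in> borel_measurable borel" unfolding k_def by measurable
 have ke: "(\<integral>\<^sup>+z. ennreal (k z) \<partial>lborel) = ennreal (2 * pi)"
 proof -
  have "(\<integral>\<^sup>+z. ennreal (k z) \<partial>lborel) = (\<integral>\<^sup>+s. ennreal (2 * pi * (inverse (1 + s))\<^sup>2) * indicator {0..} s \<partial>lborel)"
   unfolding k_def by (subst nn_integral_radial)
    (auto intro!: nn_integral_cong simp: indicator_def ennreal_mult[symmetric] divide_inverse power_inverse mult_ac)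
  also have "... = ennreal (0 - - 2 * pi * inverse (1 + 0))"
  proof (rule nn_integral_FTC_atLeast)
   show "((%s. - 2 * pi * inverse (1 + s)) has_real_derivative 2 * pi * (inverse (1 + s))\<^sup>2) (at s)" if "0 <= s" for s
    using that by (auto intro!: derivative_eq_intros simp: power2_eq_square)
   have "((%s::real. inverse (1 + s)) \<longlongrightarrow> 0) at_top" by real_asymp
   from tendsto_mult[OF tendsto_const[of "- 2 * pi"] this] show "((%s::real. - 2 * pi * inverse (1 + s)) \<longlongrightarrow> 0) at_top" by simp
  qed auto
  finally show ?thesis by simp
 qed
 have ki: "integrable lborel k" by (rule integrableI_nn_integral_finite[OF _ _ ke]) (use k0 in auto)
 have kv: "(LINT z|lborel. k z) = 2 * pi" by (subst integral_eq_nn_integral) (use k0 in "auto simp: ke")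
 have fmeas [measurable]: "f n \<in> borel_measurable borel" for n unfolding fl by measurable
 have "(%n. LINT z|lborel. k z * f n z) \<longlonglongrightarrow> (LINT z|lborel. k z)"
 proof (rule integral_dominated_convergence[OF _ _ ki])
  show "AE z in lborel. (%n. k z * f n z) \<longlonglongrightarrow> k z"
   using tendsto_mult[OF tendsto_const flim] by (intro AE_I2) simp
  show "AE z in lborel. norm (k z * f n z) <= k z" for n using f0 k0 by (intro AE_I2) (simp add: abs_mult mult_left_le)
 qed measurable
 moreover have "(LINT z|lborel. k z * f n z) = (LINT z|lborel. G0 z * l n z)" for n
 proof -
  have "(LINT z|lborel. G0 z * rad_lap (a n) 0 z) = (LINT z|lborel. k z * rad (a n) 0 z)" unfolding G0_def k_def
   by (rule green[OF C2_ln C2_rad, of "sqrt (a n)"]) (use a0[of n] rad_supp[of "a n" "sqrt (a n)" 0] in auto)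
  thus ?thesis unfolding f_def l_def by simp
 qed
 ultimately have A: "(%n. LINT z|lborel. G0 z * l n z) \<longlonglongrightarrow> 2 * pi" by (simp add: kv)
 have B: "(%n. LINT z|lborel. H z * l n z) \<longlonglongrightarrow> 0"
 proof (rule LIMSEQ_I)
  fix e :: real assume e: "e > 0"
  define eta where "eta = e / (48 * pi + 1)"
  have eta: "eta > 0" "24 * pi * eta < e / 2" using e by (auto simp: eta_def field_simps add_pos_pos)
  obtain T where T: "!!z. cmod z >= T ==> \<bar>H z\<bar> < eta"
   using asym eta(1) unfolding Lim_at_infinity H_def G0_def by (auto simp: dist_norm)
  define C where "C = (LINT z|lborel. indicator (cball 0 T) z * \<bar>H z\<bar>)"
  have Ci: "integrable lborel (%z. indicator (cball 0 T) z * \<bar>H z\<bar>)"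
   using integrable_abs[OF Hi[of T, unfolded set_integrable_def]] by (simp add: abs_mult)
  have C0: "C >= 0" unfolding C_def by (rule Bochner_Integration.integral_nonneg) auto
  obtain N :: nat where N: "48 * C / e < real N" using reals_Archimedean2 by blast
  show "\<exists>N. \<forall>n\<ge>N. norm ((LINT z|lborel. H z * l n z) - 0) < e"
  proof (intro exI[of _ N] allI impI)
   fix n assume n: "N <= n"
   have ci: "integrable lborel (%z::complex. eta * (24 / a n) * indicator (cball 0 (sqrt (a n))) z)"
    by (rule integrable_ball[OF locally_finite_lborel])
   have bi: "integrable lborel (%z. 24 / a n * (indicator (cball 0 T) z * \<bar>H z\<bar>) + eta * (24 / a n) * indicator (cball 0 (sqrt (a n))) z)"
    by (intro Bochner_Integration.integrable_add integrable_mult_right Ci ci)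
   have "norm (LINT z|lborel. H z * l n z) <= (LINT z|lborel. norm (H z * l n z))" by (rule integral_norm_bound)
   also have "... <= (LINT z|lborel. 24 / a n * (indicator (cball 0 T) z * \<bar>H z\<bar>) + eta * (24 / a n) * indicator (cball 0 (sqrt (a n))) z)"
   proof (rule integral_mono[OF _ bi])
    show "integrable lborel (%z. norm (H z * l n z))" by (intro integrable_norm li Hi Hm)
    fix z :: complex
    have "norm (H z * l n z) <= \<bar>H z\<bar> * (24 / a n * indicator (cball 0 (sqrt (a n))) z)"
     by (simp only: real_norm_def abs_mult mult_left_mono[OF lb abs_ge_zero])
    also have "... <= 24 / a n * (indicator (cball 0 T) z * \<bar>H z\<bar>) + eta * (24 / a n) * indicator (cball 0 (sqrt (a n))) z"
    proof (cases "cmod z <= T")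
     case True
     have "\<bar>H z\<bar> * (24 / a n * indicator (cball 0 (sqrt (a n))) z) <= \<bar>H z\<bar> * (24 / a n * 1)"
      using a0[of n] by (intro mult_left_mono) (auto simp: indicator_def)
     moreover have "0 <= eta * (24 / a n) * indicator (cball 0 (sqrt (a n))) z" using eta a0[of n] by simp
     ultimately show ?thesis using True by (simp add: mult_ac)
    next
     case False
     hence "\<bar>H z\<bar> <= eta" using T[of z] by simp
     hence "\<bar>H z\<bar> * (24 / a n * indicator (cball 0 (sqrt (a n))) z) <= eta * (24 / a n * indicator (cball 0 (sqrt (a n))) z)"
      using a0[of n] by (intro mult_right_mono) auto
     thus ?thesis using False by (simp add: mult.assoc)
    qed
    finally show "norm (H z * l n z) <= 24 / a n * (indicator (cball 0 T) z * \<bar>H z\<bar>) + eta * (24 / a n) * indicator (cball 0 (sqrt (a n))) z" .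
   qed
   also have "... = 24 / a n * C + eta * (24 / a n) * (pi * a n)" using measure_disc[of "sqrt (a n)"] a0[of n]
    by (subst Bochner_Integration.integral_add) (use Ci ci in "auto simp: C_def measure_def")
   also have "... = 24 * C / a n + 24 * pi * eta" using a0[of n] by (simp add: field_simps)
   also have "24 * C / a n <= e / 2"
   proof -
    have "48 * C / e <= a n" using N n by (simp add: a_def)
    thus ?thesis using e a0[of n] by (simp add: field_simps)
   qed
   finally show "norm ((LINT z|lborel. H z * l n z) - 0) < e" using eta by simp
  qed
 qed
 have "(LINT z|lborel. G z * l n z) = (LINT z|lborel. G0 z * l n z) + (LINT z|lborel. H z * l n z)" for n
  using li[OF G0i G0m, of n] li[OF Hi Hm, of n] by (subst Bochner_Integration.integral_add[symmetric]) (auto simp: H_def algebra_simps)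
 with tendsto_add[OF A B] have "(%n. LINT z|lborel. G z * l n z) \<longlonglongrightarrow> 2 * pi" by simp
 from tendsto_mult[OF tendsto_const[of "1 / (2 * pi)"] this]
 have lim1: "(%n. LINT z|m. f n z) \<longlonglongrightarrow> 1" by (simp add: fs)
 have "(%n. \<integral>\<^sup>+z. ennreal (f n z) \<partial>m) \<longlonglongrightarrow> (\<integral>\<^sup>+z. 1 \<partial>m)"
 proof (rule nn_integral_LIMSEQ)
  show "incseq (%n z. ennreal (f n z))" by (auto simp: incseq_def le_fun_def intro!: ennreal_leI fmono)
  show "(%n. ennreal (f n z)) \<longlonglongrightarrow> 1" for z using tendsto_ennrealI[OF flim[of z]] by simp
 qed simp
 moreover have "(\<integral>\<^sup>+z. ennreal (f n z) \<partial>m) = ennreal (LINT z|m. f n z)" for n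
  by (rule nn_integral_eq_integral) (use cont_supp_integrable_gen[OF m C2_cont(1)[OF C2_rad] rad_supp0] f0 in "auto simp: f_def")
 moreover have "(%n. ennreal (LINT z|m. f n z)) \<longlonglongrightarrow> 1" using tendsto_ennrealI[OF lim1] by simp
 ultimately have "(\<integral>\<^sup>+z. 1 \<partial>m) = 1" by (simp add: LIMSEQ_unique)
 thus ?thesis using sets_eq_imp_space_eq[OF sm] by simp
qed

section \<open>Smooth functions and test functions\<close>

definition smooth :: "(complex => real) => bool" where
 "smooth f \<longleftrightarrow> (\<forall>vs. foldr dir_deriv vs f differentiable_on UNIV)"

lemma smooth_diff: "smooth f ==> f differentiable (at z)"
 unfolding smooth_def by (drule spec[of _ "[]"]) (simp add: differentiable_on_eq_differentiable_at)

lemma smooth_dir_deriv: assumes "smooth f" shows "smooth (dir_deriv v f)" unfolding smooth_def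
proof
 fix vs
 show "foldr dir_deriv vs (dir_deriv v f) differentiable_on UNIV"
  using assms unfolding smooth_def by (drule_tac x = "vs @ [v]" in spec) simp
qed

lemma dir_deriv_eq: "(f has_derivative f') (at z) ==> dir_deriv v f z = f' v"
 unfolding dir_deriv_def by (simp add: frechet_derivative_at[symmetric])

lemma smooth_has_derivative:
 assumes "f differentiable (at w)"
 shows "(f has_derivative (%u. Re u * dir_deriv 1 f w + Im u * dir_deriv \<i> f w)) (at w)"
proof -
 have h: "(f has_derivative frechet_derivative f (at w)) (at w)" using assms frechet_derivative_works by blast
 then interpret l: bounded_linear "frechet_derivative f (at w)" by (rule has_derivative_bounded_linear)
 have "frechet_derivative f (at w) u = Re u * dir_deriv 1 f w + Im u * dir_deriv \<i> f w" for u
 proof -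
  have "u = Re u *\<^sub>R 1 + Im u *\<^sub>R \<i>" by (simp add: complex_eq_iff)
  hence "frechet_derivative f (at w) u = frechet_derivative f (at w) (Re u *\<^sub>R 1 + Im u *\<^sub>R \<i>)" by (rule arg_cong)
  thus ?thesis by (simp only: l.add l.scaleR dir_deriv_def real_scaleR_def)
 qed
 hence "frechet_derivative f (at w) = (%u. Re u * dir_deriv 1 f w + Im u * dir_deriv \<i> f w)" by (rule ext)
 with h show ?thesis by (simp only:)
qed

lemma dir_deriv_lin:
 "f differentiable (at w) ==> dir_deriv v f w = Re v * dir_deriv 1 f w + Im v * dir_deriv \<i> f w"
 by (rule dir_deriv_eq[OF smooth_has_derivative])

lemma dd_dir_deriv:
 assumes "!!z. f differentiable (at z)" shows "dd v f (dir_deriv v f)"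
proof (rule dd_I0)
 fix z
 have "(f has_derivative (%u. Re u * dir_deriv 1 f z + Im u * dir_deriv \<i> f z)) (at (z + of_real 0 * v))"
  using smooth_has_derivative[OF assms] by simp
 moreover have "((%s. z + of_real s * v) has_derivative (%h. of_real h * v)) (at 0)" by (auto intro!: derivative_eq_intros)
 ultimately have "((%s. f (z + of_real s * v)) has_derivative (%h. Re (of_real h * v) * dir_deriv 1 f z + Im (of_real h * v) * dir_deriv \<i> f z)) (at 0)"
  by (rule has_derivative_compose[rotated])
 moreover have "(%h. Re (of_real h * v) * dir_deriv 1 f z + Im (of_real h * v) * dir_deriv \<i> f z) = (%h. h * dir_deriv v f z)"
  by (auto simp: fun_eq_iff dir_deriv_lin[OF assms, of v] algebra_simps)
 ultimately show "((%s. f (z + of_real s * v)) has_real_derivative dir_deriv v f z) (at 0)"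
  by (simp add: has_field_derivative_def mult_commute_abs)
qed

lemma smooth_cont: "smooth f ==> continuous_on UNIV f"
 by (simp add: continuous_at_imp_continuous_on differentiable_imp_continuous_within smooth_diff)

lemma C2_smooth: assumes "smooth f" shows "C2 f (laplacian f)"
proof -
 have d: "dd v g (dir_deriv v g)" if "smooth g" for v g by (rule dd_dir_deriv, rule smooth_diff[OF that])
 note s = smooth_dir_deriv
 show ?thesis unfolding C2_def
  by (intro conjI exI[of _ "dir_deriv 1 f"] exI[of _ "dir_deriv 1 (dir_deriv 1 f)"] exI[of _ "dir_deriv \<i> f"]
    exI[of _ "dir_deriv \<i> (dir_deriv \<i> f)"] d s smooth_cont assms) (simp add: laplacian_def)
qed

lemma test_functionD:
 assumes "test_function f"
 shows "smooth f" "\<exists>r>0. \<forall>z. r <= cmod z --> f z = 0"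
proof -
 show "smooth f" using assms by (simp add: test_function_def smooth_def)
 from assms have "compact (closure {z. f z ~= 0})" unfolding test_function_def by (rule conjunct2)
 hence "bounded (closure {z. f z ~= 0})" by (rule compact_imp_bounded)
 then obtain r where r: "r > 0" "\<forall>z\<in>closure {z. f z ~= 0}. cmod z <= r" unfolding bounded_pos by blast
 have "f z = 0" if "r + 1 <= cmod z" for z
 proof (rule ccontr)
  assume "f z ~= 0"
  hence "z \<in> closure {z. f z ~= 0}" by (intro subsetD[OF closure_subset]) simp
  with r(2) have "cmod z <= r" by (rule bspec)
  with that show False by simp
 qed
 with r(1) show "\<exists>r>0. \<forall>z. r <= cmod z --> f z = 0" by (intro exI[of _ "r + 1"]) auto
qed

lemma test_functionI:
 assumes "smooth f" "!!z. r <= cmod z ==> f z = 0"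
 shows "test_function f"
proof -
 have "{z. f z ~= 0} \<subseteq> cball 0 r"
 proof
  fix z assume "z \<in> {z. f z ~= 0}"
  hence "\<not> r <= cmod z" using assms(2)[of z] by blast
  thus "z \<in> cball 0 r" by simp
 qed
 hence "bounded (closure {z. f z ~= 0})" by (meson bounded_cball bounded_closure bounded_subset)
 thus ?thesis using assms(1) by (simp add: test_function_def smooth_def compact_eq_bounded_closed)
qed

text \<open>The function algebra generated by \<open>B\<close>. When it contains the directional
  derivatives of the generators, all its members are smooth by \<open>alg_smooth\<close>; this
  replaces explicit formulas for higher derivatives.\<close>

inductive_set alg :: "(complex => real) set => (complex => real) set" for B where
 base: "f \<in> B ==> f \<in> alg B"
| const: "(%z. c) \<in> alg B"
| add: "f \<in> alg B ==> g \<in> alg B ==> (%z. f z + g z) \<in> alg B"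
| mult: "f \<in> alg B ==> g \<in> alg B ==> (%z. f z * g z) \<in> alg B"

lemma alg_smooth:
 assumes B: "!!b. b \<in> B ==> (\<forall>z. b differentiable (at z)) & (\<forall>v. dir_deriv v b \<in> alg B)"
  and f: "f \<in> alg B"
 shows "smooth f"
proof -
 have step: "(\<forall>z. f differentiable (at z)) & (\<forall>v. dir_deriv v f \<in> alg B)" if "f \<in> alg B" for f using that
 proof induction
  case (base f) thus ?case by (rule B)
 next
  case (const c)
  have "dir_deriv v (%z. c) = (%z. 0)" for v by (rule ext, rule dir_deriv_eq[where f' = "%_. 0"]) simp
  thus ?case by (auto intro: alg.const)
 next
  case (add f g)
  hence "dir_deriv v (%z. f z + g z) = (%z. dir_deriv v f z + dir_deriv v g z)" for v
   by (intro ext dir_deriv_eq[OF has_derivative_add[of f "%v. dir_deriv v f _" _ g "%v. dir_deriv v g _"]])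
    (simp_all add: dir_deriv_def frechet_derivative_works[symmetric])
  thus ?case using add by (auto intro: alg.add differentiable_add)
 next
  case (mult f g)
  hence eq: "dir_deriv v (%z. f z * g z) = (%z. f z * dir_deriv v g z + dir_deriv v f z * g z)" for v
   by (intro ext dir_deriv_eq[OF has_derivative_mult[of f "%v. dir_deriv v f _" _ UNIV g "%v. dir_deriv v g _"]])
    (simp_all add: dir_deriv_def frechet_derivative_works[symmetric])
  show ?case
  proof (intro conjI allI)
   show "(%z. f z * g z) differentiable (at z)" for z using mult by (intro differentiable_mult) blast+
   have "f \<in> alg B" "g \<in> alg B" "dir_deriv v f \<in> alg B" "dir_deriv v g \<in> alg B" for v using mult by blast+
   thus "dir_deriv v (%z. f z * g z) \<in> alg B" for v unfolding eq by (rule_tac alg.add[OF alg.mult alg.mult])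
  qed
 qed
 have "foldr dir_deriv vs f \<in> alg B" for vs by (induction vs) (use f step in auto)
 thus ?thesis using step by (auto simp: smooth_def differentiable_on_eq_differentiable_at)
qed

subsection \<open>Bump functions\<close>

text \<open>The family is closed under differentiation, which only changes the polynomial
  (\<open>flat_deriv\<close>). Smoothness at 0 thus reduces to the single limit
  \<open>poly_exp_tendsto\<close>.\<close>

definition flat :: "real poly => real => real" where
 "flat p t = (if t > 0 then poly p (1 / t) * exp (- 1 / t) else 0)"

lemma poly_exp_tendsto: "((%x. poly p x * exp (- x)) \<longlongrightarrow> (0::real)) at_top"
proof -
 have "((%x. \<Sum>i\<le>degree p. coeff p i * (x ^ i / exp x)) \<longlongrightarrow> (\<Sum>i\<le>degree p. coeff p i * (0::real))) at_top"
  by (intro tendsto_intros tendsto_power_div_exp_0)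
 also have "(%x. \<Sum>i\<le>degree p. coeff p i * (x ^ i / exp x)) = (%x. poly p x * exp (- x))"
  by (rule ext) (simp add: poly_altdef sum_distrib_left exp_minus divide_inverse mult_ac)
 finally show ?thesis by simp
qed

lemma flat_deriv: "(flat p has_real_derivative flat ([:0, 0, 1:] * (p - pderiv p)) t) (at t)"
proof (cases t "0::real" rule: linorder_cases)
 case less
 have "((%t::real. 0) has_real_derivative 0) (at t)" by simp
 hence "(flat p has_real_derivative 0) (at t)"
  by (rule has_field_derivative_transform_within_open[of _ _ _ "{..<0}"]) (use less in "auto simp: flat_def")
 thus ?thesis using less by (simp add: flat_def)
next
 case greater
 have "((%t. poly p (inverse t) * exp (- inverse t)) has_real_derivative
   (poly p (inverse t) * (exp (- inverse t) * (inverse t)\<^sup>2)) + (poly (pderiv p) (inverse t) * - (inverse t)\<^sup>2) * exp (- inverse t)) (at t)"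
  using greater by (auto intro!: derivative_eq_intros DERIV_chain'[OF _ poly_DERIV] simp: power2_eq_square)
 hence "(flat p has_real_derivative
   (poly p (inverse t) * (exp (- inverse t) * (inverse t)\<^sup>2)) + (poly (pderiv p) (inverse t) * - (inverse t)\<^sup>2) * exp (- inverse t)) (at t)"
  by (rule has_field_derivative_transform_within_open[of _ _ _ "{0<..}"]) (use greater in "auto simp: flat_def divide_inverse")
 thus ?thesis by (rule DERIV_cong) (use greater in "simp add: flat_def divide_inverse power2_eq_square algebra_simps")
next
 case equal
 have "((%h. flat p h / h) \<longlongrightarrow> 0) (at (0::real))"
 proof (rule filterlim_split_at)
  have "\<forall>\<^sub>F h in at_left (0::real). 0 = flat p h / h" by (auto simp: eventually_at_filter flat_def)
  thus "((%h. flat p h / h) \<longlongrightarrow> 0) (at_left (0::real))" by (rule Lim_transform_eventually[OF tendsto_const])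
  have "((%h. poly ([:0, 1:] * p) (inverse h) * exp (- inverse h)) \<longlongrightarrow> (0::real)) (at_right 0)"
   by (rule filterlim_compose[OF poly_exp_tendsto filterlim_inverse_at_top_right])
  moreover have "\<forall>\<^sub>F h in at_right (0::real). poly ([:0, 1:] * p) (inverse h) * exp (- inverse h) = flat p h / h"
   by (auto simp: eventually_at_filter flat_def divide_inverse)
  ultimately show "((%h. flat p h / h) \<longlongrightarrow> 0) (at_right (0::real))" by (rule Lim_transform_eventually)
 qed
 thus ?thesis using equal by (simp add: DERIV_def flat_def)
qed

definition flat_set :: "(complex => real) set" where
 "flat_set = {%z. flat p (Re (c * z) + d) |p c d. True}"

lemma flat_smooth: "f \<in> alg flat_set ==> smooth f"
proof (rule alg_smooth)
 fix b assume "b \<in> flat_set"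
 then obtain p c d where b: "b = (%z. flat p (Re (c * z) + d))" by (auto simp: flat_set_def)
 define q where "q = [:0, 0, 1:] * (p - pderiv p)"
 have h: "(b has_derivative (%v. flat q (Re (c * z) + d) * Re (c * v))) (at z)" for z
 proof -
  have "((%z. Re (c * z) + d) has_derivative (%v. Re (c * v))) (at z)" by (auto intro!: derivative_eq_intros)
  moreover have "(flat p has_derivative (%h. flat q (Re (c * z) + d) * h)) (at (Re (c * z) + d))"
   using flat_deriv[of p "Re (c * z) + d"] unfolding has_field_derivative_def q_def .
  ultimately show ?thesis unfolding b by (rule has_derivative_compose)
 qed
 have "dir_deriv v b = (%z. flat q (Re (c * z) + d) * Re (c * v))" for v by (rule ext, rule dir_deriv_eq[OF h])
 moreover have "(%z. flat q (Re (c * z) + d)) \<in> flat_set" unfolding flat_set_def by blast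
 hence "(%z. flat q (Re (c * z) + d) * Re (c * v)) \<in> alg flat_set" for v by (intro alg.mult alg.const alg.base)
 ultimately have "dir_deriv v b \<in> alg flat_set" for v by simp
 thus "(\<forall>z. b differentiable (at z)) & (\<forall>v. dir_deriv v b \<in> alg flat_set)"
  using h by (auto simp: differentiable_def)
qed

text \<open>Test functions increasing with \<open>n\<close> to the indicator of the open box with
  corners \<open>a\<close> and \<open>b\<close>.\<close>

definition bump :: "nat => complex => complex => complex => real" where
 "bump n a b z = flat 1 (real (Suc n) * (Re z - Re a)) * flat 1 (real (Suc n) * (Re b - Re z)) *
   (flat 1 (real (Suc n) * (Im z - Im a)) * flat 1 (real (Suc n) * (Im b - Im z)))"

lemma flat1_bounds: "0 <= flat 1 t" "flat 1 t <= 1" "flat 1 t = 0 \<longleftrightarrow> t <= 0" by (auto simp: flat_def)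

lemma flat1_mono: "0 <= m ==> m <= n ==> flat 1 (m * t) <= flat 1 (n * t)"
proof (cases "m * t > 0")
 case True
 assume "0 <= m" "m <= n"
 hence "m > 0" "t > 0" "n > 0" using True by (auto simp: zero_less_mult_iff)
 hence "1 / (n * t) <= 1 / (m * t)" using \<open>m <= n\<close> by (intro divide_left_mono mult_right_mono) auto
 thus ?thesis using True \<open>n > 0\<close> \<open>t > 0\<close> by (simp add: flat_def)
qed (simp add: flat_def)

lemma flat1_lim: "(%n. flat 1 (real (Suc n) * t)) \<longlonglongrightarrow> (if t > 0 then 1 else 0)"
proof (cases "t > 0")
 case True
 have "(%n. exp (- (inverse (real (Suc n)) * inverse t))) \<longlonglongrightarrow> exp (- (0 * inverse t))"
  by (intro tendsto_intros LIMSEQ_inverse_real_of_nat)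
 thus ?thesis using True by (simp add: flat_def divide_inverse)
next
 case False
 hence "flat 1 (real (Suc n) * t) = 0" for n by (simp add: flat1_bounds mult_nonneg_nonpos)
 thus ?thesis using False by simp
qed

lemma in_box_complex: "z \<in> box a b \<longleftrightarrow> Re a < Re z & Re z < Re b & Im a < Im z & Im z < Im b"
 by (auto simp: box_def Basis_complex_def inner_complex_def)

lemma bump_test: "test_function (bump n a b)"
proof (rule test_functionI)
 have f: "(%z. flat 1 (Re (c * z) + d)) \<in> alg flat_set" for c d by (rule alg.base) (auto simp: flat_set_def)
 have "bump n a b = (%z. flat 1 (Re (complex_of_real (real (Suc n)) * z) + - real (Suc n) * Re a)
   * flat 1 (Re (complex_of_real (- real (Suc n)) * z) + real (Suc n) * Re b) *
   (flat 1 (Re ((- \<i> * complex_of_real (real (Suc n))) * z) + - real (Suc n) * Im a)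
   * flat 1 (Re ((\<i> * complex_of_real (real (Suc n))) * z) + real (Suc n) * Im b)))"
  by (simp add: fun_eq_iff bump_def algebra_simps)
 note e = this
 show "smooth (bump n a b)" unfolding e by (intro flat_smooth alg.mult f)
 fix z assume z: "cmod a + cmod b + cmod a + cmod b <= cmod z"
 show "bump n a b z = 0"
 proof (cases "z \<in> box a b")
  case True
  have "cmod z <= \<bar>Re z\<bar> + \<bar>Im z\<bar>" by (rule cmod_le)
  moreover have "\<bar>Re z\<bar> < \<bar>Re a\<bar> + \<bar>Re b\<bar>" "\<bar>Im z\<bar> < \<bar>Im a\<bar> + \<bar>Im b\<bar>" using True by (auto simp: in_box_complex)
  ultimately show ?thesis using z abs_Re_le_cmod[of a] abs_Im_le_cmod[of a] abs_Re_le_cmod[of b] abs_Im_le_cmod[of b] by linarith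
 next
  case False
  thus ?thesis by (auto simp: bump_def flat1_bounds in_box_complex mult_le_0_iff)
 qed
qed

lemma bump_nonneg: "0 <= bump n a b z" by (simp add: bump_def flat1_bounds)

lemma bump_mono: "m <= n ==> bump m a b z <= bump n a b z"
 unfolding bump_def by (intro mult_mono flat1_mono mult_nonneg_nonneg flat1_bounds) auto

lemma bump_lim: "(%n. bump n a b z) \<longlonglongrightarrow> indicator (box a b) z"
proof -
 have "indicator (box a b) z = (if Re z - Re a > 0 then 1 else 0) * (if Re b - Re z > 0 then 1 else 0) *
  ((if Im z - Im a > 0 then 1 else 0) * (if Im b - Im z > 0 then 1 else (0::real)))" by (auto simp: indicator_def in_box_complex)
 thus ?thesis unfolding bump_def by (simp only: tendsto_mult flat1_lim)
qed

text \<open>Bump functions recover the measures of open boxes by monotone convergence, and boxes are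
  an intersection-stable generator of the Borel sets.\<close>

lemma measure_eq_test:
 fixes \<mu> \<nu> :: "complex measure"
 assumes lf: "locally_finite \<mu>" and s: "sets \<nu> = sets borel"
  and eq: "!!f. test_function f ==> (!!z. 0 <= f z) ==> (\<integral>\<^sup>+z. ennreal (f z) \<partial>\<mu>) = (\<integral>\<^sup>+z. ennreal (f z) \<partial>\<nu>)"
 shows "\<mu> = \<nu>"
proof -
 have sm: "sets \<mu> = sets borel" using lf by (simp add: locally_finite_def)
 have fin: "emeasure \<mu> (box a b) < \<infinity>" for a b
 proof -
  obtain r where "!!z. z \<in> box a b ==> cmod z <= r" using bounded_box[of a b] unfolding bounded_iff by blast
  hence "emeasure \<mu> (box a b) <= emeasure \<mu> (cball 0 r)" using sm by (intro emeasure_mono) auto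
  thus ?thesis using lf by (simp add: locally_finite_def le_less_trans)
 qed
 show ?thesis
proof (rule measure_eqI_generator_eq[where E = "range (%(a, b). box a b)" and \<Omega> = UNIV and A = "%i. box (- (real i *\<^sub>R One)) (real i *\<^sub>R One)"])
 show "Int_stable (range (%(a, b). box a b :: complex set))" by (auto simp: Int_stable_def box_Int_box)
 have lim: "(%n. \<integral>\<^sup>+z. ennreal (bump n a b z) \<partial>m) \<longlonglongrightarrow> emeasure m (box a b)" if m: "sets m = sets borel" for m a b
 proof -
  have [measurable]: "(%z. ennreal (bump n a b z)) \<in> borel_measurable m" for n
  proof -
   have "bump n a b \<in> borel_measurable borel"
    by (rule borel_measurable_continuous_onI[OF smooth_cont[OF test_functionD(1)[OF bump_test]]])
   hence "(%z. ennreal (bump n a b z)) \<in> borel_measurable borel" by measurable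
   thus ?thesis by (simp add: measurable_cong_sets[OF m refl])
  qed
  have "(%n. \<integral>\<^sup>+z. ennreal (bump n a b z) \<partial>m) \<longlonglongrightarrow> (\<integral>\<^sup>+z. indicator (box a b) z \<partial>m)"
  proof (rule nn_integral_LIMSEQ)
   show "incseq (%n z. ennreal (bump n a b z))" by (auto simp: incseq_def le_fun_def intro!: ennreal_leI bump_mono)
   show "(%n. ennreal (bump n a b z)) \<longlonglongrightarrow> indicator (box a b) z" for z
    using tendsto_ennrealI[OF bump_lim[of a b z]] by (simp add: ennreal_indicator)
  qed simp
  thus ?thesis using m by simp
 qed
 fix X assume "X \<in> range (%(a, b). box a b :: complex set)"
 then obtain a b where X: "X = box a b" by auto
 show "emeasure \<mu> X = emeasure \<nu> X"
  unfolding X using lim[OF sm, of a b] lim[OF s, of a b] eq[OF bump_test bump_nonneg] by (simp add: LIMSEQ_unique)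
next
 show "emeasure \<mu> (box (- (real i *\<^sub>R One)) (real i *\<^sub>R One)) ~= \<infinity>" for i using fin by (simp add: less_top[symmetric])
 show "(\<Union>i. box (- (real i *\<^sub>R One)) (real i *\<^sub>R One)) = (UNIV :: complex set)" by (rule UN_box_eq_UNIV)
qed (use s sm in "auto simp: borel_eq_box")
qed

subsection \<open>Composition with a polynomial\<close>

text \<open>Chosen for \<open>alg_smooth\<close>: by the chain rule, derivatives of a smooth
  function after \<open>p\<close> are sums of products of such functions with real parts of
  polynomials.\<close>

definition poly_set :: "complex poly => (complex => real) set" where
 "poly_set p = {%z. f (poly p z) |f. smooth f} \<union> {%z. Re (poly q z) |q. True}"

lemma poly_deriv: "(poly p has_derivative (%v. poly (pderiv p) z * v)) (at (z :: complex))"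
 using poly_DERIV[of p z] by (simp only: has_field_derivative_def)

lemma poly_chain:
 assumes "f differentiable (at (poly p z))"
 shows "((%z. f (poly p z)) has_derivative (%v. Re (poly (pderiv p) z * v) * dir_deriv 1 f (poly p z)
   + Im (poly (pderiv p) z * v) * dir_deriv \<i> f (poly p z))) (at z)"
 by (rule has_derivative_compose[OF poly_deriv smooth_has_derivative[OF assms]])

lemmas Re_poly_deriv = bounded_linear.has_derivative[OF bounded_linear_Re poly_deriv]

lemma poly_smooth: "f \<in> alg (poly_set p) ==> smooth f"
proof (rule alg_smooth)
 have R: "(%z. Re (poly q z)) \<in> alg (poly_set p)" for q by (rule alg.base) (auto simp: poly_set_def)
 fix b assume "b \<in> poly_set p"
 then consider f where "smooth f" "b = (%z. f (poly p z))" | q where "b = (%z. Re (poly q z))" by (auto simp: poly_set_def)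
 thus "(\<forall>z. b differentiable (at z)) & (\<forall>v. dir_deriv v b \<in> alg (poly_set p))"
 proof cases
  case 1
  note c = poly_chain[OF smooth_diff[OF 1(1)]]
  have "dir_deriv v b = (%z. Re (poly (smult v (pderiv p)) z) * dir_deriv 1 f (poly p z)
    + Re (poly (smult (- \<i> * v) (pderiv p)) z) * dir_deriv \<i> f (poly p z))" for v
   unfolding 1 by (rule ext, subst dir_deriv_eq[OF c]) (simp add: algebra_simps)
  moreover have "(%z. dir_deriv w f (poly p z)) \<in> alg (poly_set p)" for w
   using smooth_dir_deriv[OF 1(1)] by (intro alg.base) (auto simp: poly_set_def)
  ultimately have "dir_deriv v b \<in> alg (poly_set p)" for v by (simp only: alg.add alg.mult R)
  thus ?thesis unfolding 1 differentiable_def using c by blast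
 next
  case 2
  have "dir_deriv v b = (%z. Re (poly (smult v (pderiv q)) z))" for v
   unfolding 2 by (rule ext, subst dir_deriv_eq[OF Re_poly_deriv]) (simp add: mult.commute)
  hence "dir_deriv v b \<in> alg (poly_set p)" for v by (simp only: R)
  thus ?thesis unfolding 2 differentiable_def using Re_poly_deriv by blast
 qed
qed

lemma poly_set_base:
 "smooth f ==> (%z. f (z + c)) \<in> alg (poly_set [:c, 1:])"
 "smooth f ==> (%z. f (z ^ k)) \<in> alg (poly_set (monom 1 k))"
 "(%z. Re (c * z ^ n)) \<in> alg (poly_set p)"
 by (rule alg.base, force simp: poly_set_def poly_monom add.commute intro: exI[of _ "monom c n"])+

lemma test_function_translate:
 assumes "test_function f" shows "test_function (%z. f (z + c))"
proof -
 obtain r where r: "r > 0" "!!z. r <= cmod z ==> f z = 0" using test_functionD(2)[OF assms] by blast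
 show ?thesis
 proof (rule test_functionI[OF poly_smooth[OF poly_set_base(1)[OF test_functionD(1)[OF assms]]]])
  fix z assume "r + cmod c <= cmod z"
  hence "r <= cmod (z + c)" using norm_diff_ineq[of z c] by linarith
  thus "f (z + c) = 0" by (rule r)
 qed
qed

lemma test_function_power:
 assumes f: "test_function f" and k: "k > 0"
 shows "test_function (%z. f (z ^ k))"
proof -
 obtain r where r: "r > 0" "!!z. r <= cmod z ==> f z = 0" using test_functionD(2)[OF f] by blast
 show ?thesis
 proof (rule test_functionI)
  show "smooth (%z. f (z ^ k))" by (rule poly_smooth[OF poly_set_base(2)[OF test_functionD(1)[OF f]]])
  fix z assume "max 1 r <= cmod z"
  hence z: "1 <= cmod z" "r <= cmod z" by auto
  have "cmod z ^ 1 <= cmod z ^ k" using z k by (intro power_increasing) auto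
  thus "f (z ^ k) = 0" using z by (intro r) (simp add: norm_power)
 qed
qed

lemma power_chain:
 "f differentiable (at (z ^ k)) ==> ((%z. f (z ^ k)) has_derivative (%v. Re (of_nat k * z ^ (k - 1) * v) * dir_deriv 1 f (z ^ k)
   + Im (of_nat k * z ^ (k - 1) * v) * dir_deriv \<i> f (z ^ k))) (at z)"
 using poly_chain[of f "monom 1 k" z] by (simp add: poly_monom pderiv_monom)

lemma Re_power_deriv: "((%z. Re (c * z ^ n)) has_derivative (%v. Re (c * (of_nat n * z ^ (n - 1)) * v))) (at z)"
 using Re_poly_deriv[of "monom c n" z] by (simp add: poly_monom pderiv_monom mult_ac)

lemma dir_deriv_power:
 assumes f: "smooth f"
 shows "dir_deriv v (%z. f (z ^ k)) = (%z. Re ((of_nat k * v) * z ^ (k - 1)) * dir_deriv 1 f (z ^ k)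
    + Re ((- \<i> * of_nat k * v) * z ^ (k - 1)) * dir_deriv \<i> f (z ^ k))"
 by (rule ext, subst dir_deriv_eq[OF power_chain[OF smooth_diff[OF f]]]) (simp add: algebra_simps)

text \<open>The power map is conformal. In the sum over the directions 1 and i the mixed derivatives
  of \<open>f\<close> cancel, and so do the terms with \<open>B\<close>, the second derivative of
  the power.\<close>

lemma laplacian_power:
 assumes f: "smooth f"
 shows "laplacian (%z. f (z ^ k)) z = (cmod (of_nat k * z ^ (k - 1)))\<^sup>2 * laplacian f (z ^ k)"
proof -
 define A where "A = of_nat k * z ^ (k - 1)"
 define B where "B = of_nat k * (of_nat (k - 1) * z ^ (k - 2))"
 note s = smooth_diff[OF smooth_dir_deriv[OF f]]
 define p where "p = dir_deriv 1 f (z ^ k)"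
 define q where "q = dir_deriv \<i> f (z ^ k)"
 have R: "((%z. Re ((c * of_nat k * v) * z ^ (k - 1))) has_derivative (%u. Re (c * v * B * u))) (at z)" for c v
 proof -
  have e: "k - 1 - 1 = k - 2" by simp
  show ?thesis using Re_power_deriv[of "c * of_nat k * v" "k - 1" z] unfolding e B_def by (simp only: mult_ac)
 qed
 have P: "((%z. dir_deriv w f (z ^ k)) has_derivative (%u. Re (A * u) * dir_deriv 1 (dir_deriv w f) (z ^ k)
   + Im (A * u) * dir_deriv \<i> (dir_deriv w f) (z ^ k))) (at z)" for w unfolding A_def by (rule power_chain[OF s])
 have D: "dir_deriv v (dir_deriv v (%z. f (z ^ k))) z =
   Re (A * v) * (Re (A * v) * dir_deriv 1 (dir_deriv 1 f) (z ^ k) + Im (A * v) * dir_deriv \<i> (dir_deriv 1 f) (z ^ k))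
   + Re (v * B * v) * p
   + (Im (A * v) * (Re (A * v) * dir_deriv 1 (dir_deriv \<i> f) (z ^ k) + Im (A * v) * dir_deriv \<i> (dir_deriv \<i> f) (z ^ k))
   + Re (- \<i> * v * B * v) * q)" for v
 proof -
  have "((%z. Re ((1 * of_nat k * v) * z ^ (k - 1)) * dir_deriv 1 f (z ^ k)
    + Re ((- \<i> * of_nat k * v) * z ^ (k - 1)) * dir_deriv \<i> f (z ^ k)) has_derivative
    (%u. (Re ((1 * of_nat k * v) * z ^ (k - 1)) * (Re (A * u) * dir_deriv 1 (dir_deriv 1 f) (z ^ k) + Im (A * u) * dir_deriv \<i> (dir_deriv 1 f) (z ^ k))
     + Re (1 * v * B * u) * dir_deriv 1 f (z ^ k))
    + (Re ((- \<i> * of_nat k * v) * z ^ (k - 1)) * (Re (A * u) * dir_deriv 1 (dir_deriv \<i> f) (z ^ k) + Im (A * u) * dir_deriv \<i> (dir_deriv \<i> f) (z ^ k))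
     + Re (- \<i> * v * B * u) * dir_deriv \<i> f (z ^ k)))) (at z)" by (intro has_derivative_add has_derivative_mult R P)
  moreover have "Re ((1 * of_nat k * v) * z ^ (k - 1)) = Re (A * v)" "Re ((- \<i> * of_nat k * v) * z ^ (k - 1)) = Im (A * v)"
   by (simp_all add: A_def algebra_simps)
  ultimately show ?thesis unfolding dir_deriv_power[OF f] mult_1_left p_def q_def by (simp only: dir_deriv_eq)
 qed
 show ?thesis unfolding laplacian_def D A_def[symmetric] cmod_power2 by (simp add: power2_eq_square algebra_simps)
qed

lemma integral_dir_deriv_zero:
 assumes "test_function G" shows "(LINT z|lborel. dir_deriv v G z) = 0"
proof -
 note s = test_functionD(1)[OF assms]
 obtain r where r: "r > 0" "!!z. r <= cmod z ==> G z = 0" using test_functionD(2)[OF assms] by blast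
 have d: "dd v G (dir_deriv v G)" by (rule dd_dir_deriv[OF smooth_diff[OF s]])
 show ?thesis
 proof (rule integral_deriv_zero[OF d smooth_cont[OF s] smooth_cont[OF smooth_dir_deriv[OF s]]])
  show "G z = 0" if "r + 1 <= cmod z" for z using r that by auto
  show "dir_deriv v G z = 0" if "r + 1 <= cmod z" for z by (rule dd_supp[OF d r(2)]) (use that in auto)
 qed
qed

definition pw :: "nat => complex => real" where
 "pw k z = real k * cmod z ^ (2 * (k - 1))"

lemma pw_nonneg: "0 <= pw k z" by (simp add: pw_def)

lemma pw_cont: "continuous_on S (pw k)" unfolding pw_def by (intro continuous_intros)

lemma pw_measurable [measurable]: "pw k \<in> borel_measurable borel" by (rule borel_measurable_continuous_onI[OF pw_cont])

text \<open>\<open>pw k\<close> is the Jacobian of \<open>z \<mapsto> z\<^sup>k\<close> up to the constant \<open>k\<close>.  Since \<open>z \<mapsto> cnj z ^ (k - 1)\<close> is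
 antiholomorphic, the integrand is a divergence.\<close>

lemma integral_power_dir_deriv:
 assumes f: "test_function f" and k: "k > 0"
 shows "(LINT z|lborel. dir_deriv v f (z ^ k) * pw k z) = 0"
proof -
 note s = test_functionD(1)[OF f]
 define n where "n = k - 1"
 have kn: "k = Suc n" using k by (simp add: n_def)
 obtain r where r: "r > 0" "!!z. r <= cmod z ==> f (z ^ k) = 0" using test_functionD(2)[OF test_function_power[OF f k]] by blast
 define G where "G c z = Re (c * z ^ n) * f (z ^ k)" for c z
 have Gt: "test_function (G c)" for c
 proof (rule test_functionI)
  show "smooth (G c)" unfolding G_def[abs_def] by (rule poly_smooth[OF alg.mult[OF poly_set_base(3) poly_set_base(2)[OF s]]])
  show "G c z = 0" if "r <= cmod z" for z using r(2)[OF that] by (simp add: G_def)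
 qed
 have Gd: "dir_deriv w (G c) z = Re (c * z ^ n) * (Re (of_nat k * z ^ n * w) * dir_deriv 1 f (z ^ k) + Im (of_nat k * z ^ n * w) * dir_deriv \<i> f (z ^ k))
   + Re (c * (of_nat n * z ^ (n - 1)) * w) * f (z ^ k)" for w c z unfolding G_def[abs_def] n_def
  by (rule dir_deriv_eq[OF has_derivative_mult[OF Re_power_deriv power_chain[OF smooth_diff[OF s]]]])
 \<comment> \<open>The terms in which the coefficient is differentiated have opposite signs for the
   directions 1 and i; the others combine to the squared modulus of \<open>z ^ n\<close>.\<close>
 have pt: "dir_deriv 1 (G (cnj v)) z + dir_deriv \<i> (G (\<i> * cnj v)) z = dir_deriv v f (z ^ k) * pw k z" for z
 proof -
  define X where "X = z ^ n"
  define W where "W = z ^ (n - 1)"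
  have p: "pw k z = real k * ((Re X)\<^sup>2 + (Im X)\<^sup>2)"
   unfolding cmod_power2[symmetric] by (simp add: pw_def X_def n_def norm_power power_mult[symmetric] mult.commute)
  show ?thesis unfolding Gd p dir_deriv_lin[OF smooth_diff[OF s], of v] X_def[symmetric] W_def[symmetric]
   by (simp add: power2_eq_square algebra_simps)
 qed
 have i: "integrable lborel (dir_deriv w (G c))" for w c
 proof (rule cont_supp_integrable[of _ "r + 1"])
  show "continuous_on UNIV (dir_deriv w (G c))" by (rule smooth_cont[OF smooth_dir_deriv[OF test_functionD(1)[OF Gt]]])
  show "dir_deriv w (G c) z = 0" if "r + 1 <= cmod z" for z
   by (rule dd_supp[OF dd_dir_deriv[OF smooth_diff[OF test_functionD(1)[OF Gt]]], of r])
     (use r(2) that in "auto simp: G_def")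
 qed
 have "(LINT z|lborel. dir_deriv v f (z ^ k) * pw k z) = (LINT z|lborel. dir_deriv 1 (G (cnj v)) z + dir_deriv \<i> (G (\<i> * cnj v)) z)"
  by (simp only: pt)
 also have "... = 0" by (simp add: i integral_dir_deriv_zero[OF Gt])
 finally show ?thesis .
qed

section \<open>Substitution of a power\<close>

text \<open>Uniqueness of Haar measure: the double integral of F x times the indicator of
  \<open>B\<close> at y - x is evaluated in both orders. \<open>B\<close> is a disc about 0, so it
  is invariant under the reflection that occurs.\<close>

lemma translation_invariant_unique:
 assumes \<rho>: "locally_finite \<rho>" and tr: "!!v. distr \<rho> borel (%w. w + v) = \<rho>"
 shows "\<exists>c\<ge>0. \<rho> = density lborel (%_. ennreal c)"
proof -
 define B where "B = ball (0::complex) 1"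
 have s [measurable_cong]: "sets \<rho> = sets borel" and fin: "emeasure \<rho> (cball 0 r) < \<infinity>" for r
  using \<rho> by (auto simp: locally_finite_def)
 interpret \<rho>: sigma_finite_measure \<rho>
 proof
  have "(\<Union>n. cball 0 (real n)) = (UNIV :: complex set)" using real_arch_simple by auto
  thus "\<exists>A. countable A & A \<subseteq> sets \<rho> & \<Union> A = space \<rho> & (\<forall>a\<in>A. emeasure \<rho> a ~= \<infinity>)"
   using s sets_eq_imp_space_eq[OF s] fin by (intro exI[of _ "range (%n. cball 0 (real n))"]) (auto simp: less_top)
 qed
 interpret P: pair_sigma_finite lborel \<rho> ..
 have lt: "(\<integral>\<^sup>+y. g (y + x) \<partial>lborel) = (\<integral>\<^sup>+y. g y \<partial>lborel)" if [measurable]: "g \<in> borel_measurable borel" for g x and y :: complex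
 proof -
  have "(\<integral>\<^sup>+y. g y \<partial>lborel) = (\<integral>\<^sup>+y. g y \<partial>distr lborel borel ((+) x))" by (simp add: lborel_distr_plus)
  also have "... = (\<integral>\<^sup>+y. g (x + y) \<partial>lborel)" by (rule nn_integral_distr) auto
  finally show ?thesis by (simp add: add.commute)
 qed
 have rt: "(\<integral>\<^sup>+y. g (y + x) \<partial>\<rho>) = (\<integral>\<^sup>+y. g y \<partial>\<rho>)" if [measurable]: "g \<in> borel_measurable borel" for g x
  by (subst (2) tr[of x, symmetric], rule nn_integral_distr[symmetric]) auto
 have Bm [measurable]: "B \<in> sets borel" by (simp add: B_def)
 have key: "(\<integral>\<^sup>+x. F x \<partial>\<rho>) * emeasure lborel B = emeasure \<rho> B * (\<integral>\<^sup>+x. F x \<partial>lborel)"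
  if [measurable]: "F \<in> borel_measurable borel" for F
 proof -
  have "(\<integral>\<^sup>+x. F x \<partial>\<rho>) * emeasure lborel B = (\<integral>\<^sup>+x. F x * (\<integral>\<^sup>+y. indicator B y \<partial>lborel) \<partial>\<rho>)"
   by (simp add: nn_integral_multc)
  also have "... = (\<integral>\<^sup>+x. \<integral>\<^sup>+y. F x * indicator B (y - x) \<partial>lborel \<partial>\<rho>)"
   using lt[of "indicator B" "- _"] by (intro nn_integral_cong) (simp add: nn_integral_cmult)
  also have "... = (\<integral>\<^sup>+y. \<integral>\<^sup>+x. F x * indicator B (y - x) \<partial>\<rho> \<partial>lborel)"
   by (rule P.Fubini') measurable
  also have "... = (\<integral>\<^sup>+y. \<integral>\<^sup>+x. F (x + y) * indicator B (- x) \<partial>\<rho> \<partial>lborel)"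
  proof (rule nn_integral_cong)
   fix y :: complex
   show "(\<integral>\<^sup>+x. F x * indicator B (y - x) \<partial>\<rho>) = (\<integral>\<^sup>+x. F (x + y) * indicator B (- x) \<partial>\<rho>)"
    using rt[of "%x. F x * indicator B (y - x)" y] by (simp add: algebra_simps)
  qed
  also have "... = (\<integral>\<^sup>+x. \<integral>\<^sup>+y. F (x + y) * indicator B (- x) \<partial>lborel \<partial>\<rho>)"
   by (rule P.Fubini'[symmetric]) measurable
  also have "... = (\<integral>\<^sup>+x. indicator B x * (\<integral>\<^sup>+y. F y \<partial>lborel) \<partial>\<rho>)"
   using lt[of F] by (intro nn_integral_cong) (simp add: nn_integral_multc add.commute mult.commute B_def indicator_def)
  also have "... = emeasure \<rho> B * (\<integral>\<^sup>+x. F x \<partial>lborel)" by (simp add: nn_integral_multc)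
  finally show ?thesis .
 qed
 have lB: "emeasure lborel B = ennreal pi" using emeasure_ball[of 1 "0::complex"] by (simp add: B_def unit_ball_vol_2)
 define c where "c = enn2real (emeasure \<rho> B) / pi"
 have "emeasure \<rho> B <= emeasure \<rho> (cball 0 1)" by (rule emeasure_mono) (auto simp: B_def s)
 hence c: "emeasure \<rho> B = ennreal (c * pi)" using fin[of 1] by (simp add: c_def less_top le_less_trans)
 have c0: "c >= 0" by (simp add: c_def)
 have "\<rho> = density lborel (%_. ennreal c)"
 proof (rule measure_eqI)
  fix A assume "A \<in> sets \<rho>"
  hence [measurable]: "A \<in> sets borel" using s by simp
  have "emeasure \<rho> A * ennreal pi = ennreal c * emeasure lborel A * ennreal pi"
   using key[of "indicator A"] c0 by (simp add: lB c ennreal_mult mult_ac)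
  hence "emeasure \<rho> A = ennreal c * emeasure lborel A" by (subst (asm) mult.commute, subst (asm) mult.commute[of _ "ennreal pi"])
     (simp add: ennreal_mult_cancel_left pi_neq_zero)
  thus "emeasure \<rho> A = emeasure (density lborel (%_. ennreal c)) A" by (simp add: emeasure_density_const)
 qed (simp add: s)
 with c0 show ?thesis by blast
qed

text \<open>A change of variables for a k-to-one map without cutting the plane into sheets: the
  image measure is translation invariant by \<open>integral_power_dir_deriv\<close>. The constant is
  settled later, when two probability measures are compared.\<close>

lemma power_substitution:
 assumes k: "k > 0"
 shows "\<exists>c\<ge>0. distr (density lborel (%z. ennreal (pw k z))) borel (%z. z ^ k) = density lborel (%_. ennreal c)"
proof -
 define \<rho> where "\<rho> = distr (density lborel (%z. ennreal (pw k z))) borel (%z::complex. z ^ k)"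
 have s: "sets \<rho> = sets borel" by (simp add: \<rho>_def)
 let ?D = "density lborel (%z. ennreal (pw k z))"
 have "emeasure \<rho> (cball 0 r) < \<infinity>" for r
 proof -
  have "cmod z <= 1 + \<bar>r\<bar>" if "cmod (z ^ k) <= r" for z :: complex
  proof (rule ccontr)
   assume n: "\<not> cmod z <= 1 + \<bar>r\<bar>"
   hence "cmod z <= cmod (z ^ k)" using power_increasing[of 1 k "cmod z"] k by (simp add: norm_power)
   with n that show False by linarith
  qed
  hence "(%z. z ^ k) -` cball 0 r \<subseteq> cball (0::complex) (1 + \<bar>r\<bar>)" by auto
  hence "emeasure ?D ((%z. z ^ k) -` cball 0 r) <= emeasure ?D (cball 0 (1 + \<bar>r\<bar>))" by (rule emeasure_mono) simp
  also have "... < \<infinity>" using locally_finite_density[OF pw_cont pw_nonneg, of k] by (simp add: locally_finite_def)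
  finally show ?thesis unfolding \<rho>_def by (subst emeasure_distr) auto
 qed
 hence lf: "locally_finite \<rho>" by (simp add: locally_finite_def s)
 have LI: "(LINT w|\<rho>. f w) = (LINT z|lborel. f (z ^ k) * pw k z)" if "continuous_on UNIV f" for f :: "complex => real"
 proof -
  have [measurable]: "f \<in> borel_measurable borel" by (rule borel_measurable_continuous_onI[OF that])
  have "(LINT w|\<rho>. f w) = (LINT z|density lborel (%z. ennreal (pw k z)). f (z ^ k))" unfolding \<rho>_def by (rule integral_distr) measurable
  also have "... = (LINT z|lborel. f (z ^ k) * pw k z)" by (subst integral_density) (auto simp: pw_nonneg mult.commute)
  finally show ?thesis .
 qed
 have der0: "((%s. LINT w|\<rho>. g (w + of_real s * v)) has_real_derivative 0) (at 0)" if g: "test_function g" for g v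
 proof -
  note sm = test_functionD(1)[OF g]
  obtain r where r: "!!z. r <= cmod z ==> g z = 0" using test_functionD(2)[OF g] by blast
  note d = dd_dir_deriv[OF smooth_diff[OF sm], of v] and cd = smooth_cont[OF smooth_dir_deriv[OF sm], of v]
  have "((%s. LINT w|\<rho>. g (w + of_real s * v)) has_real_derivative (LINT w|\<rho>. dir_deriv v g w)) (at 0)"
   by (rule integral_shift_deriv[OF lf d smooth_cont[OF sm] cd, of "r + 1"]) (use r dd_supp[OF d r] in auto)
  thus ?thesis by (simp add: LI[OF cd] integral_power_dir_deriv[OF g k])
 qed
 have tr: "distr \<rho> borel (%w. w + v) = \<rho>" for v
 proof (rule measure_eq_test[OF lf, symmetric])
  fix f assume f: "test_function f" "!!z. 0 <= f z"
  have ii: "integrable \<rho> g" if g: "test_function g" for g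
  proof -
   obtain r where "!!z. r <= cmod z ==> g z = 0" using test_functionD(2)[OF g] by blast
   thus ?thesis by (rule cont_supp_integrable_gen[OF lf smooth_cont[OF test_functionD(1)[OF g]]])
  qed
  define \<Phi> where "\<Phi> s = (LINT w|\<rho>. f (w + of_real s * v))" for s
  have "(\<Phi> has_real_derivative 0) (at s)" for s
  proof -
   have "((%t. \<Phi> (t + s)) has_real_derivative 0) (at 0)"
    using der0[OF test_function_translate[OF f(1), of "of_real s * v"], of v] by (simp add: \<Phi>_def algebra_simps)
   thus ?thesis using DERIV_shift[of \<Phi> 0 0 s] by simp
  qed
  hence "\<Phi> 1 = \<Phi> 0" using DERIV_isconst_all by blast
  hence e: "(LINT w|\<rho>. f (w + v)) = (LINT w|\<rho>. f w)" by (simp add: \<Phi>_def)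
  have [measurable]: "f \<in> borel_measurable borel" by (rule borel_measurable_continuous_onI[OF smooth_cont[OF test_functionD(1)[OF f(1)]]])
  have "(\<integral>\<^sup>+w. ennreal (f w) \<partial>distr \<rho> borel (%w. w + v)) = (\<integral>\<^sup>+w. ennreal (f (w + v)) \<partial>\<rho>)"
   by (rule nn_integral_distr) (auto simp: measurable_cong_sets[OF s refl])
  also have "... = (\<integral>\<^sup>+w. ennreal (f w) \<partial>\<rho>)"
   using f(2) e nn_integral_eq_integral[OF ii[OF f(1)]] nn_integral_eq_integral[OF ii[OF test_function_translate[OF f(1)]]] by simp
  finally show "(\<integral>\<^sup>+w. ennreal (f w) \<partial>\<rho>) = (\<integral>\<^sup>+w. ennreal (f w) \<partial>distr \<rho> borel (%w. w + v))" ..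
 qed (simp_all add: s)
 show ?thesis using translation_invariant_unique[OF lf tr] unfolding \<rho>_def by blast
qed

text \<open>The image of Lebesgue measure with density \<open>pw k\<close> is a multiple of Lebesgue
  measure, so the preimage of a null set is null wherever \<open>pw k\<close> is positive, in
  particular off 0.\<close>

lemma AE_power:
 assumes k: "k > 0" and N: "AE w in lborel. P (w::complex)"
 shows "AE z in lborel. P (z ^ k)"
proof -
 obtain c where c: "distr (density lborel (%z. ennreal (pw k z))) borel (%z. z ^ k) = density lborel (%_. ennreal c)"
  using power_substitution[OF k] by blast
 obtain N' where N': "{w. \<not> P w} \<subseteq> N'" "N' \<in> sets borel" "emeasure lborel N' = 0" using AE_E[OF N] by auto
 have "emeasure (distr (density lborel (%z. ennreal (pw k z))) borel (%z. z ^ k)) N' = 0"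
  unfolding c using N' by (simp add: emeasure_density_const)
 hence "AE w in distr (density lborel (%z. ennreal (pw k z))) borel (%z. z ^ k). w \<notin> N'"
  using N'(2) by (subst AE_iff_null) (auto simp: null_sets_def)
 hence "AE z in density lborel (%z. ennreal (pw k z)). z ^ k \<notin> N'" using N'(2) by (subst (asm) AE_distr_iff) auto
 hence "AE z in lborel. 0 < ennreal (pw k z) --> z ^ k \<notin> N'" by (subst (asm) AE_density) auto
 moreover have "AE z in lborel. z ~= (0::complex)" using AE_lborel_singleton by blast
 ultimately show ?thesis
 proof eventually_elim
  case (elim z)
  hence "0 < pw k z" using k by (simp add: pw_def)
  with elim N'(1) show ?case by auto
 qed
qed

section \<open>Vague compactness in the plane\<close>

text \<open>Schoenberg's space-filling curve \<open>t \<mapsto> (curve 0 t, curve 1 t)\<close> is a continuous left inverse of the Borel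
 map that interleaves binary digits, which reduces compactness in the plane to Helly's theorem on the line.\<close>

definition schoenberg :: "real => real" where
 "schoenberg t = max 0 (min 1 (1/2 - cos (pi * t)))"

definition curve :: "nat => real => real" where
 "curve p t = (\<Sum>n. schoenberg (3 ^ (2 * n + p) * t) / 2 ^ Suc n)"

lemma schoenberg_bounds: "0 <= schoenberg t" "schoenberg t <= 1" by (auto simp: schoenberg_def)

lemma half_sums: "(%n. 1 / 2 ^ Suc n :: real) sums 1" by (rule power_half_series[unfolded power_one_over])

lemma curve_continuous: "continuous_on UNIV (curve p)"
proof (rule uniform_limit_theorem)
 show "uniform_limit UNIV (%N t. \<Sum>n<N. schoenberg (3 ^ (2 * n + p) * t) / 2 ^ Suc n) (curve p) sequentially" unfolding curve_def
  by (rule Weierstrass_m_test[OF _ sums_summable[OF half_sums]])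
    (auto simp: schoenberg_bounds divide_right_mono)
 show "\<forall>\<^sub>F N in sequentially. continuous_on UNIV (%t. \<Sum>n<N. schoenberg (3 ^ (2 * n + p) * t) / 2 ^ Suc n)"
  unfolding schoenberg_def by (intro always_eventually allI continuous_intros) auto
qed simp

text \<open>The point of the Cantor set with ternary digits \<open>2 * d n\<close>.\<close>

definition coding :: "(nat => real) => real" where
 "coding d = (\<Sum>n. 2 * d n / 3 ^ Suc n)"

lemma third_sums: "(%n. 2 / 3 ^ Suc n :: real) sums 1"
proof -
 have "(%n. 2 / 3 * (1 / 3) ^ n :: real) sums (2 / 3 * (1 / (1 - 1 / 3)))" by (intro sums_mult geometric_sums) simp
 thus ?thesis by (simp add: power_one_over field_simps)
qed

lemma coding_sums:
 assumes d: "!!n. d n \<in> {0, 1}" shows "(%n. 2 * d n / 3 ^ Suc n) sums coding d" "0 <= coding d" "coding d <= 1"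
proof -
 have d': "0 <= d n" "d n <= 1" for n using d[of n] by auto
 have le: "2 * d n / 3 ^ Suc n <= 2 / 3 ^ Suc n" for n using d'[of n] by (intro divide_right_mono) auto
 have s: "summable (%n. 2 * d n / 3 ^ Suc n)" by (rule summable_comparison_test'[OF sums_summable[OF third_sums], of 0])
    (use le d' in "simp add: abs_of_nonneg")
 thus "(%n. 2 * d n / 3 ^ Suc n) sums coding d" unfolding coding_def by (rule summable_sums)
 show "0 <= coding d" unfolding coding_def by (rule suminf_nonneg[OF s]) (simp add: d')
 show "coding d <= 1" unfolding coding_def sums_unique[OF third_sums] by (rule suminf_le[OF le s sums_summable[OF third_sums]])
qed

text \<open>Multiplication by \<open>3 ^ m\<close> shifts the digits and adds an even integer, which
  disappears in a cosine of period 2. The remainder lies in the first or the last third of the unit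
  interval, where the clipped cosine is constantly 0 or constantly 1.\<close>

lemma schoenberg_coding:
 assumes d: "!!n. d n \<in> {0, 1}" shows "schoenberg (3 ^ m * coding d) = d m"
proof -
 define t where "t = coding (%n. d (n + Suc m)) / 3"
 have tb: "0 <= t" "t <= 1/3" using coding_sums(2,3)[of "%n. d (n + Suc m)"] d by (auto simp: t_def)
 have shift: "coding (%n. d (n + j)) = 2 * d j / 3 + coding (%n. d (n + Suc j)) / 3" for j
 proof -
  have "(%n. 2 * d (n + Suc j) / 3 ^ Suc n / 3) sums (coding (%n. d (n + Suc j)) / 3)" by (intro sums_divide coding_sums(1)) (rule d)
  hence "(%n. 2 * d (Suc n + j) / 3 ^ Suc (Suc n)) sums (coding (%n. d (n + Suc j)) / 3)" by (simp add: mult.commute)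
  hence "(%n. 2 * d (n + j) / 3 ^ Suc n) sums (coding (%n. d (n + Suc j)) / 3 + 2 * d (0 + j) / 3 ^ Suc 0)" by (rule sums_Suc)
  thus ?thesis using sums_unique2[OF coding_sums(1)[of "%n. d (n + j)", OF d]] by simp
 qed
 have "\<exists>N::nat. 3 ^ m * coding d = 2 * real N + coding (%n. d (n + m))"
 proof (induction m)
  case (Suc m)
  then obtain N where N: "3 ^ m * coding d = 2 * real N + coding (%n. d (n + m))" by blast
  obtain j :: nat where j: "d m = real j" using d[of m] by (metis insertE singletonD of_nat_0 of_nat_1)
  have "3 ^ Suc m * coding d = 3 * (2 * real N + coding (%n. d (n + m)))" using N by simp
  also have "... = 2 * real (3 * N + j) + coding (%n. d (n + Suc m))" unfolding shift[of m] j by simp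
  finally show ?case by blast
 qed (auto intro: exI[of _ 0])
 then obtain N :: nat where N: "3 ^ m * coding d = 2 * real N + coding (%n. d (n + m))" by blast
 define u where "u = 2 * d m / 3 + t"
 have "3 ^ m * coding d = 2 * real N + u" using N shift[of m] by (simp add: u_def t_def)
 hence "cos (pi * (3 ^ m * coding d)) = cos (2 * real N * pi + pi * u)" by (simp add: algebra_simps)
 also have "... = cos (pi * u)" by (simp add: cos_add cos_2npi sin_2npi)
 finally have c: "schoenberg (3 ^ m * coding d) = max 0 (min 1 (1/2 - cos (pi * u)))" by (simp add: schoenberg_def)
 consider "d m = 0" | "d m = 1" using d[of m] by blast
 thus ?thesis
 proof cases
  case 1
  have "pi * u <= pi / 3" using tb mult_left_mono[of t "1/3" pi] by (simp add: u_def 1)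
  hence "cos (pi / 3) <= cos (pi * u)" using tb by (intro cos_monotone_0_pi_le) (auto simp: u_def 1)
  thus ?thesis using 1 by (simp add: c cos_60)
 next
  case 2
  have ub: "2/3 <= u" "u <= 1" using tb by (auto simp: u_def 2)
  have "2 * pi / 3 <= pi * u" "pi * u <= pi" using mult_left_mono[OF ub(1), of pi] mult_left_mono[OF ub(2), of pi] by auto
  hence "cos (pi * u) <= cos (2 * pi / 3)" by (intro cos_monotone_0_pi_le) auto
  moreover have "cos (2 * pi / 3) = - (1/2)" using cos_pi_minus[of "pi / 3"] by (simp add: cos_60 field_simps)
  ultimately show ?thesis using 2 by (simp add: c)
 qed
qed

definition binary_digit :: "nat => real => real" where
 "binary_digit n x = of_int (\<lfloor>2 ^ Suc n * x\<rfloor> - 2 * \<lfloor>2 ^ n * x\<rfloor>)"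

lemma binary_digit_01: "binary_digit n x \<in> {0, 1}"
proof -
 define y where "y = 2 ^ n * x"
 have "\<lfloor>2 * y\<rfloor> - 2 * \<lfloor>y\<rfloor> = 0 \<or> \<lfloor>2 * y\<rfloor> - 2 * \<lfloor>y\<rfloor> = 1" by linarith
 thus ?thesis by (auto simp: binary_digit_def y_def mult.assoc)
qed

lemma binary_digit_sums:
 assumes "0 <= x" "x < 1" shows "(%n. binary_digit n x / 2 ^ Suc n) sums x"
proof -
 have s: "(\<Sum>n<N. binary_digit n x / 2 ^ Suc n) = of_int \<lfloor>2 ^ N * x\<rfloor> / 2 ^ N" for N
 proof (induction N)
  case 0 show ?case using assms by (simp add: floor_unique)
 next
  case (Suc N) thus ?case by (simp add: binary_digit_def field_simps)
 qed
 have "(%N. of_int \<lfloor>2 ^ N * x\<rfloor> / 2 ^ N - x) \<longlonglongrightarrow> 0"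
 proof (rule Lim_null_comparison)
  show "(%N. (1 / 2 :: real) ^ N) \<longlonglongrightarrow> 0" by (rule LIMSEQ_power_zero) simp
  show "\<forall>\<^sub>F N in sequentially. norm (of_int \<lfloor>2 ^ N * x\<rfloor> / 2 ^ N - x) <= (1 / 2) ^ N"
  proof (rule always_eventually, rule allI)
   fix N
   have "of_int \<lfloor>2 ^ N * x\<rfloor> / 2 ^ N - x = (of_int \<lfloor>2 ^ N * x\<rfloor> - 2 ^ N * x) / 2 ^ N" by (simp add: field_simps)
   moreover have "\<bar>of_int \<lfloor>2 ^ N * x\<rfloor> - 2 ^ N * x\<bar> <= 1" by linarith
   ultimately show "norm (of_int \<lfloor>2 ^ N * x\<rfloor> / 2 ^ N - x) <= (1 / 2) ^ N"
    by (simp add: power_one_over divide_right_mono)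
  qed
 qed
 hence "(%N. of_int \<lfloor>2 ^ N * x\<rfloor> / 2 ^ N) \<longlonglongrightarrow> x" using Lim_null by blast
 thus ?thesis unfolding sums_def s .
qed

definition plane_code :: "real => real => real" where
 "plane_code x y = coding (%n. if even n then binary_digit (n div 2) x else binary_digit (n div 2) y)"

lemma plane_code_digits: "(if even n then binary_digit (n div 2) x else binary_digit (n div 2) y) \<in> {0, 1}"
 using binary_digit_01 by auto

lemma curve_plane_code:
 assumes "0 <= x" "x < 1" "0 <= y" "y < 1"
 shows "curve 0 (plane_code x y) = x" "curve 1 (plane_code x y) = y" using binary_digit_sums[of x] binary_digit_sums[of y] assms
 unfolding curve_def plane_code_def schoenberg_coding[OF plane_code_digits] by (auto simp: sums_iff)

text \<open>A bijection from the line to the open unit interval, with inverse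
  \<open>unsqueeze\<close>: the digit code works only for coordinates in the unit interval.\<close>

definition squeeze :: "real => real" where "squeeze t = 1/2 + t / (2 * (1 + \<bar>t\<bar>))"

definition unsqueeze :: "real => real" where "unsqueeze x = (2 * x - 1) / (1 - \<bar>2 * x - 1\<bar>)"

lemma squeeze_bounds: "0 < squeeze t" "squeeze t < 1"
proof -
 have "\<bar>t / (2 * (1 + \<bar>t\<bar>))\<bar> < 1/2" by (simp add: abs_mult divide_simps)
 thus "0 < squeeze t" "squeeze t < 1" unfolding squeeze_def by linarith+
qed

lemma unsqueeze_squeeze: "unsqueeze (squeeze t) = t"
proof -
 have e: "2 * squeeze t - 1 = t / (1 + \<bar>t\<bar>)" by (simp add: squeeze_def field_simps)
 have p: "1 + \<bar>t\<bar> > 0" by simp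
 have "1 - \<bar>t / (1 + \<bar>t\<bar>)\<bar> = 1 / (1 + \<bar>t\<bar>)" using p by (simp add: field_simps)
 thus ?thesis unfolding unsqueeze_def e using p by simp
qed

lemma unsqueeze_large:
 assumes r: "r > 0" and x: "0 < x" "x < 1" and o: "\<not> (1 / (2 * (1 + r)) <= x & x <= 1 - 1 / (2 * (1 + r)))"
 shows "r <= \<bar>unsqueeze x\<bar>"
proof -
 define w where "w = \<bar>2 * x - 1\<bar>"
 have w: "0 <= w" "w < 1" using x by (auto simp: w_def)
 define d where "d = 1 / (2 * (1 + r))"
 have d2: "2 * d = 1 / (1 + r)" using r by (simp add: d_def divide_simps)
 have "x < d \<or> 1 - d < x" using o unfolding d_def by auto
 hence "1 - 2 * d < w" unfolding w_def by arith
 hence "1 - 1 / (1 + r) < w" unfolding d2 .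
 hence "r / (1 + r) < w" using r by (simp add: field_simps)
 hence "r < w * (1 + r)" using r by (simp add: field_simps)
 hence "r * (1 - w) <= w" by (simp add: algebra_simps)
 hence "r <= w / (1 - w)" using w by (simp add: field_simps)
 thus ?thesis using w by (simp add: unsqueeze_def w_def[symmetric])
qed

lemma unsqueeze_measurable [measurable]: "unsqueeze \<in> borel_measurable borel" unfolding unsqueeze_def by measurable

lemma curve_measurable [measurable]: "curve p \<in> borel_measurable borel"
 by (rule borel_measurable_continuous_onI[OF curve_continuous])

text \<open>Carried to the open unit square, a function of compact support vanishes in a strip along
  the boundary, of the width \<open>\<delta>\<close> supplied by \<open>unsqueeze_large\<close>; so
  its extension by 0 is continuous.\<close>

lemma extended_continuous:
 fixes f :: "complex => real"
 assumes f: "continuous_on UNIV f" and r: "r > 0" "!!z. r <= cmod z ==> f z = 0"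
 defines "F \<equiv> %(x, y). if 0 < x & x < 1 & 0 < y & y < 1 then f (Complex (unsqueeze x) (unsqueeze y)) else 0"
 shows "continuous_on UNIV F"
proof -
 define \<delta> where "\<delta> = 1 / (2 * (1 + r))"
 define U :: "(real \<times> real) set" where "U = {0<..<1} \<times> {0<..<1}"
 define V :: "(real \<times> real) set" where "V = - ({\<delta>..1-\<delta>} \<times> {\<delta>..1-\<delta>})"
 have oU: "open U" unfolding U_def by (intro open_Times) auto
 have oV: "open V" unfolding V_def by (intro open_Compl closed_Times) auto
 have d0: "\<delta> > 0" using r by (simp add: \<delta>_def)
 have "U \<union> V = UNIV" using d0 by (auto simp: U_def V_def)
 moreover have "continuous_on (U \<union> V) F"
 proof (rule continuous_on_open_Un[OF oU oV])
  have ne: "\<bar>2 * x - 1\<bar> ~= 1" "1 ~= \<bar>2 * x - 1\<bar>" if "0 < x" "x < 1" for x :: real using that by auto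
  have "continuous_on U (%p. f (Complex (unsqueeze (fst p)) (unsqueeze (snd p))))" unfolding unsqueeze_def Complex_eq
   by (rule continuous_on_compose2[OF f]) (auto intro!: continuous_intros simp: U_def ne)
  thus "continuous_on U F" by (rule continuous_on_cong[THEN iffD1, rotated 2]) (auto simp: U_def F_def)
  have "F p = 0" if "p \<in> V" for p
  proof -
   obtain x y where p: "p = (x, y)" by (cases p)
   have "f (Complex (unsqueeze x) (unsqueeze y)) = 0" if xy: "0 < x" "x < 1" "0 < y" "y < 1"
   proof (rule r(2))
    have "r <= \<bar>unsqueeze x\<bar> \<or> r <= \<bar>unsqueeze y\<bar>"
     using unsqueeze_large[OF r(1), folded \<delta>_def, of x] unsqueeze_large[OF r(1), folded \<delta>_def, of y] xy \<open>p \<in> V\<close>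
     by (auto simp: V_def p)
    thus "r <= cmod (Complex (unsqueeze x) (unsqueeze y))"
     using abs_Re_le_cmod[of "Complex (unsqueeze x) (unsqueeze y)"] abs_Im_le_cmod[of "Complex (unsqueeze x) (unsqueeze y)"] by auto
   qed
   thus ?thesis by (simp add: F_def p)
  qed
  thus "continuous_on V F" by (subst continuous_on_cong[OF refl, where g = "%_. 0"]) auto
 qed
 ultimately show ?thesis by simp
qed

text \<open>The measures go to the unit interval by the Borel code \<open>E\<close>, a weak limit is
  taken there, and the continuous curve brings it back. Curve points outside the open square stand
  for infinity; the mass there is discarded, so the limit is only a finite measure.\<close>

theorem vague_compactness:
 fixes \<mu> :: "nat => complex measure"
 assumes p: "!!n. prob_space (\<mu> n)" and s: "!!n. sets (\<mu> n) = sets borel"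
 shows "\<exists>q \<nu>. strict_mono q & sets \<nu> = sets borel & finite_measure \<nu> &
  (\<forall>f r. continuous_on UNIV f --> (\<forall>z. r <= cmod z --> f z = (0::real)) -->
    (%n. LINT z|\<mu> (q n). f z) \<longlonglongrightarrow> (LINT z|\<nu>. f z))"
proof -
 define E where "E z = plane_code (squeeze (Re z)) (squeeze (Im z))" for z
 have Em [measurable]: "E \<in> borel_measurable borel"
  unfolding E_def plane_code_def coding_def binary_digit_def squeeze_def by measurable
 have Eb: "0 <= E z" "E z <= 1" for z unfolding E_def plane_code_def by (rule coding_sums(2,3)[OF plane_code_digits])+
 have Em': "E \<in> measurable (\<mu> n) borel" for n using Em by (simp add: measurable_cong_sets[OF s refl])
 obtain q \<nu>' where q: "strict_mono q" and \<nu>': "real_distribution \<nu>'" and conv: "\<forall>f B. continuous_on UNIV f --> (\<forall>x. \<bar>f x\<bar> <= B) -->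
   (%n. LINT z|\<mu> (q n). f (E z)) \<longlonglongrightarrow> (LINT x|\<nu>'. f x :: real)"
  using unit_interval_subsequence[of \<mu> "%_. E", OF p Em' conjI[OF Eb]] by blast
 interpret \<nu>': real_distribution \<nu>' by (rule \<nu>')
 define T where "T = {t. 0 < curve 0 t & curve 0 t < 1 & 0 < curve 1 t & curve 1 t < 1}"
 have Tm [measurable]: "T \<in> sets borel" unfolding T_def by measurable
 define \<Psi> where "\<Psi> t = Complex (unsqueeze (curve 0 t)) (unsqueeze (curve 1 t))" for t
 have Pm [measurable]: "\<Psi> \<in> borel_measurable borel" unfolding \<Psi>_def Complex_eq by measurable
 define D where "D = density \<nu>' (%t. ennreal (indicator T t))"
 define \<nu> where "\<nu> = distr D borel \<Psi>"
 have Dfin: "finite_measure D"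
 proof
  have "emeasure D (space D) = emeasure \<nu>' (T \<inter> space \<nu>')"
   unfolding D_def by (subst emeasure_density) (auto simp: ennreal_indicator indicator_inter_arith[symmetric])
  thus "emeasure D (space D) ~= \<infinity>" by (simp add: \<nu>'.emeasure_eq_measure)
 qed
 have Pm': "\<Psi> \<in> measurable D borel" unfolding D_def by simp
 have "finite_measure \<nu>" unfolding \<nu>_def by (rule finite_measure.finite_measure_distr[OF Dfin Pm'])
 moreover have "(%n. LINT z|\<mu> (q n). f z) \<longlonglongrightarrow> (LINT z|\<nu>. f z)"
  if f: "continuous_on UNIV f" and r': "\<forall>z. r' <= cmod z --> f z = 0" for f :: "complex => real" and r'
 proof -
  define r where "r = max 1 r'"
  have r: "r > 0" "!!z. r <= cmod z ==> f z = 0" using r' by (auto simp: r_def)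
  have fm [measurable]: "f \<in> borel_measurable borel" by (rule borel_measurable_continuous_onI[OF f])
  obtain B where B: "!!z. \<bar>f z\<bar> <= B" using cont_supp_bounded[OF f r(2)] by blast
  have B0: "B >= 0" using B[of 0] by linarith
  define F where "F = (%(x, y). if 0 < x & x < 1 & 0 < y & y < 1 then f (Complex (unsqueeze x) (unsqueeze y)) else 0)"
  have Fc: "continuous_on UNIV F" unfolding F_def by (rule extended_continuous[OF f r])
  define H where "H t = F (curve 0 t, curve 1 t)" for t
  have Hc: "continuous_on UNIV H"
   unfolding H_def by (rule continuous_on_compose2[OF Fc]) (auto intro!: continuous_intros curve_continuous)
  have Hm [measurable]: "H \<in> borel_measurable borel" by (rule borel_measurable_continuous_onI[OF Hc])
  have "(%n. LINT z|\<mu> (q n). H (E z)) \<longlonglongrightarrow> (LINT t|\<nu>'. H t)"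
   by (rule conv[rule_format, OF Hc]) (use B B0 in "auto simp: H_def F_def")
  moreover have "H (E z) = f z" for z using squeeze_bounds[of "Re z"] squeeze_bounds[of "Im z"]
    curve_plane_code[of "squeeze (Re z)" "squeeze (Im z)"] by (simp add: H_def F_def E_def unsqueeze_squeeze)
  moreover have "(LINT t|\<nu>'. H t) = (LINT z|\<nu>. f z)"
  proof -
   have "(LINT z|\<nu>. f z) = (LINT t|D. f (\<Psi> t))" unfolding \<nu>_def by (rule integral_distr[OF Pm' fm])
   also have "... = (LINT t|\<nu>'. indicator T t *\<^sub>R f (\<Psi> t))" unfolding D_def by (rule integral_density) auto
   also have "... = (LINT t|\<nu>'. H t)"
    by (rule Bochner_Integration.integral_cong) (auto simp: H_def F_def T_def \<Psi>_def indicator_def)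
   finally show ?thesis ..
  qed
  ultimately show ?thesis by simp
 qed
 ultimately show ?thesis using q by (intro exI[of _ q] exI[of _ \<nu>]) (auto simp: \<nu>_def)
qed

section \<open>Existence of the Brown measure\<close>

text \<open>Partial derivatives alone do not imply continuity. Continuity of one of them yields
  total differentiability, and hence continuity.\<close>

lemma dd_continuous:
 assumes d: "dd 1 f f1" "dd \<i> f f2" and c: "continuous_on UNIV f2"
 shows "continuous_on UNIV f"
proof (rule continuous_at_imp_continuous_on, rule ballI)
 fix z :: complex
 have C: "Complex x y = Complex 0 y + of_real x * 1" "Complex x y = of_real x + of_real y * \<i>" for x y by (auto simp: complex_eq_iff)
 have "((%(x, y). f (Complex x y)) has_derivative (%(tx, ty). f1 z * tx + blinfun_apply (f2 (Complex (Re z) (Im z)) *\<^sub>R id_blinfun) ty)) (at (Re z, Im z) within UNIV \<times> UNIV)"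
 proof (rule has_derivative_partialsI[where f = "%x y. f (Complex x y)" and fx = "(*) (f1 z)" and fy = "%x y. f2 (Complex x y) *\<^sub>R id_blinfun"])
  show "((%x. f (Complex x (Im z))) has_derivative (*) (f1 z)) (at (Re z))"
   using d(1)[unfolded dd_def, rule_format, of "Complex 0 (Im z)" "Re z"]
   unfolding has_field_derivative_def C(1)[symmetric] complex.collapse .
  show "((%y. f (Complex x y)) has_derivative blinfun_apply (f2 (Complex x y) *\<^sub>R id_blinfun)) (at y)" for x y
   using d(2)[unfolded dd_def, rule_format, of "of_real x" y]
   unfolding has_field_derivative_def C(2)[symmetric] by (simp add: blinfun.scaleR_left[abs_def])
  have "continuous_on UNIV (%p. f2 (Complex (fst p) (snd p)))" by (rule continuous_on_compose2[OF c]) (auto intro!: continuous_intros)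
  thus "continuous (at (Re z, Im z) within UNIV \<times> UNIV) (%(x, y). f2 (Complex x y) *\<^sub>R id_blinfun)"
   unfolding case_prod_beta UNIV_Times_UNIV by (intro continuous_intros) (simp add: continuous_on_eq_continuous_at)
 qed auto
 hence "isCont (%p. f (Complex (fst p) (snd p))) (Re z, Im z)"
  unfolding UNIV_Times_UNIV case_prod_beta by (rule has_derivative_continuous)
 hence "isCont (%w. f (Complex (fst (Re w, Im w)) (snd (Re w, Im w)))) z" by (rule isCont_o2[rotated]) (auto intro!: continuous_intros)
 thus "isCont f z" by simp
qed

lemma norm_cs_mult:
 fixes y :: "'h::complex_hilbert_space bop"
 shows "norm (cs w * y) <= cmod w * norm y" "norm (y * cs w) <= cmod w * norm y"
proof -
 show "norm (cs w * y) <= cmod w * norm y" by (rule order_trans[OF norm_mult_ineq]) (intro mult_right_mono norm_cs norm_ge_zero)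
 thus "norm (y * cs w) <= cmod w * norm y" by (simp only: cs_commute)
qed

lemma shifted_diff_bound:
 fixes x :: "'h::complex_hilbert_space bop"
 shows "norm (((cmod z + norm x)\<^sup>2) *\<^sub>R 1 - adj (x - cs z) * (x - cs z)) <= 4 * cmod z * norm x + 2 * (norm x)\<^sup>2"
proof -
 have zz: "cs (cnj z) * cs z = (cmod z)\<^sup>2 *\<^sub>R (1 :: 'h bop)"
 proof -
  have "cnj z * z = complex_of_real ((cmod z)\<^sup>2)" by (simp only: complex_norm_square mult.commute)
  thus ?thesis by (simp only: cs_simps(6)[symmetric] cs_of_real')
 qed
 have e: "((cmod z + norm x)\<^sup>2) *\<^sub>R 1 - adj (x - cs z) * (x - cs z)
   = (2 * cmod z * norm x + (norm x)\<^sup>2) *\<^sub>R 1 + (cs (cnj z) * x + adj x * cs z) - adj x * x"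
 proof -
  have "(cmod z + norm x)\<^sup>2 = (2 * cmod z * norm x + (norm x)\<^sup>2) + (cmod z)\<^sup>2" by (simp add: power2_eq_square algebra_simps)
  hence "((cmod z + norm x)\<^sup>2) *\<^sub>R (1 :: 'h bop) = (2 * cmod z * norm x + (norm x)\<^sup>2) *\<^sub>R 1 + cs (cnj z) * cs z"
   by (simp only: zz scaleR_add_left)
  thus ?thesis by (simp add: algebra_simps)
 qed
 have "norm ((2 * cmod z * norm x + (norm x)\<^sup>2) *\<^sub>R (1 :: 'h bop)) <= 2 * cmod z * norm x + (norm x)\<^sup>2"
  using mult_left_le[OF norm_one_bop, of "2 * cmod z * norm x + (norm x)\<^sup>2"] by simp
 moreover have "norm (cs (cnj z) * x) <= cmod z * norm x" "norm (adj x * cs z) <= cmod z * norm x"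
  using norm_cs_mult(1)[of "cnj z" x] norm_cs_mult(2)[of "adj x" z] by auto
 moreover have "norm (adj x * x) <= (norm x)\<^sup>2" using norm_mult_ineq[of "adj x" x] by (simp add: power2_eq_square)
 ultimately show ?thesis unfolding e
  using norm_triangle_ineq4[of "(2 * cmod z * norm x + (norm x)\<^sup>2) *\<^sub>R 1 + (cs (cnj z) * x + adj x * cs z)" "adj x * x"]
   norm_triangle_ineq[of "(2 * cmod z * norm x + (norm x)\<^sup>2) *\<^sub>R (1 :: 'h bop)" "cs (cnj z) * x + adj x * cs z"]
   norm_triangle_ineq[of "cs (cnj z) * x" "adj x * cs z"] by linarith
qed

section \<open>Growth and integrability of the regularized potentials\<close>

context tracial
begin

text \<open>\<open>lower\<close> and \<open>upper\<close> are the square of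
  \<open>cmod z + norm x\<close> minus and plus the bound of \<open>shifted_diff_bound\<close>,
  enlarged by 1 so that the radius in \<open>law_support\<close> is positive.\<close>

definition lower :: "'h bop => complex => real" where
 "lower x z = (cmod z)\<^sup>2 - 2 * norm x * cmod z - (norm x)\<^sup>2 - 1"

definition upper :: "'h bop => complex => real" where
 "upper x z = (cmod z)\<^sup>2 + 6 * norm x * cmod z + 3 * (norm x)\<^sup>2 + 1"

lemma law_bounds:
 assumes x: "x \<in> AA" shows "AE s in law (x - cs z). lower x z <= s & s <= upper x z & 0 <= s"
proof -
 have y: "x - cs z \<in> AA" using x by simp
 have "norm (((cmod z + norm x)\<^sup>2) *\<^sub>R 1 - adj (x - cs z) * (x - cs z)) <= 4 * cmod z * norm x + 2 * (norm x)\<^sup>2 + 1"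
  using shifted_diff_bound[of z x] by linarith
 from law_support[OF y this] have "AE s in law (x - cs z). \<bar>(cmod z + norm x)\<^sup>2 - s\<bar> <= 4 * cmod z * norm x + 2 * (norm x)\<^sup>2 + 1"
  by (simp add: add_nonneg_pos)
 thus ?thesis using law(3)[OF y] by eventually_elim (auto simp: lower_def upper_def abs_le_iff power2_eq_square algebra_simps)
qed

lemma upper_pos: "upper x z > 0" unfolding upper_def by (simp add: add_nonneg_pos)

lemma ln_bounds:
 assumes x: "x \<in> AA" and e: "0 <= e" and l: "0 < lower x z"
 shows "ln (lower x z + e) <= (LINT s|law (x - cs z). ln (s + e))" "(LINT s|law (x - cs z). ln (s + e)) <= ln (upper x z + e)"
proof -
 have y: "x - cs z \<in> AA" using x by simp
 interpret prob_space "law (x - cs z)" by (rule law[OF y])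
 have sm [measurable]: "sets (law (x - cs z)) = sets borel" by (rule law[OF y])
 have b: "AE s in law (x - cs z). ln (lower x z + e) <= ln (s + e) & ln (s + e) <= ln (upper x z + e)"
  using law_bounds[OF x, of z] by eventually_elim (use e l in "auto intro!: ln_mono")
 have int: "integrable (law (x - cs z)) (%s. ln (s + e))"
 proof (rule integrable_const_bound[where B = "\<bar>ln (lower x z + e)\<bar> + \<bar>ln (upper x z + e)\<bar>"])
  show "AE s in law (x - cs z). norm (ln (s + e)) <= \<bar>ln (lower x z + e)\<bar> + \<bar>ln (upper x z + e)\<bar>"
   using b by eventually_elim auto
 qed (unfold measurable_cong_sets[OF sm refl], measurable)
 have b1: "AE s in law (x - cs z). ln (lower x z + e) <= ln (s + e)"
  and b2: "AE s in law (x - cs z). ln (s + e) <= ln (upper x z + e)" using b by auto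
 have "(LINT s|law (x - cs z). ln (lower x z + e)) <= (LINT s|law (x - cs z). ln (s + e))" by (rule integral_mono_AE[OF _ int b1]) simp
 moreover have "(LINT s|law (x - cs z). ln (s + e)) <= (LINT s|law (x - cs z). ln (upper x z + e))"
  by (rule integral_mono_AE[OF int _ b2]) simp
 ultimately show "ln (lower x z + e) <= (LINT s|law (x - cs z). ln (s + e))" "(LINT s|law (x - cs z). ln (s + e)) <= ln (upper x z + e)"
  by (simp_all add: prob_space)
qed

lemma lr_upper:
 assumes x: "x \<in> AA" and e: "0 < e" "e <= 1"
 shows "lr (x - cs z) e <= ln (upper x z + 1)"
proof -
 have y: "x - cs z \<in> AA" using x by simp
 interpret prob_space "law (x - cs z)" by (rule law[OF y])
 have "lr (x - cs z) e <= (LINT s|law (x - cs z). ln (upper x z + 1))" unfolding lr_def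
 proof (rule integral_mono_AE[OF lr_integrable[OF y e(1)]])
  show "AE s in law (x - cs z). ln (s + e) <= ln (upper x z + 1)"
   using law_bounds[OF x, of z] by eventually_elim (use e in "auto intro!: ln_mono")
 qed simp
 thus ?thesis by (simp add: prob_space)
qed

text \<open>Both bounds for the support are the squared modulus of \<open>z\<close> up to linear
  terms, so the integral is squeezed between functions asymptotic to the reference logarithm. The
  case \<open>e = 0\<close> is included for the limit potential.\<close>

lemma ln_asymptotics:
 assumes x: "x \<in> AA" and e: "0 <= e"
 shows "((%z. (LINT s|law (x - cs z). ln (s + e)) / 2 - ln (1 + (cmod z)\<^sup>2) / 2) \<longlongrightarrow> 0) at_infinity"
proof -
 define n where "n = norm x"
 have n: "n >= 0" by (simp add: n_def)
 have na: "filterlim (%z::complex. cmod z) at_top at_infinity" by (rule filterlim_norm_at_top)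
 have 1: "((%r::real. ln (r\<^sup>2 - 2 * n * r - n\<^sup>2 - 1 + e) / 2 - ln (1 + r\<^sup>2) / 2) \<longlongrightarrow> 0) at_top"
  using n e by real_asymp
 have 2: "((%r::real. ln (r\<^sup>2 + 6 * n * r + 3 * n\<^sup>2 + 1 + e) / 2 - ln (1 + r\<^sup>2) / 2) \<longlongrightarrow> 0) at_top"
  using n e by real_asymp
 have 3: "\<forall>\<^sub>F r::real in at_top. 0 < r\<^sup>2 - 2 * n * r - n\<^sup>2 - 1" using n by real_asymp
 note L = filterlim_compose[OF 1 na] filterlim_compose[OF 2 na]
 from 3 na have ev: "\<forall>\<^sub>F z in at_infinity. 0 < lower x z" unfolding lower_def n_def filterlim_iff by blast
 show ?thesis
 proof (rule tendsto_sandwich[OF _ _ L])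
  show "\<forall>\<^sub>F z in at_infinity. ln ((cmod z)\<^sup>2 - 2 * n * cmod z - n\<^sup>2 - 1 + e) / 2 - ln (1 + (cmod z)\<^sup>2) / 2
    <= (LINT s|law (x - cs z). ln (s + e)) / 2 - ln (1 + (cmod z)\<^sup>2) / 2"
   using ev by eventually_elim (use ln_bounds(1)[OF x e] in "auto simp: lower_def n_def")
  show "\<forall>\<^sub>F z in at_infinity. (LINT s|law (x - cs z). ln (s + e)) / 2 - ln (1 + (cmod z)\<^sup>2) / 2
    <= ln ((cmod z)\<^sup>2 + 6 * n * cmod z + 3 * n\<^sup>2 + 1 + e) / 2 - ln (1 + (cmod z)\<^sup>2) / 2"
   using ev by eventually_elim (use ln_bounds(2)[OF x e] in "auto simp: upper_def n_def")
 qed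
qed

definition Lp :: "'h bop => real => complex => real" where
 "Lp x e z = lr (x - cs z) e / 2"

lemma C2_Lp:
 assumes x: "x \<in> AA" and e: "e > 0" shows "C2 (Lp x e) (%z. 2 * gam x e z)"
proof -
 have c: "continuous_on UNIV (%z. d1 x e v z / 2)" "continuous_on UNIV (%z. d2 x e v z / 2)" for v
  using isCont_gam_d[OF x e] by (auto intro!: continuous_at_imp_continuous_on continuous_intros)
 have a: "dd v (Lp x e) (%z. d1 x e v z / 2)" for v unfolding dd_def Lp_def using lr_d1[OF x e] by (auto intro!: DERIV_cdivide)
 have b: "dd v (%z. d1 x e v z / 2) (%z. d2 x e v z / 2)" for v unfolding dd_def using d1_d2[OF x e] by (auto intro!: DERIV_cdivide)
 have "2 * gam x e z = d2 x e 1 z / 2 + d2 x e \<i> z / 2" for z using d2_sum[OF x e, of z] by simp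
 thus ?thesis unfolding C2_def using a b c dd_continuous[OF a a c(1)] by blast
qed

lemma Lp_continuous: "x \<in> AA ==> e > 0 ==> continuous_on UNIV (Lp x e)" by (rule C2_cont(1)[OF C2_Lp])

lemma Lp_far:
 assumes x: "x \<in> AA"
 shows "\<exists>W. \<forall>z. W <= cmod z --> 0 < lower x z & (\<forall>e>0. 0 <= Lp x e z)"
proof -
 have "\<forall>\<^sub>F r::real in at_top. 1 <= r\<^sup>2 - 2 * norm x * r - (norm x)\<^sup>2 - 1" by real_asymp
 then obtain W where W: "!!z. W <= cmod z ==> 1 <= lower x z" unfolding eventually_at_top_linorder lower_def by blast
 have "0 < lower x z & (\<forall>e>0. 0 <= Lp x e z)" if "W <= cmod z" for z
 proof (intro conjI allI impI)
  show l: "0 < lower x z" using W[OF that] by simp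
  fix e :: real assume e: "e > 0"
  have "0 <= ln (lower x z + e)" using e W[OF that] by (intro ln_ge_zero) auto
  also have "... <= lr (x - cs z) e" unfolding lr_def by (rule ln_bounds(1)[OF x _ l]) (use e in auto)
  finally show "0 <= Lp x e z" by (simp add: Lp_def)
 qed
 thus ?thesis by blast
qed

lemma Lp_antimono:
 assumes x: "x \<in> AA" and e: "0 < e" "e <= e'" shows "Lp x e z <= Lp x e' z"
 unfolding Lp_def using lr_mono[of "x - cs z" e e'] x e by (auto intro: divide_right_mono)

lemma Lp_upper_ball:
 assumes x: "x \<in> AA"
 shows "\<exists>C\<ge>0. \<forall>e z. 0 < e --> e <= 1 --> cmod z <= r --> Lp x e z <= C"
proof -
 define C where "C = \<bar>ln (r\<^sup>2 + 6 * norm x * \<bar>r\<bar> + 3 * (norm x)\<^sup>2 + 2)\<bar>"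
 have "Lp x e z <= C" if e: "0 < e" "e <= 1" and z: "cmod z <= r" for e z
 proof -
  have "(cmod z)\<^sup>2 <= r\<^sup>2" "norm x * cmod z <= norm x * \<bar>r\<bar>" using z by (auto intro!: power_mono mult_left_mono)
  hence "upper x z + 1 <= r\<^sup>2 + 6 * norm x * \<bar>r\<bar> + 3 * (norm x)\<^sup>2 + 2" unfolding upper_def by linarith
  hence "ln (upper x z + 1) <= ln (r\<^sup>2 + 6 * norm x * \<bar>r\<bar> + 3 * (norm x)\<^sup>2 + 2)" using upper_pos[of x z] by (intro ln_mono) auto
  hence "lr (x - cs z) e <= C" using lr_upper[OF x e, of z] unfolding C_def by linarith
  moreover have "0 <= C" by (simp add: C_def)
  ultimately show ?thesis unfolding Lp_def by simp
 qed
 thus ?thesis by (intro exI[of _ C]) (simp add: C_def)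
qed

text \<open>Subharmonicity is tested against a function whose Laplacian is negative only on a disc far away
 from the origin, where the potentials are nonnegative.\<close>

lemma Lp_integral_lower:
 assumes x: "x \<in> AA"
 shows "\<exists>C K. \<forall>e. 0 < e --> e <= 1 --> (\<forall>z. cmod z <= r0 --> Lp x e z <= C) &
  (\<integral>\<^sup>+z. ennreal (C - Lp x e z) * indicator (cball 0 r0) z \<partial>lborel) <= ennreal K"
proof -
 obtain W where W: "\<forall>z. W <= cmod z --> 0 < lower x z & (\<forall>e>0. 0 <= Lp x e z)" using Lp_far[OF x] by blast
 define r where "r = max 1 (max r0 W)"
 have r: "r >= 1" "r0 <= r" "W <= r" by (auto simp: r_def)
 \<comment> \<open>The disc of radius r about 0 lies between the circles of radii 8 r and 10 r about
   \<open>z0\<close>, where \<open>rad_lap\<close> is positive as 101 / 3 < 64 and 100 < 101. Where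
   it is negative, the distance to \<open>z0\<close> is below 6 r, so \<open>cmod z > 3 * r\<close>.
   The support has radius below 11 r about \<open>z0\<close>, whence 20 r for
   \<open>T\<close>.\<close>
 define z0 where "z0 = complex_of_real (9 * r)"
 define a where "a = 101 * r\<^sup>2"
 define T where "T = 20 * r"
 have cz0: "cmod z0 = 9 * r" unfolding z0_def norm_of_real using r by simp
 obtain C where C: "C >= 0" "!!e z. 0 < e ==> e <= 1 ==> cmod z <= T + 1 ==> Lp x e z <= C"
  using Lp_upper_ball[OF x, of "T + 1"] by blast
 have f2: "C2 (rad a z0) (rad_lap a z0)" by (rule C2_rad)
 have supp: "rad a z0 z = 0" if "T <= cmod z" for z
  by (rule rad_supp[of a "11 * r"]) (use that r in "auto simp: a_def cz0 T_def power_mult_distrib")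
 have lsupp: "rad_lap a z0 z = 0" if "T + 1 <= cmod z" for z by (rule C2_supp[OF f2 supp that])
 have lc: "continuous_on UNIV (rad_lap a z0)" by (rule C2_cont(2)[OF f2])
 obtain M where M: "!!z. \<bar>rad_lap a z0 z\<bar> <= M" using cont_supp_bounded[OF lc lsupp] by blast
 have M0: "M >= 0" using M[of 0] by linarith
 have inner: "12 <= rad_lap a z0 z" if z: "cmod z <= r" for z
 proof -
  define s where "s = (cmod (z - z0))\<^sup>2"
  have "8 * r <= cmod (z - z0)" "cmod (z - z0) <= 10 * r"
   using z cz0 norm_triangle_ineq4[of z z0] norm_triangle_ineq2[of z0 z] by (simp_all add: norm_minus_commute)
  hence "(8 * r)\<^sup>2 <= s" "s <= (10 * r)\<^sup>2" using power_mono[of "8 * r" _ 2] power_mono[of _ "10 * r" 2] r unfolding s_def by simp_all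
  moreover have "1 <= r\<^sup>2" using r(1) by simp
  ultimately have m: "1 <= a - s" "1 <= 3 * s - a" unfolding a_def power_mult_distrib by auto
  hence "1 * 1 <= (a - s) * (3 * s - a)" by (intro mult_mono) auto
  moreover have "rad_lap a z0 z = 12 * ((a - s) * (3 * s - a))" using m by (simp add: rad_lap_def s_def[symmetric])
  ultimately show ?thesis by simp
 qed
 define K where "K = C * M * (pi * (T + 1)\<^sup>2)"
 have "(\<forall>z. cmod z <= r0 --> Lp x e z <= C) &
  (\<integral>\<^sup>+z. ennreal (C - Lp x e z) * indicator (cball 0 r0) z \<partial>lborel) <= ennreal K" if e: "0 < e" "e <= 1" for e
 proof
  show "\<forall>z. cmod z <= r0 --> Lp x e z <= C" using C(2)[OF e] r by (auto simp: T_def)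
  note Lc = Lp_continuous[OF x e(1)]
  have far: "0 <= Lp x e z" if "r < cmod z" for z using W r that e by auto
  have pt: "12 * (indicator (cball 0 r) z * (C - Lp x e z)) <= C * M * indicator (cball 0 (T + 1)) z - Lp x e z * rad_lap a z0 z" for z
  proof (cases "cmod z <= r")
   case True
   have zT: "cmod z <= T + 1" using True r by (simp add: T_def)
   have "12 * (C - Lp x e z) <= rad_lap a z0 z * (C - Lp x e z)" using inner[OF True] C(2)[OF e zT] by (intro mult_right_mono) auto
   also have "... <= C * M - Lp x e z * rad_lap a z0 z"
    using mult_left_mono[OF abs_le_D1[OF M[of z]] C(1)] by (simp add: algebra_simps)
   finally show ?thesis using True zT by simp
  next
   case False
   have "Lp x e z * rad_lap a z0 z <= C * M * indicator (cball 0 (T + 1)) z"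
   proof (cases "cmod z <= T + 1")
    case True
    have "Lp x e z * rad_lap a z0 z <= Lp x e z * M" using far[of z] False M[of z] by (intro mult_left_mono) auto
    also have "... <= C * M" using C(2)[OF e True] M0 by (intro mult_right_mono) auto
    finally show ?thesis using True by simp
   next
    case False
    thus ?thesis using lsupp[of z] C(1) M0 by simp
   qed
   thus ?thesis using False by simp
  qed
  have i1: "integrable lborel (%z. Lp x e z * rad_lap a z0 z)"
   by (rule cont_supp_integrable[of _ "T + 1"]) (use lsupp Lc lc in "auto intro!: continuous_intros")
  have i2: "integrable lborel (%z::complex. C * M * indicator (cball 0 (T + 1)) z)" by (rule integrable_ball[OF locally_finite_lborel])
  have "integrable lborel (%z. indicator (cball 0 r) z *\<^sub>R (C - Lp x e z))"
   by (rule borel_integrable_compact) (auto intro!: continuous_intros continuous_on_subset[OF Lc])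
  hence i3: "integrable lborel (%z. indicator (cball 0 r) z * (C - Lp x e z))" by simp
  have Cr: "0 <= indicator (cball 0 r) z * (C - Lp x e z)" for z using C(2)[OF e, of z] r by (auto simp: indicator_def T_def)
  have "0 <= (LINT z|lborel. 2 * gam x e z * rad a z0 z)"
   by (rule Bochner_Integration.integral_nonneg) (use gam_nonneg[OF x e(1)] in "auto simp: rad_def")
  also have "... = (LINT z|lborel. Lp x e z * rad_lap a z0 z)" by (rule green[OF C2_Lp[OF x e(1)] f2 supp, symmetric])
  finally have pos: "0 <= (LINT z|lborel. Lp x e z * rad_lap a z0 z)" .
  have "12 * (LINT z|lborel. indicator (cball 0 r) z * (C - Lp x e z))
    <= (LINT z|lborel. C * M * indicator (cball 0 (T + 1)) z - Lp x e z * rad_lap a z0 z)"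
   using pt i1 i2 i3 by (subst integral_mult_right_zero[symmetric], intro integral_mono) auto
  also have "... = C * M * measure lborel (cball (0::complex) (T + 1)) - (LINT z|lborel. Lp x e z * rad_lap a z0 z)"
   using i1 i2 by simp
  also have "... <= K" using pos measure_disc[of "T + 1"] r by (simp add: K_def measure_def T_def)
  finally have le12: "12 * (LINT z|lborel. indicator (cball 0 r) z * (C - Lp x e z)) <= K" .
  have "0 <= (LINT z|lborel. indicator (cball 0 r) z * (C - Lp x e z))" by (rule Bochner_Integration.integral_nonneg) (rule Cr)
  with le12 have le: "(LINT z|lborel. indicator (cball 0 r) z * (C - Lp x e z)) <= K" by linarith
  have "(\<integral>\<^sup>+z. ennreal (C - Lp x e z) * indicator (cball 0 r0) z \<partial>lborel)
    <= (\<integral>\<^sup>+z. ennreal (indicator (cball 0 r) z * (C - Lp x e z)) \<partial>lborel)"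
   by (rule nn_integral_mono) (use r in "auto simp: indicator_def")
  also have "... = ennreal (LINT z|lborel. indicator (cball 0 r) z * (C - Lp x e z))"
   by (rule nn_integral_eq_integral[OF i3]) (use Cr in auto)
  also have "... <= ennreal K" using le by (rule ennreal_leI)
  finally show "(\<integral>\<^sup>+z. ennreal (C - Lp x e z) * indicator (cball 0 r0) z \<partial>lborel) <= ennreal K" .
 qed
 thus ?thesis by blast
qed

end

section \<open>The limit potential and the existence of the Brown measure\<close>

definition ee :: "nat => real" where "ee n = 1 / real (Suc n)"

lemma ee_bounds: "0 < ee n" "ee n <= 1" "ee (Suc n) <= ee n" by (auto simp: ee_def field_simps)

lemma ee_antimono: "m <= n ==> ee n <= ee m" by (simp add: ee_def frac_le)

lemma ee_lim: "ee \<longlonglongrightarrow> 0" unfolding ee_def[abs_def] using LIMSEQ_inverse_real_of_nat by (simp add: inverse_eq_divide)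

context tracial
begin

text \<open>Monotone convergence: a lower bound for the regularized logarithms makes
  \<open>ln\<close> integrable. It also excludes an atom at 0, where the integrands would tend to
  minus infinity.\<close>

lemma lr_limit:
 assumes y: "y \<in> AA" and B: "!!n. B <= lr y (ee n)"
 shows "AE s in law y. s > 0" "integrable (law y) ln" "(%n. lr y (ee n)) \<longlonglongrightarrow> (LINT s|law y. ln s)"
proof -
 interpret prob_space "law y" by (rule law(1)[OF y])
 note [measurable_cong] = law(2)[OF y]
 define C where "C = \<bar>B\<bar> + ln ((norm y)\<^sup>2 + 1)"
 define F where "F n s = ennreal (C - ln (s + ee n))" for n and s :: real
 have int: "(\<integral>\<^sup>+s. F n s \<partial>law y) <= ennreal (C - B)" for n
 proof -
  have "AE s in law y. 0 <= C - ln (s + ee n)" using law(3)[OF y]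
  proof eventually_elim
   case (elim s)
   hence "ln (s + ee n) <= ln ((norm y)\<^sup>2 + 1)" using ee_bounds[of n] by (intro ln_mono) auto
   thus ?case by (simp add: C_def)
  qed
  hence "(\<integral>\<^sup>+s. F n s \<partial>law y) = ennreal (LINT s|law y. C - ln (s + ee n))" unfolding F_def
   by (rule nn_integral_eq_integral[rotated]) (intro Bochner_Integration.integrable_diff lr_integrable[OF y] ee_bounds integrable_const)
  also have "(LINT s|law y. C - ln (s + ee n)) = C - lr y (ee n)"
   using lr_integrable[OF y ee_bounds(1)] by (simp add: lr_def prob_space)
  finally show ?thesis using B[of n] by (simp add: ennreal_leI)
 qed
 have "AE s in law y. incseq (%n. F n s)" using law(3)[OF y]
  by eventually_elim (auto intro!: incseq_SucI ennreal_leI ln_mono add_nonneg_pos ee_bounds simp: F_def)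
 hence "(\<integral>\<^sup>+s. (SUP n. F n s) \<partial>law y) = (SUP n. (\<integral>\<^sup>+s. F n s \<partial>law y))"
  unfolding F_def by (intro nn_integral_monotone_convergence_SUP_AE) (auto simp: incseq_def)
 also have "... <= ennreal (C - B)" by (rule SUP_least) (rule int)
 finally have "AE s in law y. (SUP n. F n s) ~= \<infinity>" by (intro nn_integral_noteq_infinite) (auto simp: F_def top_unique)
 thus pos: "AE s in law y. s > 0" using law(3)[OF y]
 proof eventually_elim
  case (elim s)
  obtain b where b: "(SUP n. F n s) = ennreal b" "b >= 0" using elim by (cases "SUP n. F n s") auto
  obtain n where "exp (b - C + 1) < real n" using reals_Archimedean2 by blast
  hence "b - C + 1 <= ln (real (Suc n))" by (subst ln_ge_iff) auto
  moreover have "C - ln (s + ee n) <= b" using SUP_upper[of n UNIV "%n. F n s"] b by (simp add: F_def ennreal_le_iff)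
  moreover have "ln (ee n) = - ln (real (Suc n))" unfolding ee_def by (subst ln_divide_pos) auto
  ultimately have "s ~= 0" by auto
  with elim show ?case by simp
 qed
 have dec: "decseq (%n. lr y (ee n))" by (rule decseq_SucI) (intro lr_mono y ee_bounds)
 obtain L where L: "(%n. lr y (ee n)) \<longlonglongrightarrow> L" using decseq_convergent[OF dec] B by metis
 have *: "integrable (law y) (%s. - ln s) & (LINT s|law y. - ln s) = - L"
 proof (intro conjI)
  have i: "integrable (law y) (%s. - ln (s + ee n))" for n using lr_integrable[OF y ee_bounds(1)] by simp
  have mo: "AE s in law y. mono (%n. - ln (s + ee n))" using pos
  proof eventually_elim
   case (elim s)
   show ?case using elim ee_antimono ee_bounds(1) by (intro monoI) (simp add: add_pos_pos)
  qed
  have li: "AE s in law y. (%n. - ln (s + ee n)) \<longlonglongrightarrow> - ln s" using pos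
  proof eventually_elim
   case (elim s)
   show ?case using tendsto_add[OF tendsto_const ee_lim, of s] elim by (intro tendsto_intros) auto
  qed
  have lim: "(%n. LINT s|law y. - ln (s + ee n)) \<longlonglongrightarrow> - L" using tendsto_minus[OF L] by (simp add: lr_def)
  have me: "(%s. - ln s) \<in> borel_measurable (law y)" by measurable
  show "integrable (law y) (%s. - ln s)" by (rule integrable_monotone_convergence[OF i mo li lim me])
  show "(LINT s|law y. - ln s) = - L" by (rule integral_monotone_convergence[OF i mo li lim me])
 qed
 show "integrable (law y) ln" using * by simp
 show "(%n. lr y (ee n)) \<longlonglongrightarrow> (LINT s|law y. ln s)" using L * by simp
qed

definition good :: "'h bop => complex => bool" where
 "good x z \<longleftrightarrow> (\<exists>B. \<forall>n. B <= Lp x (ee n) z)"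

definition L0 :: "'h bop => complex => real" where
 "L0 x z = (LINT s|law (x - cs z). ln s) / 2"

text \<open>The limit of the regularized potentials. It is a Borel function of \<open>z\<close> by
  construction, and it agrees with \<open>L0\<close> at good points, that is almost
  everywhere.\<close>

definition Ls :: "'h bop => complex => real" where
 "Ls x z = lim (%n. Lp x (ee n) z)"

lemma Lp_lim:
 assumes x: "x \<in> AA" and g: "good x z"
 shows "(%n. Lp x (ee n) z) \<longlonglongrightarrow> L0 x z" "Ls x z = L0 x z"
proof -
 obtain B where B: "!!n. B <= Lp x (ee n) z" using g by (auto simp: good_def)
 have "(%n. lr (x - cs z) (ee n)) \<longlonglongrightarrow> (LINT s|law (x - cs z). ln s)"
  by (rule lr_limit[of _ "2 * B"]) (use B x in "auto simp: Lp_def mult.commute")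
 thus *: "(%n. Lp x (ee n) z) \<longlonglongrightarrow> L0 x z" unfolding Lp_def L0_def by (intro tendsto_divide) auto
 show "Ls x z = L0 x z" unfolding Ls_def by (rule limI[OF *])
qed

lemma Lp_measurable: "x \<in> AA ==> Lp x (ee n) \<in> borel_measurable borel"
 by (intro borel_measurable_continuous_onI Lp_continuous ee_bounds)

lemma Ls_measurable: "x \<in> AA ==> Ls x \<in> borel_measurable borel"
 unfolding Ls_def[abs_def] by (intro borel_measurable_lim_metric Lp_measurable)

text \<open>The bound of \<open>Lp_integral_lower\<close> is uniform in the parameter, so the
  supremum of the increasing functions C - Lp is integrable on the disc and therefore finite almost
  everywhere.\<close>

lemma good_ball:
 assumes x: "x \<in> AA"
 shows "AE z in lborel. z \<in> cball 0 r --> good x z" "integrable lborel (%z. indicator (cball 0 r) z * Ls x z)"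
  "\<exists>C. \<forall>n z. cmod z <= r --> Lp x (ee n) z <= C"
proof -
 obtain C K where CK: "!!e z. 0 < e ==> e <= 1 ==> cmod z <= r ==> Lp x e z <= C"
  "!!e. 0 < e ==> e <= 1 ==> (\<integral>\<^sup>+z. ennreal (C - Lp x e z) * indicator (cball 0 r) z \<partial>lborel) <= ennreal K"
  using Lp_integral_lower[OF x, of r] by blast
 show "\<exists>C. \<forall>n z. cmod z <= r --> Lp x (ee n) z <= C" using CK(1) ee_bounds by (intro exI[of _ C]) blast
 note [measurable] = Lp_measurable[OF x] Ls_measurable[OF x]
 have [measurable]: "cball (0::complex) r \<in> sets borel" by simp
 define S where "S z = (SUP n. ennreal (C - Lp x (ee n) z) * indicator (cball 0 r) z)" for z
 have inc: "incseq (%n z. ennreal (C - Lp x (ee n) z) * indicator (cball 0 r) z)"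
  by (rule incseq_SucI, rule le_funI, rule mult_right_mono, rule ennreal_leI, rule diff_left_mono, rule Lp_antimono[OF x])
   (auto intro: ee_bounds)
 have "(\<integral>\<^sup>+z. S z \<partial>lborel) = (SUP n. (\<integral>\<^sup>+z. ennreal (C - Lp x (ee n) z) * indicator (cball 0 r) z \<partial>lborel))"
  unfolding S_def by (rule nn_integral_monotone_convergence_SUP[OF inc]) measurable
 also have "... <= ennreal K" by (intro SUP_least CK(2) ee_bounds)
 finally have SK: "(\<integral>\<^sup>+z. S z \<partial>lborel) <= ennreal K" .
 have [measurable]: "S \<in> borel_measurable borel" unfolding S_def[abs_def] by measurable
 have "AE z in lborel. S z ~= \<infinity>" by (rule nn_integral_noteq_infinite) (use SK in "auto simp: top_unique")
 thus g: "AE z in lborel. z \<in> cball 0 r --> good x z"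
 proof eventually_elim
  case (elim z)
  show ?case
  proof
   assume z: "z \<in> cball 0 r"
   obtain b where b: "S z = ennreal b" "b >= 0" using elim by (cases "S z") auto
   have "C - b <= Lp x (ee n) z" for n
   proof -
    have "ennreal (C - Lp x (ee n) z) * indicator (cball 0 r) z <= S z" unfolding S_def by (rule SUP_upper) simp
    hence "C - Lp x (ee n) z <= b" using z b by (simp add: ennreal_le_iff)
    thus ?thesis by simp
   qed
   thus "good x z" unfolding good_def by blast
  qed
 qed
 have le: "AE z in lborel. ennreal (norm (indicator (cball 0 r) z * (C - Ls x z))) <= S z" using g
 proof eventually_elim
  case (elim z)
  show ?case
  proof (cases "z \<in> cball 0 r")
   case True
   have l: "(%n. Lp x (ee n) z) \<longlonglongrightarrow> Ls x z" using Lp_lim[OF x, of z] elim True by simp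
   have "Ls x z <= C" by (rule LIMSEQ_le_const2[OF l]) (use CK(1) ee_bounds True in "auto simp del: of_nat_Suc")
   moreover have "ennreal (C - Ls x z) <= S z"
   proof (rule LIMSEQ_le_const2)
    show "(%n. ennreal (C - Lp x (ee n) z)) \<longlonglongrightarrow> ennreal (C - Ls x z)"
     by (intro tendsto_ennrealI tendsto_diff tendsto_const l)
    have "ennreal (C - Lp x (ee n) z) * indicator (cball 0 r) z <= S z" for n unfolding S_def by (rule SUP_upper) simp
    thus "\<exists>N. \<forall>n\<ge>N. ennreal (C - Lp x (ee n) z) <= S z" using True by simp
   qed
   ultimately show ?thesis using True by simp
  qed simp
 qed
 have "integrable lborel (%z. indicator (cball 0 r) z * (C - Ls x z))"
 proof (rule integrableI_bounded)
  have "(\<integral>\<^sup>+z. ennreal (norm (indicator (cball 0 r) z * (C - Ls x z))) \<partial>lborel) <= ennreal K"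
   using nn_integral_mono_AE[OF le] SK by simp
  thus "(\<integral>\<^sup>+z. ennreal (norm (indicator (cball 0 r) z * (C - Ls x z))) \<partial>lborel) < \<infinity>"
   by (rule le_less_trans) simp
 qed measurable
 moreover have "integrable lborel (%z. indicator (cball 0 r) (z::complex) * C)"
  using integrable_ball[OF locally_finite_lborel, of C r] by (simp only: mult.commute)
 ultimately have "integrable lborel (%z. indicator (cball 0 r) z * C - indicator (cball 0 r) z * (C - Ls x z))" by (intro Bochner_Integration.integrable_diff)
 thus "integrable lborel (%z. indicator (cball 0 r) z * Ls x z)" by (simp add: algebra_simps)
qed

lemma AE_good:
 assumes x: "x \<in> AA" shows "AE z in lborel. good x z"
proof -
 have "AE z in lborel. \<forall>n. z \<in> cball 0 (real n) --> good x z" unfolding AE_all_countable using good_ball(1)[OF x] by blast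
 thus ?thesis
 proof eventually_elim
  case (elim z)
  obtain n where "cmod z <= real n" using real_arch_simple by blast
  thus ?case using spec[OF elim, of n] by (simp add: mem_cball)
 qed
qed

text \<open>Measurability of \<open>L0\<close> comes from completeness of Lebesgue measure: almost
  everywhere it equals the Borel function \<open>Ls\<close>.\<close>

lemma integral_L0:
 assumes x: "x \<in> AA" and g: "continuous_on UNIV g"
 shows "(LINT z|lebesgue. L0 x z * g z) = (LINT z|lborel. Ls x z * g z)"
proof -
 note [measurable] = Ls_measurable[OF x] borel_measurable_continuous_onI[OF g]
 have ae: "AE z in lebesgue. Ls x z = L0 x z"
  by (rule AE_completion) (rule AE_mp[OF AE_good[OF x]], rule AE_I2, rule impI, rule Lp_lim(2)[OF x])
 have b: "Ls x \<in> borel_measurable lebesgue" "g \<in> borel_measurable lebesgue"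
  by (auto intro!: measurable_completion simp: measurable_lborel1)
 have "L0 x \<in> borel_measurable lebesgue" by (rule borel_measurable_AE[OF b(1) ae])
 hence "(LINT z|lebesgue. L0 x z * g z) = (LINT z|lebesgue. Ls x z * g z)" using ae b by (intro integral_cong_AE) auto
 also have "... = (LINT z|lborel. Ls x z * g z)" by (rule integral_completion) measurable
 finally show ?thesis .
qed

lemma Lp_integral_lim:
 assumes x: "x \<in> AA" and g: "continuous_on UNIV g" and s: "!!z. r <= cmod z ==> g z = 0"
 shows "(%n. LINT z|lborel. Lp x (ee n) z * g z) \<longlonglongrightarrow> (LINT z|lborel. Ls x z * g z)"
proof -
 note [measurable] = Lp_measurable[OF x] Ls_measurable[OF x] borel_measurable_continuous_onI[OF g]
 obtain M where M: "!!z. \<bar>g z\<bar> <= M" using cont_supp_bounded[OF g s] by blast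
 obtain C where C: "!!n z. cmod z <= r ==> Lp x (ee n) z <= C" using good_ball(3)[OF x, of r] by blast
 show ?thesis
 proof (rule integral_dominated_convergence[where w = "%z. M * (\<bar>C\<bar> * indicator (cball 0 r) z + \<bar>indicator (cball 0 r) z * Ls x z\<bar>)"])
  show "integrable lborel (%z. M * (\<bar>C\<bar> * indicator (cball 0 r) z + \<bar>indicator (cball 0 r) z * Ls x z\<bar>))"
   using good_ball(2)[OF x, of r] integrable_ball[OF locally_finite_lborel] by (intro integrable_mult_right Bochner_Integration.integrable_add integrable_abs) auto
  show "AE z in lborel. (%n. Lp x (ee n) z * g z) \<longlonglongrightarrow> Ls x z * g z" using AE_good[OF x]
  proof eventually_elim
   case (elim z)
   show ?case using Lp_lim[OF x elim] by (auto intro!: tendsto_intros)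
  qed
  fix n
  show "AE z in lborel. norm (Lp x (ee n) z * g z) <= M * (\<bar>C\<bar> * indicator (cball 0 r) z + \<bar>indicator (cball 0 r) z * Ls x z\<bar>)"
   using AE_good[OF x]
  proof eventually_elim
   case (elim z)
   show ?case
   proof (cases "cmod z <= r")
    case True
    have l: "(%n. Lp x (ee n) z) \<longlonglongrightarrow> Ls x z" using Lp_lim[OF x elim] by simp
    \<comment> \<open>By monotonicity \<open>Ls\<close> is below every approximant and
      \<open>C\<close> is above, which gives the integrable majorant.\<close>
    have "decseq (%n. Lp x (ee n) z)" by (rule decseq_SucI) (intro Lp_antimono x ee_bounds)
    hence "Ls x z <= Lp x (ee n) z" using l by (rule decseq_ge)
    hence "\<bar>Lp x (ee n) z\<bar> <= \<bar>C\<bar> + \<bar>Ls x z\<bar>" using C[OF True, of n] by linarith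
    hence "\<bar>Lp x (ee n) z\<bar> * \<bar>g z\<bar> <= (\<bar>C\<bar> + \<bar>Ls x z\<bar>) * M" using M[of z] by (intro mult_mono) auto
    thus ?thesis using True by (simp add: abs_mult mult.commute)
   next
    case False
    have "0 <= M" using M[of 0] by linarith
    thus ?thesis using False s[of z] by simp
   qed
  qed
 qed measurable
qed

text \<open>These are the regularized Brown measures. Green's formula gives the weak equation, and
  \<open>mass_one\<close> with the asymptotics of the potential gives mass 1.\<close>

lemma approximant_prob:
 assumes x: "x \<in> AA"
 shows "prob_space (density lborel (%z. ennreal (gam x (ee n) z / pi)))"
  "C2 f Lf ==> (!!z. r <= cmod z ==> f z = 0) ==>
   (LINT z|density lborel (%z. ennreal (gam x (ee n) z / pi)). f z) = 1 / (2 * pi) * (LINT z|lborel. Lp x (ee n) z * Lf z)"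
proof -
 note e = ee_bounds(1)[of n]
 have gc: "continuous_on S (gam x (ee n))" for S by (intro continuous_at_imp_continuous_on ballI isCont_gam_d x e)
 have g0: "AE z in lborel. 0 <= gam x (ee n) z / pi" using gam_nonneg[OF x e] by simp
 have [measurable]: "gam x (ee n) \<in> borel_measurable borel" by (rule borel_measurable_continuous_onI[OF gc])
 let ?m = "density lborel (%z. ennreal (gam x (ee n) z / pi))"
 have weak: "(LINT z|?m. f z) = 1 / (2 * pi) * (LINT z|lborel. Lp x (ee n) z * Lf z)"
  if f: "C2 f Lf" and s: "!!z. r <= cmod z ==> f z = 0" for f Lf r
 proof -
  have [measurable]: "f \<in> borel_measurable borel" by (rule borel_measurable_continuous_onI[OF C2_cont(1)[OF f]])
  have "(LINT z|?m. f z) = (LINT z|lborel. gam x (ee n) z / pi * f z)" using g0 by (subst integral_density) auto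
  also have "... = (LINT z|lborel. 1 / (2 * pi) * (2 * gam x (ee n) z * f z))" by (rule Bochner_Integration.integral_cong) (auto simp: field_simps)
  also have "... = 1 / (2 * pi) * (LINT z|lborel. 2 * gam x (ee n) z * f z)" by (rule integral_mult_right_zero)
  also have "(LINT z|lborel. 2 * gam x (ee n) z * f z) = (LINT z|lborel. Lp x (ee n) z * Lf z)"
   by (rule green[OF C2_Lp[OF x e] f s, symmetric])
  finally show ?thesis .
 qed
 thus "C2 f Lf ==> (!!z. r <= cmod z ==> f z = 0) ==>
   (LINT z|?m. f z) = 1 / (2 * pi) * (LINT z|lborel. Lp x (ee n) z * Lf z)" .
 have "emeasure ?m UNIV = 1"
 proof (rule mass_one)
  show "(LINT z|?m. f z) = 1 / (2 * pi) * (LINT z|lborel. Lp x (ee n) z * Lf z)"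
   if "C2 f Lf" "!!z. r <= cmod z ==> f z = 0" for f Lf r by (rule weak[OF that])
  show "locally_finite ?m" by (rule locally_finite_density) (use gam_nonneg[OF x e] in "auto intro!: continuous_intros gc")
  show "set_integrable lborel (cball 0 r) (Lp x (ee n))" for r
   unfolding set_integrable_def by (rule borel_integrable_compact) (use Lp_continuous[OF x e] in "auto intro: continuous_on_subset")
  show "((%z. Lp x (ee n) z - ln (1 + (cmod z)\<^sup>2) / 2) \<longlongrightarrow> 0) at_infinity"
   using ln_asymptotics[OF x less_imp_le[OF e]] by (simp add: Lp_def lr_def)
 qed (simp_all add: x Lp_measurable)
 thus "prob_space ?m" by (intro prob_spaceI) simp
qed

text \<open>A vague limit point of the regularized Brown measures satisfies the weak equation for
  the limit potential. That potential again has logarithmic growth with the right constant, so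
  \<open>mass_one\<close> shows that no mass has escaped.\<close>

lemma brown_measure_exists:
 assumes x: "x \<in> AA"
 shows "\<exists>\<nu>. prob_space \<nu> & sets \<nu> = sets borel & (\<forall>f Lf r. C2 f Lf --> (\<forall>z. r <= cmod z --> f z = 0) -->
   (LINT z|\<nu>. f z) = 1 / (2 * pi) * (LINT z|lebesgue. L0 x z * Lf z))"
proof -
 let ?m = "%n. density lborel (%z. ennreal (gam x (ee n) z / pi))"
 obtain q \<nu> where q: "strict_mono q" and \<nu>: "sets \<nu> = sets borel" "finite_measure \<nu>"
  and lim: "\<forall>f r. continuous_on UNIV f --> (\<forall>z. r <= cmod z --> f z = (0::real)) -->
    (%n. LINT z|?m (q n). f z) \<longlonglongrightarrow> (LINT z|\<nu>. f z)"
  using vague_compactness[of ?m, OF approximant_prob(1)[OF x]] by auto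
 note [measurable_cong] = \<nu>(1)
 have weak: "(LINT z|\<nu>. f z) = 1 / (2 * pi) * (LINT z|lborel. Ls x z * Lf z)"
  if f: "C2 f Lf" and s: "!!z. r <= cmod z ==> f z = 0" for f Lf r
 proof (rule LIMSEQ_unique)
  show "(%n. LINT z|?m (q n). f z) \<longlonglongrightarrow> (LINT z|\<nu>. f z)" using lim C2_cont(1)[OF f] s by blast
  have "(%n. LINT z|lborel. Lp x (ee n) z * Lf z) \<longlonglongrightarrow> (LINT z|lborel. Ls x z * Lf z)"
   by (rule Lp_integral_lim[OF x C2_cont(2)[OF f], of "r + 1"]) (rule C2_supp[OF f s])
  hence "(%n. LINT z|lborel. Lp x (ee (q n)) z * Lf z) \<longlonglongrightarrow> (LINT z|lborel. Ls x z * Lf z)"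
   using LIMSEQ_subseq_LIMSEQ[OF _ q] by (force simp: o_def)
  hence "(%n. 1 / (2 * pi) * (LINT z|lborel. Lp x (ee (q n)) z * Lf z)) \<longlonglongrightarrow> 1 / (2 * pi) * (LINT z|lborel. Ls x z * Lf z)"
   by (intro tendsto_mult tendsto_const)
  moreover have "(LINT z|?m (q n). f z) = 1 / (2 * pi) * (LINT z|lborel. Lp x (ee (q n)) z * Lf z)" for n
   using approximant_prob(2)[OF x f s] by blast
  ultimately show "(%n. LINT z|?m (q n). f z) \<longlonglongrightarrow> 1 / (2 * pi) * (LINT z|lborel. Ls x z * Lf z)" by simp
 qed
 have "emeasure \<nu> UNIV = 1"
 proof (rule mass_one)
  show "(LINT z|\<nu>. f z) = 1 / (2 * pi) * (LINT z|lborel. Ls x z * Lf z)"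
   if "C2 f Lf" "!!z. r <= cmod z ==> f z = 0" for f Lf r by (rule weak[OF that])
  show "set_integrable lborel (cball 0 r) (Ls x)" for r unfolding set_integrable_def real_scaleR_def by (rule good_ball(2)[OF x])
  obtain W where W: "\<forall>z. W <= cmod z --> 0 < lower x z & (\<forall>e>0. 0 <= Lp x e z)" using Lp_far[OF x] by blast
  have "\<forall>\<^sub>F z in at_infinity. L0 x z - ln (1 + (cmod z)\<^sup>2) / 2 = Ls x z - ln (1 + (cmod z)\<^sup>2) / 2"
   unfolding eventually_at_infinity
  proof (intro exI[of _ W] allI impI)
   fix z assume "W <= cmod z"
   hence "good x z" unfolding good_def using W ee_bounds(1) by blast
   thus "L0 x z - ln (1 + (cmod z)\<^sup>2) / 2 = Ls x z - ln (1 + (cmod z)\<^sup>2) / 2" by (simp add: Lp_lim(2)[OF x])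
  qed
  moreover have "((%z. L0 x z - ln (1 + (cmod z)\<^sup>2) / 2) \<longlongrightarrow> 0) at_infinity"
   using ln_asymptotics[OF x, of 0] by (simp add: L0_def)
  ultimately show "((%z. Ls x z - ln (1 + (cmod z)\<^sup>2) / 2) \<longlongrightarrow> 0) at_infinity"
   by (rule Lim_transform_eventually[rotated])
 qed (simp_all add: x \<nu> Ls_measurable finite_locally_finite)
 hence p: "prob_space \<nu>" using sets_eq_imp_space_eq[OF \<nu>(1)] by (intro prob_spaceI) simp
 have "(LINT z|\<nu>. f z) = 1 / (2 * pi) * (LINT z|lebesgue. L0 x z * Lf z)"
  if f: "C2 f Lf" and s: "\<forall>z. r <= cmod z --> f z = 0" for f Lf r
 proof -
  have "(LINT z|\<nu>. f z) = 1 / (2 * pi) * (LINT z|lborel. Ls x z * Lf z)" by (rule weak[OF f, of r]) (use s in auto)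
  thus ?thesis by (simp only: integral_L0[OF x C2_cont(2)[OF f]])
 qed
 thus ?thesis using p \<nu>(1) by blast
qed

end

section \<open>From the limit potential to the Brown measure of the statement\<close>

lemma op_of_power: "op_of (x ^ n) = op_power (op_of x) n"
 by (induction n) (simp_all add: op_power_def op_prod_def one_bop.rep_eq op_of_mult)

context tracial
begin

lemma spectral_distribution_absb:
 assumes y: "y \<in> AA" and \<phi>: "!!y. \<tau> y = \<phi> (op_of y)"
 shows "spectral_distribution \<phi> (abs_op (op_of y)) = distr (law y) borel sqrt"
proof -
 interpret prob_space "law y" by (rule law(1)[OF y])
 note [measurable_cong] = law(2)[OF y]
 let ?d = "distr (law y) borel sqrt"
 have p: "prob_space ?d" by (rule prob_space_distr) measurable
 have b: "AE s in ?d. \<bar>s\<bar> <= norm y"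
 proof (subst AE_distr_iff)
  show "AE s in law y. \<bar>sqrt s\<bar> <= norm y" using law(3)[OF y] by eventually_elim (auto simp: real_le_lsqrt)
 qed auto
 have m: "\<phi> (op_power (op_of (absb y)) n) = complex_of_real (LINT s|?d. s ^ n)" for n
  using absb_moments[OF y, of n] by (subst integral_distr) (auto simp: op_of_power \<phi>)
 show ?thesis unfolding spectral_distribution_def abs_op_eq
 proof (rule the_equality)
  show "prob_space ?d & sets ?d = sets borel & (\<exists>R. AE s in ?d. \<bar>s\<bar> <= R) &
    (\<forall>n. \<phi> (op_power (op_of (absb y)) n) = complex_of_real (LINT s|?d. s ^ n))" using p b m by auto
  fix \<nu> assume \<nu>: "prob_space \<nu> & sets \<nu> = sets borel & (\<exists>R. AE s in \<nu>. \<bar>s\<bar> <= R) &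
    (\<forall>n. \<phi> (op_power (op_of (absb y)) n) = complex_of_real (LINT s|\<nu>. s ^ n))"
  then obtain R where R: "AE s in \<nu>. \<bar>s\<bar> <= R" by blast
  show "\<nu> = ?d"
  proof (rule moments_determine_measure)
   show "AE s in \<nu>. \<bar>s\<bar> <= max R (norm y)" using R by eventually_elim auto
   show "AE s in ?d. \<bar>s\<bar> <= max R (norm y)" using b by eventually_elim auto
   show "(LINT s|\<nu>. s ^ n) = (LINT s|?d. s ^ n)" for n using \<nu> m[of n] by (metis of_real_eq_iff)
  qed (use p \<nu> in auto)
 qed
qed

lemma log_potential_L0:
 assumes x: "x \<in> AA" and \<phi>: "!!y. \<tau> y = \<phi> (op_of y)"
 shows "log_potential \<phi> (op_of x) z = L0 x z"
proof -
 have y: "x - cs z \<in> AA" using x by simp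
 note [measurable_cong] = law(2)[OF y]
 have "log_potential \<phi> (op_of x) z = (LINT s:{0..}|distr (law (x - cs z)) borel sqrt. ln s)"
  unfolding log_potential_def spectral_distribution_absb[OF y \<phi>, symmetric] minus_bop.rep_eq cs.rep_eq ..
 also have "... = (LINT s|law (x - cs z). indicator {0..} (sqrt s) *\<^sub>R ln (sqrt s))"
  unfolding set_lebesgue_integral_def by (rule integral_distr) measurable
 also have "... = (LINT s|law (x - cs z). ln s / 2)"
 proof (rule integral_cong_AE)
  \<comment> \<open>At \<open>s = 0\<close> both sides are 0 by the convention for
    \<open>ln 0\<close>; elsewhere the factor 1/2 is due to \<open>law\<close> being the law of the
    square.\<close>
  show "AE s in law (x - cs z). indicator {0..} (sqrt s) *\<^sub>R ln (sqrt s) = ln s / 2"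
   using law(3)[OF y] by eventually_elim (auto simp: ln_sqrt le_less)
 qed measurable
 finally show ?thesis by (simp add: L0_def)
qed

text \<open>The last conclusion recognizes the Brown measure up to an unknown factor
  \<open>c\<close>: measures of mass 1 that are proportional on test functions are equal. This
  absorbs the constant of \<open>power_substitution\<close>.\<close>

lemma brown_measure_test:
 assumes x: "x \<in> AA" and \<phi>: "!!y. \<tau> y = \<phi> (op_of y)"
 defines "B \<equiv> brown_measure \<phi> (op_of x)"
 shows "prob_space B" "sets B = sets borel"
  "test_function f ==> (LINT z|B. f z) = 1 / (2 * pi) * (LINT z|lborel. Ls x z * laplacian f z)"
  "[|prob_space \<nu>; sets \<nu> = sets borel; c >= 0;
   !!f. test_function f ==> (LINT z|\<nu>. f z) = c * (LINT z|lborel. Ls x z * laplacian f z)|] ==> \<nu> = B"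
proof -
 have Ls: "(LINT z|lebesgue. log_potential \<phi> (op_of x) z * laplacian f z) = (LINT z|lborel. Ls x z * laplacian f z)"
  if "test_function f" for f
  unfolding log_potential_L0[OF x \<phi>] by (rule integral_L0[OF x C2_cont(2)[OF C2_smooth[OF test_functionD(1)[OF that]]]])
 define P where "P \<mu> \<longleftrightarrow> prob_space \<mu> & sets \<mu> = sets borel & (\<forall>f. test_function f -->
    (LINT z|\<mu>. f z) = 1 / (2 * pi) * (LINT z|lebesgue. log_potential \<phi> (op_of x) z * laplacian f z))" for \<mu>
 have uniq: "\<nu> = \<mu>" if \<mu>: "P \<mu>" and \<nu>: "prob_space \<nu>" "sets \<nu> = sets borel" and c: "c >= 0"
  and eq: "!!f. test_function f ==> (LINT z|\<nu>. f z) = c * (LINT z|lborel. Ls x z * laplacian f z)" for \<mu> \<nu> c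
 proof -
  interpret m: prob_space \<mu> using \<mu> by (simp add: P_def)
  interpret n: prob_space \<nu> by fact
  have s: "sets \<mu> = sets borel" using \<mu> by (simp add: P_def)
  have i: "integrable M f" if f: "test_function f" and M: "finite_measure M" "sets M = sets borel" for f and M :: "complex measure"
  proof -
   obtain r where "!!z. r <= cmod z ==> f z = 0" using test_functionD(2)[OF f] by blast
   thus ?thesis by (rule cont_supp_integrable_gen[OF finite_locally_finite[OF M] smooth_cont[OF test_functionD(1)[OF f]]])
  qed
  define d where "d = 2 * pi * c"
  have d: "d >= 0" using c by (simp add: d_def)
  have e: "\<nu> = density \<mu> (%_. ennreal d)"
  proof (rule measure_eq_test[OF finite_locally_finite[OF n.finite_measure_axioms \<nu>(2)]])
   show "sets (density \<mu> (%_. ennreal d)) = sets borel" using s by simp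
   fix f assume f: "test_function f" and f0: "!!z. 0 <= f z"
   have fm: "f \<in> borel_measurable \<mu>" using i[OF f m.finite_measure_axioms s] by simp
   have "(LINT z|\<nu>. f z) = d * (LINT z|\<mu>. f z)" using eq[OF f] \<mu> f Ls[OF f] by (simp add: P_def d_def)
   hence "(\<integral>\<^sup>+z. ennreal (f z) \<partial>\<nu>) = ennreal d * (\<integral>\<^sup>+z. ennreal (f z) \<partial>\<mu>)"
    using f0 d i[OF f n.finite_measure_axioms \<nu>(2)] i[OF f m.finite_measure_axioms s]
    by (simp add: nn_integral_eq_integral ennreal_mult)
   also have "... = (\<integral>\<^sup>+z. ennreal (f z) \<partial>density \<mu> (%_. ennreal d))"
    using fm by (simp add: nn_integral_density nn_integral_cmult)
   finally show "(\<integral>\<^sup>+z. ennreal (f z) \<partial>\<nu>) = (\<integral>\<^sup>+z. ennreal (f z) \<partial>density \<mu> (%_. ennreal d))" .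
  qed
  have "emeasure \<nu> (space \<mu>) = ennreal d * emeasure \<mu> (space \<mu>)" unfolding e by (simp add: emeasure_density_const)
  moreover have "space \<nu> = space \<mu>" using s \<nu>(2) by (metis sets_eq_imp_space_eq)
  ultimately have "ennreal d = 1" using n.emeasure_space_1 m.emeasure_space_1 by simp
  thus "\<nu> = \<mu>" unfolding e by (simp add: density_1)
 qed
 obtain \<mu> where \<mu>: "P \<mu>"
 proof -
  obtain \<nu> where \<nu>: "prob_space \<nu>" "sets \<nu> = sets borel" and
   eq: "\<forall>f Lf r. C2 f Lf --> (\<forall>z. r <= cmod z --> f z = 0) -->
    (LINT z|\<nu>. f z) = 1 / (2 * pi) * (LINT z|lebesgue. L0 x z * Lf z)" using brown_measure_exists[OF x] by auto
  have "(LINT z|\<nu>. f z) = 1 / (2 * pi) * (LINT z|lebesgue. L0 x z * laplacian f z)" if "test_function f" for f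
   using test_functionD[OF that] C2_smooth eq by metis
  thus ?thesis using that[of \<nu>] \<nu> by (simp add: P_def log_potential_L0[OF x \<phi>])
 qed
 have u: "\<nu> = \<mu>" if "P \<nu>" for \<nu> by (rule uniq[OF \<mu>, of \<nu> "1 / (2 * pi)"]) (use that Ls in "auto simp: P_def")
 have B: "B = \<mu>" unfolding B_def brown_measure_def using \<mu> u unfolding P_def by (intro the_equality) blast+
 show "prob_space B" "sets B = sets borel"
  "test_function f ==> (LINT z|B. f z) = 1 / (2 * pi) * (LINT z|lborel. Ls x z * laplacian f z)"
  using \<mu> Ls[of f] unfolding B P_def by auto
 show "[|prob_space \<nu>; sets \<nu> = sets borel; c >= 0;
   !!f. test_function f ==> (LINT z|\<nu>. f z) = c * (LINT z|lborel. Ls x z * laplacian f z)|] ==> \<nu> = B"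
  unfolding B by (rule uniq[OF \<mu>])
qed

end

text \<open>The Laplacian of \<open>f\<close> after the power map brings out
  \<open>k * pw k z\<close>. The factor 1 / k of the potential leaves the weight
  \<open>pw k\<close>, and the image of Lebesgue measure with this weight is a multiple of Lebesgue
  measure.\<close>

lemma brown_measure_power:
 assumes T: "tracial A1 \<tau>1" "x \<in> A1" "!!y. \<tau>1 y = \<phi>1 (op_of y)"
  and T': "tracial A2 \<tau>2" "y \<in> A2" "!!y. \<tau>2 y = \<phi>2 (op_of y)"
  and k: "k > 0" and pot: "AE z in lborel. tracial.Ls \<tau>2 y z = tracial.Ls \<tau>1 x (z ^ k) / real k"
 shows "brown_measure \<phi>1 (op_of x) = distr (brown_measure \<phi>2 (op_of y)) borel (%z. z ^ k)"
proof -
 interpret X: tracial A1 \<tau>1 by fact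
 interpret Y: tracial A2 \<tau>2 by fact
 let ?B = "brown_measure \<phi>2 (op_of y)"
 note B = Y.brown_measure_test[OF T'(2,3)]
 note [measurable_cong] = B(2)
 note [measurable] = X.Ls_measurable[OF T(2)] Y.Ls_measurable[OF T'(2)]
 obtain c where c: "c >= 0" "distr (density lborel (%z. ennreal (pw k z))) borel (%z. z ^ k) = density lborel (%_. ennreal c)"
  using power_substitution[OF k] by blast
 have "distr ?B borel (%z. z ^ k) = brown_measure \<phi>1 (op_of x)"
 proof (rule X.brown_measure_test(4)[OF T(2,3), of _ "c / (2 * pi)"])
  show "prob_space (distr ?B borel (%z. z ^ k))" by (rule prob_space.prob_space_distr[OF B(1)]) measurable
  fix f assume f: "test_function f"
  note sm = test_functionD(1)[OF f]
  have [measurable]: "laplacian f \<in> borel_measurable borel" "f \<in> borel_measurable borel"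
   using C2_cont[OF C2_smooth[OF sm]] by (auto intro: borel_measurable_continuous_onI)
  define G where "G z = X.Ls x z * laplacian f z" for z
  have [measurable]: "G \<in> borel_measurable borel" unfolding G_def[abs_def] by measurable
  have lc: "laplacian (%z. f (z ^ k)) \<in> borel_measurable borel"
   using C2_cont(2)[OF C2_smooth[OF test_functionD(1)[OF test_function_power[OF f k]]]] by (rule borel_measurable_continuous_onI)
  have "(LINT z|distr ?B borel (%z. z ^ k). f z) = (LINT z|?B. f (z ^ k))" by (rule integral_distr) measurable
  also have "... = 1 / (2 * pi) * (LINT z|lborel. Y.Ls y z * laplacian (%z. f (z ^ k)) z)"
   by (rule B(3)[OF test_function_power[OF f k]])
  also have "(LINT z|lborel. Y.Ls y z * laplacian (%z. f (z ^ k)) z) = (LINT z|lborel. pw k z * G (z ^ k))"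
  proof (rule integral_cong_AE)
   show "AE z in lborel. Y.Ls y z * laplacian (%z. f (z ^ k)) z = pw k z * G (z ^ k)" using pot
   proof eventually_elim
    case (elim z)
    show ?case unfolding elim laplacian_power[OF sm] G_def pw_def using k
     by (simp add: norm_mult norm_power power_mult_distrib power_add[symmetric] mult_2[symmetric] power2_eq_square mult.commute)
   qed
  qed (use lc in measurable)
  also have "... = (LINT z|density lborel (%z. ennreal (pw k z)). G (z ^ k))" by (subst integral_density) (auto simp: pw_nonneg)
  also have "... = (LINT z|distr (density lborel (%z. ennreal (pw k z))) borel (%z. z ^ k). G z)"
   by (rule integral_distr[symmetric]) measurable
  also have "... = (LINT z|density lborel (%_. ennreal c). G z)" by (simp only: c(2))
  also have "... = c * (LINT z|lborel. G z)" using c(1) by (subst integral_density) auto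
  finally show "(LINT z|distr ?B borel (%z. z ^ k). f z) = c / (2 * pi) * (LINT z|lborel. X.Ls x z * laplacian f z)"
   by (simp add: G_def)
 qed (use c in simp_all)
 thus ?thesis ..
qed

section \<open>Matrices\<close>

lift_definition ent :: "('h::complex_hilbert_space ^ 'k::finite) bop => 'k => 'k => 'h bop" is matrix_entry
proof -
 fix b :: "('h ^ 'k) op" and p q :: 'k
 assume b: "b \<in> bounded_ops"
 have "axis q (c *\<^sub>C y) = c *\<^sub>C (axis q y :: 'h ^ 'k)" for c y by (simp add: vec_eq_iff axis_def scaleC_vec_def)
 thus "matrix_entry b p q \<in> bounded_ops" using b by (simp add: bounded_ops_def matrix_entry.rep_eq scaleC_vec_def)
qed

lift_definition eunit :: "'h::complex_hilbert_space bop => 'k::finite => 'k => ('h ^ 'k) bop" is tensor_unit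
 by (simp add: bounded_ops_def tensor_unit.rep_eq scaleC_vec_def axis_def vec_eq_iff)

lemma ap_ent: "ap (ent X p q) y = ap X (axis q y) $ p" by (simp add: ap.rep_eq ent.rep_eq matrix_entry.rep_eq)

lemma ap_eunit: "ap (eunit x p q) v = axis p (ap x (v $ q))" by (simp add: ap.rep_eq eunit.rep_eq tensor_unit.rep_eq)

lemma axis_decomp: "(v :: 'a::real_vector ^ 'k::finite) = (\<Sum>q\<in>UNIV. axis q (v $ q))"
 by (simp add: vec_eq_iff axis_def sum.delta' if_distrib[of "%v. v $ _"] cong: if_cong)

lemma ap_sum: "ap X (sum f I) = (\<Sum>i\<in>I. ap X (f i))" by (induction I rule: infinite_finite_induct) auto

lemma ap_entries: "ap X v $ p = (\<Sum>q\<in>UNIV. ap (ent X p q) (v $ q))" by (subst axis_decomp[of v]) (simp add: ap_sum ap_ent)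

lemma ent_eqI: "(!!p q. ent X p q = ent Y p q) ==> X = Y" by (intro bop_eqI) (simp add: vec_eq_iff ap_entries)

lemma ent_simps [simp]:
 "ent (X + Y) p q = ent X p q + ent Y p q" "ent (X - Y) p q = ent X p q - ent Y p q" "ent (- X) p q = - ent X p q"
 "ent (r *\<^sub>R X) p q = r *\<^sub>R ent X p q" "ent 0 p q = 0" "ent 1 p q = (if p = q then 1 else 0)"
 "ent (cs c) p q = (if p = q then cs c else 0)" "ent (cs c * X) p q = cs c * ent X p q"
 by (rule bop_eqI; simp add: ap_ent axis_def scaleC_vec_def)+

lemma ent_mult: "ent (X * Y) p q = (\<Sum>r\<in>UNIV. ent X p r * ent Y r q)"
proof (rule bop_eqI)
 have s: "ap (sum f I) u = (\<Sum>i\<in>I. ap (f i) u)" for f :: "'b => 'a bop" and I :: "'b set" and u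
  by (induction I rule: infinite_finite_induct) auto
 show "ap (ent (X * Y) p q) u = ap (\<Sum>r\<in>UNIV. ent X p r * ent Y r q) u" for u
  by (simp add: s ap_ent[of "X * Y"] ap_entries[of X] ap_ent[of Y])
qed

lemma ent_eunit: "ent (eunit x p q) r s = (if r = p & s = q then x else 0)" by (rule bop_eqI) (simp add: ap_ent ap_eunit axis_def)

lemma eunit_mult: "eunit x p q * eunit y r s = (if q = r then eunit (x * y) p s else 0)"
 by (rule bop_eqI) (simp add: ap_eunit axis_def vec_eq_iff)

lemma cinner_axis: "cinner (axis p y) (v :: 'h::complex_hilbert_space ^ 'k::finite) = cinner y (v $ p)"
proof -
 have "cinner (axis p y $ i) (v $ i) = (if i = p then cinner y (v $ p) else 0)" for i by (simp add: axis_def)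
 thus ?thesis by (simp add: cinner_vec_def)
qed

lemma ent_adj: "ent (adj X) p q = adj (ent X q p)"
proof (rule sym, rule adj_unique)
 fix u v :: 'a
 have "cinner (ap (ent (adj X) p q) u) v = cinner (ap (adj X) (axis q u)) (axis p v)" by (metis ap_ent cinner_axis cinner_commute)
 also have "... = cinner u (ap (ent X q p) v)" by (simp add: cinner_adj cinner_axis ap_ent)
 finally show "cinner (ap (ent (adj X) p q) u) v = cinner u (ap (ent X q p) v)" .
qed

lemma norm_ent: "norm (ent X p q) <= norm X"
proof (rule norm_bop_bound)
 fix u
 have "norm (ap X (axis q u) $ p) <= norm (ap X (axis q u))" by (rule Finite_Cartesian_Product.norm_nth_le)
 also have "... <= norm X * norm (axis q u)" by (rule norm_ap)
 also have "norm (axis q u) = norm u" by (simp add: norm_eq_sqrt_inner inner_axis_axis)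
 finally show "norm (ap (ent X p q) u) <= norm X * norm u" by (simp add: ap_ent)
qed simp

definition mat_alg :: "'h::complex_hilbert_space bop set => ('h ^ 'k::finite) bop set" where
 "mat_alg AA = {X. \<forall>p q. ent X p q \<in> AA}"

definition mat_tr :: "('h::complex_hilbert_space bop => complex) => ('h ^ 'k::finite) bop => complex" where
 "mat_tr \<tau> X = (\<Sum>p\<in>UNIV. \<tau> (ent X p p)) / of_nat CARD('k)"

lemma (in tracial) tracial_matrix: "tracial (mat_alg AA :: ('h ^ 'k::finite) bop set) (mat_tr \<tau>)"
proof
 let ?M = "mat_alg AA :: ('h ^ 'k) bop set"
 have e: "ent X p q \<in> AA" if "X \<in> ?M" for X p q using that by (simp add: mat_alg_def)
 have k: "of_nat CARD('k) ~= (0::complex)" by simp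
 have entc: "continuous_on UNIV (%X :: ('h ^ 'k) bop. ent X p q)" for p q
  by (rule bounded_linear.continuous_on[OF bounded_linear_intro[where K = 1]])
   (auto simp: norm_ent)
 show "cs c \<in> ?M" for c by (simp add: mat_alg_def)
 show "X + Y \<in> ?M" "X * Y \<in> ?M" if "X \<in> ?M" "Y \<in> ?M" for X Y using that by (auto simp: mat_alg_def ent_mult)
 show "adj X \<in> ?M" if "X \<in> ?M" for X using that by (simp add: mat_alg_def ent_adj)
 have "?M = (\<Inter>p. \<Inter>q. (%X. ent X p q) -` AA)" by (auto simp: mat_alg_def)
 thus "closed ?M" using closed_AA entc by (auto intro!: closed_INT continuous_closed_vimage simp: continuous_on_eq_continuous_at)
 show "mat_tr \<tau> (X + Y) = mat_tr \<tau> X + mat_tr \<tau> Y" if "X \<in> ?M" "Y \<in> ?M" for X Y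
  using that e by (simp add: mat_tr_def tau_add sum.distrib add_divide_distrib)
 show "mat_tr \<tau> (cs c * X) = c * mat_tr \<tau> X" if "X \<in> ?M" for X c
  using that e by (simp add: mat_tr_def tau_cs sum_distrib_left)
 show "mat_tr \<tau> (adj X * X) \<in> \<real>\<^sub>\<ge>\<^sub>0" if X: "X \<in> ?M" for X
 proof -
  have "(\<Sum>p\<in>UNIV. \<tau> (ent (adj X * X) p p)) = (\<Sum>p\<in>UNIV. \<Sum>r\<in>UNIV. \<tau> (adj (ent X r p) * ent X r p))"
   using e[OF X] by (simp add: ent_mult ent_adj tau_sum)
  also have "... \<in> \<real>\<^sub>\<ge>\<^sub>0" using tau_pos[OF e[OF X]] by (simp add: complex_nonneg_Reals_iff sum_nonneg)
  finally have "complex_of_real (1 / real CARD('k)) * (\<Sum>p\<in>UNIV. \<tau> (ent (adj X * X) p p)) \<in> \<real>\<^sub>\<ge>\<^sub>0"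
   by (intro nonneg_Reals_mult_I nonneg_Reals_of_real_iff[THEN iffD2]) auto
  thus ?thesis by (simp add: mat_tr_def)
 qed
 show "mat_tr \<tau> 1 = 1" using tau_one by (simp add: mat_tr_def)
 show "mat_tr \<tau> (X * Y) = mat_tr \<tau> (Y * X)" if XY: "X \<in> ?M" "Y \<in> ?M" for X Y
 proof -
  have "(\<Sum>p\<in>UNIV. \<tau> (ent (X * Y) p p)) = (\<Sum>p\<in>UNIV. \<Sum>r\<in>UNIV. \<tau> (ent X p r * ent Y r p))"
   using e XY by (simp add: ent_mult tau_sum)
  also have "... = (\<Sum>r\<in>UNIV. \<Sum>p\<in>UNIV. \<tau> (ent Y r p * ent X p r))"
   by (subst sum.swap) (use e XY in "simp add: tau_comm")
  also have "... = (\<Sum>r\<in>UNIV. \<tau> (ent (Y * X) r r))" using e XY by (simp add: ent_mult tau_sum)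
  finally show ?thesis by (simp add: mat_tr_def)
 qed
 obtain K where K: "!!x. x \<in> AA ==> cmod (\<tau> x) <= K * norm x" using tau_bound by blast
 have "cmod (\<tau> (ent X p p)) <= \<bar>K\<bar> * norm X" if X: "X \<in> ?M" for X p
 proof -
  have "cmod (\<tau> (ent X p p)) <= K * norm (ent X p p)" by (rule K[OF e[OF X]])
  also have "... <= \<bar>K\<bar> * norm X" by (intro mult_mono norm_ent) auto
  finally show ?thesis .
 qed
 hence "cmod (\<Sum>p\<in>UNIV. \<tau> (ent X p p)) <= real CARD('k) * (\<bar>K\<bar> * norm X)" if "X \<in> ?M" for X
  using that by (intro order_trans[OF norm_sum]) (simp add: sum_bounded_above)
 thus "\<exists>K. \<forall>X\<in>?M. cmod (mat_tr \<tau> X) <= K * norm X"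
  by (intro exI[of _ "\<bar>K\<bar>"]) (simp add: mat_tr_def norm_divide field_simps)
qed

text \<open>Equality of regularized logarithms up to a constant factor in the parameter. It is
  transitive and preserves the limit at 0, which is what multiplication by unipotent factors
  allows.\<close>

definition comparable :: "('h::complex_hilbert_space bop => complex) => 'h bop => 'h bop => bool" where
 "comparable \<tau> y w \<longleftrightarrow> (\<exists>K>0. \<forall>e>0. tracial.lr \<tau> y e <= tracial.lr \<tau> w (e * K) & tracial.lr \<tau> w e <= tracial.lr \<tau> y (e * K))"

context tracial
begin

lemma comparable_trans: "comparable \<tau> y w ==> comparable \<tau> w v ==> comparable \<tau> y v"
proof -
 assume "comparable \<tau> y w" "comparable \<tau> w v"
 then obtain K M where K: "K > 0" "!!e. e > 0 ==> lr y e <= lr w (e * K) & lr w e <= lr y (e * K)"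
  and M: "M > 0" "!!e. e > 0 ==> lr w e <= lr v (e * M) & lr v e <= lr w (e * M)" unfolding comparable_def by blast
 have "lr y e <= lr v (e * (K * M)) & lr v e <= lr y (e * (K * M))" if e: "e > 0" for e
  using K(2)[OF e] M(2)[OF mult_pos_pos[OF e K(1)]] M(2)[OF e] K(2)[OF mult_pos_pos[OF e M(1)]]
  by (simp add: mult.assoc mult.commute[of M K])
 thus ?thesis unfolding comparable_def using K(1) M(1) by (intro exI[of _ "K * M"]) auto
qed

text \<open>The inverse of \<open>1 + N\<close> is \<open>1 - N\<close>, of the same kind, so
  \<open>lr_nilpotent_le\<close> applies in both directions with the same constant.\<close>

lemma comparable_right:
 assumes y: "y \<in> AA" and N: "N \<in> AA" "N * N = 0" "\<tau> N = 0"
 shows "comparable \<tau> y (y * (1 + N))" unfolding comparable_def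
proof (intro exI conjI allI impI)
 fix e :: real assume e: "e > 0"
 show "lr y e <= lr (y * (1 + N)) (e * exp (1 + (norm N)\<^sup>2))" by (rule lr_nilpotent_le[OF y N e])
 have "(1 + N) * (1 + - N) = 1" using N(2) by (simp add: distrib_right right_diff_distrib)
 hence "y * (1 + N) * (1 + - N) = y" by (simp only: mult.assoc mult_1_right)
 thus "lr (y * (1 + N)) e <= lr y (e * exp (1 + (norm N)\<^sup>2))"
  using lr_nilpotent_le[of "y * (1 + N)" "- N" e] y N e by (simp add: tau_minus)
qed simp

lemma comparable_left:
 assumes y: "y \<in> AA" and N: "N \<in> AA" "N * N = 0" "\<tau> N = 0"
 shows "comparable \<tau> y ((1 + N) * y)"
proof -
 have "adj N * adj N = 0" using N(2) by (metis adj_simps(5,7))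
 hence "comparable \<tau> (adj y) (adj y * (1 + adj N))" using N y tau_adj[OF N(1)] by (intro comparable_right) auto
 moreover have "adj y * (1 + adj N) = adj ((1 + N) * y)" by (simp add: distrib_left distrib_right)
 ultimately show ?thesis unfolding comparable_def using y N by (simp only: lr_adj AA_intros)
qed

text \<open>Comparability rescales the parameter and so leaves the sequence \<open>ee\<close>;
  monotonicity in the parameter upgrades the limit along the sequence to a full right-hand
  limit.\<close>

lemma lr_lim_at_right:
 assumes y: "y \<in> AA" and l: "(%n. lr y (ee n)) \<longlonglongrightarrow> l"
 shows "(lr y \<longlongrightarrow> l) (at_right 0)"
proof (rule tendstoI)
 fix r :: real assume r: "r > 0"
 then obtain n where n: "dist (lr y (ee n)) l < r" using tendstoD[OF l r] by (auto simp: eventually_sequentially)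
 have ge: "l <= lr y e" if e: "e > 0" for e
 proof (rule LIMSEQ_le_const2[OF l])
  obtain N where N: "ee N < e" using order_tendstoD(2)[OF ee_lim e] by (auto simp: eventually_sequentially)
  have "lr y (ee m) <= lr y e" if "N <= m" for m using ee_antimono[OF that] N by (intro lr_mono[OF y] ee_bounds) auto
  thus "\<exists>N. \<forall>m\<ge>N. lr y (ee m) <= lr y e" by blast
 qed
 have "dist (lr y e) l < r" if e: "e > 0" "e < ee n" for e
  using ge[OF e(1)] lr_mono[OF y e(1), of "ee n"] e n by (simp add: dist_real_def)
 thus "\<forall>\<^sub>F e in at_right 0. dist (lr y e) l < r" unfolding eventually_at_right_field using ee_bounds(1)[of n] by blast
qed

lemma lr_lim_comparable:
 assumes c: "comparable \<tau> y w" and l: "(lr y \<longlongrightarrow> l) (at_right 0)"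
 shows "(lr w \<longlongrightarrow> l) (at_right 0)"
proof -
 obtain K where K: "K > 0" "!!e. e > 0 ==> lr y e <= lr w (e * K) & lr w e <= lr y (e * K)" using c unfolding comparable_def by blast
 have f: "filterlim (%e. e * c) (at_right 0) (at_right (0::real))" if "c > 0" for c using that by real_asymp
 have "((%e. lr y (e * (1 / K))) \<longlongrightarrow> l) (at_right 0)" "((%e. lr y (e * K)) \<longlongrightarrow> l) (at_right 0)"
  by (rule filterlim_compose[OF l f]; simp add: K)+
 moreover have "\<forall>\<^sub>F e in at_right 0. lr y (e * (1 / K)) <= lr w e" using eventually_at_right_less
 proof eventually_elim
  case (elim e)
  thus ?case using K(2)[of "e * (1 / K)"] K(1) by simp
 qed
 moreover have "\<forall>\<^sub>F e in at_right 0. lr w e <= lr y (e * K)"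
  using eventually_at_right_less by eventually_elim (use K in auto)
 ultimately show ?thesis by (rule tendsto_sandwich[rotated 2])
qed

text \<open>With \<open>R\<close> scaled by the squared modulus of \<open>c\<close>, the series of
  \<open>lr_series\<close> for the two operators agree term by term.\<close>

lemma lr_scale:
 assumes y: "y \<in> AA" and e: "e > 0" and c: "c ~= 0"
 shows "lr (cs c * y) e = 2 * ln (cmod c) + lr y (e / (cmod c)\<^sup>2)"
proof -
 define R where "R = (norm (cs c * y))\<^sup>2 + e + (cmod c)\<^sup>2 * (norm y)\<^sup>2"
 have c0: "(cmod c)\<^sup>2 > 0" using c by simp
 have R0: "R > 0" using e by (simp add: R_def add_pos_nonneg add_nonneg_pos)
 have "shifted (cs c * y) e = (cmod c)\<^sup>2 *\<^sub>R shifted y (e / (cmod c)\<^sup>2)"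
 proof -
  have "adj (cs c * y) * (cs c * y) = cs (complex_of_real ((cmod c)\<^sup>2)) * (adj y * y)"
   unfolding complex_norm_square by (simp add: mult.assoc cs_left_commute[of "adj y"] cs_commute[of "adj y"] mult.commute[of c])
  hence "adj (cs c * y) * (cs c * y) = (cmod c)\<^sup>2 *\<^sub>R (adj y * y)" by (simp only: cs_of_real)
  thus ?thesis using c by (simp add: shifted_def scaleR_right_distrib)
 qed
 hence eq: "1 - (1 / R) *\<^sub>R shifted (cs c * y) e = 1 - (1 / (R / (cmod c)\<^sup>2)) *\<^sub>R shifted y (e / (cmod c)\<^sup>2)" by simp
 have le: "(norm y)\<^sup>2 + e / (cmod c)\<^sup>2 <= R / (cmod c)\<^sup>2" using c0 by (simp add: R_def field_simps)
 have "ln (R / (cmod c)\<^sup>2) - lr y (e / (cmod c)\<^sup>2) = ln R - lr (cs c * y) e"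
 proof (rule sums_unique2[OF lr_series[OF y divide_pos_pos[OF e c0] le]])
  have "(norm (cs c * y))\<^sup>2 + e <= R" by (simp add: R_def)
  from lr_series[OF mult_in[OF cs_in y] e this]
  show "(%n. Re (\<tau> ((1 - (1 / (R / (cmod c)\<^sup>2)) *\<^sub>R shifted y (e / (cmod c)\<^sup>2)) ^ Suc n)) / real (Suc n)) sums (ln R - lr (cs c * y) e)"
   unfolding eq .
 qed
 thus ?thesis using R0 c by (simp add: ln_divide_pos ln_realpow)
qed

lemma lr_one: assumes "e > 0" shows "lr 1 e = ln (1 + e)"
proof -
 have "law 1 = return borel 1" by (rule law_unique[of _ _ 1]) (auto simp: prob_space_return AE_return integral_return tau_one)
 thus ?thesis by (simp add: lr_def integral_return)
qed

end

subsection \<open>Diagonal matrices\<close>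

definition diag_mat :: "('h::complex_hilbert_space ^ 'k::finite) bop => ('k => 'h bop) => bool" where
 "diag_mat X f \<longleftrightarrow> (\<forall>p q. ent X p q = (if p = q then f p else 0))"

lemma diag_mat_mult: "diag_mat X f ==> diag_mat Y g ==> diag_mat (X * Y) (%p. f p * g p)"
proof -
 assume *: "diag_mat X f" "diag_mat Y g"
 have "(\<Sum>r\<in>UNIV. ent X p r * ent Y r q) = (\<Sum>r\<in>UNIV. if r = p then (if p = q then f p * g p else 0) else 0)" for p q
  using * by (intro sum.cong) (auto simp: diag_mat_def)
 thus ?thesis by (simp add: diag_mat_def ent_mult)
qed

lemma diag_mat_power: "diag_mat X f ==> diag_mat (X ^ n) (%p. f p ^ n)"
 by (induction n) (auto simp: diag_mat_mult, simp add: diag_mat_def)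

lemma diag_mat_adj: "diag_mat X f ==> diag_mat (adj X) (%p. adj (f p))" by (simp add: diag_mat_def ent_adj)

lemma (in tracial) lr_diag:
 fixes X :: "('h ^ 'k::finite) bop"
 assumes X: "diag_mat X f" and f: "!!p. f p \<in> AA" and e: "e > 0"
 shows "tracial.lr (mat_tr \<tau>) X e = (\<Sum>p\<in>UNIV. lr (f p) e) / real CARD('k)"
proof -
 interpret M: tracial "mat_alg AA :: ('h ^ 'k) bop set" "mat_tr \<tau>" by (rule tracial_matrix)
 have XM: "X \<in> mat_alg AA" using X f by (simp add: mat_alg_def diag_mat_def)
 define R where "R = (norm X)\<^sup>2 + e"
 have R: "(norm (f p))\<^sup>2 + e <= R" for p using norm_ent[of X p p] X by (simp add: R_def diag_mat_def power_mono)
 have "diag_mat (shifted X e) (%p. shifted (f p) e)"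
  using diag_mat_mult[OF diag_mat_adj[OF X] X] by (simp add: diag_mat_def shifted_def)
 hence "diag_mat (1 - (1 / R) *\<^sub>R shifted X e) (%p. 1 - (1 / R) *\<^sub>R shifted (f p) e)" by (simp add: diag_mat_def)
 note d = diag_mat_power[OF this]
 have "Re (mat_tr \<tau> ((1 - (1 / R) *\<^sub>R shifted X e) ^ n)) = (\<Sum>p\<in>UNIV. Re (\<tau> ((1 - (1 / R) *\<^sub>R shifted (f p) e) ^ n))) / real CARD('k)" for n
  using d[of n] by (simp add: mat_tr_def diag_mat_def)
 hence eq: "Re (mat_tr \<tau> ((1 - (1 / R) *\<^sub>R shifted X e) ^ Suc n)) / real (Suc n)
   = (\<Sum>p\<in>UNIV. Re (\<tau> ((1 - (1 / R) *\<^sub>R shifted (f p) e) ^ Suc n)) / real (Suc n)) / real CARD('k)" for n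
  by (simp only: sum_divide_distrib[symmetric]) (simp add: field_simps)
 have "(%n. Re (mat_tr \<tau> ((1 - (1 / R) *\<^sub>R shifted X e) ^ Suc n)) / real (Suc n)) sums ((\<Sum>p\<in>UNIV. ln R - lr (f p) e) / real CARD('k))"
  unfolding eq by (intro sums_divide sums_sum lr_series f e R)
 moreover have "(%n. Re (mat_tr \<tau> ((1 - (1 / R) *\<^sub>R shifted X e) ^ Suc n)) / real (Suc n)) sums (ln R - M.lr X e)"
  by (rule M.lr_series[OF XM e]) (simp add: R_def)
 ultimately have "(\<Sum>p\<in>UNIV. ln R - lr (f p) e) / real CARD('k) = ln R - M.lr X e" by (rule sums_unique2)
 thus ?thesis by (simp add: sum_subtractf field_simps)
qed

subsection \<open>The cyclic matrix\<close>

lemma cs_assoc: "cs a * (cs b * w) = cs (a * b) * w" by (simp add: mult.assoc)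

context tracial
begin

text \<open>Up to a scalar, \<open>Z + \<surd>(t/k) A - \<zeta>\<close> is a product of unipotent factors, which do not affect the
 limiting logarithmic integrals, and of a diagonal matrix with a single nontrivial entry.\<close>

lemma cyclic_comparable:
 fixes idx :: "nat => 'k::finite" and q :: "nat => 'h bop"
 assumes idx: "bij_betw idx {1..k} UNIV" and q: "!!j. j \<in> {1..k} ==> q j \<in> AA"
 shows "comparable (mat_tr \<tau>) (cs c * (1 - (\<Sum>j=1..k. eunit (q j) (idx j) (idx (j mod k + 1)))))
  (cs c * (1 - eunit (prod_list (map q [1..<Suc k])) (idx 1) (idx 1)))"
proof -
 interpret M: tracial "mat_alg AA :: ('h ^ 'k) bop set" "mat_tr \<tau>" by (rule tracial_matrix)
 have k: "k >= 1" using bij_betw_same_card[OF idx] by (cases k) auto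
 have inj: "idx i = idx j \<longleftrightarrow> i = j" if "i \<in> {1..k}" "j \<in> {1..k}" for i j
  by (rule inj_on_eq_iff[OF bij_betw_imp_inj_on[OF idx] that])
 define U where "U x i j = eunit x (idx i) (idx j)" for x :: "'h bop" and i j
 have U: "U x i j * U y l m = (if j = l then U (x * y) i m else 0)" if "j \<in> {1..k}" "l \<in> {1..k}" for x y i j l m
  using inj[OF that] by (simp add: U_def eunit_mult)
 have U0: "U x i j * U y l m = 0" if "j \<in> {1..k}" "l \<in> {1..k}" "j ~= l" for x y i j l m using U that by simp
 have UM: "U x i j \<in> mat_alg AA" if "x \<in> AA" for x i j using that by (simp add: mat_alg_def U_def ent_eunit)
 have tU: "mat_tr \<tau> (U x i j) = 0" if "i \<in> {1..k}" "j \<in> {1..k}" "i ~= j" for x i j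
  using inj[OF that(1,2)] that(3) by (auto simp: mat_tr_def U_def ent_eunit tau_0 intro!: sum.neutral)
 define W where "W j = prod_list (map q [j..<Suc k])" for j
 have WA: "W j \<in> AA" if "j >= 1" for j
 proof -
  have "prod_list xs \<in> AA" if "set xs \<subseteq> AA" for xs using that by (induction xs) auto
  thus ?thesis unfolding W_def by (rule) (use q that in auto)
 qed
 have W: "W j = q j * W (Suc j)" if "j \<in> {1..k}" for j using that by (simp add: W_def upt_conv_Cons del: upt_Suc)
 define e where "e j = U (q j) j (Suc j)" for j
 define N where "N m = (\<Sum>j=1..m. e j)" for m
 define V where "V = (\<Sum>j=1..k. U (W j) j 1)"
 define C where "C = - (\<Sum>j=2..k. U (W j) j 1)"
 define D where "D = 1 - U (W 1) 1 1"
 have eM: "e j \<in> mat_alg AA" if "j \<in> {1..k}" for j unfolding e_def by (rule UM[OF q[OF that]])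
 \<comment> \<open>\<open>N m\<close> need not have square 0, so its entries are removed one at a
   time. In this order the cross terms \<open>e (Suc m) * N m\<close> vanish and the factors
   multiply to \<open>1 - N m\<close>.\<close>
 have left: "comparable (mat_tr \<tau>) Y ((1 - N m) * Y)" if Y: "Y \<in> mat_alg AA" and m: "m <= k - 1" for Y m using m
 proof (induction m)
  case 0
  have "comparable (mat_tr \<tau>) Y Y" using M.comparable_right[OF Y M.zero_in] by (simp add: M.tau_0)
  thus ?case by (simp add: N_def)
 next
  case (Suc m)
  have NM: "N m \<in> mat_alg AA" unfolding N_def using Suc.prems by (intro M.sum_in eM) auto
  have S: "Suc m \<in> {1..k}" "Suc (Suc m) \<in> {1..k}" using Suc.prems by auto
  have eN: "e (Suc m) * N m = 0" unfolding N_def sum_distrib_left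
   using S Suc.prems by (intro sum.neutral ballI) (auto simp: e_def intro!: U0)
  have ee: "- e (Suc m) * - e (Suc m) = 0" using S by (simp add: e_def U0)
  have "comparable (mat_tr \<tau>) ((1 - N m) * Y) ((1 + - e (Suc m)) * ((1 - N m) * Y))"
   using NM Y eM[OF S(1)] ee tU[OF S(1) S(2)] S by (intro M.comparable_left) (auto simp: e_def M.tau_minus UM q)
  also have "(1 + - e (Suc m)) * ((1 - N m) * Y) = ((1 + - e (Suc m)) * (1 - N m)) * Y" by (simp only: mult.assoc)
  also have "(1 + - e (Suc m)) * (1 - N m) = 1 - N (Suc m)"
  proof -
   have "N (Suc m) = N m + e (Suc m)" by (simp add: N_def)
   thus ?thesis using eN by (simp add: left_diff_distrib right_diff_distrib)
  qed
  finally have "comparable (mat_tr \<tau>) ((1 - N m) * Y) ((1 - N (Suc m)) * Y)" .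
  with Suc show ?case using M.comparable_trans by (meson Suc_leD)
 qed
 have sp: "{1..k} = insert 1 {2..k}" using k by auto
 have spk: "{1..k} = insert k {1..k - 1}" using k by auto
 have NV: "N (k - 1) * V = (\<Sum>j=1..k-1. U (W j) j 1)"
 proof -
  have "e j * V = U (W j) j 1" if j: "j \<in> {1..k-1}" for j
  proof -
   have "e j * V = (\<Sum>i=1..k. if i = Suc j then U (q j * W (Suc j)) j 1 else 0)"
    unfolding V_def sum_distrib_left e_def using j by (intro sum.cong) (auto simp: U)
   moreover have "Suc j <= k" "j <= k" "j >= 1" using j by auto
   ultimately show ?thesis using W[of j] by simp
  qed
  thus ?thesis by (simp add: N_def sum_distrib_right)
 qed
 \<comment> \<open>Gaussian elimination: clearing the superdiagonal from the left leaves only the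
   first column, with entries the partial products \<open>W j\<close>; its part below the diagonal
   is then removed from the right by \<open>1 + C\<close>.\<close>
 have "(1 - N (k - 1)) * (1 - V) = 1 - (\<Sum>j=1..k. U (q j) j (j mod k + 1))"
 proof -
  have S: "(\<Sum>j=1..k. U (q j) j (j mod k + 1)) = U (q k) k 1 + N (k - 1)"
   unfolding spk using k by (subst sum.insert) (auto simp: N_def e_def intro!: sum.cong)
  have "V = U (q k) k 1 + N (k - 1) * V" unfolding NV unfolding V_def spk using k W[of k] by (subst sum.insert) (auto simp: W_def)
  hence V2: "V - N (k - 1) * V = U (q k) k 1" by (simp only: diff_eq_eq)
  have "(1 - N (k - 1)) * (1 - V) = 1 - N (k - 1) - (V - N (k - 1) * V)" by (simp add: left_diff_distrib right_diff_distrib)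
  thus ?thesis unfolding V2 S by simp
 qed
 moreover have "1 - V = D * (1 + C)"
 proof -
  have "U (W 1) 1 1 * C = 0" unfolding C_def sum_distrib_left mult_minus_right using k by (simp add: sum_distrib_left U0)
  moreover have "V = U (W 1) 1 1 - C" unfolding V_def sp C_def by (subst sum.insert) auto
  ultimately show ?thesis by (simp add: D_def left_diff_distrib distrib_left)
 qed
 ultimately have fac: "cs c * (1 - (\<Sum>j=1..k. U (q j) j (j mod k + 1))) = (1 - N (k - 1)) * ((cs c * D) * (1 + C))"
  by (simp only: mult.assoc cs_left_commute[of "1 - N (k - 1)"])
 have DM: "cs c * D \<in> mat_alg AA" unfolding D_def by (intro M.mult_in M.cs_in M.diff_in M.one_in UM WA) simp
 have CM: "C \<in> mat_alg AA" unfolding C_def by (intro M.uminus_in M.sum_in UM WA) auto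
 have "C * C = 0" unfolding C_def minus_mult_minus sum_distrib_right sum_distrib_left using k by (intro sum.neutral ballI U0) auto
 moreover have "mat_tr \<tau> C = 0"
 proof -
  have "mat_tr \<tau> (\<Sum>j=2..k. U (W j) j 1) = (\<Sum>j=2..k. mat_tr \<tau> (U (W j) j 1))"
   by (rule M.tau_sum) (use UM WA in auto)
  also have "... = 0" using k by (intro sum.neutral ballI tU) auto
  finally show ?thesis unfolding C_def by (subst M.tau_minus) (auto intro!: M.sum_in UM WA)
 qed
 ultimately have "comparable (mat_tr \<tau>) (cs c * D) ((cs c * D) * (1 + C))" by (intro M.comparable_right DM CM)
 moreover have "comparable (mat_tr \<tau>) ((cs c * D) * (1 + C)) (cs c * (1 - (\<Sum>j=1..k. U (q j) j (j mod k + 1))))"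
  unfolding fac by (intro left M.mult_in DM M.add_in M.one_in CM) simp
 ultimately have "comparable (mat_tr \<tau>) (cs c * D) (cs c * (1 - (\<Sum>j=1..k. U (q j) j (j mod k + 1))))" by (rule M.comparable_trans)
 hence "comparable (mat_tr \<tau>) (cs c * (1 - (\<Sum>j=1..k. U (q j) j (j mod k + 1)))) (cs c * D)" unfolding comparable_def by blast
 thus ?thesis by (simp only: U_def D_def W_def)
qed

text \<open>Division by \<open>z\<close> turns the matrix into 1 minus a cyclic matrix. The powers
  of \<open>z\<close> taken out of the diagonal entries balance those taken out of P - z^k, so only
  the factor 1 / k of the normalized trace remains. The points excluded are 0 and those where one of
  the two potentials is not a limit.\<close>

lemma cyclic_potential:
 fixes idx :: "nat => 'k::finite" and y :: "nat => 'h bop"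
 assumes idx: "bij_betw idx {1..k} UNIV" and y: "!!j. j \<in> {1..k} ==> y j \<in> AA"
 defines "X \<equiv> (\<Sum>j=1..k. eunit (y j) (idx j) (idx (j mod k + 1)))" and "P \<equiv> prod_list (map y [1..<Suc k])"
 shows "X \<in> mat_alg AA" "AE z in lborel. tracial.Ls (mat_tr \<tau>) X z = Ls P (z ^ k) / real k"
proof -
 interpret M: tracial "mat_alg AA :: ('h ^ 'k) bop set" "mat_tr \<tau>" by (rule tracial_matrix)
 have k: "k > 0" using bij_betw_same_card[OF idx] by (cases k) auto
 have card: "CARD('k) = k" using bij_betw_same_card[OF idx] by simp
 show XM: "X \<in> mat_alg AA" unfolding X_def by (intro M.sum_in) (simp add: mat_alg_def ent_eunit y)
 have pA: "prod_list xs \<in> AA" if "set xs \<subseteq> AA" for xs using that by (induction xs) auto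
 have PA: "P \<in> AA" unfolding P_def by (rule pA) (use y in auto)
 have main: "M.Ls X z = Ls P (z ^ k) / real k" if z: "z ~= 0" and gX: "M.good X z" and gP: "good P (z ^ k)" for z
 proof -
  define q where "q j = cs (1 / z) * y j" for j
  have qA: "q j \<in> AA" if "j \<in> {1..k}" for j using y[OF that] by (simp add: q_def)
  define d where "d = 1 - prod_list (map q [1..<Suc k])"
  define D where "D = (1 - eunit (prod_list (map q [1..<Suc k])) (idx 1) (idx 1) :: ('h ^ 'k) bop)"
  have dA: "d \<in> AA" unfolding d_def by (intro diff_in one_in pA) (use qA in auto)
  have Xz: "X - cs z = cs (- z) * (1 - (\<Sum>j=1..k. eunit (q j) (idx j) (idx (j mod k + 1))))"
  proof -
   have "cs z * eunit (cs (1 / z) * w) p r = eunit w p r" for w :: "'h bop" and p r :: 'k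
    using z by (intro ent_eqI) (simp add: ent_eunit mult.assoc[symmetric] flip: cs_simps(6))
   thus ?thesis by (simp add: X_def q_def right_diff_distrib sum_distrib_left sum_negf)
  qed
  have qp: "prod_list (map q xs) = cs (1 / z ^ length xs) * prod_list (map y xs)" for xs
   by (induction xs) (simp_all add: q_def mult.assoc cs_left_commute[of "y _"] cs_assoc del: cs_simps(6))
  have Pd: "P - cs (z ^ k) = cs (- (z ^ k)) * d"
   unfolding d_def qp using z k by (simp add: P_def right_diff_distrib cs_assoc del: cs_simps(6) upt_Suc)
  have dm: "diag_mat (cs (- z) * D) (%p. if p = idx 1 then cs (- z) * d else cs (- z) * 1)"
   by (auto simp: diag_mat_def D_def d_def ent_eunit)
  have DA: "(if p = idx 1 then cs (- z) * d else cs (- z) * 1) \<in> AA" for p using dA by simp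
  have DM: "cs (- z) * D \<in> mat_alg AA" using dm dA by (simp add: mat_alg_def diag_mat_def)
  have "(%n. lr (P - cs (z ^ k)) (ee n)) \<longlonglongrightarrow> 2 * Ls P (z ^ k)"
   using tendsto_mult_left[OF Lp_lim(1)[OF PA gP], of 2] Lp_lim(2)[OF PA gP] by (simp add: Lp_def)
  hence lP: "(lr (P - cs (z ^ k)) \<longlongrightarrow> 2 * Ls P (z ^ k)) (at_right 0)" by (intro lr_lim_at_right) (use PA in auto)
  have "(%n. M.lr (X - cs z) (ee n)) \<longlonglongrightarrow> 2 * M.Ls X z"
   using tendsto_mult_left[OF M.Lp_lim(1)[OF XM gX], of 2] M.Lp_lim(2)[OF XM gX] by (simp add: M.Lp_def)
  hence lX: "(M.lr (X - cs z) \<longlongrightarrow> 2 * M.Ls X z) (at_right 0)" by (intro M.lr_lim_at_right) (use XM in auto)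
  have cD: "comparable (mat_tr \<tau>) (X - cs z) (cs (- z) * D)" unfolding Xz D_def by (rule cyclic_comparable[OF idx qA])
  from M.lr_lim_comparable[OF cD lX] have l1: "(M.lr (cs (- z) * D) \<longlongrightarrow> 2 * M.Ls X z) (at_right 0)" .
  have m: "((%e. e * c) \<longlongrightarrow> 0) (at_right (0::real))" "filterlim (%e. e * c) (at_right 0) (at_right (0::real))" if "c > 0" for c
   using that by real_asymp+
  \<comment> \<open>One diagonal entry is - z d, where P - z^k = - z^k d, and k - 1 entries are - z.
    In the limit the coefficients of \<open>ln (cmod z)\<close> are 2, - 2 k and 2 (k - 1), with sum
    0.\<close>
  have ld: "M.lr (cs (- z) * D) e = (2 * ln (cmod z) - 2 * real k * ln (cmod z) + lr (P - cs (z ^ k)) (e * cmod z ^ (2 * (k - 1)))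
    + (real k - 1) * (2 * ln (cmod z) + ln (1 + e / (cmod z)\<^sup>2))) / real k" if e: "e > 0" for e
  proof -
   have sq: "e * cmod z ^ (2 * (k - 1)) / (cmod (- (z ^ k)))\<^sup>2 = e / (cmod z)\<^sup>2"
    using z k by (cases k) (simp_all add: norm_mult norm_power power_mult_distrib power_mult power2_eq_square power_mult[symmetric] field_simps)
   have "lr (P - cs (z ^ k)) (e * cmod z ^ (2 * (k - 1))) = 2 * ln (cmod (- (z ^ k))) + lr d (e / (cmod z)\<^sup>2)"
    unfolding Pd sq[symmetric] by (rule lr_scale[OF dA]) (use z e in auto)
   hence a: "lr d (e / (cmod z)\<^sup>2) = lr (P - cs (z ^ k)) (e * cmod z ^ (2 * (k - 1))) - 2 * real k * ln (cmod z)"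
    using z by (simp add: norm_power ln_realpow)
   have b: "lr (cs (- z) * d) e = 2 * ln (cmod z) + lr d (e / (cmod z)\<^sup>2)" using lr_scale[OF dA e, of "- z"] z by simp
   have c: "lr (cs (- z) * 1) e = 2 * ln (cmod z) + ln (1 + e / (cmod z)\<^sup>2)"
    using lr_scale[OF one_in e, of "- z"] z e by (simp add: lr_one)
   have u: "(UNIV :: 'k set) = insert (idx 1) (UNIV - {idx 1})" by auto
   have "M.lr (cs (- z) * D) e = (\<Sum>p\<in>UNIV. lr (if p = idx 1 then cs (- z) * d else cs (- z) * 1) e) / real k"
    using lr_diag[OF dm DA e] by (simp add: card)
   also have "(\<Sum>p\<in>UNIV. lr (if p = idx 1 then cs (- z) * d else cs (- z) * 1) e)
     = lr (cs (- z) * d) e + (\<Sum>p\<in>UNIV - {idx 1}. lr (cs (- z) * 1) e)" by (subst u, subst sum.insert) (auto intro!: sum.cong)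
   also have "(\<Sum>p\<in>UNIV - {idx 1}. lr (cs (- z) * 1) e) = (real k - 1) * lr (cs (- z) * 1) e"
    using k by (simp add: card_Diff_singleton card of_nat_diff)
   finally show ?thesis unfolding b c a by simp
  qed
  have l2: "((%e. (2 * ln (cmod z) - 2 * real k * ln (cmod z) + lr (P - cs (z ^ k)) (e * cmod z ^ (2 * (k - 1)))
    + (real k - 1) * (2 * ln (cmod z) + ln (1 + e / (cmod z)\<^sup>2))) / real k) \<longlongrightarrow>
    (2 * ln (cmod z) - 2 * real k * ln (cmod z) + 2 * Ls P (z ^ k) + (real k - 1) * (2 * ln (cmod z) + ln (1 + 0))) / real k) (at_right 0)"
   using z k m(1)[of "1 / (cmod z)\<^sup>2"]
   by (intro tendsto_divide tendsto_add tendsto_mult tendsto_const tendsto_ln filterlim_compose[OF lP m(2)]) auto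
  have "(M.lr (cs (- z) * D) \<longlongrightarrow> (2 * ln (cmod z) - 2 * real k * ln (cmod z) + 2 * Ls P (z ^ k) + (real k - 1) * (2 * ln (cmod z) + ln (1 + 0))) / real k) (at_right 0)"
   by (rule Lim_transform_eventually[OF l2]) (rule eventually_mono[OF eventually_at_right_less], rule ld[symmetric])
  from tendsto_unique[OF _ l1 this] show ?thesis using k by (simp add: field_simps)
 qed
 have "AE z in lborel. z ~= (0::complex)" by (rule AE_lborel_singleton)
 with M.AE_good[OF XM] AE_power[OF k AE_good[OF PA]]
 show "AE z in lborel. M.Ls X z = Ls P (z ^ k) / real k" by eventually_elim (rule main)
qed

end

section \<open>Noncrossing partitions and R-diagonal elements\<close>

text \<open>Partitions of an arbitrary set of positions, so that a word can be deleted without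
  renumbering the remaining positions.\<close>

definition NCS :: "nat set => nat set set set" where
 "NCS S = {\<pi>. partition_on S \<pi> & \<not> (\<exists>V\<in>\<pi>. \<exists>W\<in>\<pi>. V ~= W &
   (\<exists>a b c d. a < b & b < c & c < d & a \<in> V & c \<in> V & b \<in> W & d \<in> W))}"

lemma finite_NCS: "finite S ==> finite (NCS S)" by (rule finite_subset[OF _ finitely_many_partition_on]) (auto simp: NCS_def)

lemma NCS_block: "\<pi> \<in> NCS S ==> V \<in> \<pi> ==> V \<subseteq> S & V ~= {}" by (auto simp: NCS_def partition_on_def)

lemma NCS_disjoint: "\<pi> \<in> NCS S ==> V \<in> \<pi> ==> W \<in> \<pi> ==> x \<in> V ==> x \<in> W ==> V = W"
 by (auto simp: NCS_def partition_on_def disjoint_def)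

lemma NCS_noncrossing:
 "\<pi> \<in> NCS S ==> V \<in> \<pi> ==> W \<in> \<pi> ==> a < b ==> b < c ==> c < d ==> a \<in> V ==> c \<in> V ==> b \<in> W ==> d \<in> W ==> V = W"
 unfolding NCS_def by blast

lemma NCS_cover: "\<pi> \<in> NCS S ==> x \<in> S ==> \<exists>V\<in>\<pi>. x \<in> V" by (auto simp: NCS_def partition_on_def)

lemma NCS_image:
 assumes e: "!!i j. i \<in> S ==> j \<in> S ==> e i < e j \<longleftrightarrow> i < (j::nat)" and \<pi>: "\<pi> \<in> NCS S"
 shows "(`) e ` \<pi> \<in> NCS (e ` S)"
proof -
 have inj: "inj_on e S" by (intro inj_onI) (metis e nat_neq_iff)
 have p: "partition_on S \<pi>" using \<pi> by (simp add: NCS_def)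
 have "{} \<notin> (`) e ` \<pi>" using partition_onD3[OF p] by auto
 hence "partition_on (e ` S) ((`) e ` \<pi>)" using partition_on_inj_image[OF p inj] by simp
 moreover have "e ` V = e ` W" if VW: "V \<in> \<pi>" "W \<in> \<pi>" and o: "a < b" "b < c" "c < d" "a \<in> e ` V" "c \<in> e ` V" "b \<in> e ` W" "d \<in> e ` W" for V W a b c d
 proof -
  obtain a' b' c' d' where "a' \<in> V" "c' \<in> V" "b' \<in> W" "d' \<in> W" "a = e a'" "b = e b'" "c = e c'" "d = e d'" using o by blast
  moreover have "V \<subseteq> S" "W \<subseteq> S" using VW NCS_block[OF \<pi>] by auto
  ultimately have "V = W" using o e by (intro NCS_noncrossing[OF \<pi> VW, of a' b' c' d']) auto
  thus ?thesis by simp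
 qed
 ultimately show ?thesis unfolding NCS_def by blast
qed

definition splits :: "nat set set => nat set => bool" where
 "splits \<pi> I \<longleftrightarrow> (\<forall>V\<in>\<pi>. V \<subseteq> I \<or> V \<inter> I = {})"

text \<open>Blocks inside an interval of \<open>S\<close> cannot cross blocks outside it: a crossing
  would put a point outside \<open>I\<close> between two points of \<open>I\<close>. So the two
  parts of the partition are independent. \<open>C\<close> carries along a condition that only sees
  the blocks outside \<open>I\<close>.\<close>

lemma NCS_split:
 assumes I: "I \<subseteq> S" "!!x p q. x \<in> S ==> p \<in> I ==> q \<in> I ==> p <= x ==> x <= q ==> x \<in> I"
  and C: "!!\<pi>1 \<pi>2. \<pi>1 \<in> NCS I ==> \<pi>2 \<in> NCS (S - I) ==> C (\<pi>1 \<union> \<pi>2) = C \<pi>2"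
 shows "bij_betw (%(\<pi>1, \<pi>2). \<pi>1 \<union> \<pi>2) (NCS I \<times> {\<pi> \<in> NCS (S - I). C \<pi>}) {\<pi> \<in> NCS S. C \<pi> & splits \<pi> I}"
proof (rule bij_betw_byWitness[where f' = "%\<pi>. ({V \<in> \<pi>. V \<subseteq> I}, {V \<in> \<pi>. V \<inter> I = {}})"])
 have b1: "V \<subseteq> I & V ~= {}" if "\<pi>1 \<in> NCS I" "V \<in> \<pi>1" for V \<pi>1 using NCS_block[OF that] .
 have b2: "V \<inter> I = {} & V ~= {} & V \<subseteq> S" if "\<pi>2 \<in> NCS (S - I)" "V \<in> \<pi>2" for V \<pi>2 using NCS_block[OF that] by blast
 show "\<forall>x\<in>NCS I \<times> {\<pi> \<in> NCS (S - I). C \<pi>}. (%\<pi>. ({V \<in> \<pi>. V \<subseteq> I}, {V \<in> \<pi>. V \<inter> I = {}})) ((%(\<pi>1, \<pi>2). \<pi>1 \<union> \<pi>2) x) = x"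
  using b1 b2 by (auto simp: Int_absorb2) blast+
 show "\<forall>\<pi>\<in>{\<pi> \<in> NCS S. C \<pi> & splits \<pi> I}. (%(\<pi>1, \<pi>2). \<pi>1 \<union> \<pi>2) ({V \<in> \<pi>. V \<subseteq> I}, {V \<in> \<pi>. V \<inter> I = {}}) = \<pi>"
  by (auto simp: splits_def)
 have union: "\<pi>1 \<union> \<pi>2 \<in> NCS S & splits (\<pi>1 \<union> \<pi>2) I" if p: "\<pi>1 \<in> NCS I" "\<pi>2 \<in> NCS (S - I)" for \<pi>1 \<pi>2
 proof
  show "splits (\<pi>1 \<union> \<pi>2) I" using b1[OF p(1)] b2[OF p(2)] unfolding splits_def by blast
  have "partition_on S (\<pi>1 \<union> \<pi>2)" unfolding partition_on_def
  proof (intro conjI)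
   show "\<Union> (\<pi>1 \<union> \<pi>2) = S" using p I(1) by (auto simp: NCS_def partition_on_def)
   show "disjoint (\<pi>1 \<union> \<pi>2)"
    using b1[OF p(1)] b2[OF p(2)] NCS_disjoint[OF p(1)] NCS_disjoint[OF p(2)] unfolding disjoint_def by blast
   show "{} \<notin> \<pi>1 \<union> \<pi>2" using b1[OF p(1)] b2[OF p(2)] by blast
  qed
  moreover have "V = W" if VW: "V \<in> \<pi>1 \<union> \<pi>2" "W \<in> \<pi>1 \<union> \<pi>2" and o: "a < b" "b < c" "c < d" "a \<in> V" "c \<in> V" "b \<in> W" "d \<in> W" for V W a b c d
  proof -
   have S: "a \<in> S" "b \<in> S" "c \<in> S" "d \<in> S" using VW o b1[OF p(1)] b2[OF p(2)] I(1) by blast+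
   consider "V \<in> \<pi>1" "W \<in> \<pi>1" | "V \<in> \<pi>2" "W \<in> \<pi>2" | "V \<in> \<pi>1" "W \<in> \<pi>2" | "V \<in> \<pi>2" "W \<in> \<pi>1" using VW by blast
   thus ?thesis
   proof cases
    case 1 thus ?thesis using NCS_noncrossing[OF p(1)] o by blast
   next
    case 2 thus ?thesis using NCS_noncrossing[OF p(2)] o by blast
   next
    case 3
    hence "a \<in> I" "c \<in> I" "b \<notin> I" using o b1[OF p(1)] b2[OF p(2)] by blast+
    thus ?thesis using I(2)[OF S(2), of a c] o by simp
   next
    case 4
    hence "b \<in> I" "d \<in> I" "c \<notin> I" using o b1[OF p(1)] b2[OF p(2)] by blast+
    thus ?thesis using I(2)[OF S(3), of b d] o by simp
   qed
  qed
  ultimately show "\<pi>1 \<union> \<pi>2 \<in> NCS S" unfolding NCS_def by blast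
 qed
 thus "(%(\<pi>1, \<pi>2). \<pi>1 \<union> \<pi>2) ` (NCS I \<times> {\<pi> \<in> NCS (S - I). C \<pi>}) \<subseteq> {\<pi> \<in> NCS S. C \<pi> & splits \<pi> I}"
  using C by auto
 have sub: "{V \<in> \<pi>. P V} \<in> NCS T" if p: "\<pi> \<in> NCS S" and T: "T = \<Union>{V \<in> \<pi>. P V}" for \<pi> P T
 proof -
  have "partition_on T {V \<in> \<pi>. P V}" using p T by (auto simp: NCS_def partition_on_def disjoint_def)
  thus ?thesis using p unfolding NCS_def by blast
 qed
 show "(%\<pi>. ({V \<in> \<pi>. V \<subseteq> I}, {V \<in> \<pi>. V \<inter> I = {}})) ` {\<pi> \<in> NCS S. C \<pi> & splits \<pi> I} \<subseteq> NCS I \<times> {\<pi> \<in> NCS (S - I). C \<pi>}"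
 proof
  fix x assume "x \<in> (%\<pi>. ({V \<in> \<pi>. V \<subseteq> I}, {V \<in> \<pi>. V \<inter> I = {}})) ` {\<pi> \<in> NCS S. C \<pi> & splits \<pi> I}"
  then obtain \<pi> where x: "x = ({V \<in> \<pi>. V \<subseteq> I}, {V \<in> \<pi>. V \<inter> I = {}})" and p: "\<pi> \<in> NCS S" "C \<pi>" "splits \<pi> I" by blast
  have U: "\<Union>\<pi> = S" using p(1) by (auto simp: NCS_def partition_on_def)
  have 1: "{V \<in> \<pi>. V \<subseteq> I} \<in> NCS I" by (rule sub[OF p(1)]) (use U I(1) p(3) in "unfold splits_def, blast")
  have 2: "{V \<in> \<pi>. V \<inter> I = {}} \<in> NCS (S - I)" by (rule sub[OF p(1)]) (use U p(3) in "unfold splits_def, blast")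
  have "{V \<in> \<pi>. V \<subseteq> I} \<union> {V \<in> \<pi>. V \<inter> I = {}} = \<pi>" using p(3) by (auto simp: splits_def)
  hence "C {V \<in> \<pi>. V \<inter> I = {}}" using C[OF 1 2] p(2) by simp
  thus "x \<in> NCS I \<times> {\<pi> \<in> NCS (S - I). C \<pi>}" using 1 2 x by simp
 qed
qed

text \<open>If an element lies in between, one of the two shorter stretches still has a change of
  \<open>P\<close>. This locates neighbouring elements of a block of which one lies in a given set
  and the other does not.\<close>

lemma consecutive_pair:
 fixes V :: "nat set"
 assumes "p \<in> V" "q \<in> V" "p < q" "P p ~= P q"
 shows "\<exists>p'\<in>V. \<exists>q'\<in>V. p <= p' & p' < q' & q' <= q & (\<forall>r\<in>V. \<not> (p' < r & r < q')) & P p' ~= (P q' :: bool)"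
 using assms
proof (induction "q - p" arbitrary: p q rule: less_induct)
 case less
 show ?case
 proof (cases "\<exists>r\<in>V. p < r & r < q")
  case True
  then obtain r where r: "r \<in> V" "p < r" "r < q" by blast
  show ?thesis
  proof (cases "P r = P p")
   case True
   have "\<exists>p'\<in>V. \<exists>q'\<in>V. r <= p' & p' < q' & q' <= q & (\<forall>r\<in>V. \<not> (p' < r & r < q')) & P p' ~= P q'"
    by (rule less.hyps) (use less.prems r True in auto)
   thus ?thesis using r(2) by (meson less_imp_le order_trans)
  next
   case False
   have "\<exists>p'\<in>V. \<exists>q'\<in>V. p <= p' & p' < q' & q' <= r & (\<forall>r\<in>V. \<not> (p' < r & r < q')) & P p' ~= P q'"
    by (rule less.hyps) (use less.prems r False in auto)
   thus ?thesis using r(3) by (meson less_imp_le order_trans)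
  qed
 next
  case False
  thus ?thesis using less.prems by blast
 qed
qed

lemma distinct_adj_parity:
 "distinct_adj bs ==> i + d < length bs ==> bs ! i = bs ! (i + d) \<longleftrightarrow> even d" for bs :: "bool list"
proof (induction d)
 case (Suc d)
 thus ?case using distinct_adj_nth[of bs "i + d"] by auto
qed simp

text \<open>If no word is a union of blocks, then a shortest arc that leaves its word joins neighbouring words,
 and everything below it is cut by the junction into two even parts.\<close>

lemma alternating_words_block:
 fixes Is :: "nat list list" and l :: "nat => bool"
 assumes srt: "sorted_wrt (<) (concat Is)" and ne: "Is ~= []" "!!i. i < length Is ==> Is ! i ~= []"
  and alt: "!!i. i < length Is ==> distinct_adj (map l (Is ! i))"
  and junction: "!!i. Suc i < length Is ==> l (last (Is ! i)) = l (hd (Is ! Suc i))"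
  and \<pi>: "\<pi> \<in> NCS (set (concat Is))" and nsp: "!!i. i < length Is ==> \<not> splits \<pi> (set (Is ! i))"
 shows "\<exists>V\<in>\<pi>. odd (card V) \<or> \<not> distinct_adj (map l (sorted_list_of_set V))"
proof (rule ccontr)
 assume "\<not> ?thesis"
 hence ev: "!!V. V \<in> \<pi> ==> even (card V)" and da: "!!V. V \<in> \<pi> ==> distinct_adj (map l (sorted_list_of_set V))" by auto
 let ?S = "set (concat Is)" and ?W = "%i. set (Is ! i)"
 have S: "x \<in> ?S \<longleftrightarrow> (\<exists>i<length Is. x \<in> ?W i)" for x by (auto simp: in_set_conv_nth Bex_def)
 have ord: "x < y" if "i < j" "j < length Is" "x \<in> ?W i" "y \<in> ?W j" for i j x y
 proof -
  have "concat Is = concat (take j Is) @ concat (drop j Is)" by (simp flip: concat_append)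
  moreover have "Is ! i \<in> set (take j Is)" using that by (auto simp: in_set_conv_nth intro!: exI[of _ i])
  hence "x \<in> set (concat (take j Is))" using that(3) by auto
  moreover have "Is ! j \<in> set (drop j Is)" using that by (auto simp: in_set_conv_nth intro!: exI[of _ 0])
  hence "y \<in> set (concat (drop j Is))" using that(4) by auto
  ultimately show ?thesis using srt by (metis sorted_wrt_append)
 qed
 have srtI: "sorted_wrt (<) (Is ! i)" if "i < length Is" for i
 proof -
  have "concat Is = concat (take i Is) @ Is ! i @ concat (drop (Suc i) Is)"
   using id_take_nth_drop[OF that] by (metis concat.simps(2) concat_append)
  thus ?thesis using srt by (metis sorted_wrt_append)
 qed
 have uniq: "i = j" if "i < length Is" "j < length Is" "x \<in> ?W i" "x \<in> ?W j" for i j x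
  using ord[of i j x x] ord[of j i x x] that by (meson less_irrefl nat_neq_iff)
 have fin: "finite V" if "V \<in> \<pi>" for V using NCS_block[OF \<pi> that] finite_subset by blast
 \<comment> \<open>Neighbouring elements of a block carry different letters, because the word read
   along the block alternates.\<close>
 have arc: "l p ~= l q" if V: "V \<in> \<pi>" "p \<in> V" "q \<in> V" "p < q" "\<forall>r\<in>V. \<not> (p < r & r < q)" for V p q
 proof -
  let ?xs = "sorted_list_of_set V"
  obtain i j where ij: "i < length ?xs" "?xs ! i = p" "j < length ?xs" "?xs ! j = q"
   using V fin[OF V(1)] by (metis in_set_conv_nth set_sorted_list_of_set)
  have s: "sorted_wrt (<) ?xs" by (rule strict_sorted_list_of_set)
  have "i < j" using sorted_wrt_nth_less[OF s, of j i] ij V(4) by (metis less_asym nat_neq_iff less_irrefl)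
  moreover have "\<not> Suc i < j"
  proof
   assume "Suc i < j"
   hence "p < ?xs ! Suc i" "?xs ! Suc i < q" using sorted_wrt_nth_less[OF s] ij by auto
   moreover have "?xs ! Suc i \<in> V" using \<open>Suc i < j\<close> ij fin[OF V(1)] by (metis less_trans nth_mem set_sorted_list_of_set)
   ultimately show False using V(5) by blast
  qed
  ultimately have "j = Suc i" by simp
  thus ?thesis using distinct_adj_nth[OF da[OF V(1)], of i] ij by simp
 qed
 \<comment> \<open>The lengths of arcs, that is of pairs of neighbouring elements of a block, whose
   ends lie in different words.\<close>
 define X where "X d \<longleftrightarrow> (\<exists>V\<in>\<pi>. \<exists>p\<in>V. \<exists>q\<in>V. p < q & (\<forall>r\<in>V. \<not> (p < r & r < q)) & (\<forall>i<length Is. \<not> (p \<in> ?W i & q \<in> ?W i)) & d = q - p)" for d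
 text \<open>a block that meets a word, or a part of one, without being contained in it crosses a junction\<close>
 have cut: "\<exists>d. X d & d <= b - a" if V: "V \<in> \<pi>" "!!x. x \<in> V ==> a <= x & x <= b" and x: "x \<in> V" "x \<in> T" and y: "y \<in> V" "y \<notin> T"
  and T: "!!u w i. u \<in> V ==> w \<in> V ==> u \<in> T ==> w \<notin> T ==> i < length Is ==> \<not> (u \<in> ?W i & w \<in> ?W i)" for V a b x y T
 proof -
  have "x ~= y" using x y by auto
  hence "\<exists>p\<in>V. \<exists>q\<in>V. p < q & (p \<in> T) ~= (q \<in> T)" using x y by (metis nat_neq_iff)
  then obtain p q where pq: "p \<in> V" "q \<in> V" "p < q" "(p \<in> T) ~= (q \<in> T)" by blast
  obtain p' q' where c: "p' \<in> V" "q' \<in> V" "p' < q'" "\<forall>r\<in>V. \<not> (p' < r & r < q')" "(p' \<in> T) ~= (q' \<in> T)"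
   using consecutive_pair[OF pq(1-3), of "%x. x \<in> T"] pq(4) by blast
  have "X (q' - p')" unfolding X_def using V(1) c T[of p' q'] T[of q' p'] by blast
  moreover have "q' - p' <= b - a" using V(2)[OF c(1)] V(2)[OF c(2)] by (meson diff_le_mono diff_le_mono2 order_trans)
  ultimately show ?thesis by blast
 qed
 have "\<exists>d. X d"
 proof -
  have 0: "0 < length Is" using ne by simp
  obtain V x y where V: "V \<in> \<pi>" "x \<in> V" "x \<in> ?W 0" "y \<in> V" "y \<notin> ?W 0" using nsp[OF 0] unfolding splits_def by blast
  have "\<exists>d. X d & d <= Max V - 0"
  proof (rule cut[OF V(1) _ V(2,3) V(4,5)])
   show "0 <= x & x <= Max V" if "x \<in> V" for x using fin[OF V(1)] that by simp
   show "\<not> (u \<in> ?W i & w \<in> ?W i)" if "u \<in> ?W 0" "w \<notin> ?W 0" "i < length Is" for u w i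
    using uniq[OF 0 that(3,1)] that(2) by blast
  qed
  thus ?thesis by blast
 qed
 define d where "d = (LEAST d. X d)"
 have Xd: "X d" unfolding d_def by (rule LeastI_ex) fact
 have least: "d <= d'" if "X d'" for d' unfolding d_def by (rule Least_le) fact
 obtain V p q where V: "V \<in> \<pi>" "p \<in> V" "q \<in> V" "p < q" "\<forall>r\<in>V. \<not> (p < r & r < q)" "\<forall>i<length Is. \<not> (p \<in> ?W i & q \<in> ?W i)" "d = q - p"
  using Xd unfolding X_def by blast
 obtain i where i: "i < length Is" "p \<in> ?W i" using NCS_block[OF \<pi> V(1)] V(2) S by blast
 obtain j where j: "j < length Is" "q \<in> ?W j" using NCS_block[OF \<pi> V(1)] V(3) S by blast
 have ij: "i < j" using V(4,6) i j ord[of j i q p] by (metis less_asym nat_neq_iff)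
 \<comment> \<open>A block with a point strictly under the arc lies strictly under it, since the
   partition is noncrossing.\<close>
 have gap: "p < y & y < q" if W: "W \<in> \<pi>" "x \<in> W" "y \<in> W" "p < x" "x < q" for W x y
 proof -
  have VW: "V ~= W" using V(5) W by blast
  hence "y ~= p" "y ~= q" using NCS_disjoint[OF \<pi> V(1) W(1)] V(2,3) W(3) by blast+
  moreover have "\<not> y < p" using NCS_noncrossing[OF \<pi> W(1) V(1), of y p x q] V W VW by blast
  moreover have "\<not> q < y" using NCS_noncrossing[OF \<pi> V(1) W(1), of p x q y] V W VW by blast
  ultimately show ?thesis by simp
 qed
 text \<open>a set under the arc whose blocks cannot be cut without crossing a junction\<close>
 have spl: "splits \<pi> T" if T: "!!x. x \<in> T ==> p < x & x < q"
  and T': "!!u w n. u \<in> T ==> w \<notin> T ==> p < w ==> w < q ==> n < length Is ==> \<not> (u \<in> ?W n & w \<in> ?W n)" for T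
 proof (rule ccontr)
  assume "\<not> splits \<pi> T"
  then obtain W x y where W: "W \<in> \<pi>" "x \<in> W" "x \<in> T" "y \<in> W" "y \<notin> T" unfolding splits_def by blast
  have g: "p < z & z < q" if "z \<in> W" for z using gap[OF W(1,2) that] T[OF W(3)] by blast
  have "\<exists>d. X d & d <= (q - 1) - (p + 1)" by (rule cut[OF W(1) _ W(2,3) W(4,5)]) (use g T' in "fastforce+")
  then obtain d' where "X d'" "d' <= (q - 1) - (p + 1)" by blast
  thus False using least[of d'] V(4,7) by linarith
 qed
 have even: "even (card T)" if T: "splits \<pi> T" "T \<subseteq> ?S" for T
 proof -
  have U: "T = \<Union>{W \<in> \<pi>. W \<subseteq> T}" using T NCS_cover[OF \<pi>] unfolding splits_def by blast
  have "card (\<Union>{W \<in> \<pi>. W \<subseteq> T}) = sum card {W \<in> \<pi>. W \<subseteq> T}"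
   by (rule card_Union_disjoint) (use fin partition_onD2 \<pi> in "auto simp: NCS_def disjoint_def partition_on_def")
  also have "even ..." using ev by (intro dvd_sum) auto
  finally show ?thesis using U by simp
 qed
 show False
 proof (cases "j = Suc i")
  case False
  hence m: "i < Suc i" "Suc i < j" "Suc i < length Is" using ij j by auto
  have "splits \<pi> (?W (Suc i))" by (rule spl) (use ord[OF m(1,3) i(2)] ord[OF m(2) j(1) _ j(2)] uniq[OF m(3)] in blast)+
  thus False using nsp[OF m(3)] by blast
 next
  case True
  have js: "Suc i < length Is" using True j(1) by simp
  have jq: "q \<in> ?W (Suc i)" using True j(2) by simp
  obtain a where a: "a < length (Is ! i)" "Is ! i ! a = p" using i(2) by (auto simp: in_set_conv_nth)
  obtain b where b: "b < length (Is ! Suc i)" "Is ! Suc i ! b = q" using jq by (auto simp: in_set_conv_nth)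
  have mono: "Is ! n ! u < Is ! n ! w \<longleftrightarrow> u < w" if "n < length Is" "u < length (Is ! n)" "w < length (Is ! n)" for n u w
   using sorted_wrt_nth_less[OF srtI[OF that(1)]] that by (metis less_asym nat_neq_iff)
  have lt: "x < q" if "x \<in> ?W i" for x using ord[OF lessI js that jq] .
  have gt: "p < x" if "x \<in> ?W (Suc i)" for x using ord[OF lessI js i(2) that] .
  have T1: "splits \<pi> {x \<in> ?W i. p < x}" by (rule spl) (use lt uniq[OF i(1)] in blast)+
  have T2: "splits \<pi> {x \<in> ?W (Suc i). x < q}" by (rule spl) (use gt uniq[OF js] in blast)+
  have inj: "inj_on ((!) (Is ! n)) {..<length (Is ! n)}" if "n < length Is" for n
   by (intro inj_onI) (metis lessThan_iff mono[OF that] nat_neq_iff)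
  have "{x \<in> ?W i. p < x} = (!) (Is ! i) ` {Suc a..<length (Is ! i)}"
   using mono[OF i(1) a(1)] a(2) by (auto simp: in_set_conv_nth Suc_le_eq image_iff)
  hence "card {x \<in> ?W i. p < x} = length (Is ! i) - Suc a"
   using card_image[OF inj_on_subset[OF inj[OF i(1)]], of "{Suc a..<length (Is ! i)}"] by (simp add: subset_eq)
  hence e1: "even (length (Is ! i) - Suc a)" using even[OF T1] S i(1) by auto
  have "{x \<in> ?W (Suc i). x < q} = (!) (Is ! Suc i) ` {..<b}"
   using mono[OF js _ b(1)] b by (auto simp: in_set_conv_nth image_iff) (use less_trans in blast)+
  hence "card {x \<in> ?W (Suc i). x < q} = b" using card_image[OF inj_on_subset[OF inj[OF js], of "{..<b}"]] b(1) by auto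
  hence e2: "even b" using even[OF T2] S js by auto
  \<comment> \<open>Evenly many positions follow \<open>p\<close> in its word and evenly many
    precede \<open>q\<close> in the next one. As both words alternate, \<open>p\<close> and
    \<open>q\<close> carry the letters at the junction, which agree, although the ends of an arc
    must differ.\<close>
  have "l p = l (last (Is ! i))"
   using distinct_adj_parity[OF alt[OF i(1)], of a "length (Is ! i) - Suc a"] e1 a by (simp add: last_conv_nth[OF ne(2)[OF i(1)]])
  moreover have "l q = l (hd (Is ! Suc i))"
   using distinct_adj_parity[OF alt[OF js], of 0 b] e2 b ne(2)[OF js] by (simp add: hd_conv_nth)
  ultimately show False using junction[OF js] arc[OF V(1-5)] by simp
 qed
qed

section \<open>Words in an R-diagonal element\<close>

definition letter :: "'h::complex_hilbert_space bop => bool => 'h bop" where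
 "letter a s = (if s then adj a else a)"

definition wd :: "'h::complex_hilbert_space bop => bool list => 'h bop" where
 "wd a \<epsilon> = prod_list (map (letter a) \<epsilon>)"

lemma wd_simps [simp]: "wd a [] = 1" "wd a (s # \<epsilon>) = letter a s * wd a \<epsilon>" "wd a (\<epsilon> @ \<delta>) = wd a \<epsilon> * wd a \<delta>"
 by (simp_all add: wd_def)

lemma finite_NCS_member: "\<pi> \<in> NCS S ==> finite S ==> finite \<pi>" using finite_elements by (auto simp: NCS_def)

lemma op_of_prod_list: "op_of (prod_list xs) = op_prod (map op_of xs)"
 by (induction xs) (simp_all add: op_prod_def one_bop.rep_eq op_of_mult)

lemma (in tracial) prod_list_in: "(!!x. x \<in> set xs ==> x \<in> AA) ==> prod_list xs \<in> AA" by (induction xs) auto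

locale R_diagonal_element = tracial AA \<tau>
 for AA :: "'h::complex_hilbert_space bop set" and \<tau> +
 fixes \<phi> :: "'h op => complex" and a :: "'h bop"
 assumes tau_phi: "\<tau> y = \<phi> (op_of y)" and a_in: "a \<in> AA" and rd: "R_diagonal \<phi> (op_of a)"
begin

definition kap :: "(nat => bool) => nat set => complex" where
 "kap l V = free_cumulant \<phi> (map (%i. op_of (letter a (l i))) (sorted_list_of_set V))"

lemma wd_in: "wd a \<epsilon> \<in> AA" by (induction \<epsilon>) (auto simp: letter_def a_in)

lemma kap_zero: "odd (card V) \<or> \<not> distinct_adj (map l (sorted_list_of_set V)) ==> kap l V = 0"
 using rd[unfolded R_diagonal_def, rule_format, of "map l (sorted_list_of_set V)"]
 by (auto simp: kap_def letter_def comp_def op_of_adj if_distrib[of op_of] cong: if_cong)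

text \<open>\<open>free_cumulant\<close> solves the moment-cumulant formula for the one-block term;
  here that term is put back, and the increasing enumeration \<open>e\<close> carries the formula
  from an initial segment to any finite set of positions.\<close>

lemma moment_cumulant:
 assumes S: "finite S"
 shows "\<tau> (wd a (map l (sorted_list_of_set S))) = (\<Sum>\<pi>\<in>NCS S. \<Prod>V\<in>\<pi>. kap l V)"
proof (cases "S = {}")
 case True
 have "NCS {} = {{}}" by (auto simp: NCS_def partition_on_empty)
 thus ?thesis using True by (simp add: tau_one)
next
 case False
 define xs where "xs = sorted_list_of_set S"
 define n where "n = length xs"
 define e where "e i = xs ! i" for i
 define ys where "ys = map (%i. op_of (letter a (l i))) xs"
 have s: "sorted_wrt (<) xs" "set xs = S" "distinct xs" unfolding xs_def using S by auto
 have n: "n > 0" "length ys = n" using False s(2) by (auto simp: n_def ys_def)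
 have e: "e i < e j \<longleftrightarrow> i < j" if "i < n" "j < n" for i j
  using that sorted_wrt_nth_less[OF s(1)] unfolding e_def n_def by (metis less_asym nat_neq_iff)
 have im: "e ` {..<n} = S" using s(2) by (auto simp: e_def n_def set_conv_nth)
 have inj: "inj_on e {..<n}" by (intro inj_onI) (metis e lessThan_iff nat_neq_iff)
 define e' where "e' = inv_into {..<n} e"
 have e'e: "e' (e i) = i" if "i < n" for i unfolding e'_def using inj that by (simp add: inv_into_f_f)
 have ee': "e (e' x) = x" "e' x < n" if "x \<in> S" for x
  using that im inv_into_into[of x e "{..<n}"] f_inv_into_f[of x e "{..<n}"] by (auto simp: e'_def)
 have im': "e' ` S = {..<n}" using e'e im by (force simp: image_iff)
 have bij: "bij_betw (%\<pi>. (`) e ` \<pi>) (NCS {..<n}) (NCS S)"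
 proof (rule bij_betw_byWitness[where f' = "%\<pi>. (`) e' ` \<pi>"])
  show "\<forall>\<pi>\<in>NCS {..<n}. (`) e' ` (`) e ` \<pi> = \<pi>"
  proof
   fix \<pi> assume "\<pi> \<in> NCS {..<n}"
   hence "e' ` e ` V = V" if "V \<in> \<pi>" for V using NCS_block[of \<pi> "{..<n}" V] that e'e by (force simp: image_iff)
   thus "(`) e' ` (`) e ` \<pi> = \<pi>" by (simp add: image_image cong: image_cong_simp)
  qed
  show "\<forall>\<pi>\<in>NCS S. (`) e ` (`) e' ` \<pi> = \<pi>"
  proof
   fix \<pi> assume "\<pi> \<in> NCS S"
   hence "e ` e' ` V = V" if "V \<in> \<pi>" for V using NCS_block[of \<pi> S V] that ee' by (force simp: image_iff)
   thus "(`) e ` (`) e' ` \<pi> = \<pi>" by (simp add: image_image cong: image_cong_simp)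
  qed
  show "(%\<pi>. (`) e ` \<pi>) ` NCS {..<n} \<subseteq> NCS S" using NCS_image[of "{..<n}" e] e im by auto
  have "e' i < e' j \<longleftrightarrow> i < j" if "i \<in> S" "j \<in> S" for i j using e[of "e' i" "e' j"] ee' that by simp
  thus "(%\<pi>. (`) e' ` \<pi>) ` NCS S \<subseteq> NCS {..<n}" using NCS_image[of S e'] im' by auto
 qed
 have nths: "free_cumulant \<phi> (nths ys V) = kap l (e ` V)" if "V \<subseteq> {..<n}" for V
 proof -
  have "set (nths xs V) = e ` V" using that by (auto simp: set_nths e_def n_def)
  moreover have "sorted (nths xs V)" "distinct (nths xs V)" using s by (auto intro: sorted_nths strict_sorted_imp_sorted distinct_nthsI)
  ultimately have "sorted_list_of_set (e ` V) = nths xs V" using sorted_list_of_set.idem_if_sorted_distinct by metis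
  thus ?thesis by (simp add: kap_def ys_def nths_map)
 qed
 have mem: "{{..<n}} \<in> noncrossing_partitions n" using n(1) by (auto simp: noncrossing_partitions_def partition_on_space lessThan_empty_iff)
 have fin: "finite (noncrossing_partitions n)" using finite_NCS[of "{..<n}"] by (simp add: NCS_def noncrossing_partitions_def)
 have all: "nths ys {..<n} = ys" using n(2) by (simp add: nths_all)
 have "\<phi> (op_prod ys) = (\<Sum>\<pi>\<in>noncrossing_partitions n. \<Prod>V\<in>\<pi>. free_cumulant \<phi> (nths ys V))"
  using free_cumulant.simps[of \<phi> ys] unfolding n(2) by (subst sum.remove[OF fin mem]) (simp add: n(2))
 also have "... = (\<Sum>\<pi>\<in>NCS {..<n}. \<Prod>V\<in>(`) e ` \<pi>. kap l V)"
 proof (rule sum.cong)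
  fix \<pi> assume p: "\<pi> \<in> NCS {..<n}"
  have "inj_on ((`) e) \<pi>" using NCS_block[OF p] inj by (intro inj_onI) (metis inj_on_image_eq_iff)
  hence "(\<Prod>V\<in>(`) e ` \<pi>. kap l V) = (\<Prod>V\<in>\<pi>. kap l (e ` V))" by (rule prod.reindex_cong) auto
  also have "... = (\<Prod>V\<in>\<pi>. free_cumulant \<phi> (nths ys V))" using NCS_block[OF p] by (intro prod.cong) (auto simp: nths)
  finally show "(\<Prod>V\<in>\<pi>. free_cumulant \<phi> (nths ys V)) = (\<Prod>V\<in>(`) e ` \<pi>. kap l V)" ..
 qed (simp add: NCS_def noncrossing_partitions_def)
 also have "... = (\<Sum>\<pi>\<in>NCS S. \<Prod>V\<in>\<pi>. kap l V)" by (rule sum.reindex_bij_betw[OF bij])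
 finally show ?thesis by (simp add: tau_phi wd_def op_of_prod_list ys_def xs_def comp_def)
qed

definition piece :: "(nat => bool) => bool \<times> nat list => 'h bop" where
 "piece l p = wd a (map l (snd p)) - (if fst p then cs (\<tau> (wd a (map l (snd p)))) else 0)"

definition unsplit :: "(bool \<times> nat list) list => nat set set => bool" where
 "unsplit ps \<pi> \<longleftrightarrow> (\<forall>p\<in>set ps. fst p --> \<not> splits \<pi> (set (snd p)))"

text \<open>By \<open>NCS_split\<close>, centring a word subtracts precisely the partitions for
  which that word is a union of blocks. The flags mark the centred words; the induction clears one
  flag at a time and compares with the product in which that word is deleted.\<close>

lemma piece_moments:
 assumes "sorted_wrt (<) (concat (map snd ps))"
 shows "\<tau> (prod_list (map (piece l) ps)) =
  (\<Sum>\<pi>\<in>{\<pi> \<in> NCS (set (concat (map snd ps))). unsplit ps \<pi>}. \<Prod>V\<in>\<pi>. kap l V)" using assms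
proof (induction "length (filter fst ps)" arbitrary: ps)
 case 0
 hence nf: "\<not> fst p" if "p \<in> set ps" for p using that by (auto simp: filter_empty_conv)
 hence "prod_list (map (piece l) ps) = wd a (map l (concat (map snd ps)))" by (induction ps) (auto simp: piece_def)
 moreover have "{\<pi> \<in> NCS (set (concat (map snd ps))). unsplit ps \<pi>} = NCS (set (concat (map snd ps)))"
  using nf by (auto simp: unsplit_def)
 moreover have "sorted_list_of_set (set (concat (map snd ps))) = concat (map snd ps)"
  using 0(2) by (intro sorted_list_of_set.idem_if_sorted_distinct) (auto simp: strict_sorted_iff)
 ultimately show ?case using moment_cumulant[of "set (concat (map snd ps))" l] by simp
next
 case (Suc m)
 then obtain p where "p \<in> set ps" "fst p" by (metis Zero_not_Suc filter_empty_conv list.size(3))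
 then obtain I qs rs where ps: "ps = qs @ (True, I) # rs" by (metis prod.collapse split_list)
 define S where "S = set (concat (map snd ps))"
 let ?ps1 = "qs @ (False, I) # rs" and ?ps2 = "qs @ rs"
 have srt: "sorted_wrt (<) (concat (map snd ps))" by fact
 have o: "!!x y. x \<in> set (concat (map snd qs)) ==> y \<in> set I ==> x < y"
  "!!x y. x \<in> set I ==> y \<in> set (concat (map snd rs)) ==> x < y" "sorted_wrt (<) I"
  using srt unfolding ps by (auto simp: sorted_wrt_append)
 have 1: "\<tau> (prod_list (map (piece l) ?ps1)) = (\<Sum>\<pi>\<in>{\<pi> \<in> NCS S. unsplit ?ps1 \<pi>}. \<Prod>V\<in>\<pi>. kap l V)"
  using Suc.hyps(1)[of ?ps1] Suc.hyps(2) srt by (simp add: ps S_def)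
 have S2: "set (concat (map snd ?ps2)) = S - set I" unfolding S_def ps using o by fastforce
 have 2: "\<tau> (prod_list (map (piece l) ?ps2)) = (\<Sum>\<pi>\<in>{\<pi> \<in> NCS (S - set I). unsplit ?ps2 \<pi>}. \<Prod>V\<in>\<pi>. kap l V)"
 proof -
  have "sorted_wrt (<) (concat (map snd ?ps2))" using srt unfolding ps by (simp add: sorted_wrt_append ball_Un)
  moreover have "m = length (filter fst ?ps2)" using Suc.hyps(2) by (simp add: ps)
  ultimately show ?thesis unfolding S2[symmetric] by (intro Suc.hyps(1))
 qed
 have A: "prod_list (map (piece l) us) \<in> AA" for us by (rule prod_list_in) (auto simp: piece_def wd_in)
 define m where "m = \<tau> (wd a (map l I))"
 have "prod_list (map (piece l) ps) = prod_list (map (piece l) ?ps1) - cs m * prod_list (map (piece l) ?ps2)"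
  by (simp add: ps piece_def[of l "(_, I)"] m_def left_diff_distrib right_diff_distrib cs_left_commute)
 hence "\<tau> (prod_list (map (piece l) ps)) = \<tau> (prod_list (map (piece l) ?ps1)) - m * \<tau> (prod_list (map (piece l) ?ps2))"
  using A by (simp only: tau_diff tau_cs AA_intros)
 moreover have "{\<pi> \<in> NCS S. unsplit ps \<pi>} = {\<pi> \<in> NCS S. unsplit ?ps1 \<pi>} - {\<pi> \<in> NCS S. unsplit ?ps2 \<pi> & splits \<pi> (set I)}"
  unfolding ps unsplit_def by auto
 moreover have "(\<Sum>\<pi>\<in>{\<pi> \<in> NCS S. unsplit ?ps2 \<pi> & splits \<pi> (set I)}. \<Prod>V\<in>\<pi>. kap l V)
   = m * \<tau> (prod_list (map (piece l) ?ps2))"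
 proof -
  have dis: "set (snd p) \<inter> set I = {}" if "p \<in> set ?ps2" for p
   using that o(1)[of _ _] o(2)[of _ _] by (fastforce simp: disjoint_iff)
  have C: "unsplit ?ps2 (\<pi>1 \<union> \<pi>2) = unsplit ?ps2 \<pi>2" if p: "\<pi>1 \<in> NCS (set I)" "\<pi>2 \<in> NCS (S - set I)" for \<pi>1 \<pi>2
  proof -
   have "splits (\<pi>1 \<union> \<pi>2) J = splits \<pi>2 J" if "J \<inter> set I = {}" for J
    using NCS_block[OF p(1)] that unfolding splits_def by blast
   thus ?thesis unfolding unsplit_def using dis by auto
  qed
  have conv: "x \<in> set I" if x: "x \<in> S" and pq: "p \<in> set I" "q \<in> set I" "p <= x" "x <= q" for x p q
   using x o(1)[OF _ pq(1), of x] o(2)[OF pq(2), of x] pq(3,4) unfolding S_def ps by auto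
  have fS: "finite S" unfolding S_def by simp
  have "(\<Sum>\<pi>\<in>{\<pi> \<in> NCS S. unsplit ?ps2 \<pi> & splits \<pi> (set I)}. \<Prod>V\<in>\<pi>. kap l V)
   = (\<Sum>(\<pi>1, \<pi>2)\<in>NCS (set I) \<times> {\<pi> \<in> NCS (S - set I). unsplit ?ps2 \<pi>}. (\<Prod>V\<in>\<pi>1. kap l V) * (\<Prod>V\<in>\<pi>2. kap l V))"
  proof (subst sum.reindex_bij_betw[OF NCS_split[of "set I" S "unsplit ?ps2", OF _ conv C], symmetric])
   show "set I \<subseteq> S" unfolding S_def ps by auto
   show "(\<Sum>x\<in>NCS (set I) \<times> {\<pi> \<in> NCS (S - set I). unsplit ?ps2 \<pi>}. \<Prod>V\<in>(case x of (\<pi>1, \<pi>2) => \<pi>1 \<union> \<pi>2). kap l V)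
    = (\<Sum>(\<pi>1, \<pi>2)\<in>NCS (set I) \<times> {\<pi> \<in> NCS (S - set I). unsplit ?ps2 \<pi>}. (\<Prod>V\<in>\<pi>1. kap l V) * (\<Prod>V\<in>\<pi>2. kap l V))"
   proof (rule sum.cong[OF refl], clarify)
    fix \<pi>1 \<pi>2 assume p: "\<pi>1 \<in> NCS (set I)" "\<pi>2 \<in> NCS (S - set I)"
    have "finite \<pi>1" "finite \<pi>2" using finite_NCS_member[OF p(1)] finite_NCS_member[OF p(2)] fS by auto
    moreover have "\<pi>1 \<inter> \<pi>2 = {}" using NCS_block[OF p(1)] NCS_block[OF p(2)] by blast
    ultimately show "(\<Prod>V\<in>\<pi>1 \<union> \<pi>2. kap l V) = (\<Prod>V\<in>\<pi>1. kap l V) * (\<Prod>V\<in>\<pi>2. kap l V)" by (rule prod.union_disjoint)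
   qed
  qed
  also have "... = (\<Sum>\<pi>\<in>NCS (set I). \<Prod>V\<in>\<pi>. kap l V) * (\<Sum>\<pi>\<in>{\<pi> \<in> NCS (S - set I). unsplit ?ps2 \<pi>}. \<Prod>V\<in>\<pi>. kap l V)"
   by (simp add: sum_product sum.cartesian_product)
  also have "(\<Sum>\<pi>\<in>NCS (set I). \<Prod>V\<in>\<pi>. kap l V) = m"
   using moment_cumulant[of "set I" l] o(3) by (simp add: m_def sorted_list_of_set.idem_if_sorted_distinct strict_sorted_iff)
  finally show ?thesis unfolding 2 .
 qed
 moreover have "finite {\<pi> \<in> NCS S. unsplit ?ps1 \<pi>}" by (rule finite_subset[OF _ finite_NCS[of S]]) (auto simp: S_def)
 moreover have "{\<pi> \<in> NCS S. unsplit ?ps2 \<pi> & splits \<pi> (set I)} \<subseteq> {\<pi> \<in> NCS S. unsplit ?ps1 \<pi>}" by (auto simp: unsplit_def)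
 ultimately show ?case using 1 by (simp add: sum_diff S_def)
qed

text \<open>A partition of an odd set has an odd block, and the cumulant of that block
  vanishes.\<close>

lemma odd_moment:
 assumes "odd (length \<epsilon>)" shows "\<tau> (wd a \<epsilon>) = 0"
proof -
 let ?n = "length \<epsilon>"
 have "(\<Prod>V\<in>\<pi>. kap ((!) \<epsilon>) V) = 0" if p: "\<pi> \<in> NCS {..<?n}" for \<pi>
 proof -
  have f: "finite \<pi>" by (rule finite_NCS_member[OF p]) simp
  have "card (\<Union>\<pi>) = sum card \<pi>"
  proof (rule card_Union_disjoint)
   show "disjoint \<pi>" using p by (auto simp: NCS_def partition_on_def)
   show "finite A" if "A \<in> \<pi>" for A using NCS_block[OF p that] finite_subset by blast
  qed
  moreover have "\<Union>\<pi> = {..<?n}" using p by (auto simp: NCS_def partition_on_def)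
  ultimately have "odd (sum card \<pi>)" using assms by simp
  then obtain V where "V \<in> \<pi>" "odd (card V)" using dvd_sum by metis
  thus ?thesis using f kap_zero by (auto intro!: prod_zero)
 qed
 hence "\<tau> (wd a (map ((!) \<epsilon>) (sorted_list_of_set {..<?n}))) = 0" by (subst moment_cumulant) (auto intro: sum.neutral)
 moreover have "map ((!) \<epsilon>) (sorted_list_of_set {..<?n}) = \<epsilon>" by (simp add: lessThan_atLeast0 map_nth)
 ultimately show ?thesis by simp
qed

text \<open>By \<open>piece_moments\<close> only partitions that split off none of the words
  contribute, and \<open>alternating_words_block\<close> provides each of them with a block of
  vanishing cumulant.\<close>

lemma alternating_centred_zero:
 assumes ws: "ws ~= []" "!!w. w \<in> set ws ==> w ~= [] & distinct_adj w"
  and j: "!!i. Suc i < length ws ==> last (ws ! i) = hd (ws ! Suc i)"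
 shows "\<tau> (prod_list (map (%w. wd a w - cs (\<tau> (wd a w))) ws)) = 0"
proof -
 have "\<exists>Is l. concat Is = [n..<n + length (concat ws)] & map (map l) Is = ws" for n
 proof -
  have *: "\<exists>Is. concat Is = [n..<n + length (concat vs)] & map (map (%i. concat ws ! (i - n0))) Is = vs"
   if "concat ws = us @ concat vs" "n = n0 + length us" for n n0 us vs using that
  proof (induction vs arbitrary: n us)
   case (Cons v vs)
   obtain Is where Is: "concat Is = [n + length v..<n + length v + length (concat vs)]" "map (map (%i. concat ws ! (i - n0))) Is = vs"
    using Cons.IH[of "us @ v" "n + length v"] Cons.prems by auto
   have "map (%i. concat ws ! (i - n0)) [n..<n + length v] = v" using Cons.prems by (intro nth_equalityI) (auto simp: nth_append)
   moreover have "[n..<n + length (concat (v # vs))] = [n..<n + length v] @ [n + length v..<n + length v + length (concat vs)]"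
    using upt_add_eq_append[of n "n + length v" "length (concat vs)"] by (simp add: add.assoc)
   ultimately show ?case using Is by (intro exI[of _ "[n..<n + length v] # Is"]) (simp only: concat.simps list.map)
  qed simp
  show ?thesis using *[of "[]" ws n n] by auto
 qed
 then obtain Is l where Is: "concat Is = [0..<length (concat ws)]" "map (map l) Is = ws" by (metis add_0)
 have len: "length Is = length ws" using Is(2) by auto
 have nth: "map l (Is ! i) = ws ! i" if "i < length Is" for i using Is(2) that by (metis nth_map)
 have ne: "Is ! i ~= []" "distinct_adj (map l (Is ! i))" if "i < length Is" for i
  using nth[OF that] ws(2)[of "ws ! i"] that len by auto
 have jn: "l (last (Is ! i)) = l (hd (Is ! Suc i))" if "Suc i < length Is" for i
  using j[of i] that len nth[of i] nth[of "Suc i"] ne by (metis Suc_lessD hd_map last_map)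
 define ps where "ps = map (Pair True) Is"
 have c: "concat (map snd ps) = concat Is" by (simp add: ps_def comp_def)
 have s: "sorted_wrt (<) (concat Is)" unfolding Is(1) by simp
 have "(\<Prod>V\<in>\<pi>. kap l V) = 0" if p: "\<pi> \<in> NCS (set (concat Is))" "unsplit ps \<pi>" for \<pi>
 proof -
  have "\<exists>V\<in>\<pi>. odd (card V) \<or> \<not> distinct_adj (map l (sorted_list_of_set V))"
  proof (rule alternating_words_block[OF s _ ne(1) ne(2) jn p(1)])
   show "Is ~= []" using ws(1) len by auto
   show "\<not> splits \<pi> (set (Is ! i))" if "i < length Is" for i using p(2) that by (auto simp: unsplit_def ps_def)
  qed
  moreover have "finite \<pi>" by (rule finite_NCS_member[OF p(1)]) simp
  ultimately show ?thesis using kap_zero by (auto intro!: prod_zero)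
 qed
 hence "\<tau> (prod_list (map (piece l) ps)) = 0" using piece_moments[of ps l] s unfolding c by simp
 moreover have "map (piece l) ps = map (%w. wd a w - cs (\<tau> (wd a w))) ws"
  unfolding ps_def Is(2)[symmetric] by (simp add: piece_def)
 ultimately show ?thesis by simp
qed

end

section \<open>Approximation in a von Neumann algebra\<close>

text \<open>The Hilbert space of square-summable sequences in H, on which operators act termwise
  through \<open>amp\<close>. In this amplification a normal functional is controlled by a single
  vector, see \<open>normal_bounds\<close>.\<close>

typedef (overloaded) 'h ell2 = "{f :: nat => 'h::real_inner. summable (%n. (norm (f n))\<^sup>2)}"
 morphisms seq_of ell2_of by (rule exI[of _ "%_. 0"]) simp

setup_lifting type_definition_ell2

lemma norm_add_square_le: "(norm (x + y))\<^sup>2 <= 2 * (norm x)\<^sup>2 + 2 * (norm (y :: 'h::real_inner))\<^sup>2"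
proof -
 have "0 <= (norm (x - y))\<^sup>2" by simp
 thus ?thesis by (simp add: power2_norm_eq_inner inner_simps inner_commute)
qed

lemma ell2_add:
 fixes f g :: "nat => 'h::real_inner"
 assumes "summable (%n. (norm (f n))\<^sup>2)" "summable (%n. (norm (g n))\<^sup>2)"
 shows "summable (%n. (norm (f n + g n))\<^sup>2)"
proof (rule summable_comparison_test')
 show "summable (%n. 2 * (norm (f n))\<^sup>2 + 2 * (norm (g n))\<^sup>2)" by (intro summable_add summable_mult assms)
qed (simp add: norm_add_square_le)

lemma ell2_inner:
 fixes f g :: "nat => 'h::real_inner"
 assumes "summable (%n. (norm (f n))\<^sup>2)" "summable (%n. (norm (g n))\<^sup>2)"
 shows "summable (%n. inner (f n) (g n))"
proof (rule summable_comparison_test')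
 show "summable (%n. (norm (f n))\<^sup>2 + (norm (g n))\<^sup>2)" by (intro summable_add assms)
 show "norm (inner (f n) (g n)) <= (norm (f n))\<^sup>2 + (norm (g n))\<^sup>2" for n
  using Cauchy_Schwarz_ineq2[of "f n" "g n"] sum_squares_bound[of "norm (f n)" "norm (g n)"]
   zero_le_power2[of "norm (f n)"] zero_le_power2[of "norm (g n)"] by (simp add: mult.assoc)
qed

instantiation ell2 :: (real_inner) "{zero, plus, uminus, minus, scaleR}"
begin
lift_definition zero_ell2 :: "'a ell2" is "%_. 0" by simp
lift_definition plus_ell2 :: "'a ell2 => 'a ell2 => 'a ell2" is "%f g n. f n + g n" by (rule ell2_add)
lift_definition scaleR_ell2 :: "real => 'a ell2 => 'a ell2" is "%r f n. r *\<^sub>R f n"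
 by (simp add: power_mult_distrib summable_mult)
lift_definition uminus_ell2 :: "'a ell2 => 'a ell2" is "%f n. - f n" by simp
definition minus_ell2 :: "'a ell2 => 'a ell2 => 'a ell2" where "minus_ell2 f g = f + - g"
instance ..
end

instantiation ell2 :: (real_inner) real_inner
begin
lift_definition inner_ell2 :: "'a ell2 => 'a ell2 => real" is "%f g. \<Sum>n. inner (f n) (g n)" .
definition norm_ell2 :: "'a ell2 => real" where "norm_ell2 f = sqrt (inner f f)"
definition dist_ell2 :: "'a ell2 => 'a ell2 => real" where "dist_ell2 x y = norm (x - y)"
definition sgn_ell2 :: "'a ell2 => 'a ell2" where "sgn_ell2 x = x /\<^sub>R norm x"
definition uniformity_ell2 :: "('a ell2 \<times> 'a ell2) filter"
 where "uniformity_ell2 = (INF e\<in>{0<..}. principal {(x, y). dist x y < e})"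
definition open_ell2 :: "'a ell2 set => bool"
 where "open_ell2 U = (\<forall>x\<in>U. \<forall>\<^sub>F (x', y) in uniformity. x' = x --> y \<in> U)"
instance
proof
 fix x y z :: "'a ell2" and r s :: real
 show "x + y + z = x + (y + z)" "x + y = y + x" "0 + x = x" "- x + x = 0" by (transfer; simp add: ac_simps)+
 show "x - y = x + - y" by (rule minus_ell2_def)
 show "r *\<^sub>R (x + y) = r *\<^sub>R x + r *\<^sub>R y" "(r + s) *\<^sub>R x = r *\<^sub>R x + s *\<^sub>R x" "r *\<^sub>R s *\<^sub>R x = (r * s) *\<^sub>R x" "1 *\<^sub>R x = x"
  by (transfer; simp add: scaleR_add_right scaleR_add_left)+
 show "dist x y = norm (x - y)" "sgn x = x /\<^sub>R norm x" "norm x = sqrt (inner x x)"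
  by (simp_all add: dist_ell2_def sgn_ell2_def norm_ell2_def)
 show "uniformity = (INF e\<in>{0<..}. principal {(x, y :: 'a ell2). dist x y < e})" by (rule uniformity_ell2_def)
 show "open U = (\<forall>x\<in>U. \<forall>\<^sub>F (x', y) in uniformity. x' = x --> y \<in> U)" for U :: "'a ell2 set" by (rule open_ell2_def)
 show "inner x y = inner y x" by (transfer; simp add: inner_commute)
 show "inner (x + y) z = inner x z + inner y z" by (transfer; simp add: inner_add_left suminf_add ell2_inner)
 show "inner (r *\<^sub>R x) y = r * inner x y" by (transfer; simp add: suminf_mult ell2_inner)
 show "0 <= inner x x" by (transfer; simp add: suminf_nonneg ell2_inner)
 show "inner x x = 0 \<longleftrightarrow> x = 0" by (transfer; simp add: suminf_eq_zero_iff ell2_inner fun_eq_iff)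
qed
end

lemma seq_of_simps [simp]: "seq_of (x + y) n = seq_of x n + seq_of y n" "seq_of (x - y) n = seq_of x n - seq_of y n"
 "seq_of (r *\<^sub>R x) n = r *\<^sub>R seq_of x n" "seq_of 0 n = 0" unfolding minus_ell2_def by (transfer; simp)+

lemma seq_of_eqI: "(!!n. seq_of x n = seq_of y n) ==> x = y" by transfer auto

lemma seq_of_summable: "summable (%n. (norm (seq_of x n))\<^sup>2)" using seq_of by blast

lemma norm_ell2_square: "(norm x)\<^sup>2 = (\<Sum>n. (norm (seq_of x n))\<^sup>2)"
 unfolding power2_norm_eq_inner inner_ell2.rep_eq by simp

lemma norm_seq_of_le: "norm (seq_of x n) <= norm x"
 by (rule power2_le_imp_le) (use sum_le_suminf[OF seq_of_summable, of "{n}" x] in "auto simp: norm_ell2_square")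

instance ell2 :: ("{real_inner, complete_space}") complete_space
proof
 fix F :: "nat => 'a ell2" assume F: "Cauchy F"
 have "Cauchy (%m. seq_of (F m) n)" for n
 proof (rule CauchyI)
  fix e :: real assume "e > 0"
  then obtain M where "!!m k. m >= M ==> k >= M ==> norm (F m - F k) < e" using CauchyD[OF F] by blast
  thus "\<exists>M. \<forall>m\<ge>M. \<forall>k\<ge>M. norm (seq_of (F m) n - seq_of (F k) n) < e"
   using le_less_trans[OF norm_seq_of_le[of "F _ - F _" n, simplified]] by blast
 qed
 moreover define f where "f n = lim (%m. seq_of (F m) n)" for n
 ultimately have f: "(%m. seq_of (F m) n) \<longlonglongrightarrow> f n" for n by (simp add: Cauchy_convergent_iff convergent_LIMSEQ_iff)
 have bd: "\<exists>M. \<forall>m\<ge>M. \<forall>N. (\<Sum>n<N. (norm (f n - seq_of (F m) n))\<^sup>2) <= e\<^sup>2" if e: "e > 0" for e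
 proof -
  obtain M where M: "!!m k. m >= M ==> k >= M ==> norm (F k - F m) < e" using CauchyD[OF F e] by blast
  have "(\<Sum>n<N. (norm (f n - seq_of (F m) n))\<^sup>2) <= e\<^sup>2" if m: "m >= M" for m N
  proof (rule LIMSEQ_le_const2)
   show "(%k. \<Sum>n<N. (norm (seq_of (F k) n - seq_of (F m) n))\<^sup>2) \<longlonglongrightarrow> (\<Sum>n<N. (norm (f n - seq_of (F m) n))\<^sup>2)"
    by (intro tendsto_intros f)
   have "(\<Sum>n<N. (norm (seq_of (F k) n - seq_of (F m) n))\<^sup>2) <= e\<^sup>2" if "k >= M" for k
   proof -
    have "(\<Sum>n<N. (norm (seq_of (F k - F m) n))\<^sup>2) <= (norm (F k - F m))\<^sup>2"
     unfolding norm_ell2_square by (rule sum_le_suminf[OF seq_of_summable]) auto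
    also have "... <= e\<^sup>2" using M[OF m that] by (intro power_mono) auto
    finally show ?thesis by simp
   qed
   thus "\<exists>N'. \<forall>k\<ge>N'. (\<Sum>n<N. (norm (seq_of (F k) n - seq_of (F m) n))\<^sup>2) <= e\<^sup>2" by blast
  qed
  thus ?thesis by blast
 qed
 have s: "summable (%n. (norm (f n - seq_of (F m) n))\<^sup>2)" if "!!N. (\<Sum>n<N. (norm (f n - seq_of (F m) n))\<^sup>2) <= c" for m c
  by (rule summableI_nonneg_bounded[of _ c]) (use that in auto)
 obtain M1 where "!!N. (\<Sum>n<N. (norm (f n - seq_of (F M1) n))\<^sup>2) <= 1\<^sup>2" using bd[of 1] by auto
 from ell2_add[OF s[OF this] seq_of_summable[of "F M1"]] have fs: "summable (%n. (norm (f n))\<^sup>2)" by simp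
 define G where "G = ell2_of f"
 have G: "seq_of G n = f n" for n unfolding G_def using fs by (subst ell2_of_inverse) auto
 have "F \<longlonglongrightarrow> G"
 proof (rule LIMSEQ_I)
  fix e :: real assume e: "e > 0"
  then obtain M where M: "!!m N. m >= M ==> (\<Sum>n<N. (norm (f n - seq_of (F m) n))\<^sup>2) <= (e / 2)\<^sup>2" using bd[of "e / 2"] by auto
  have "norm (F m - G) < e" if "m >= M" for m
  proof -
   have "(norm (G - F m))\<^sup>2 <= (e / 2)\<^sup>2"
    unfolding norm_ell2_square by (rule suminf_le_const) (use s[OF M[OF that]] M[OF that] in "auto simp: G")
   hence "norm (G - F m) <= e / 2" by (rule power2_le_imp_le) (use e in simp)
   thus ?thesis using e by (simp add: norm_minus_commute)
  qed
  thus "\<exists>M. \<forall>m\<ge>M. norm (F m - G) < e" by blast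
 qed
 thus "convergent F" by (auto simp: convergent_def)
qed

lift_definition amp :: "'h::complex_hilbert_space bop => 'h ell2 => 'h ell2" is "%T f n. ap T (f n)"
proof -
 fix T :: "'h bop" and f :: "nat => 'h" assume f: "summable (%n. (norm (f n))\<^sup>2)"
 show "summable (%n. (norm (ap T (f n)))\<^sup>2)"
 proof (rule summable_comparison_test')
  show "summable (%n. (norm T)\<^sup>2 * (norm (f n))\<^sup>2)" by (rule summable_mult[OF f])
  show "norm ((norm (ap T (f n)))\<^sup>2) <= (norm T)\<^sup>2 * (norm (f n))\<^sup>2" for n
   using power_mono[OF norm_ap[of T "f n"], of 2] by (simp add: power_mult_distrib)
 qed
qed

lift_definition delta :: "nat => 'h::real_inner => 'h ell2" is "%n y m. if m = n then y else 0"
 by (rule summable_finite[of "{n}" for n]) auto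

lemma seq_of_amp [simp]: "seq_of (amp T f) n = ap T (seq_of f n)" by transfer simp

lemma seq_of_delta [simp]: "seq_of (delta n y) m = (if m = n then y else 0)" by transfer simp

lemma amp_linear: "amp T (x + y) = amp T x + amp T y" "amp T (r *\<^sub>R x) = r *\<^sub>R amp T x" "amp T (x - y) = amp T x - amp T y"
 "amp (T + U) x = amp T x + amp U x" "amp (T - U) x = amp T x - amp U x" "amp (r *\<^sub>R T) x = r *\<^sub>R amp T x" "amp (T * U) x = amp T (amp U x)"
 "amp T 0 = 0" "amp 1 x = x" "amp T (delta n u) = delta n (ap T u)" by (rule seq_of_eqI; simp)+

lemma norm_amp: "norm (amp T f) <= norm T * norm f"
proof (rule power2_le_imp_le)
 have "(norm (amp T f))\<^sup>2 <= (\<Sum>n. (norm T)\<^sup>2 * (norm (seq_of f n))\<^sup>2)" unfolding norm_ell2_square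
 proof (rule suminf_le)
  show "(norm (seq_of (amp T f) n))\<^sup>2 <= (norm T)\<^sup>2 * (norm (seq_of f n))\<^sup>2" for n
   using power_mono[OF norm_ap[of T "seq_of f n"], of 2] by (simp add: power_mult_distrib)
 qed (intro seq_of_summable summable_mult)+
 thus "(norm (amp T f))\<^sup>2 <= (norm T * norm f)\<^sup>2"
  by (simp add: suminf_mult[OF seq_of_summable] norm_ell2_square power_mult_distrib)
qed simp

lemma bounded_linear_amp: "bounded_linear (amp T)"
 by (rule bounded_linear_intro[of _ "norm T"]) (simp_all add: amp_linear norm_amp mult.commute)

lemma inner_amp: "inner (amp T f) g = inner f (amp (adj T) g)"
proof -
 have "inner (ap T x) y = inner x (ap (adj T) y)" for x y by (simp add: inner_eq_Re_cinner cinner_adj')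
 thus ?thesis by (simp add: inner_ell2.rep_eq)
qed

lemma delta_sums: "(%n. delta n (seq_of f n)) sums f" unfolding sums_def
proof (rule LIMSEQ_I)
 fix e :: real assume e: "e > 0"
 have sum: "seq_of (\<Sum>n<N. delta n (seq_of f n)) m = (if m < N then seq_of f m else 0)" for N m by (induction N) auto
 have "(%N. (\<Sum>n. (norm (seq_of f (n + N)))\<^sup>2)) \<longlonglongrightarrow> 0" by (rule suminf_exist_split2[OF seq_of_summable])
 then obtain M where M: "!!N. N >= M ==> norm (\<Sum>n. (norm (seq_of f (n + N)))\<^sup>2) < e\<^sup>2" using LIMSEQ_D[of _ 0 "e\<^sup>2"] e by fastforce
 have "norm ((\<Sum>n<N. delta n (seq_of f n)) - f) < e" if N: "N >= M" for N
 proof (rule power2_less_imp_less)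
  let ?h = "%m. (norm (seq_of ((\<Sum>n<N. delta n (seq_of f n)) - f) m))\<^sup>2"
  have "suminf ?h = (\<Sum>n. ?h (n + N)) + sum ?h {..<N}" by (rule suminf_split_initial_segment[OF seq_of_summable])
  also have "... = (\<Sum>n. (norm (seq_of f (n + N)))\<^sup>2)" by (simp add: sum)
  finally show "(norm ((\<Sum>n<N. delta n (seq_of f n)) - f))\<^sup>2 < e\<^sup>2" using M[OF N] by (simp add: norm_ell2_square)
 qed (use e in simp)
 thus "\<exists>M. \<forall>N\<ge>M. norm ((\<Sum>n<N. delta n (seq_of f n)) - f) < e" by blast
qed

lemma subspace_closure:
 fixes W :: "'a::real_normed_vector set"
 assumes W: "subspace W" shows "subspace (closure W)" unfolding subspace_def
proof (intro conjI ballI allI)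
 show "0 \<in> closure W" using subspace_0[OF W] closure_subset by blast
 fix x assume "x \<in> closure W"
 then obtain u where u: "!!n. u n \<in> W" "u \<longlonglongrightarrow> x" unfolding closure_sequential by blast
 show "c *\<^sub>R x \<in> closure W" for c
  unfolding closure_sequential by (intro exI[of _ "%n. c *\<^sub>R u n"] conjI allI subspace_scale W u tendsto_intros)
 fix y assume "y \<in> closure W"
 then obtain v where v: "!!n. v n \<in> W" "v \<longlonglongrightarrow> y" unfolding closure_sequential by blast
 show "x + y \<in> closure W"
  unfolding closure_sequential by (intro exI[of _ "%n. u n + v n"] conjI allI subspace_add W u v tendsto_intros)
qed

text \<open>The projection onto the closure of the orbit of \<open>\<zeta>\<close> has matrix entries in the commutant.\<close>

lemma bicommutant_dense:
 fixes \<B> :: "'h::complex_hilbert_space bop set"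
 assumes \<B>: "!!c. cs c \<in> \<B>" "!!x y. x \<in> \<B> ==> y \<in> \<B> ==> x + y \<in> \<B>" "!!x y. x \<in> \<B> ==> y \<in> \<B> ==> x * y \<in> \<B>" "!!x. x \<in> \<B> ==> adj x \<in> \<B>"
  and b: "!!X. (!!y. y \<in> \<B> ==> X * y = y * X) ==> X * b = b * X" and e: "e > 0"
 shows "\<exists>T\<in>\<B>. norm (amp (b - T) \<zeta>) < e"
proof -
 define M where "M = closure ((%T. amp T \<zeta>) ` \<B>)"
 have sc: "r *\<^sub>R T \<in> \<B>" if "T \<in> \<B>" for r T using \<B>(3)[OF \<B>(1) that, of "complex_of_real r"] by (simp add: cs_of_real)
 have 0: "0 \<in> \<B>" using \<B>(1)[of 0] by simp
 have "subspace ((%T. amp T \<zeta>) ` \<B>)" unfolding subspace_def using 0 \<B>(2) sc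
  by (auto simp flip: amp_linear(4,6) intro!: image_eqI[of _ _ 0] seq_of_eqI)
 hence M: "closed M" "subspace M" unfolding M_def by (auto intro: subspace_closure)
 have inv: "amp T f \<in> M" if "T \<in> \<B>" "f \<in> M" for T f
 proof -
  have "amp T ` (%T. amp T \<zeta>) ` \<B> \<subseteq> M" unfolding M_def using \<B>(3)[OF that(1)] closure_subset
   by (force simp flip: amp_linear(7))
  moreover have "continuous_on (closure ((%T. amp T \<zeta>) ` \<B>)) (amp T)" by (rule linear_continuous_on[OF bounded_linear_amp])
  ultimately show ?thesis using image_closure_subset[of _ "amp T" M] M(1) that(2) unfolding M_def by blast
 qed
 define P where "P f = (SOME y. y \<in> M & (\<forall>z\<in>M. inner (f - y) z = 0))" for f
 have "P f \<in> M & (\<forall>z\<in>M. inner (f - P f) z = 0)" for f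
  unfolding P_def by (rule someI_ex) (use projection_exists[OF M, of f] in blast)
 hence P: "!!f. P f \<in> M" "!!f z. z \<in> M ==> inner (f - P f) z = 0" by blast+
 have uniq: "P f = y" if "y \<in> M" "!!z. z \<in> M ==> inner (f - y) z = 0" for f y
 proof -
  have "y - P f \<in> M" using M(2) P(1) that(1) by (simp add: subspace_diff)
  from P(2)[OF this, of f] that(2)[OF this] have "inner (y - P f) (y - P f) = 0" by (simp add: inner_diff_left)
  thus ?thesis by simp
 qed
 have Padd: "P (f + g) = P f + P g" for f g
 proof (rule uniq)
  show "P f + P g \<in> M" using M(2) P(1) by (simp add: subspace_add)
  show "inner (f + g - (P f + P g)) z = 0" if "z \<in> M" for z using P(2)[OF that, of f] P(2)[OF that, of g] by (simp add: inner_simps)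
 qed
 have Psc: "P (r *\<^sub>R f) = r *\<^sub>R P f" for r f
 proof (rule uniq)
  show "r *\<^sub>R P f \<in> M" using M(2) P(1) by (simp add: subspace_scale)
  show "inner (r *\<^sub>R f - r *\<^sub>R P f) z = 0" if "z \<in> M" for z using P(2)[OF that, of f] by (simp flip: scaleR_diff_right)
 qed
 have Pamp: "P (amp T f) = amp T (P f)" if T: "T \<in> \<B>" for T f
 proof (rule uniq)
  show "amp T (P f) \<in> M" using inv[OF T P(1)] .
  show "inner (amp T f - amp T (P f)) z = 0" if "z \<in> M" for z
   using P(2)[OF inv[OF \<B>(4)[OF T] that], of f] by (simp add: inner_amp flip: amp_linear(3))
 qed
 have Pn: "norm (P f) <= norm f" for f
 proof -
  have "inner f (P f) = (norm (P f))\<^sup>2" using P(2)[OF P(1), of f f] by (simp add: inner_diff_left power2_norm_eq_inner)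
  hence "norm (P f) * norm (P f) <= norm f * norm (P f)" using norm_cauchy_schwarz[of f "P f"] by (simp add: power2_eq_square)
  thus ?thesis by (cases "norm (P f) = 0") auto
 qed
 have blP: "bounded_linear P" by (rule bounded_linear_intro[of _ 1]) (simp_all add: Padd Psc Pn)
 have nd: "norm (delta n y) <= norm y" for n and y :: 'h
 proof (rule power2_le_imp_le)
  have "(\<Sum>m. (norm (seq_of (delta n y) m))\<^sup>2) = (\<Sum>m\<in>{n}. (norm (seq_of (delta n y) m))\<^sup>2)" by (rule suminf_finite) auto
  thus "(norm (delta n y))\<^sup>2 <= (norm y)\<^sup>2" by (simp add: norm_ell2_square)
 qed simp
 have Pd: "P (delta n (ap b y)) = amp b (P (delta n y))" for n y
 proof (rule seq_of_eqI)
  fix m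
  \<comment> \<open>The matrix entry of \<open>P\<close> from the n-th to the m-th copy of H. It
    commutes with all of \<open>\<B>\<close>, in particular with the scalars, so it is
    complex-linear and the hypothesis on \<open>b\<close> applies to it.\<close>
  define X0 where "X0 = Blinfun (%y. seq_of (P (delta n y)) m)"
  have bl: "bounded_linear (%y. seq_of (P (delta n y)) m)"
  proof (rule bounded_linear_intro[of _ 1])
   have "delta n (x + y) = delta n x + delta n y" "delta n (r *\<^sub>R x) = r *\<^sub>R delta n x" for x y :: 'h and r by (rule seq_of_eqI; simp)+
   thus "seq_of (P (delta n (x + y))) m = seq_of (P (delta n x)) m + seq_of (P (delta n y)) m"
    "seq_of (P (delta n (r *\<^sub>R x))) m = r *\<^sub>R seq_of (P (delta n x)) m" for x y r by (simp_all add: Padd Psc)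
   show "norm (seq_of (P (delta n y)) m) <= norm y * 1" for y
    using norm_seq_of_le[of "P (delta n y)" m] Pn[of "delta n y"] nd[of n y] by simp
  qed
  have X0: "blinfun_apply X0 y = seq_of (P (delta n y)) m" for y unfolding X0_def using bl by (simp add: bounded_linear_Blinfun_apply)
  have co: "seq_of (P (delta n (ap T y))) m = ap T (seq_of (P (delta n y)) m)" if "T \<in> \<B>" for T y
   using Pamp[OF that, of "delta n y"] by (simp add: amp_linear)
  have "X0 \<in> bounded_ops" unfolding bounded_ops_def using co[OF \<B>(1)] by (simp add: X0)
  hence X: "ap (bop_of X0) y = seq_of (P (delta n y)) m" for y by (simp add: ap.rep_eq bop_of_inverse X0)
  have "bop_of X0 * b = b * bop_of X0" by (rule b) (rule bop_eqI, simp add: X co)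
  from arg_cong[OF this, of "%T. ap T y"] show "seq_of (P (delta n (ap b y))) m = seq_of (amp b (P (delta n y))) m" by (simp add: X)
 qed
 have "P (amp b \<zeta>) = amp b (P \<zeta>)"
 proof (rule sums_unique2)
  have "(%n. amp b (delta n (seq_of \<zeta> n))) sums amp b \<zeta>" by (rule bounded_linear.sums[OF bounded_linear_amp delta_sums])
  from bounded_linear.sums[OF blP this] show "(%n. P (delta n (ap b (seq_of \<zeta> n)))) sums P (amp b \<zeta>)" by (simp add: amp_linear)
  have "(%n. amp b (P (delta n (seq_of \<zeta> n)))) sums amp b (P \<zeta>)"
   by (rule bounded_linear.sums[OF bounded_linear_amp bounded_linear.sums[OF blP delta_sums]])
  thus "(%n. P (delta n (ap b (seq_of \<zeta> n)))) sums amp b (P \<zeta>)" by (simp add: Pd)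
 qed
 moreover have "amp 1 \<zeta> \<in> M" unfolding M_def using \<B>(1)[of 1] by (intro subsetD[OF closure_subset]) auto
 hence "P \<zeta> = \<zeta>" by (intro uniq) (auto simp: amp_linear)
 ultimately have "amp b \<zeta> \<in> M" using P(1)[of "amp b \<zeta>"] by simp
 then obtain T where "T \<in> \<B>" "dist (amp T \<zeta>) (amp b \<zeta>) < e" unfolding M_def closure_approachable using e by auto
 thus ?thesis by (intro bexI[of _ T]) (simp_all add: amp_linear dist_norm norm_minus_commute)
qed

text \<open>A form of the Cauchy-Schwarz inequality, from positivity at
  \<open>Y = x + cs (of_real s * d) * adj z\<close>; the phase \<open>d\<close> makes the cross
  terms equal to -2 s times the modulus of the trace of \<open>z * x\<close>.\<close>

lemma (in tracial) tau_small:
 assumes x: "x \<in> AA" and z: "z \<in> AA" and s: "s > 0" "Re (\<tau> (adj x * x)) <= s\<^sup>2"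
 shows "cmod (\<tau> (z * x)) <= s * ((1 + Re (\<tau> (z * adj z))) / 2)"
proof (cases "\<tau> (z * x) = 0")
 case True
 have "0 <= Re (\<tau> (z * adj z))" using Re_tau_pos[of "adj z"] z by simp
 thus ?thesis using s(1) True by simp
next
 case False
 define w where "w = \<tau> (z * x)"
 define d where "d = - (w / of_real (cmod w))"
 have d: "cnj d * w = - of_real (cmod w)" "cnj d * d = 1"
  using False complex_norm_square[of w] by (simp_all add: d_def w_def[symmetric] power2_eq_square field_simps complex_cnj_divide)
 define Y where "Y = x + cs (of_real s * d) * adj z"
 have e1: "adj Y * Y = adj x * x + cs (of_real s * d) * (adj x * adj z) + cs (of_real s * cnj d) * (z * x) + cs (of_real s * of_real s * (cnj d * d)) * (z * adj z)"
  unfolding Y_def by (simp add: distrib_left distrib_right mult.assoc cs_commute[of z] cs_left_commute[of z] cs_left_commute[of "adj x"] del: cs_simps(6))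
   (simp add: mult.assoc cs_left_commute[of "cs _"])
 have "\<tau> (adj x * adj z) = cnj w" using tau_adj[of "z * x"] x z by (simp add: w_def)
 hence "\<tau> (adj Y * Y) = \<tau> (adj x * x) + of_real s * cnj (cnj d * w) + of_real s * (cnj d * w) + of_real s * of_real s * \<tau> (z * adj z)"
  unfolding e1 using x z by (simp add: tau_add tau_cs w_def d(2) del: cs_simps(6))
 hence "Re (\<tau> (adj Y * Y)) = Re (\<tau> (adj x * x)) - 2 * s * cmod w + s * s * Re (\<tau> (z * adj z))" unfolding d(1) by simp
 moreover have "0 <= Re (\<tau> (adj Y * Y))" unfolding Y_def using x z by (intro Re_tau_pos) auto
 ultimately have "2 * s * cmod w <= s * (s * (1 + Re (\<tau> (z * adj z))))" using s(2) by (simp add: power2_eq_square algebra_simps)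
 hence "2 * cmod w <= s * (1 + Re (\<tau> (z * adj z)))" using s(1) by (simp add: mult.assoc mult.left_commute[of 2])
 thus ?thesis by (simp add: w_def)
qed

lemma prod_le_squares: "0 <= x ==> 0 <= y ==> x * y <= x\<^sup>2 + (y :: real)\<^sup>2"
 using sum_squares_bound[of x y] mult_nonneg_nonneg[of x y] by linarith

lemma op_of_in [simp]: "op_of x \<in> bounded_ops" by (rule op_of)

lemma mem_commutant: "op_of x \<in> commutant S \<longleftrightarrow> (\<forall>y. op_of y \<in> S --> x * y = y * x)" if "S \<subseteq> bounded_ops"
proof -
 have "op_of x o\<^sub>L op_of y = op_of y o\<^sub>L op_of x \<longleftrightarrow> x * y = y * x" for y by (simp add: op_of_inject flip: op_of_mult)
 thus ?thesis using that by (auto simp: commutant_def) (metis bop_of_inverse subsetD)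
qed

lemma commutant_bounded: "commutant S \<subseteq> bounded_ops" by (auto simp: commutant_def)

section \<open>Density in the 2-norm and freeness of the generated von Neumann algebra\<close>

context wstar_probability_space
begin

definition AA :: "'h bop set" where "AA = {x. op_of x \<in> A}"

abbreviation "\<tau> \<equiv> %y. \<phi> (op_of y)"

lemma A_bounded: "A \<subseteq> bounded_ops" using von_neumann by (simp add: von_neumann_algebra_def)

lemma mem_A: "op_of x \<in> A \<longleftrightarrow> (\<forall>y. op_of y \<in> commutant A --> x * y = y * x)"
 using mem_commutant[OF commutant_bounded, of x A] von_neumann by (simp add: von_neumann_algebra_def)

lemma ell2_bound:
 fixes f g :: "'h ell2"
 assumes "!!n. cmod (c n) <= r * ((norm (seq_of f n))\<^sup>2 + (norm (seq_of g n))\<^sup>2)"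
 shows "cmod (\<Sum>n. c n) <= r * ((norm f)\<^sup>2 + (norm g)\<^sup>2)"
proof -
 have s: "(%n. r * ((norm (seq_of f n))\<^sup>2 + (norm (seq_of g n))\<^sup>2)) sums (r * ((norm f)\<^sup>2 + (norm g)\<^sup>2))"
  unfolding norm_ell2_square by (intro sums_mult sums_add summable_sums seq_of_summable)
 show ?thesis using suminf_le_const norm_suminf_le[OF assms sums_summable[OF s]] sums_unique[OF s] by simp
qed

lemma cinner_bound: "cmod (cinner x y) <= (norm x)\<^sup>2 + (norm (y :: 'h))\<^sup>2"
 using order_trans[OF cmod_cinner_le prod_le_squares[of "norm x" "norm y"]] by simp

lemma merge_two: "\<exists>Z. \<forall>X. (norm (amp X f))\<^sup>2 + (norm (amp X g))\<^sup>2 = (norm (amp X Z))\<^sup>2" for f g :: "'h ell2"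
proof -
 define h where "h n = (if even n then seq_of f (n div 2) else seq_of g ((n - 1) div 2))" for n
 have s: "(%n. (norm (ap X (h n)))\<^sup>2) sums ((norm (amp X f))\<^sup>2 + (norm (amp X g))\<^sup>2)" for X
 proof -
  have "(%n. (norm (ap X (h n)))\<^sup>2) = (%n. if even n then (norm (seq_of (amp X f) (n div 2)))\<^sup>2
   else (norm (seq_of (amp X g) ((n - 1) div 2)))\<^sup>2)" by (auto simp: h_def)
  thus ?thesis using sums_if[OF summable_sums[OF seq_of_summable[of "amp X g"]] summable_sums[OF seq_of_summable[of "amp X f"]]]
   unfolding norm_ell2_square by (simp add: add.commute)
 qed
 have "summable (%n. (norm (h n))\<^sup>2)" using sums_summable[OF s[of 1]] by simp
 hence "seq_of (ell2_of h) = h" by (simp add: ell2_of_inverse)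
 hence "(norm (amp X (ell2_of h)))\<^sup>2 = (norm (amp X f))\<^sup>2 + (norm (amp X g))\<^sup>2" for X
  using sums_unique[OF s[of X]] by (simp add: norm_ell2_square)
 thus ?thesis by metis
qed

text \<open>The finitely many pairs of sequences of the normal functional are interleaved into one
  vector \<open>Z\<close>. On \<open>adj X * X\<close> the trace is then at most the squared norm of
  \<open>amp X Z\<close>, the quantity that \<open>bicommutant_dense\<close> makes small.\<close>

lemma normal_bounds:
 shows "\<exists>K. \<forall>x\<in>AA. cmod (\<tau> x) <= K * norm x" "\<exists>Z. \<forall>X. adj X * X \<in> AA --> cmod (\<tau> (adj X * X)) <= (norm (amp X Z))\<^sup>2"
proof -
 obtain m :: nat and \<xi> \<eta> :: "nat => nat => 'h" where
  s: "!!i. i < m ==> summable (%n. (norm (\<xi> i n))\<^sup>2) & summable (%n. (norm (\<eta> i n))\<^sup>2)" and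
  b: "!!T. T \<in> A ==> cmod (\<phi> T) <= (\<Sum>i<m. cmod (\<Sum>n. cinner (\<xi> i n) (blinfun_apply T (\<eta> i n))))"
  using normal unfolding normal_functional_def by blast
 define x y where "x i = ell2_of (\<xi> i)" and "y i = ell2_of (\<eta> i)" for i
 have xy: "seq_of (x i) n = \<xi> i n" "seq_of (y i) n = \<eta> i n" if "i < m" for i n
  using s[OF that] by (simp_all add: x_def y_def ell2_of_inverse)
 have "cmod (\<tau> X) <= (\<Sum>i<m. (norm (x i))\<^sup>2 + (norm (y i))\<^sup>2) * norm X" if "X \<in> AA" for X
 proof -
  have "cmod (\<Sum>n. cinner (\<xi> i n) (blinfun_apply (op_of X) (\<eta> i n))) <= norm X * ((norm (x i))\<^sup>2 + (norm (y i))\<^sup>2)" if i: "i < m" for i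
  proof (rule ell2_bound)
   fix n
   have "cmod (cinner (\<xi> i n) (ap X (\<eta> i n))) <= norm (\<xi> i n) * (norm X * norm (\<eta> i n))"
    by (rule order_trans[OF cmod_cinner_le]) (intro mult_left_mono norm_ap norm_ge_zero)
   also have "... = norm X * (norm (\<xi> i n) * norm (\<eta> i n))" by simp
   also have "... <= norm X * ((norm (\<xi> i n))\<^sup>2 + (norm (\<eta> i n))\<^sup>2)"
    by (intro mult_left_mono prod_le_squares norm_ge_zero)
   finally show "cmod (cinner (\<xi> i n) (blinfun_apply (op_of X) (\<eta> i n))) <= norm X * ((norm (seq_of (x i) n))\<^sup>2 + (norm (seq_of (y i) n))\<^sup>2)"
    using i by (simp add: xy ap.rep_eq)
  qed
  hence "cmod (\<tau> X) <= (\<Sum>i<m. norm X * ((norm (x i))\<^sup>2 + (norm (y i))\<^sup>2))"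
   using that by (intro order_trans[OF b] sum_mono) (auto simp: AA_def)
  thus ?thesis by (simp add: sum_distrib_left[symmetric] mult.commute)
 qed
 thus "\<exists>K. \<forall>x\<in>AA. cmod (\<tau> x) <= K * norm x" by blast
 have "\<exists>Z. \<forall>X. (\<Sum>i<n. (norm (amp X (x i)))\<^sup>2 + (norm (amp X (y i)))\<^sup>2) = (norm (amp X Z))\<^sup>2" for n
 proof (induction n)
  case 0
  have "amp X 0 = 0" for X :: "'h bop" by (rule seq_of_eqI) simp
  thus ?case by (intro exI[of _ 0]) simp
 next
  case (Suc n)
  then obtain Z where Z: "!!X. (\<Sum>i<n. (norm (amp X (x i)))\<^sup>2 + (norm (amp X (y i)))\<^sup>2) = (norm (amp X Z))\<^sup>2" by blast
  obtain Y where Y: "!!X. (norm (amp X (x n)))\<^sup>2 + (norm (amp X (y n)))\<^sup>2 = (norm (amp X Y))\<^sup>2" using merge_two by blast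
  obtain W where "!!X. (norm (amp X Z))\<^sup>2 + (norm (amp X Y))\<^sup>2 = (norm (amp X W))\<^sup>2" using merge_two by blast
  thus ?case by (intro exI[of _ W]) (simp add: Z Y)
 qed
 then obtain Z where Z: "!!X. (\<Sum>i<m. (norm (amp X (x i)))\<^sup>2 + (norm (amp X (y i)))\<^sup>2) = (norm (amp X Z))\<^sup>2" by blast
 have "cmod (\<tau> (adj X * X)) <= (norm (amp X Z))\<^sup>2" if "adj X * X \<in> AA" for X
 proof -
  have "cmod (\<Sum>n. cinner (\<xi> i n) (blinfun_apply (op_of (adj X * X)) (\<eta> i n))) <= 1 * ((norm (amp X (x i)))\<^sup>2 + (norm (amp X (y i)))\<^sup>2)" if i: "i < m" for i
  proof (rule ell2_bound)
   fix n
   have "cinner (\<xi> i n) (blinfun_apply (op_of (adj X * X)) (\<eta> i n)) = cinner (ap X (\<xi> i n)) (ap X (\<eta> i n))"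
    by (simp add: cinner_adj' flip: ap.rep_eq)
   thus "cmod (cinner (\<xi> i n) (blinfun_apply (op_of (adj X * X)) (\<eta> i n))) <= 1 * ((norm (seq_of (amp X (x i)) n))\<^sup>2 + (norm (seq_of (amp X (y i)) n))\<^sup>2)"
    using i cinner_bound[of "ap X (\<xi> i n)" "ap X (\<eta> i n)"] by (simp add: xy)
  qed
  thus ?thesis unfolding Z[symmetric] using that by (intro order_trans[OF b] sum_mono) (auto simp: AA_def)
 qed
 thus "\<exists>Z. \<forall>X. adj X * X \<in> AA --> cmod (\<tau> (adj X * X)) <= (norm (amp X Z))\<^sup>2" by blast
qed

lemma tracial_AA: "tracial AA \<tau>"
proof
 note [simp] = AA_def plus_bop.rep_eq op_of_mult cs.rep_eq op_of_adj one_bop.rep_eq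
 show "cs c \<in> AA" for c by (simp add: mem_A cs_commute del: cs.rep_eq)
 show add_in: "x + y \<in> AA" "x * y \<in> AA" if "x \<in> AA" "y \<in> AA" for x y
  using that unfolding AA_def mem_Collect_eq mem_A by (simp_all add: distrib_left distrib_right) (metis mult.assoc)
 show "adj x \<in> AA" if "x \<in> AA" for x using that von_neumann by (simp add: von_neumann_algebra_def)
 have "AA = (\<Inter>y\<in>{y. op_of y \<in> commutant A}. {x. x * y = y * x})" by (auto simp: AA_def mem_A)
 thus "closed AA" by (auto simp del: AA_def intro!: closed_Collect_eq continuous_intros)
 show "\<tau> (x + y) = \<tau> x + \<tau> y" if "x \<in> AA" "y \<in> AA" for x y using add that by simp
 show "\<tau> (cs c * x) = c * \<tau> x" if "x \<in> AA" for c x using scale that by simp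
 show "\<tau> (adj x * x) \<in> \<real>\<^sub>\<ge>\<^sub>0" if "x \<in> AA" for x using positive that by simp
 show "\<tau> 1 = 1" using unit by simp
 show "\<tau> (x * y) = \<tau> (y * x)" if "x \<in> AA" "y \<in> AA" for x y using tracial that by simp
 show "\<exists>K. \<forall>x\<in>AA. cmod (\<tau> x) <= K * norm x" by (rule normal_bounds(1))
qed

definition gen :: "'h bop => 'h bop set" where
 "gen u = {x. op_of x \<in> generated_vn_algebra {op_of u}}"

definition alg_gen :: "'h bop => 'h bop set" where
 "alg_gen u = {x. op_of x \<in> star_algebra_generated {op_of u}}"

lemma alg_gen_intros: "u \<in> alg_gen u" "cs c \<in> alg_gen u" "x \<in> alg_gen u ==> adj x \<in> alg_gen u"
 "x \<in> alg_gen u ==> y \<in> alg_gen u ==> x + y \<in> alg_gen u" "x \<in> alg_gen u ==> y \<in> alg_gen u ==> x * y \<in> alg_gen u"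
 by (auto simp: alg_gen_def plus_bop.rep_eq op_of_mult cs.rep_eq op_of_adj intro: star_algebra_generated.intros)

lemma alg_gen_sub: assumes "u \<in> AA" shows "alg_gen u \<subseteq> AA"
proof -
 interpret tracial AA \<tau> by (rule tracial_AA)
 have *: "\<exists>x. T = op_of x & x \<in> AA" if "T \<in> star_algebra_generated {op_of u}" for T using that
 proof induction
  case (2 c) show ?case using cs_in[of c] by (intro exI[of _ "cs c"]) (simp add: cs.rep_eq)
 next
  case (3 T) thus ?case using adj_in by (metis op_of_adj)
 next
  case (4 T R) thus ?case using add_in by (metis plus_bop.rep_eq)
 next
  case (5 T R) thus ?case using mult_in by (metis op_of_mult)
 qed (use assms in blast)
 show ?thesis
 proof
  fix x assume "x \<in> alg_gen u"
  hence "op_of x \<in> star_algebra_generated {op_of u}" by (simp add: alg_gen_def)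
  from *[OF this] show "x \<in> AA" by (auto simp: op_of_inject)
 qed
qed

lemma mem_gen: "x \<in> gen u \<longleftrightarrow> (\<forall>X. X * u = u * X --> X * adj u = adj u * X --> x * X = X * x)"
proof -
 have "{op_of u} \<union> adj_op ` {op_of u} = op_of ` {u, adj u}" by (auto simp: op_of_adj)
 moreover have "op_of X \<in> commutant (op_of ` {u, adj u}) \<longleftrightarrow> X * u = u * X & X * adj u = adj u * X" for X
  by (subst mem_commutant) (auto simp: op_of_inject)
 ultimately show ?thesis unfolding gen_def generated_vn_algebra_def mem_Collect_eq by (subst mem_commutant[OF commutant_bounded]) auto
qed

lemma gen_intros: "u \<in> gen u" "cs c \<in> gen u" "x \<in> gen u ==> adj x \<in> gen u"
 "x \<in> gen u ==> y \<in> gen u ==> x + y \<in> gen u" "x \<in> gen u ==> y \<in> gen u ==> x * y \<in> gen u"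
proof -
 show "u \<in> gen u" "cs c \<in> gen u" by (auto simp: mem_gen cs_commute)
 show "x + y \<in> gen u" if "x \<in> gen u" "y \<in> gen u" using that by (auto simp: mem_gen distrib_left distrib_right)
 show "x * y \<in> gen u" if "x \<in> gen u" "y \<in> gen u" using that unfolding mem_gen by (metis mult.assoc)
 show "adj x \<in> gen u" if "x \<in> gen u" unfolding mem_gen
 proof (intro allI impI)
  fix X assume "X * u = u * X" "X * adj u = adj u * X"
  hence "adj X * adj u = adj u * adj X" "adj X * u = u * adj X" by (metis adj_simps(1,7))+
  hence "x * adj X = adj X * x" using that by (simp add: mem_gen)
  thus "adj x * X = X * adj x" by (metis adj_simps(1,7))
 qed
qed

lemma gen_sub: assumes "u \<in> AA" shows "gen u \<subseteq> AA"
proof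
 fix x assume x: "x \<in> gen u"
 have "op_of (adj u) \<in> A" using tracial.adj_in[OF tracial_AA assms] by (simp add: AA_def)
 thus "x \<in> AA" using x assms mem_A[of u] mem_A[of "adj u"] unfolding mem_gen AA_def by (simp add: mem_A)
qed

text \<open>\<open>bicommutant_dense\<close> for the star-algebra of \<open>u\<close>, at the vector
  that dominates the trace, gives approximation in the 2-norm.\<close>

lemma gen_approx:
 assumes u: "u \<in> AA" and b: "b \<in> gen u" and e: "e > 0"
 shows "\<exists>T\<in>alg_gen u. cmod (\<tau> (adj (b - T) * (b - T))) < e"
proof -
 interpret tracial AA \<tau> by (rule tracial_AA)
 obtain Z where Z: "!!X. adj X * X \<in> AA ==> cmod (\<tau> (adj X * X)) <= (norm (amp X Z))\<^sup>2" using normal_bounds(2) by blast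
 have "\<exists>T\<in>alg_gen u. norm (amp (b - T) Z) < sqrt e"
 proof (rule bicommutant_dense)
  show "X * b = b * X" if "!!y. y \<in> alg_gen u ==> X * y = y * X" for X
   using b that[OF alg_gen_intros(1)] that[OF alg_gen_intros(3)[OF alg_gen_intros(1)]] by (simp add: mem_gen)
 qed (use e in "auto intro: alg_gen_intros")
 then obtain T where T: "T \<in> alg_gen u" "norm (amp (b - T) Z) < sqrt e" by blast
 have "(norm (amp (b - T) Z))\<^sup>2 < (sqrt e)\<^sup>2" using T(2) by (intro power_strict_mono) auto
 moreover have "adj (b - T) * (b - T) \<in> AA" using T(1) b alg_gen_sub[OF u] gen_sub[OF u] by (intro mult_in adj_in diff_in) auto
 ultimately show ?thesis using Z[of "b - T"] T(1) e by (intro bexI[of _ T]) auto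
qed

text \<open>Letters of the index \<open>j\<close> may come from the von Neumann algebra. One at a
  time they are replaced by centred elements of the star-algebra; the error is small in the 2-norm,
  and \<open>tau_small\<close> controls it against the fixed product of the other letters. The
  induction counts the letters still to be replaced.\<close>

lemma gen_free:
 fixes x :: "nat => 'h bop"
 assumes free: "star_free \<phi> I (%i. op_of (x i))" and x: "!!i. i \<in> I ==> x i \<in> AA"
 shows "w ~= [] ==> distinct_adj (map fst w) ==>
  (\<forall>(i, y)\<in>set w. i \<in> I & (y \<in> alg_gen (x i) \<or> i = j & y \<in> gen (x i)) & \<tau> y = 0) ==> \<tau> (prod_list (map snd w)) = 0"
proof (induction "length (filter (%(i, y). y \<notin> alg_gen (x i)) w)" arbitrary: w)
 case 0
 hence "\<forall>(i, y)\<in>set (map (%(i, y). (i, op_of y)) w). i \<in> I & y \<in> star_algebra_generated {op_of (x i)} & \<phi> y = 0"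
  by (auto simp: filter_empty_conv alg_gen_def)
 moreover have "map (%(i, y). (i, op_of y)) w ~= []" "distinct_adj (map fst (map (%(i, y). (i, op_of y)) w))"
  using 0 by (auto simp: comp_def case_prod_beta)
 ultimately have "\<phi> (op_prod (map snd (map (%(i, y). (i, op_of y)) w))) = 0" using free unfolding star_free_def by blast
 thus ?case by (simp add: op_of_prod_list comp_def case_prod_beta)
next
 case (Suc n)
 interpret tracial AA \<tau> by (rule tracial_AA)
 obtain i b where "(i, b) \<in> set w" "b \<notin> alg_gen (x i)" using Suc.hyps(2) by (metis (mono_tags, lifting) Zero_not_Suc case_prodI2 filter_False list.size(3) split_paired_Ex surj_pair case_prod_conv)
 then obtain p q where w: "w = p @ (i, b) # q" and nb: "b \<notin> alg_gen (x i)" by (metis split_list)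
 have b: "i \<in> I" "i = j" "b \<in> gen (x i)" "\<tau> b = 0" using Suc.prems(3) nb unfolding w by auto
 have xi: "x i \<in> AA" by (rule x[OF b(1)])
 have el: "y \<in> AA" if "(i, y) \<in> set w" for i y
 proof -
  have iy: "i \<in> I" "y \<in> alg_gen (x i) \<or> y \<in> gen (x i)" using Suc.prems(3) that by auto
  show ?thesis using iy(2) subsetD[OF alg_gen_sub[OF x[OF iy(1)]]] subsetD[OF gen_sub[OF x[OF iy(1)]]] by blast
 qed
 have pl: "prod_list (map snd v) \<in> AA" if "set v \<subseteq> set w" for v
 proof -
  have "y \<in> AA" if "y \<in> set (map snd v)" for y using that el \<open>set v \<subseteq> set w\<close> by auto
  thus ?thesis by (rule prod_list_in)
 qed
 define P Q where "P = prod_list (map snd p)" and "Q = prod_list (map snd q)"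
 have PQ: "P \<in> AA" "Q \<in> AA" using pl[of p] pl[of q] unfolding P_def Q_def by (auto simp: w)
 have bA: "b \<in> AA" by (rule el[of i]) (simp add: w)
 define D where "D = (1 + Re (\<tau> (Q * P * adj (Q * P)))) / 2"
 have D: "D > 0" using Re_tau_pos[of "adj (Q * P)"] PQ unfolding D_def by (simp add: add_pos_nonneg)
 have "cmod (\<tau> (P * b * Q)) <= s * D" if s: "s > 0" for s
 proof -
  obtain T where T: "T \<in> alg_gen (x i)" "cmod (\<tau> (adj (b - T) * (b - T))) < s\<^sup>2" using gen_approx[OF xi b(3), of "s\<^sup>2"] s by auto
  have TA: "T \<in> AA" using T(1) alg_gen_sub[OF xi] by blast
  \<comment> \<open>Centring does not increase the 2-distance to \<open>b\<close>, because
    \<open>b\<close> is centred.\<close>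
  define T' where "T' = T + cs (- \<tau> T)"
  have T': "T' \<in> alg_gen (x i)" unfolding T'_def by (intro alg_gen_intros T)
  have T'A: "T' \<in> AA" using T' alg_gen_sub[OF xi] by blast
  have cs1: "\<tau> (cs c) = c" for c using tau_cs[OF one_in, of c] tau_one by simp
  have "\<tau> T' = 0" unfolding T'_def using TA by (subst tau_add) (auto simp: cs1 simp del: cs_simps)
  define y where "y = b - T"
  have yA: "y \<in> AA" using bA TA by (simp add: y_def)
  have ty: "\<tau> y = - \<tau> T" unfolding y_def using bA TA b(4) by (subst tau_diff) auto
  have bt: "b - T' = y + cs (\<tau> T)" by (simp add: T'_def y_def)
  have "\<tau> (adj (b - T') * (b - T')) = \<tau> (adj y * y) - cnj (\<tau> T) * \<tau> T"
  proof -
   have "adj (b - T') * (b - T') = adj y * y + cs (\<tau> T) * adj y + cs (cnj (\<tau> T)) * y + cs (cnj (\<tau> T) * \<tau> T)"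
    unfolding bt by (simp add: distrib_left distrib_right cs_commute[of "adj y"])
   thus ?thesis using yA tau_adj[OF yA] ty by (simp add: tau_add tau_cs cs1 del: cs_simps)
  qed
  hence "Re (\<tau> (adj (b - T') * (b - T'))) = Re (\<tau> (adj y * y)) - (cmod (\<tau> T))\<^sup>2" by (simp add: cmod_power2[of "\<tau> T"] power2_eq_square[of "Re _"] power2_eq_square[of "Im _"])
  also have "... <= Re (\<tau> (adj y * y))" by simp
  also have "... <= cmod (\<tau> (adj y * y))" by (rule complex_Re_le_cmod)
  finally have small: "Re (\<tau> (adj (b - T') * (b - T'))) <= s\<^sup>2" using T(2) unfolding y_def by linarith
  define w' where "w' = p @ (i, T') # q"
  have "\<tau> (prod_list (map snd w')) = 0"
  proof (rule Suc.hyps(1))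
   show "n = length (filter (%(i, y). y \<notin> alg_gen (x i)) w')" using Suc.hyps(2) nb T' unfolding w w'_def by simp
   show "distinct_adj (map fst w')" using Suc.prems(2) unfolding w w'_def by simp
   show "\<forall>(i, y)\<in>set w'. i \<in> I & (y \<in> alg_gen (x i) \<or> i = j & y \<in> gen (x i)) & \<tau> y = 0"
    using Suc.prems(3) T' \<open>\<tau> T' = 0\<close> b(1) unfolding w w'_def by auto
  qed (simp add: w'_def)
  hence z: "\<tau> (P * T' * Q) = 0" by (simp add: w'_def P_def Q_def mult.assoc)
  have "P * b * Q = P * (b - T') * Q + P * T' * Q" by (simp add: left_diff_distrib right_diff_distrib)
  hence "\<tau> (P * b * Q) = \<tau> (P * (b - T') * Q)" using z PQ bA T'A by (simp add: tau_add)
  also have "... = \<tau> (Q * (P * (b - T')))" using PQ bA T'A by (intro tau_comm mult_in diff_in)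
  also have "Q * (P * (b - T')) = Q * P * (b - T')" by (simp only: mult.assoc)
  also have "cmod (\<tau> (Q * P * (b - T'))) <= s * D" unfolding D_def using PQ bA T'A by (intro tau_small small s mult_in diff_in)
  finally show ?thesis .
 qed
 hence "cmod (\<tau> (P * b * Q)) <= 0 + e" if "e > 0" for e
  using that D divide_pos_pos[OF that D] by (metis add_0 less_irrefl nonzero_eq_divide_eq)
 hence "cmod (\<tau> (P * b * Q)) <= 0" by (rule field_le_epsilon)
 thus ?case by (simp add: w P_def Q_def mult.assoc)
qed

end

section \<open>Conjugating R-diagonal elements\<close>

text \<open>\<open>Beta\<close> syllables are meant to be centred elements of \<open>B\<close>, and
  \<open>Alpha\<close> syllables centred alternating words in one \<open>a j\<close>; see
  \<open>ok\<close>.\<close>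

datatype 'b syllable = Beta 'b | Alpha nat "bool list"

inductive_set cspan :: "'h::complex_hilbert_space bop set => 'h bop set" for X where
 "x \<in> X ==> x \<in> cspan X"
| "x \<in> cspan X ==> y \<in> cspan X ==> x + y \<in> cspan X"
| "x \<in> cspan X ==> cs c * x \<in> cspan X"

text \<open>\<open>B\<close> plays the role of the von Neumann algebra generated by \<open>u\<^sub>0\<close>, \<open>F j\<close> that of the \<open>*\<close>-algebra
 generated by \<open>a\<^sub>j\<close>.\<close>

locale free_system = tracial AA \<tau>
 for AA :: "'h::complex_hilbert_space bop set" and \<tau> +
 fixes \<phi> :: "'h op => complex" and k :: nat and a g h :: "nat => 'h bop" and B :: "'h bop set" and F :: "nat => 'h bop set"
 assumes Rd: "j \<in> {1..k} ==> R_diagonal_element AA \<tau> \<phi> (a j)"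
  and B_sub: "B \<subseteq> AA" and B: "cs c \<in> B" "x \<in> B ==> y \<in> B ==> x + y \<in> B" "x \<in> B ==> y \<in> B ==> x * y \<in> B" "x \<in> B ==> adj x \<in> B"
  and F_sub: "j \<in> {1..k} ==> F j \<subseteq> AA"
  and F: "j \<in> {1..k} ==> a j \<in> F j" "cs c \<in> F j" "x \<in> F j ==> y \<in> F j ==> x + y \<in> F j" "x \<in> F j ==> y \<in> F j ==> x * y \<in> F j" "x \<in> F j ==> adj x \<in> F j"
  and free: "w ~= [] ==> distinct_adj (map fst w) ==>
   (\<forall>(i, y)\<in>set w. (i = 0 & y \<in> B \<or> i \<in> {1..k} & y \<in> F i) & \<tau> y = 0) ==> \<tau> (prod_list (map snd w)) = 0"
  and gh: "j \<in> {1..k} ==> g j \<in> B" "j \<in> {1..k} ==> h j \<in> B"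
   "j \<in> {1..k} ==> adj (g j) * g j = 1" "j \<in> {1..k} ==> g j * adj (g j) = 1"
   "j \<in> {1..k} ==> adj (h j) * h j = 1" "j \<in> {1..k} ==> h j * adj (h j) = 1"
begin

definition a' :: "nat => 'h bop" where "a' j = g j * a j * h j"

abbreviation mom :: "nat => bool list => complex" where "mom j w \<equiv> \<tau> (wd (a j) w)"

definition cw :: "nat => bool list => 'h bop" where "cw j w = wd (a j) w - cs (mom j w)"

primrec val :: "'h bop syllable => 'h bop" where
 "val (Beta b) = b" | "val (Alpha j w) = cw j w"

text \<open>The centring constant is the moment of the original word, so that the two evaluations of
  a syllable differ only in the letters.\<close>

primrec val' :: "'h bop syllable => 'h bop" where
 "val' (Beta b) = b" | "val' (Alpha j w) = wd (a' j) w - cs (mom j w)"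

primrec ok :: "'h bop syllable => bool" where
 "ok (Beta b) \<longleftrightarrow> b \<in> B & \<tau> b = 0" | "ok (Alpha j w) \<longleftrightarrow> j \<in> {1..k} & w ~= [] & distinct_adj w"

text \<open>Two neighbouring \<open>Alpha\<close> syllables may have the same index if the letters
  at the junction agree. They do not join to a longer alternating word, and
  \<open>alternating_centred_zero\<close> covers their product.\<close>

fun compat :: "'h bop syllable => 'h bop syllable => bool" where
 "compat (Beta _) (Beta _) \<longleftrightarrow> False"
| "compat (Alpha i v) (Alpha j w) \<longleftrightarrow> i ~= j \<or> last v = hd w"
| "compat _ _ \<longleftrightarrow> True"

definition reduced :: "'h bop syllable list => bool" where
 "reduced s \<longleftrightarrow> (\<forall>p\<in>set s. ok p) & successively compat s"

definition cval :: "'h bop syllable list => 'h bop" where "cval s = prod_list (map val s)"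

definition cval' :: "'h bop syllable list => 'h bop" where "cval' s = prod_list (map val' s)"

lemma cval_simps [simp]: "cval [] = 1" "cval (p # s) = val p * cval s" "cval' [] = 1" "cval' (p # s) = val' p * cval' s"
 by (simp_all add: cval_def cval'_def)

lemma reduced_Cons: "reduced (p # s) \<longleftrightarrow> ok p & reduced s & (s = [] \<or> compat p (hd s))"
 by (auto simp: reduced_def successively_Cons)

lemma B_diff: "x \<in> B ==> y \<in> B ==> x - y \<in> B" using B(2)[OF _ B(3)[OF B(1), of y "-1"], of x] by simp

lemma BAA: "x \<in> B ==> x \<in> AA" using B_sub by blast

lemma tau_cs1: "\<tau> (cs c) = c" using tau_cs[OF one_in, of c] tau_one by simp

lemma centre_B: "x \<in> B ==> ok (Beta (x - cs (\<tau> x)))" using BAA by (simp add: B B_diff tau_diff tau_cs1)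

lemma a_in: "j \<in> {1..k} ==> a j \<in> AA" using F(1) F_sub by blast

lemma wd_F: "j \<in> {1..k} ==> wd (a j) w \<in> F j" using F(2)[of 1 j] F by (induction w) (auto simp: letter_def)

lemma cw_F: "j \<in> {1..k} ==> cw j w \<in> F j" using F(3)[OF wd_F F(2), of j w "- mom j w"] by (simp add: cw_def)

lemma group_zero:
 assumes "j \<in> {1..k}" "ws ~= []" "!!w. w \<in> set ws ==> w ~= [] & distinct_adj w" "successively (%u v. last u = hd v) ws"
 shows "prod_list (map (cw j) ws) \<in> F j" "\<tau> (prod_list (map (cw j) ws)) = 0"
proof -
 interpret R_diagonal_element AA \<tau> \<phi> "a j" by (rule Rd) fact
 show "prod_list (map (cw j) ws) \<in> F j" using F(2)[of 1 j] F(4) cw_F[OF assms(1)] by (induction ws) auto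
 have "\<tau> (prod_list (map (%w. wd (a j) w - cs (\<tau> (wd (a j) w))) ws)) = 0"
  using assms by (intro alternating_centred_zero) (auto simp: successively_conv_nth)
 thus "\<tau> (prod_list (map (cw j) ws)) = 0" by (simp add: cw_def[abs_def])
qed

definition centred :: "nat \<times> 'h bop => bool" where
 "centred p \<longleftrightarrow> (fst p = 0 & snd p \<in> B \<or> fst p \<in> {1..k} & snd p \<in> F (fst p)) & \<tau> (snd p) = 0"

primrec shape :: "'h bop syllable => nat => 'h bop => bool" where
 "shape (Beta b) i y \<longleftrightarrow> i = 0"
| "shape (Alpha j v) i y \<longleftrightarrow> i = j & (\<exists>ws. ws ~= [] & hd ws = v & y = prod_list (map (cw j) ws) &
   (\<forall>w\<in>set ws. w ~= [] & distinct_adj w) & successively (%u v. last u = hd v) ws)"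

text \<open>Neighbouring \<open>Alpha\<close> syllables of equal index are multiplied into one
  letter of \<open>F j\<close>, centred by \<open>group_zero\<close>; freeness then applies to the
  product of the groups. The shape of the first group is kept so that the induction can extend
  it.\<close>

lemma grouping:
 "reduced s ==> s ~= [] ==> \<exists>i y w. distinct_adj (i # map fst w) & cval s = y * prod_list (map snd w) &
   centred (i, y) & (\<forall>p\<in>set w. centred p) & shape (hd s) i y"
proof (induction s)
 case (Cons p s)
 have p: "ok p" "reduced s" "s = [] \<or> compat p (hd s)" using Cons.prems(1) by (auto simp: reduced_Cons)
 define i0 where "i0 = (case p of Beta b => 0 | Alpha j w => j)"
 have gp: "centred (i0, val p)" "shape p i0 (val p)"
 proof (atomize(full), cases p)
  case (Alpha j v)
  have "prod_list (map (cw j) [v]) \<in> F j & \<tau> (prod_list (map (cw j) [v])) = 0" using group_zero[of j "[v]"] p(1) Alpha by auto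
  moreover have "\<exists>ws. ws ~= [] & hd ws = v & cw j v = prod_list (map (cw j) ws) & (\<forall>w\<in>set ws. w ~= [] & distinct_adj w) & successively (%u v. last u = hd v) ws"
   using p(1) Alpha by (intro exI[of _ "[v]"]) auto
  ultimately show "centred (i0, val p) & shape p i0 (val p)" using p(1) Alpha by (auto simp: centred_def i0_def)
 qed (use p(1) in "auto simp: centred_def i0_def")
 show ?case
 proof (cases "s = []")
  case True
  thus ?thesis using gp by (intro exI[of _ i0] exI[of _ "val p"] exI[of _ "[]"]) simp
 next
  case False
  then obtain i y w where w: "distinct_adj (i # map fst w)" "cval s = y * prod_list (map snd w)"
   "centred (i, y)" "\<forall>p\<in>set w. centred p" "shape (hd s) i y" using Cons.IH p(2) by blast
  have pos: "j > 0" if "q \<in> set s" "q = Alpha j v" for q j v using p(2) that by (auto simp: reduced_def)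
  show ?thesis
  proof (cases "i0 = i")
   case False
   thus ?thesis using w gp by (intro exI[of _ i0] exI[of _ "val p"] exI[of _ "(i, y) # w"]) simp
  next
   case True
   obtain j v u where ps: "p = Alpha j v" "hd s = Alpha j u"
   proof (cases p)
    case (Beta b)
    then obtain j u where "hd s = Alpha j u" using p(3) False by (cases "hd s") auto
    thus ?thesis using w(5) True Beta pos[of "hd s" j u] hd_in_set[OF False] by (simp add: i0_def)
   next
    case (Alpha j v)
    hence "hd s ~= Beta b" for b using w(5) True p(1) by (auto simp: i0_def)
    thus ?thesis using that[of j v] Alpha w(5) True by (cases "hd s") (auto simp: i0_def)
   qed
   obtain ws where ws: "ws ~= []" "hd ws = u" "y = prod_list (map (cw j) ws)" "\<forall>w\<in>set ws. w ~= [] & distinct_adj w"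
    "successively (%u v. last u = hd v) ws" using w(5) ps by auto
   have j: "j \<in> {1..k}" "v ~= []" "distinct_adj v" "last v = hd u" using p ps False by auto
   have ws': "v # ws ~= []" "\<forall>w\<in>set (v # ws). w ~= [] & distinct_adj w" "successively (%u v. last u = hd v) (v # ws)"
    using ws j by (auto simp: successively_Cons)
   have "centred (j, cw j v * y)" using group_zero[OF j(1) ws'(1) _ ws'(3)] ws'(2) j(1) ws(3) by (auto simp: centred_def)
   moreover have "shape p j (cw j v * y)" using ws' ws(3) ps(1) by (auto intro!: exI[of _ "v # ws"])
   ultimately show ?thesis using w True ps(1) by (intro exI[of _ j] exI[of _ "cw j v * y"] exI[of _ w]) (simp add: i0_def mult.assoc)
  qed
 qed
qed simp

lemma cval_zero: "reduced s ==> s ~= [] ==> \<tau> (cval s) = 0"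
proof -
 assume "reduced s" "s ~= []"
 then obtain i y w where w: "distinct_adj (i # map fst w)" "cval s = y * prod_list (map snd w)" "centred (i, y)" "\<forall>p\<in>set w. centred p"
  using grouping by blast
 have "\<tau> (prod_list (map snd ((i, y) # w))) = 0" by (rule free) (use w in "auto simp: centred_def")
 thus ?thesis using w(2) by simp
qed

lemma val_in: "ok p ==> val p \<in> AA"
proof (cases p)
 case (Alpha j w)
 moreover assume "ok p"
 ultimately show ?thesis using subsetD[OF F_sub cw_F] by simp
qed (simp add: BAA)

lemma cval_in: "reduced s ==> cval s \<in> AA" by (induction s) (auto simp: reduced_Cons val_in)

section \<open>Expansion of words in the conjugated elements\<close>

definition V :: "'h bop set" where "V = {cval t |t. reduced t & t ~= []}"

text \<open>The first syllable is prescribed because it decides what may be put in front.\<close>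

definition HS :: "nat => bool list => 'h bop set" where
 "HS j w = {cval t |t. reduced t & t ~= [] & hd t = Alpha j w}"

lemma HS_I: "reduced (Alpha j w # t) ==> cval (Alpha j w # t) \<in> cspan (HS j w)" unfolding HS_def by (rule cspan.intros(1)) force

lemma cspan_V_zero: "x \<in> cspan V ==> x \<in> AA & \<tau> x = 0"
 by (induction rule: cspan.induct) (auto simp: V_def cval_in cval_zero tau_add tau_cs)

lemma cspan_map:
 assumes "x \<in> cspan X" "!!x. x \<in> X ==> c * x \<in> cspan Y" shows "c * x \<in> cspan Y" using assms(1)
proof induction
 case (3 x d)
 thus ?case using cspan.intros(3)[of "c * x" Y d] by (simp add: cs_left_commute)
qed (auto simp: assms(2) distrib_left intro: cspan.intros)

lemma centre_split: "c * x = cs (\<tau> c) * x + (c - cs (\<tau> c)) * x" by (simp add: left_diff_distrib)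

lemma glue_end: "ok (Alpha j w) ==> c \<in> B ==> cw j w * c \<in> cspan (HS j w)"
proof -
 assume o: "ok (Alpha j w)" and c: "c \<in> B"
 have r: "reduced [Alpha j w]" "reduced [Alpha j w, Beta (c - cs (\<tau> c))]" using o centre_B[OF c] by (auto simp: reduced_Cons simp del: ok.simps) (simp add: reduced_def)+
 have "cw j w * c = cs (\<tau> c) * cval [Alpha j w] + cval [Alpha j w, Beta (c - cs (\<tau> c))]"
  by (simp add: right_diff_distrib cs_commute)
 thus ?thesis using HS_I[OF r(1)] HS_I[OF r(2)] by (simp only: cspan.intros)
qed

text \<open>The element \<open>c\<close> between two \<open>Alpha\<close> syllables is split into
  its trace and its centred part. The centred part is a \<open>Beta\<close> syllable; the scalar
  part makes the two syllables adjacent, and \<open>d\<close> ensures that they are then compatible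
  or that this part is absent.\<close>

lemma glue:
 assumes o: "ok (Alpha j w)" and c: "c \<in> B" and x: "x \<in> cspan (HS j' w')" and d: "j ~= j' \<or> last w = hd w' \<or> \<tau> c = 0"
 shows "cw j w * (c * x) \<in> cspan (HS j w)"
proof -
 have "(cw j w * c) * y \<in> cspan (HS j w)" if y: "y \<in> HS j' w'" for y
 proof -
  obtain t where t: "y = cval t" "reduced t" "t ~= []" "hd t = Alpha j' w'" using y by (auto simp: HS_def)
  have r: "reduced (Alpha j w # Beta (c - cs (\<tau> c)) # t)" using o centre_B[OF c] t by (simp add: reduced_Cons del: ok.simps)
  have eq: "(cw j w * c) * y = cs (\<tau> c) * (cw j w * cval t) + cval (Alpha j w # Beta (c - cs (\<tau> c)) # t)"
   unfolding t(1) by (simp add: left_diff_distrib right_diff_distrib mult.assoc cs_left_commute)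
  show ?thesis
  proof (cases "\<tau> c = 0")
   case True
   thus ?thesis unfolding eq using HS_I[OF r] by simp
  next
   case False
   hence "reduced (Alpha j w # t)" using o t d by (auto simp: reduced_Cons)
   from HS_I[OF this] HS_I[OF r] show ?thesis unfolding eq by (simp only: cspan.intros cval_simps val.simps)
  qed
 qed
 from cspan_map[OF x this] show ?thesis by (simp only: mult.assoc)
qed

lemma left_V: "c \<in> B ==> x \<in> cspan (HS j w) ==> c * x \<in> cspan V"
proof (erule cspan_map)
 fix x assume c: "c \<in> B" and "x \<in> HS j w"
 then obtain t where t: "x = cval t" "reduced t" "t ~= []" "hd t = Alpha j w" by (auto simp: HS_def)
 have r: "reduced (Beta (c - cs (\<tau> c)) # t)" using centre_B[OF c] t by (simp add: reduced_Cons del: ok.simps)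
 have "cval t \<in> V" "cval (Beta (c - cs (\<tau> c)) # t) \<in> V" unfolding V_def using t r by blast+
 thus "c * x \<in> cspan V" unfolding t(1) centre_split[of c] by (intro cspan.intros) simp_all
qed

text \<open>\<open>Lf\<close> and \<open>Rt\<close> are the unitaries to the left and right of a
  letter: \<open>a' j\<close> is \<open>g j * a j * h j\<close>, and its adjoint has
  \<open>adj (h j)\<close> on the left and \<open>adj (g j)\<close> on the right. Between two
  different letters they cancel, by \<open>RL\<close>.\<close>

definition Lf :: "nat => bool => 'h bop" where "Lf j s = (if s then adj (h j) else g j)"

definition Rt :: "nat => bool => 'h bop" where "Rt j s = (if s then adj (g j) else h j)"

lemma LR_B: "j \<in> {1..k} ==> Lf j s \<in> B & Rt j s \<in> B" by (simp add: Lf_def Rt_def gh B)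

lemma letter': "letter (a' j) s = Lf j s * letter (a j) s * Rt j s" by (simp add: letter_def Lf_def Rt_def a'_def mult.assoc)

lemma RL: "j \<in> {1..k} ==> s ~= s' ==> Rt j s * Lf j s' = 1" "j \<in> {1..k} ==> s ~= s' ==> Lf j s * Rt j s' = 1"
 by (auto simp: Lf_def Rt_def gh)

lemma wd': "j \<in> {1..k} ==> w ~= [] ==> distinct_adj w ==> wd (a' j) w = Lf j (hd w) * wd (a j) w * Rt j (last w)"
proof (induction w)
 case (Cons s w)
 show ?case
 proof (cases w)
  case Nil thus ?thesis by (simp add: letter')
 next
  case (Cons s' w')
  hence IH: "wd (a' j) w = Lf j s' * wd (a j) w * Rt j (last w)" "s ~= s'" using Cons.IH Cons.prems by auto
  have "wd (a' j) (s # w) = Lf j s * letter (a j) s * (Rt j s * Lf j s') * wd (a j) w * Rt j (last w)"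
   using IH(1) by (simp add: letter' mult.assoc)
  thus ?thesis using RL(1)[OF Cons.prems(1) IH(2)] Cons by (simp add: mult.assoc)
 qed
qed simp

lemma mom_nonzero: "j \<in> {1..k} ==> mom j w ~= 0 ==> w ~= [] ==> distinct_adj w ==> hd w ~= last w"
 using R_diagonal_element.odd_moment[OF Rd, of j w] distinct_adj_parity[of w 0 "length w - 1"]
 by (auto simp: hd_conv_nth last_conv_nth)

text \<open>Inner unitaries of an alternating word cancel by \<open>wd'\<close>. The scalar part
  fits as well: a nonzero moment forces even length, hence different end letters, for which the
  outer unitaries cancel too.\<close>

lemma val'_Alpha: "ok (Alpha j w) ==> val' (Alpha j w) = Lf j (hd w) * (cw j w * Rt j (last w))"
proof (cases "mom j w = 0")
 case False
 assume o: "ok (Alpha j w)"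
 hence "Lf j (hd w) * Rt j (last w) = 1" using RL(2) mom_nonzero False by auto
 hence "Lf j (hd w) * (cs (mom j w) * Rt j (last w)) = cs (mom j w)" by (simp add: cs_left_commute)
 thus ?thesis using o wd' by (simp add: cw_def left_diff_distrib right_diff_distrib mult.assoc)
qed (use wd' in "simp add: cw_def mult.assoc")

text \<open>The unitary \<open>Rt\<close> left by the head meets \<open>Lf\<close> of the next
  \<open>Alpha\<close> syllable, with at most one \<open>Beta\<close> between. If the index is the
  same and the end letters differ, then there is a \<open>Beta\<close>, and conjugating it by these
  unitaries keeps it centred; in all other cases \<open>glue\<close> accepts any trace.\<close>

lemma cval'_head: "reduced (Alpha j w # s) ==> cw j w * (Rt j (last w) * cval' s) \<in> cspan (HS j w)"
proof (induction "length s" arbitrary: j w s rule: less_induct)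
 case less
 have o: "ok (Alpha j w)" "reduced s" "s = [] \<or> compat (Alpha j w) (hd s)" using less.prems by (auto simp: reduced_Cons simp del: ok.simps)
 have j: "j \<in> {1..k}" using o(1) by simp
 note R = LR_B[OF j, THEN conjunct2]
 show ?case
 proof (cases s)
  case Nil
  thus ?thesis using glue_end[OF o(1) R, of "last w"] by simp
 next
  case (Cons p s')
  show ?thesis
  proof (cases p)
   case (Alpha j' w')
   have X: "cw j' w' * (Rt j' (last w') * cval' s') \<in> cspan (HS j' w')" by (rule less.hyps) (use o(2) Cons Alpha in auto)
   have o': "ok (Alpha j' w')" "j ~= j' \<or> last w = hd w'" using o(2,3) Cons Alpha by (auto simp: reduced_Cons)
   have "cw j w * ((Rt j (last w) * Lf j' (hd w')) * (cw j' w' * (Rt j' (last w') * cval' s'))) \<in> cspan (HS j w)"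
    by (rule glue[OF o(1) _ X]) (use LR_B R o' B(3) in auto)
   thus ?thesis using Cons Alpha val'_Alpha[OF o'(1)] by (simp add: mult.assoc del: val'.simps)
  next
   case (Beta b)
   have b: "b \<in> B" "\<tau> b = 0" "reduced s'" using o(2) Cons Beta by (auto simp: reduced_Cons)
   show ?thesis
   proof (cases s')
    case Nil
    thus ?thesis using glue_end[OF o(1) B(3)[OF R b(1)], of "last w"] Cons Beta by simp
   next
    case C2: (Cons p' s'')
    then obtain j' w' where p': "p' = Alpha j' w'" using o(2) Cons Beta by (cases p') (auto simp: reduced_Cons)
    have X: "cw j' w' * (Rt j' (last w') * cval' s'') \<in> cspan (HS j' w')" by (rule less.hyps) (use b(3) C2 Cons p' in auto)
    have o': "ok (Alpha j' w')" using b(3) C2 p' by (simp add: reduced_Cons del: ok.simps)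
    have c: "Rt j (last w) * b * Lf j' (hd w') \<in> B" using LR_B R o' b(1) B(3) by auto
    have "\<tau> (Rt j (last w) * b * Lf j' (hd w')) = 0" if "j = j'" "last w ~= hd w'"
    proof -
     have "\<tau> (Rt j (last w) * b * Lf j (hd w')) = \<tau> (Lf j (hd w') * (Rt j (last w) * b))"
      using R LR_B[OF j] b(1) BAA by (intro tau_comm) auto
     also have "Lf j (hd w') * (Rt j (last w) * b) = b" using RL(2)[OF j that(2)[symmetric]] by (simp flip: mult.assoc)
     finally show ?thesis using b(2) that(1) by simp
    qed
    hence "cw j w * ((Rt j (last w) * b * Lf j' (hd w')) * (cw j' w' * (Rt j' (last w') * cval' s''))) \<in> cspan (HS j w)"
     by (intro glue[OF o(1) c X]) blast
    thus ?thesis using Cons C2 Beta p' val'_Alpha[OF o'] by (simp add: mult.assoc del: val'.simps(2))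
   qed
  qed
 qed
qed

text \<open>With \<open>cspan_V_zero\<close> this says that reduced nonempty words in the conjugated
  elements have trace 0; freeness of the conjugated family is used in this form.\<close>

lemma cval'_V: "reduced s ==> s ~= [] ==> cval' s \<in> cspan V"
proof (induction s)
 case (Cons p s)
 have *: "c * cval' (Alpha j w # s) \<in> cspan V" if "reduced (Alpha j w # s)" "c \<in> B" for c j w s
 proof -
  have o: "ok (Alpha j w)" using that(1) by (simp add: reduced_Cons del: ok.simps)
  have "(c * Lf j (hd w)) * (cw j w * (Rt j (last w) * cval' s)) \<in> cspan V"
   by (rule left_V[OF _ cval'_head[OF that(1)]]) (use o LR_B that(2) B(3) in auto)
  thus ?thesis using val'_Alpha[OF o] by (simp add: mult.assoc del: val'.simps)
 qed
 show ?case
 proof (cases p)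
  case (Alpha j w)
  thus ?thesis using *[of j w s 1] B(1)[of 1] Cons.prems by simp
 next
  case (Beta b)
  have b: "b \<in> B" using Cons.prems Beta by (simp add: reduced_Cons)
  show ?thesis
  proof (cases s)
   case Nil
   have "cval [Beta b] \<in> V" unfolding V_def using Cons.prems Beta Nil by blast
   thus ?thesis using Beta Nil by (auto intro: cspan.intros)
  next
   case C2: (Cons p' s')
   then obtain j w where "p' = Alpha j w" using Cons.prems Beta by (cases p') (auto simp: reduced_Cons)
   thus ?thesis using *[of j w s' b] b Cons.prems C2 Beta by (simp add: reduced_Cons del: ok.simps val'.simps(2))
  qed
 qed
qed simp

text \<open>Corresponding combinations of reduced words in the two families. A relation is used
  instead of a map because an element may have several expansions; the traces of each pair agree by
  \<open>PS_tau\<close>.\<close>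

inductive_set PS :: "('h bop \<times> 'h bop) set" where
 "reduced s ==> (cval s, cval' s) \<in> PS"
| "(x, x') \<in> PS ==> (y, y') \<in> PS ==> (x + y, x' + y') \<in> PS"
| "(x, x') \<in> PS ==> (cs c * x, cs c * x') \<in> PS"

lemma PS_tau: "(x, x') \<in> PS ==> x \<in> AA & x' \<in> AA & \<tau> x = \<tau> x'"
proof (induction rule: PS.induct)
 case (1 s)
 thus ?case using cspan_V_zero[OF cval'_V[OF 1]] cval_zero[OF 1] cval_in[OF 1] by (cases "s = []") auto
qed (auto simp: tau_add tau_cs)

lemma PS_B_start: "b \<in> B ==> reduced s ==> s = [] \<or> (\<exists>j w. hd s = Alpha j w) ==> (b * cval s, b * cval' s) \<in> PS"
proof -
 assume b: "b \<in> B" and s: "reduced s" "s = [] \<or> (\<exists>j w. hd s = Alpha j w)"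
 hence "reduced (Beta (b - cs (\<tau> b)) # s)" using centre_B[OF b] by (auto simp: reduced_Cons simp del: ok.simps)
 from PS.intros(2)[OF PS.intros(3)[OF PS.intros(1)[OF s(1)], of "\<tau> b"] PS.intros(1)[OF this]]
 show ?thesis unfolding centre_split[of b] by simp
qed

text \<open>If the letter differs from the first letter of a leading word \<open>w\<close> of the
  same index, it lengthens that word, and re-centring produces terms with the moments of
  \<open>t # w\<close> and of \<open>w\<close>. When the latter is nonzero, \<open>w\<close> ends in
  \<open>t\<close>, so the syllable \<open>[t]\<close> may stand before the rest. In every other
  case \<open>[t]\<close> is simply a new first syllable.\<close>

lemma PS_letter_start:
 assumes j: "j \<in> {1..k}" and s: "reduced s"
 shows "(letter (a j) t * cval s, letter (a' j) t * cval' s) \<in> PS"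
proof -
 have m1: "mom j [t] = 0" using R_diagonal_element.odd_moment[OF Rd[OF j], of "[t]"] by simp
 have pre: "(letter (a j) t * cval r, letter (a' j) t * cval' r) \<in> PS" if "reduced (Alpha j [t] # r)" for r
  using PS.intros(1)[OF that] m1 by (simp add: cw_def)
 show ?thesis
 proof (cases "\<exists>w r. s = Alpha j w # r & hd w ~= t")
  case False
  hence "reduced (Alpha j [t] # s)" using s j by (cases s; cases "hd s") (auto simp: reduced_Cons)
  thus ?thesis by (rule pre)
 next
  case True
  then obtain w r where w: "s = Alpha j w # r" "hd w ~= t" by blast
  have o: "w ~= []" "distinct_adj w" "reduced r" "r = [] \<or> compat (Alpha j w) (hd r)" using s w(1) by (auto simp: reduced_Cons)
  have "distinct_adj (t # w)" using o w(2) by (cases w) auto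
  hence r1: "reduced (Alpha j (t # w) # r)" using o j by (cases r; cases "hd r") (auto simp: reduced_Cons)
  have "(cs (- mom j w) * (letter (a j) t * cval r), cs (- mom j w) * (letter (a' j) t * cval' r)) \<in> PS"
  proof (cases "mom j w = 0")
   case True
   thus ?thesis using PS.intros(3)[OF PS.intros(1)[OF o(3)], of 0] by simp
  next
   case False
   hence "last w = t" using mom_nonzero[OF j False] o w(2) by auto
   hence "reduced (Alpha j [t] # r)" using o j by (cases r; cases "hd r") (auto simp: reduced_Cons)
   thus ?thesis by (intro PS.intros(3) pre)
  qed
  from PS.intros(2)[OF PS.intros(1)[OF r1] PS.intros(2)[OF PS.intros(3)[OF PS.intros(1)[OF o(3)], of "mom j (t # w)"] this]]
  show ?thesis unfolding w(1) by (simp add: cw_def left_diff_distrib right_diff_distrib mult.assoc cs_left_commute[of "letter _ _"])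
 qed
qed

text \<open>Pairs of left multipliers that preserve \<open>PS\<close>. They are closed under sums
  and products, so it suffices to check generators, and applying them to the pair of units compares
  the traces of polynomials.\<close>

definition Mu :: "('h bop \<times> 'h bop) set" where
 "Mu = {(y, y'). \<forall>x x'. (x, x') \<in> PS --> (y * x, y' * x') \<in> PS}"

lemma Mu_I:
 assumes "!!s. reduced s ==> (y * cval s, y' * cval' s) \<in> PS" shows "(y, y') \<in> Mu"
proof -
 have "(y * x, y' * x') \<in> PS" if "(x, x') \<in> PS" for x x' using that
 proof (induction rule: PS.induct)
  case (3 x x' c)
  thus ?case using PS.intros(3)[of "y * x" "y' * x'" c] by (simp add: cs_left_commute)
 qed (auto simp: assms distrib_left intro: PS.intros)
 thus ?thesis by (simp add: Mu_def)
qed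

lemma Mu_closed: "(x, x') \<in> Mu ==> (y, y') \<in> Mu ==> (x + y, x' + y') \<in> Mu" "(x, x') \<in> Mu ==> (y, y') \<in> Mu ==> (x * y, x' * y') \<in> Mu"
 by (auto simp: Mu_def distrib_right mult.assoc intro: PS.intros)

lemma Mu_letter: "j \<in> {1..k} ==> (letter (a j) t, letter (a' j) t) \<in> Mu" by (intro Mu_I PS_letter_start)

lemma Mu_B: "b \<in> B ==> (b, b) \<in> Mu"
proof (rule Mu_I)
 fix s assume b: "b \<in> B" and s: "reduced s"
 show "(b * cval s, b * cval' s) \<in> PS"
 proof (cases "\<exists>c r. s = Beta c # r")
  case True
  then obtain c r where r: "s = Beta c # r" by blast
  have "c \<in> B" "reduced r" "r = [] \<or> (\<exists>j w. hd r = Alpha j w)"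
   using s r by (auto simp: reduced_Cons) (cases "hd r"; auto)
  hence "((b * c) * cval r, (b * c) * cval' r) \<in> PS" using b B(3) by (intro PS_B_start) auto
  thus ?thesis using r by (simp add: mult.assoc)
 next
  case False
  hence "s = [] \<or> (\<exists>j w. hd s = Alpha j w)" by (cases s; cases "hd s") auto
  thus ?thesis using PS_B_start[OF b s] by blast
 qed
qed

lemma same_law:
 assumes y: "(y, y') \<in> Mu" "(adj y, adj y') \<in> Mu" "y \<in> AA" "y' \<in> AA"
 shows "law y = law y'"
proof -
 interpret prob_space "law y'" by (rule law(1)[OF y(4)])
 have "((adj y * y) ^ n, (adj y' * y') ^ n) \<in> Mu" for n
 proof (induction n)
  case 0 thus ?case using Mu_B[OF B(1), of 1] by simp
 next
  case (Suc n) thus ?case using Mu_closed(2)[OF Mu_closed(2)[OF y(2,1)]] by simp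
 qed
 moreover have "(1, 1) \<in> PS" using PS.intros(1)[of "[]"] by (simp add: reduced_def)
 ultimately have "((adj y * y) ^ n * 1, (adj y' * y') ^ n * 1) \<in> PS" for n unfolding Mu_def by blast
 from PS_tau[OF this] have eq: "\<tau> ((adj y * y) ^ n) = complex_of_real (LINT s|law y'. s ^ n)" for n
  using law(4)[OF y(4), of n] by simp
 show ?thesis
  by (rule law_unique[OF y(3) law(1,2)[OF y(4)] _ eq, of "(norm y')\<^sup>2"]) (use law(3)[OF y(4)] in "eventually_elim, simp")
qed

lemma product_law:
 assumes u: "u \<in> B"
 shows "law (u * prod_list (map (%j. 1 + cs c * a j) [1..<Suc k]) - cs z) = law (u * prod_list (map (%j. 1 + cs c * a' j) [1..<Suc k]) - cs z)"
proof -
 define MM where "MM = {(y, y'). (y, y') \<in> Mu & (adj y, adj y') \<in> Mu & y \<in> AA & y' \<in> AA}"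
 have plus: "(x + y, x' + y') \<in> MM" and times: "(x * y, x' * y') \<in> MM" if "(x, x') \<in> MM" "(y, y') \<in> MM" for x x' y y'
  using that Mu_closed by (auto simp: MM_def)
 have b: "(b, b) \<in> MM" if "b \<in> B" for b using that Mu_B B(4) BAA by (auto simp: MM_def)
 have a: "(a j, a' j) \<in> MM" if j: "j \<in> {1..k}" for j
  using Mu_letter[OF j, of False] Mu_letter[OF j, of True] a_in[OF j] gh(1,2)[OF j] BAA unfolding MM_def letter_def a'_def by auto
 have "(1 + cs c * a j, 1 + cs c * a' j) \<in> MM" if j: "j \<in> {1..k}" for j
  using plus[OF b[OF B(1), of 1] times[OF b[OF B(1)] a[OF j]]] by simp
 hence P: "(prod_list (map (%j. 1 + cs c * a j) xs), prod_list (map (%j. 1 + cs c * a' j) xs)) \<in> MM" if "set xs \<subseteq> {1..k}" for xs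
  using that times b[OF B(1), of 1] by (induction xs) auto
 have "set [1..<Suc k] \<subseteq> {1..k}" by auto
 from plus[OF times[OF b[OF u] P[OF this]] b[OF B(1), of "- z"]] show ?thesis by (intro same_law) (auto simp: MM_def)
qed

end

section \<open>The theorem\<close>

lemma star_free_cong: "(!!i. i \<in> I ==> x i = y i) ==> star_free \<phi> I x ==> star_free \<phi> I y"
 unfolding star_free_def by (simp add: case_prod_beta)

lemma op_of_sum: "op_of (sum f I) = (\<Sum>i\<in>I. op_of (f i))"
 by (induction I rule: infinite_finite_induct) (simp_all add: zero_bop.rep_eq plus_bop.rep_eq)

lemma tensor_unit_add: "tensor_unit (S + r *\<^sub>R T) p q = tensor_unit S p q + r *\<^sub>R tensor_unit T p q"
 by (rule blinfun_eqI) (simp add: tensor_unit.rep_eq blinfun.add_left blinfun.scaleR_left vec_eq_iff axis_def)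

text \<open>Powers of \<open>v\<close> are moved to the left through the product, and each passage
  conjugates one \<open>a j\<close>. The factor \<open>v ^ (k - m)\<close> on the left side feeds
  the induction and is 1 for \<open>m = k\<close>.\<close>

lemma twisted_product:
 fixes v :: "'h::complex_hilbert_space bop"
 assumes v: "v * adj v = 1" and m: "m <= k"
 shows "prod_list (map (%j. v + cs c * a j) [1..<Suc m]) * v ^ (k - m) =
  v ^ k * prod_list (map (%j. 1 + cs c * (adj v ^ (k - j + 1) * a j * v ^ (k - j))) [1..<Suc m])" using m
proof (induction m)
 case (Suc m)
 have vv: "v ^ n * (adj v ^ n * x) = x" for n x
 proof (induction n arbitrary: x)
  case (Suc n)
  have "v ^ Suc n * (adj v ^ Suc n * x) = v ^ n * ((v * adj v) * (adj v ^ n * x))" by (simp only: power_Suc2[of v] power_Suc[of "adj v"] mult.assoc)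
  thus ?case using v Suc by simp
 qed simp
 define n where "n = k - Suc m"
 have n: "k - m = Suc n" "k - Suc m = n" "k - Suc m + 1 = Suc n" using Suc.prems by (auto simp: n_def)
 have "(v + cs c * a (Suc m)) * v ^ n = v ^ Suc n * (1 + cs c * (adj v ^ Suc n * a (Suc m) * v ^ n))"
  by (simp add: distrib_left distrib_right cs_left_commute[of "v ^ Suc n"] mult.assoc vv del: power_Suc) (simp add: power_Suc)
 note eq = this
 define L R where "L = prod_list (map (%j. v + cs c * a j) [1..<Suc m])"
  and "R = prod_list (map (%j. 1 + cs c * (adj v ^ (k - j + 1) * a j * v ^ (k - j))) [1..<Suc m])"
 have up: "[1..<Suc (Suc m)] = [1..<Suc m] @ [Suc m]" by simp
 have IH: "L * v ^ Suc n = v ^ k * R" using Suc by (simp only: L_def R_def n Suc_leD)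
 have "L * (v + cs c * a (Suc m)) * v ^ n = L * v ^ Suc n * (1 + cs c * (adj v ^ Suc n * a (Suc m) * v ^ n))"
  unfolding mult.assoc[of L] eq ..
 thus ?case unfolding IH up map_append prod_list.append L_def[symmetric] R_def[symmetric]
  by (simp only: list.map prod_list.Cons prod_list.Nil mult_1_right n mult.assoc Suc_eq_plus1[symmetric])
qed simp

theorem proposition1p23:
  fixes A :: "'h::complex_hilbert_space op set" and \<phi> :: "'h op \<Rightarrow> complex"
    and k :: nat and t :: real
    and u0 v :: "'h op" and a :: "nat \<Rightarrow> 'h op"
    and idx :: "nat \<Rightarrow> 'k::finite"
  defines "ub \<equiv> u0 o\<^sub>L op_prod (map (\<lambda>j. id_blinfun + sqrt (t / real k) *\<^sub>R a j) [1..<Suc k])"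
    and "Z \<equiv> (\<Sum>j=1..k. tensor_unit v (idx j) (idx (j mod k + 1)))"
    and "AA \<equiv> (\<Sum>j=1..k. tensor_unit (a j) (idx j) (idx (j mod k + 1)))"
  assumes "wstar_probability_space A \<phi>"
    and "t > 0"
    and "bij_betw idx {1..k} UNIV"
    and "u0 \<in> A" and "\<And>j. j \<in> {1..k} \<Longrightarrow> a j \<in> A"
    and "unitary_op u0"
    and "\<And>j. j \<in> {1..k} \<Longrightarrow> R_diagonal \<phi> (a j)"
    and "star_free \<phi> {0..k} (\<lambda>j. if j = 0 then u0 else a j)"
    and "unitary_op v" and "v \<in> generated_vn_algebra {u0}" and "op_power v k = u0"
  shows "brown_measure \<phi> ub =
    distr (brown_measure (matrix_trace \<phi>) (Z + sqrt (t / real k) *\<^sub>R AA)) borel (\<lambda>z. z ^ k)"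
proof -
 interpret W: wstar_probability_space A \<phi> by fact
 interpret T: tracial W.AA W.\<tau> by (rule W.tracial_AA)
 interpret M: tracial "mat_alg W.AA :: ('h ^ 'k) bop set" "mat_tr W.\<tau>" by (rule T.tracial_matrix)
 have k: "k > 0" using bij_betw_same_card[OF assms(6)] by (cases k) auto
 define U V b where "U = bop_of u0" and "V = bop_of v" and "b j = bop_of (a j)" for j
 have bo: "op_of (bop_of x) = x" if "x \<in> bounded_ops" for x :: "'h op" using that by (rule bop_of_inverse)
 have op: "op_of U = u0" "op_of V = v" unfolding U_def V_def using assms(7,13) W.A_bounded commutant_bounded
  by (auto intro!: bo simp: generated_vn_algebra_def)
 have opb: "op_of (b j) = a j" if "j \<in> {1..k}" for j unfolding b_def using assms(8)[OF that] W.A_bounded by (auto intro!: bo)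
 have UA: "U \<in> W.AA" using assms(7) by (simp add: W.AA_def op)
 have bA: "b j \<in> W.AA" if "j \<in> {1..k}" for j using assms(8) that by (simp add: W.AA_def opb)
 have VG: "V \<in> W.gen U" using assms(13) by (simp add: W.gen_def op)
 have VV: "adj V * V = 1" "V * adj V = 1" using assms(12)
  by (simp_all add: unitary_op_def op_of_mult op_of_adj op one_bop.rep_eq flip: op_of_inject)
 have Vk: "V ^ k = U" using assms(14) by (simp add: op_of_power op flip: op_of_inject)
 have VP: "V ^ n \<in> W.gen U" for n by (induction n) (use W.gen_intros(2)[of 1] W.gen_intros(5) VG in auto)
 have AVP: "adj V ^ n \<in> W.gen U" for n using W.gen_intros(3)[OF VP[of n]] by (simp add: adj_power)
 have pw: "x ^ n * y ^ n = 1" if "x * y = 1" for x y :: "'h bop" and n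
 proof (induction n)
  case (Suc n)
  have "x ^ Suc n * y ^ Suc n = x ^ n * (x * y) * y ^ n" by (simp only: power_Suc2[of x] power_Suc[of y] mult.assoc)
  thus ?case using that Suc by simp
 qed simp
 \<comment> \<open>The exponents of \<open>twisted_product\<close>. Both factors lie in the von
   Neumann algebra of \<open>U\<close>, though in general not in its star-algebra, which is why
   freeness was extended in \<open>gen_free\<close>.\<close>
 define g h where "g j = adj V ^ (k - j + 1)" and "h j = V ^ (k - j)" for j :: nat
 define c where "c = complex_of_real (sqrt (t / real k))"
 define x where "x j = (if j = 0 then U else b j)" for j
 have free: "star_free \<phi> {0..k} (%j. op_of (x j))" by (rule star_free_cong[OF _ assms(11)]) (auto simp: x_def op opb)
 have xA: "x j \<in> W.AA" if "j \<in> {0..k}" for j using that UA bA by (auto simp: x_def)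
 interpret F: free_system W.AA W.\<tau> \<phi> k b g h "W.gen U" "%j. W.alg_gen (b j)"
 proof unfold_locales
  show "b j \<in> W.AA" "R_diagonal \<phi> (op_of (b j))" if "j \<in> {1..k}" for j using bA assms(10) opb that by auto
  show "g j \<in> W.gen U" "adj (g j) * g j = 1" "g j * adj (g j) = 1" for j
   unfolding g_def adj_power adj_simps(1) by (rule AVP pw VV)+
  show "W.gen U \<subseteq> W.AA" by (rule W.gen_sub[OF UA])
  show "W.alg_gen (b j) \<subseteq> W.AA" if "j \<in> {1..k}" for j by (rule W.alg_gen_sub[OF bA[OF that]])
  show "\<phi> (op_of (prod_list (map snd w))) = 0" if w: "w ~= []" "distinct_adj (map fst w)"
   "\<forall>(i, y)\<in>set w. (i = 0 & y \<in> W.gen U \<or> i \<in> {1..k} & y \<in> W.alg_gen (b i)) & \<phi> (op_of y) = 0" for w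
   by (rule W.gen_free[OF free xA w(1,2), of 0]) (use w(3) in "auto simp: x_def")
 qed (auto simp: h_def adj_power pw VV intro: VP AVP W.gen_intros W.alg_gen_intros)
 define u where "u = U * prod_list (map (%j. 1 + cs c * b j) [1..<Suc k])"
 define P where "P = prod_list (map (%j. V + cs c * b j) [1..<Suc k])"
 define X where "X = (\<Sum>j=1..k. eunit (V + cs c * b j) (idx j) (idx (j mod k + 1)))"
 have PF: "P = U * prod_list (map (%j. 1 + cs c * F.a' j) [1..<Suc k])"
  using twisted_product[where k = k and m = k and c = c and a = b, OF VV(2) order_refl] by (simp add: P_def Vk F.a'_def g_def h_def del: upt_Suc)
 have uP: "T.law (u - cs z) = T.law (P - cs z)" for z
  using F.product_law[where c = c and z = z, OF W.gen_intros(1)] PF by (simp only: u_def)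
 \<comment> \<open>The potential depends on an operator only through the laws of its translates by
   scalars.\<close>
 have Ls: "T.Ls u z = T.Ls P z" for z by (simp only: T.Ls_def T.Lp_def T.lr_def uP)
 have yA: "V + cs c * b j \<in> W.AA" if "j \<in> {1..k}" for j using bA[OF that] VG W.gen_sub[OF UA] by auto
 note pot = T.cyclic_potential[where y = "%j. V + cs c * b j", OF assms(6) yA, folded X_def P_def]
 have uA: "u \<in> W.AA" unfolding u_def using UA bA by (intro T.mult_in T.prod_list_in) auto
 have opu: "op_of u = ub"
 proof -
  have "map (%j. op_of (1 + cs c * b j)) [1..<Suc k] = map (%j. id_blinfun + sqrt (t / real k) *\<^sub>R a j) [1..<Suc k]"
   by (rule map_cong[OF refl]) (auto simp: c_def cs_of_real plus_bop.rep_eq one_bop.rep_eq scaleR_bop.rep_eq opb)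
  thus ?thesis by (simp only: u_def ub_def op_of_mult op_of_prod_list op map_map o_def)
 qed
 have opX: "op_of X = Z + sqrt (t / real k) *\<^sub>R AA"
 proof -
  have "op_of X = (\<Sum>j=1..k. tensor_unit v (idx j) (idx (j mod k + 1)) + sqrt (t / real k) *\<^sub>R tensor_unit (a j) (idx j) (idx (j mod k + 1)))"
   unfolding X_def op_of_sum
   by (rule sum.cong[OF refl]) (simp add: eunit.rep_eq plus_bop.rep_eq c_def cs_of_real scaleR_bop.rep_eq op opb tensor_unit_add)
  thus ?thesis by (simp add: Z_def AA_def sum.distrib scaleR_sum_right)
 qed
 have tr: "mat_tr W.\<tau> Y = matrix_trace \<phi> (op_of Y)" for Y :: "('h ^ 'k) bop"
  by (simp add: mat_tr_def matrix_trace_def ent.rep_eq)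
 have "AE z in lborel. M.Ls X z = T.Ls u (z ^ k) / real k" unfolding Ls by (rule pot(2))
 hence "brown_measure \<phi> (op_of u) = distr (brown_measure (matrix_trace \<phi>) (op_of X)) borel (%z. z ^ k)"
  by - (rule brown_measure_power[of W.AA W.\<tau> u \<phi> "mat_alg W.AA" "mat_tr W.\<tau>" X "matrix_trace \<phi>", OF T.tracial_axioms uA refl M.tracial_axioms pot(1) tr k])
 thus ?thesis by (simp only: opu opX)
qed

end
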